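(* Let $n\ge 2$ and fix $\delta\in(0,1/96)$. Then the lacunary spherical maximal function $M^{lac}_{\mathbb{H}^n}f=\sup_{k\in\mathbb{Z}}|A_{\delta^k}f|$ is bounded on $L^p(\mathbb{H}^n)$ for all $1<p<\infty$; that is, for each such $p$ there is a constant $C$ with $\|M^{lac}_{\mathbb{H}^n}f\|_p\le C\|f\|_p$ for all $f\in L^p(\mathbb{H}^n)$.
   Context: $\mathbb{H}^n=\mathbb{C}^n\times\mathbb{R}$ is the Heisenberg group with group law $(z,t)(w,s)=(z+w,\,t+s+\tfrac12\Im(z\cdot\bar w))$, Haar measure equal to Lebesgue measure, dilations $\delta_r(z,t)=(rz,r^2t)$ for $r>0$, Koranyi norm $|(z,t)|=(|z|^4+16t^2)^{1/4}$, and homogeneous dimension $Q=2n+2$. Let $S_K=\{x\in\mathbb{H}^n:|x|=1\}$ and let $\sigma$ be the unique Radon measure on $S_K$ such that $\int_{\mathbb{H}^n}f(x)\,dx=\int_0^\infty\int_{S_K}f(\delta_r\omega)\,r^{Q-1}\,d\sigma(\omega)\,dr$ for all integrable $f$. The spherical means over Koranyi spheres are $A_rf(x)=\int_{S_K}f(x\cdot\delta_r y^{-1})\,d\sigma(y)$, $r>0$. (The number $\delta$ is a fixed parameter, not to be confused with the dilations $\delta_r$.) *)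

theory Defs
  imports "HOL-Analysis.Analysis"
begin

section \<open>The Heisenberg group\<close>

type_synonym 'n heis = "(complex ^ 'n) \<times> real"

definition heis_mult :: "'n::finite heis \<Rightarrow> 'n heis \<Rightarrow> 'n heis" (infixl "\<odot>" 70) where
  "x \<odot> y = (fst x + fst y,
     snd x + snd y + (1/2) * Im (\<Sum>j\<in>UNIV. fst x $ j * cnj (fst y $ j)))"

definition heis_inv :: "'n::finite heis \<Rightarrow> 'n heis" where
  "heis_inv x = (- fst x, - snd x)"

definition heis_dil :: "real \<Rightarrow> 'n::finite heis \<Rightarrow> 'n heis" where
  "heis_dil r x = (r *\<^sub>R fst x, r\<^sup>2 * snd x)"

definition koranyi_norm :: "'n::finite heis \<Rightarrow> real" where
  "koranyi_norm x = root 4 (norm (fst x) ^ 4 + 16 * (snd x)\<^sup>2)"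

definition koranyi_sphere :: "'n::finite heis set" where
  "koranyi_sphere = {x. koranyi_norm x = 1}"

definition hom_dim :: "'n::finite itself \<Rightarrow> nat" where
  "hom_dim _ = 2 * CARD('n) + 2"

lemma heis_mult_assoc: "(x \<odot> y) \<odot> w = x \<odot> (y \<odot> w)"
  by (simp add: heis_mult_def sum.distrib algebra_simps)

lemma heis_mult_zero [simp]: "x \<odot> 0 = x" "0 \<odot> x = x"
  by (simp_all add: heis_mult_def)

lemma heis_mult_inv [simp]: "x \<odot> heis_inv x = 0" "heis_inv x \<odot> x = 0"
  by (simp_all add: heis_mult_def heis_inv_def prod_eq_iff mult.commute)

lemma heis_dil_inv: "heis_dil r (heis_inv x) = heis_inv (heis_dil r x)"
  by (simp add: heis_dil_def heis_inv_def)


section \<open>The surface measure on the Koranyi sphere\<close>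

text \<open>
  The sphere is compact, so the Radon measures on it are the finite Borel measures.
\<close>

definition koranyi_polar :: "'n::finite heis measure \<Rightarrow> bool" where
  "koranyi_polar \<sigma> \<longleftrightarrow>
     sets \<sigma> = sets (restrict_space borel koranyi_sphere) \<and> finite_measure \<sigma> \<and>
     (\<forall>f::'n heis \<Rightarrow> complex. integrable lborel f \<longrightarrow>
        (LINT x|lborel. f x) =
        (LINT r:{0<..}|lborel. (LINT \<omega>|\<sigma>. r ^ (hom_dim TYPE('n) - 1) *\<^sub>R f (heis_dil r \<omega>))))"

definition koranyi_measure :: "'n::finite heis measure" where
  "koranyi_measure = (THE \<sigma>. koranyi_polar \<sigma>)"

text \<open>The following lemmas show that this definite description is legitimate.\<close>

lemma heis_dil_dil: "heis_dil r (heis_dil s x) = heis_dil (r * s) x"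
  by (simp add: heis_dil_def power2_eq_square)

lemma heis_dil_1 [simp]: "heis_dil 1 x = x"
  by (simp add: heis_dil_def)

lemma koranyi_norm_nonneg: "0 \<le> koranyi_norm x"
  by (simp add: koranyi_norm_def)

lemma koranyi_norm_eq_0: "koranyi_norm x = 0 \<longleftrightarrow> x = 0"
  by (auto simp: koranyi_norm_def prod_eq_iff add_nonneg_eq_0_iff)

lemma koranyi_norm_dil: "0 \<le> r \<Longrightarrow> koranyi_norm (heis_dil r x) = r * koranyi_norm x"
proof -
  assume r: "0 \<le> r"
  have "norm (r *\<^sub>R fst x) ^ 4 + 16 * (r\<^sup>2 * snd x)\<^sup>2 = r ^ 4 * (norm (fst x) ^ 4 + 16 * (snd x)\<^sup>2)"
    using r by (simp add: power_mult_distrib algebra_simps flip: power_mult)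
  then show ?thesis
    using r by (simp add: koranyi_norm_def heis_dil_def real_root_mult real_root_power_cancel)
qed

lemma borel_measurable_koranyi_norm [measurable]: "koranyi_norm \<in> borel_measurable borel"
  unfolding koranyi_norm_def[abs_def]
  by (intro borel_measurable_continuous_onI continuous_intros)

lemma borel_measurable_heis_dil [measurable]:
  assumes [measurable]: "g \<in> borel_measurable M" "h \<in> borel_measurable M"
  shows "(\<lambda>x. heis_dil (g x) (h x)) \<in> borel_measurable M"
proof -
  have "(\<lambda>p::real \<times> 'b heis. heis_dil (fst p) (snd p)) \<in> borel_measurable borel"
    unfolding heis_dil_def[abs_def]
    by (intro borel_measurable_continuous_onI continuous_intros)
  then have "(\<lambda>x. (\<lambda>p::real \<times> 'b heis. heis_dil (fst p) (snd p)) (g x, h x)) \<in> borel_measurable M"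
    by (rule measurable_compose[rotated]) (intro borel_measurable_Pair assms)
  then show ?thesis by simp
qed

lemma koranyi_sphere_borel [measurable]: "koranyi_sphere \<in> sets borel"
  unfolding koranyi_sphere_def by measurable

lemma lborel_heis_dil:
  fixes A :: "'n::finite heis set"
  assumes r: "0 < r" and A [measurable]: "A \<in> sets borel"
  shows "emeasure lborel A = ennreal (r ^ hom_dim TYPE('n)) * emeasure lborel (heis_dil r -` A)"
proof -
  define c :: "'n heis \<Rightarrow> real" where "c j = (if snd j = 0 then r else r\<^sup>2)" for j
  have T: "(0::'n heis) + (\<Sum>j\<in>Basis. (c j * (x \<bullet> j)) *\<^sub>R j) = heis_dil r x" for x
  proof -
    have "(\<Sum>j\<in>Basis. (c j * (x \<bullet> j)) *\<^sub>R j) = heis_dil r x"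
    proof (subst euclidean_representation_sum, intro ballI)
      fix j :: "'n heis" assume "j \<in> Basis"
      then show "c j * (x \<bullet> j) = heis_dil r x \<bullet> j"
        by (cases x) (auto simp: Basis_prod_def heis_dil_def c_def)
    qed
    then show ?thesis by simp
  qed
  have P: "(\<Prod>j\<in>Basis. \<bar>c j\<bar>) = r ^ hom_dim TYPE('n)"
  proof -
    have "(\<Prod>j\<in>(Basis::'n heis set). \<bar>c j\<bar>) =
        (\<Prod>j\<in>(\<lambda>u. (u, 0::real)) ` (Basis::(complex^'n) set). \<bar>c j\<bar>) *
        (\<Prod>j\<in>(\<lambda>v. (0::complex^'n, v)) ` (Basis::real set). \<bar>c j\<bar>)"
      unfolding Basis_prod_def by (rule prod.union_disjoint) auto
    also have "\<dots> = r ^ DIM(complex^'n) * r\<^sup>2"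
      using r by (simp add: prod.reindex inj_on_def c_def)
    finally show ?thesis by (simp add: hom_dim_def power_add power2_eq_square mult.commute)
  qed
  have "(lborel :: 'n heis measure) = density (distr lborel borel (heis_dil r)) (\<lambda>_. ennreal (r ^ hom_dim TYPE('n)))"
  proof -
    have "c j \<noteq> 0" for j using r by (simp add: c_def)
    then show ?thesis using lborel_affine_euclidean[of c "0::'n heis"] unfolding T P by simp
  qed
  then have "emeasure lborel A =
      emeasure (density (distr lborel borel (heis_dil r)) (\<lambda>_. ennreal (r ^ hom_dim TYPE('n)))) A"
    by simp
  also have "\<dots> = ennreal (r ^ hom_dim TYPE('n)) * emeasure lborel (heis_dil r -` A)"
    by (simp add: emeasure_density nn_integral_cmult emeasure_distr)
  finally show ?thesis .
qed

definition koranyi_proj :: "'n::finite heis \<Rightarrow> 'n heis" where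
  "koranyi_proj x = heis_dil (1 / koranyi_norm x) x"

definition koranyi_cone :: "real \<Rightarrow> 'n::finite heis set \<Rightarrow> 'n heis set" where
  "koranyi_cone a E = {x. 0 < koranyi_norm x \<and> koranyi_norm x \<le> a \<and> koranyi_proj x \<in> E}"

definition radial_measure :: "nat \<Rightarrow> real measure" where
  "radial_measure q = density lborel (\<lambda>r. ennreal (indicator {0<..} r * r ^ (q - 1)))"

lemma koranyi_proj_sphere: "0 < koranyi_norm x \<Longrightarrow> koranyi_proj x \<in> koranyi_sphere"
  by (simp add: koranyi_proj_def koranyi_sphere_def koranyi_norm_dil)

lemma heis_dil_proj: "0 < koranyi_norm x \<Longrightarrow> heis_dil (koranyi_norm x) (koranyi_proj x) = x"
  by (simp add: koranyi_proj_def heis_dil_dil)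

lemma koranyi_proj_dil: "0 < r \<Longrightarrow> koranyi_proj (heis_dil r x) = koranyi_proj x"
  by (simp add: koranyi_proj_def heis_dil_dil koranyi_norm_dil)

lemma borel_measurable_koranyi_proj [measurable]: "koranyi_proj \<in> borel_measurable borel"
  unfolding koranyi_proj_def[abs_def] by measurable

lemma koranyi_cone_borel [measurable]:
  assumes [measurable]: "E \<in> sets borel" shows "koranyi_cone a E \<in> sets borel"
  unfolding koranyi_cone_def by measurable

lemma emeasure_koranyi_cone:
  fixes E :: "'n::finite heis set"
  assumes a: "0 < a" and [measurable]: "E \<in> sets borel"
  shows "emeasure lborel (koranyi_cone a E) =
    ennreal (a ^ hom_dim TYPE('n)) * emeasure lborel (koranyi_cone 1 E)"
proof -
  have "heis_dil a -` koranyi_cone a E = koranyi_cone 1 E"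
    using a by (auto simp: koranyi_cone_def koranyi_norm_dil koranyi_proj_dil zero_less_mult_iff)
  then show ?thesis
    using lborel_heis_dil[OF a, of "koranyi_cone a E"] by simp
qed

lemma emeasure_koranyi_cone_finite:
  assumes [measurable]: "E \<in> sets borel"
  shows "emeasure lborel (koranyi_cone 1 E) < \<infinity>"
proof -
  have "koranyi_cone 1 E \<subseteq> cball 0 1 \<times> cball 0 1"
  proof
    fix x assume "x \<in> koranyi_cone 1 E"
    then have *: "norm (fst x) ^ 4 + 16 * (snd x)\<^sup>2 \<le> 1"
      by (simp add: koranyi_cone_def koranyi_norm_def real_root_le_1_iff)
    have "norm (fst x) ^ 4 \<le> 1" "(snd x)\<^sup>2 \<le> 1"
      using * zero_le_power2[of "snd x"] zero_le_power[of "norm (fst x)" 4] norm_ge_zero[of "fst x"]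
      by linarith+
    then have "norm (fst x) \<le> 1" "\<bar>snd x\<bar> \<le> 1"
      using power_le_one_iff[of "norm (fst x)" 4] abs_square_le_1[of "snd x"] by auto
    then show "x \<in> cball 0 1 \<times> cball 0 1" by (cases x) auto
  qed
  then have "bounded (koranyi_cone 1 E)"
    using bounded_Times[OF bounded_cball bounded_cball] bounded_subset by metis
  then show ?thesis by (rule emeasure_bounded_finite)
qed

lemma emeasure_radial_atMost:
  assumes q: "0 < q" and a: "0 < a"
  shows "emeasure (radial_measure q) {..a} = ennreal (a ^ q / q)"
proof -
  have "emeasure (radial_measure q) {..a} =
      (\<integral>\<^sup>+ r. ennreal (r ^ (q - 1)) * indicator {0..a} r \<partial>lborel)"
    unfolding radial_measure_def
    by (subst emeasure_density, measurable, intro nn_integral_cong_AE)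
      (use AE_lborel_singleton[of "0::real"] in \<open>eventually_elim, auto simp: indicator_def\<close>)
  also have "\<dots> = ennreal (a ^ q / q - 0 ^ q / q)"
    using q a
    by (intro nn_integral_FTC_Icc) (auto intro!: derivative_eq_intros)
  also have "a ^ q / q - 0 ^ q / q = a ^ q / q" using q by simp
  finally show ?thesis .
qed

lemma emeasure_radial_atMost_nonpos:
  "a \<le> 0 \<Longrightarrow> emeasure (radial_measure q) {..a} = 0"
proof -
  assume a: "a \<le> 0"
  have "emeasure (radial_measure q) {..a} = (\<integral>\<^sup>+ r. 0 \<partial>(lborel :: real measure))"
    unfolding radial_measure_def
    by (subst emeasure_density, measurable, intro nn_integral_cong)
      (use a in \<open>auto simp: indicator_def\<close>)
  then show ?thesis by simp
qed

lemma sigma_finite_radial: "sigma_finite_measure (radial_measure q)"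
  unfolding radial_measure_def
  by (subst sigma_finite_measure.sigma_finite_iff_density_finite[OF sigma_finite_lborel]) auto

text \<open>The explicit form of the measure, used only to prove existence.\<close>

definition koranyi_measure0 :: "'n::finite heis measure" where
  "koranyi_measure0 = scale_measure (ennreal (hom_dim TYPE('n)))
     (distr (restrict_space lborel (koranyi_cone 1 UNIV)) (restrict_space borel koranyi_sphere)
        koranyi_proj)"

lemma sets_koranyi_measure0 [measurable_cong]:
  "sets koranyi_measure0 = sets (restrict_space borel koranyi_sphere)"
  by (simp add: koranyi_measure0_def)

lemma emeasure_koranyi_measure0:
  fixes E :: "'n::finite heis set"
  assumes E: "E \<in> sets (restrict_space borel koranyi_sphere)"
  shows "emeasure koranyi_measure0 E =
    ennreal (hom_dim TYPE('n)) * emeasure lborel (koranyi_cone 1 E)"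
proof -
  have Eb [measurable]: "E \<in> sets borel"
    using E by (subst (asm) sets_restrict_space_iff) auto
  have m: "koranyi_proj \<in> restrict_space lborel (koranyi_cone 1 UNIV) \<rightarrow>\<^sub>M
      restrict_space borel (koranyi_sphere :: 'n heis set)"
    by (rule measurable_restrict_space3) (auto simp: koranyi_cone_def koranyi_proj_sphere)
  have [measurable]: "koranyi_cone 1 UNIV \<in> sets (borel :: 'n heis measure)" by measurable
  have "koranyi_proj -` E \<inter> space (restrict_space lborel (koranyi_cone 1 UNIV)) = koranyi_cone 1 E"
    by (auto simp: space_restrict_space koranyi_cone_def)
  then show ?thesis
    using E m
    by (simp add: koranyi_measure0_def emeasure_distr)
      (subst emeasure_restrict_space, auto simp: koranyi_cone_def)
qed

lemma finite_koranyi_measure0: "finite_measure (koranyi_measure0 :: 'n::finite heis measure)"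
proof
  have "space koranyi_measure0 \<in> sets (koranyi_measure0 :: 'n heis measure)" by simp
  then have E: "space (koranyi_measure0 :: 'n heis measure) \<in> sets (restrict_space borel koranyi_sphere)"
    by (simp only: sets_koranyi_measure0)
  then have "space (koranyi_measure0 :: 'n heis measure) \<in> sets borel"
    by (subst (asm) sets_restrict_space_iff) auto
  from emeasure_koranyi_cone_finite[OF this]
  show "emeasure (koranyi_measure0 :: 'n heis measure) (space koranyi_measure0) \<noteq> \<infinity>"
    by (simp add: emeasure_koranyi_measure0[OF E] ennreal_mult_eq_top_iff)
qed

lemma koranyi_pair_measure:
  "radial_measure (hom_dim TYPE('n::finite)) \<Otimes>\<^sub>M (koranyi_measure0 :: 'n heis measure) =
    distr (restrict_space lborel {x. 0 < koranyi_norm x})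
      (radial_measure (hom_dim TYPE('n)) \<Otimes>\<^sub>M koranyi_measure0)
      (\<lambda>x. (koranyi_norm x, koranyi_proj x))"
  (is "?R \<Otimes>\<^sub>M ?S = distr ?L _ ?\<Psi>")
proof (rule pair_measure_eqI)
  show "sigma_finite_measure ?R" by (rule sigma_finite_radial)
  show "sigma_finite_measure ?S"
    using finite_koranyi_measure0 by (rule finite_measure.axioms)
  show "sets (?R \<Otimes>\<^sub>M ?S) = sets (distr ?L (?R \<Otimes>\<^sub>M ?S) ?\<Psi>)" by simp
  have q: "0 < hom_dim TYPE('n)" by (simp add: hom_dim_def)
  have sR [measurable_cong]: "sets ?R = sets borel" by (simp add: radial_measure_def)
  have p1: "koranyi_proj \<in> ?L \<rightarrow>\<^sub>M restrict_space borel (koranyi_sphere :: 'n heis set)"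
    by (rule measurable_restrict_space3) (auto simp: koranyi_proj_sphere)
  then have p2 [measurable]: "koranyi_proj \<in> ?L \<rightarrow>\<^sub>M ?S"
    by (simp cong: measurable_cong_sets add: sets_koranyi_measure0)
  have p3 [measurable]: "koranyi_norm \<in> ?L \<rightarrow>\<^sub>M ?R"
    by (rule measurable_restrict_space1) measurable
  have \<Psi>: "?\<Psi> \<in> ?L \<rightarrow>\<^sub>M ?R \<Otimes>\<^sub>M ?S" by measurable
  fix A :: "real set" and B :: "'n heis set" assume A: "A \<in> sets ?R" and B: "B \<in> sets ?S"
  have A' [measurable]: "A \<in> sets borel" using A sR by simp
  have B0: "B \<in> sets (restrict_space borel koranyi_sphere)" using B by (simp add: sets_koranyi_measure0)
  then have B' [measurable]: "B \<in> sets borel" by (subst (asm) sets_restrict_space_iff) auto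
  define \<mu> where "\<mu> = distr (density lborel (indicator {x. 0 < koranyi_norm x \<and> koranyi_proj x \<in> B}))
    borel (koranyi_norm :: 'n heis \<Rightarrow> real)"
  have \<mu>: "emeasure \<mu> X = emeasure lborel {x. 0 < koranyi_norm x \<and> koranyi_norm x \<in> X \<and> koranyi_proj x \<in> B}"
    if [measurable]: "X \<in> sets borel" for X
  proof -
    have "emeasure \<mu> X = (\<integral>\<^sup>+ x. indicator {x. 0 < koranyi_norm x \<and> koranyi_norm x \<in> X \<and> koranyi_proj x \<in> B} x \<partial>lborel)"
      unfolding \<mu>_def
      by (subst emeasure_distr, measurable, subst emeasure_density, measurable,
          intro nn_integral_cong) (auto simp: indicator_def)
    then show ?thesis by simp
  qed
  have "scale_measure (emeasure ?S B) ?R = \<mu>"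
  proof (rule measure_eqI_generator_eq[where E="range (\<lambda>a::real. {..a})" and \<Omega>=UNIV
        and A="\<lambda>i. {..real i}"])
    show "Int_stable (range (\<lambda>a::real. {..a}))" by (auto simp: Int_stable_def)
    show "sets (scale_measure (emeasure ?S B) ?R) = sigma_sets UNIV (range (\<lambda>a::real. {..a}))"
      "sets \<mu> = sigma_sets UNIV (range (\<lambda>a::real. {..a}))"
      by (simp_all add: sR \<mu>_def borel_eq_atMost)
    show "(\<Union>i. {..real i}) = UNIV" by (auto intro: real_arch_simple)
    have fin: "emeasure ?S B \<noteq> \<infinity>"
      using finite_measure.emeasure_finite[OF finite_koranyi_measure0] by simp
    have eq: "emeasure (scale_measure (emeasure ?S B) ?R) {..a} = emeasure \<mu> {..a}" for a
    proof (cases "0 < a")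
      case True
      have "emeasure \<mu> {..a} = emeasure lborel (koranyi_cone a B)"
        by (simp add: \<mu> koranyi_cone_def)
      also have "\<dots> = ennreal (a ^ hom_dim TYPE('n)) * emeasure lborel (koranyi_cone 1 B)"
        using True by (rule emeasure_koranyi_cone) measurable
      also have "ennreal (a ^ hom_dim TYPE('n)) =
          ennreal (a ^ hom_dim TYPE('n) / hom_dim TYPE('n)) * ennreal (hom_dim TYPE('n))"
        using True q by (subst ennreal_mult[symmetric]) auto
      finally show ?thesis
        using True q by (simp add: emeasure_radial_atMost emeasure_koranyi_measure0[OF B0] ac_simps)
    next
      case False
      then have "{x::'n heis. 0 < koranyi_norm x \<and> koranyi_norm x \<in> {..a} \<and> koranyi_proj x \<in> B} = {}"
        by auto
      then have "emeasure \<mu> {..a} = 0" by (subst \<mu>) (simp, metis emeasure_empty)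
      then show ?thesis using False by (simp add: emeasure_radial_atMost_nonpos)
    qed
    show "emeasure (scale_measure (emeasure ?S B) ?R) X = emeasure \<mu> X"
      if "X \<in> range (\<lambda>a::real. {..a})" for X using that eq by auto
    show "emeasure (scale_measure (emeasure ?S B) ?R) {..real i} \<noteq> \<infinity>" for i
      using fin q
      by (cases "i = 0") (auto simp: emeasure_radial_atMost emeasure_radial_atMost_nonpos ennreal_mult_eq_top_iff)
  qed auto
  then have "emeasure ?R A * emeasure ?S B = emeasure \<mu> A"
    by (metis emeasure_scale_measure mult.commute)
  also have "\<dots> = emeasure (distr ?L (?R \<Otimes>\<^sub>M ?S) ?\<Psi>) (A \<times> B)"
  proof -
    have "?\<Psi> -` (A \<times> B) \<inter> space ?L =
        {x. 0 < koranyi_norm x \<and> koranyi_norm x \<in> A \<and> koranyi_proj x \<in> B}"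
      by (auto simp: space_restrict_space)
    then show ?thesis
      using A B
      by (subst emeasure_distr[OF \<Psi>], simp, simp only:, subst emeasure_restrict_space)
        (auto simp: \<mu>)
  qed
  finally show "emeasure ?R A * emeasure ?S B = emeasure (distr ?L (?R \<Otimes>\<^sub>M ?S) ?\<Psi>) (A \<times> B)" .
qed

lemma restrict_lborel_punctured:
  fixes g :: "'n::finite heis \<Rightarrow> complex"
  assumes g [measurable]: "g \<in> borel_measurable borel"
  shows "integrable (restrict_space lborel {x. 0 < koranyi_norm x}) g \<longleftrightarrow> integrable lborel g"
      (is "integrable ?L g \<longleftrightarrow> _")
    and "(LINT x|restrict_space lborel {x. 0 < koranyi_norm x}. g x) = (LINT x|lborel. g x)"
proof -
  have AE: "AE x::'n heis in lborel. 0 < koranyi_norm x"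
    using AE_lborel_singleton[of "0::'n heis"]
    by eventually_elim (metis koranyi_norm_eq_0 koranyi_norm_nonneg less_le)
    have "integrable ?L g \<longleftrightarrow> integrable lborel (\<lambda>x. indicator {x. 0 < koranyi_norm x} x *\<^sub>R g x)"
      by (rule integrable_restrict_space) auto
    also have "\<dots> \<longleftrightarrow> integrable lborel g"
    proof (rule integrable_cong_AE)
      show "AE x in lborel. indicator {x. 0 < koranyi_norm x} x *\<^sub>R g x = g x"
        using AE by eventually_elim simp
    qed measurable
    finally show "integrable ?L g \<longleftrightarrow> integrable lborel g" .
    have "(LINT x|?L. g x) = (LINT x|lborel. indicator {x. 0 < koranyi_norm x} x *\<^sub>R g x)"
      by (rule integral_restrict_space) auto
    also have "\<dots> = (LINT x|lborel. g x)"
    proof (rule integral_cong_AE)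
      show "AE x in lborel. indicator {x. 0 < koranyi_norm x} x *\<^sub>R g x = g x"
        using AE by eventually_elim simp
    qed measurable
    finally show "(LINT x|?L. g x) = (LINT x|lborel. g x)" .
qed

lemma koranyi_polar_measure0: "koranyi_polar (koranyi_measure0 :: 'n::finite heis measure)"
  unfolding koranyi_polar_def
proof (intro conjI allI impI)
  show "sets (koranyi_measure0 :: 'n heis measure) = sets (restrict_space borel koranyi_sphere)"
    by (rule sets_koranyi_measure0)
  show "finite_measure (koranyi_measure0 :: 'n heis measure)" by (rule finite_koranyi_measure0)
  let ?q = "hom_dim TYPE('n)"
  let ?R = "radial_measure ?q" and ?S = "koranyi_measure0 :: 'n heis measure"
  let ?L = "restrict_space lborel {x::'n heis. 0 < koranyi_norm x}"
  let ?\<Psi> = "\<lambda>x::'n heis. (koranyi_norm x, koranyi_proj x)"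
  fix f :: "'n heis \<Rightarrow> complex" assume f: "integrable lborel f"
  then have [measurable]: "f \<in> borel_measurable borel" by auto
  have sR [measurable_cong]: "sets ?R = sets borel" by (simp add: radial_measure_def)
  have "koranyi_proj \<in> ?L \<rightarrow>\<^sub>M restrict_space borel (koranyi_sphere :: 'n heis set)"
    by (rule measurable_restrict_space3) (auto simp: koranyi_proj_sphere)
  then have [measurable]: "koranyi_proj \<in> ?L \<rightarrow>\<^sub>M ?S"
    by (simp cong: measurable_cong_sets add: sets_koranyi_measure0)
  have [measurable]: "koranyi_norm \<in> ?L \<rightarrow>\<^sub>M ?R"
    by (rule measurable_restrict_space1) measurable
  have \<Psi> [measurable]: "?\<Psi> \<in> ?L \<rightarrow>\<^sub>M ?R \<Otimes>\<^sub>M ?S" by measurable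
  have idS [measurable]: "(\<lambda>\<omega>. \<omega>) \<in> ?S \<rightarrow>\<^sub>M borel"
    by (simp cong: measurable_cong_sets add: sets_koranyi_measure0 measurable_restrict_space1)
  have F [measurable]: "(\<lambda>(r, \<omega>). f (heis_dil r \<omega>)) \<in> borel_measurable (?R \<Otimes>\<^sub>M ?S)"
  proof -
    have "(\<lambda>z. heis_dil (fst z) (snd z)) \<in> borel_measurable (?R \<Otimes>\<^sub>M ?S)"
    proof (rule borel_measurable_heis_dil)
      show "fst \<in> borel_measurable (?R \<Otimes>\<^sub>M ?S)"
        using measurable_fst[of ?R ?S] by (simp cong: measurable_cong_sets add: sR)
      show "snd \<in> borel_measurable (?R \<Otimes>\<^sub>M ?S)"
        by (rule measurable_compose[OF measurable_snd idS])
    qed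
    then show ?thesis by (simp add: case_prod_beta)
  qed
  interpret R: sigma_finite_measure ?R by (rule sigma_finite_radial)
  interpret S: finite_measure ?S by (rule finite_koranyi_measure0)
  interpret pair_sigma_finite ?R ?S ..
  have int: "integrable (?R \<Otimes>\<^sub>M ?S) (\<lambda>(r, \<omega>). f (heis_dil r \<omega>))"
  proof -
    have "integrable ?L (\<lambda>x. case ?\<Psi> x of (r, \<omega>) \<Rightarrow> f (heis_dil r \<omega>)) \<longleftrightarrow> integrable ?L f"
      by (rule Bochner_Integration.integrable_cong) (auto simp: space_restrict_space heis_dil_proj)
    then show ?thesis
      using f restrict_lborel_punctured(1)[of f]
      by (subst koranyi_pair_measure, subst integrable_distr_eq) auto
  qed
  have "(LINT x|lborel. f x) = (LINT x|?L. f x)" by (simp add: restrict_lborel_punctured)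
  also have "\<dots> = (LINT x|?L. (case ?\<Psi> x of (r, \<omega>) \<Rightarrow> f (heis_dil r \<omega>)))"
    by (rule Bochner_Integration.integral_cong) (auto simp: space_restrict_space heis_dil_proj)
  also have "\<dots> = (LINT z|distr ?L (?R \<Otimes>\<^sub>M ?S) ?\<Psi>. (case z of (r, \<omega>) \<Rightarrow> f (heis_dil r \<omega>)))"
    by (rule integral_distr[symmetric]) (rule \<Psi>, rule F)
  also have "\<dots> = (LINT z|(?R \<Otimes>\<^sub>M ?S). (case z of (r, \<omega>) \<Rightarrow> f (heis_dil r \<omega>)))"
    by (simp only: koranyi_pair_measure[symmetric])
  also have "\<dots> = (LINT r|?R. (LINT \<omega>|?S. f (heis_dil r \<omega>)))"
    using integral_fst'[OF int] by simp
  also have "\<dots> = (LINT r|lborel. (indicator {0<..} r * r ^ (?q - 1)) *\<^sub>R (LINT \<omega>|?S. f (heis_dil r \<omega>)))"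
    unfolding radial_measure_def
  proof (rule integral_density)
    have "(\<lambda>r. LINT \<omega>|?S. f (heis_dil r \<omega>)) \<in> borel_measurable ?R"
      by (rule S.borel_measurable_lebesgue_integral) (use F in simp)
    then show "(\<lambda>r. LINT \<omega>|?S. f (heis_dil r \<omega>)) \<in> borel_measurable lborel"
      by (simp cong: measurable_cong_sets add: sR)
  qed (auto simp: indicator_def)
  finally show "(LINT x|lborel. f x) =
      (LINT r:{0<..}|lborel. (LINT \<omega>|?S. r ^ (?q - 1) *\<^sub>R f (heis_dil r \<omega>)))"
    by (simp add: set_lebesgue_integral_def)
qed

lemma koranyi_polar_determines:
  fixes E :: "'n::finite heis set"
  assumes "koranyi_polar \<sigma>" and E: "E \<in> sets (restrict_space borel koranyi_sphere)"
  shows "measure \<sigma> E = hom_dim TYPE('n) * measure lborel (koranyi_cone 1 E)"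
proof -
  let ?q = "hom_dim TYPE('n)"
  have q: "0 < ?q" by (simp add: hom_dim_def)
  have s: "sets \<sigma> = sets (restrict_space borel koranyi_sphere)" and "finite_measure \<sigma>"
    using assms by (auto simp: koranyi_polar_def)
  interpret finite_measure \<sigma> by fact
  have sp: "space \<sigma> = koranyi_sphere"
    using sets_eq_imp_space_eq[OF s] by (simp add: space_restrict_space)
  have Eb [measurable]: "E \<in> sets borel" and ES: "E \<subseteq> koranyi_sphere"
    using E by (auto simp: sets_restrict_space_iff)
  define f :: "'n heis \<Rightarrow> complex" where "f = indicator (koranyi_cone 1 E)"
  have ind: "indicator X = (\<lambda>x. complex_of_real (indicator X x))" for X :: "'n heis set"
    by (auto simp: indicator_def)
  have "integrable lborel f"
    unfolding f_def using emeasure_koranyi_cone_finite[OF Eb]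
    by (subst ind) (auto intro!: integrable_of_real)
  then have *: "(LINT x|lborel. f x) =
      (LINT r:{0<..}|lborel. (LINT \<omega>|\<sigma>. r ^ (?q - 1) *\<^sub>R f (heis_dil r \<omega>)))"
    using assms by (auto simp: koranyi_polar_def)
  have inner: "(LINT \<omega>|\<sigma>. r ^ (?q - 1) *\<^sub>R f (heis_dil r \<omega>)) =
      complex_of_real (indicator {..1} r * r ^ (?q - 1) * measure \<sigma> E)" if r: "0 < r" for r
  proof -
    have "(LINT \<omega>|\<sigma>. r ^ (?q - 1) *\<^sub>R f (heis_dil r \<omega>)) =
        (LINT \<omega>|\<sigma>. complex_of_real (indicator {..1} r * r ^ (?q - 1) * indicator E \<omega>))"
      by (rule Bochner_Integration.integral_cong)
        (use r sp in \<open>auto simp: f_def indicator_def koranyi_cone_def koranyi_norm_dil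
          koranyi_proj_dil koranyi_sphere_def koranyi_proj_def heis_dil_dil scaleR_conv_of_real\<close>)
    also have "\<dots> = complex_of_real (LINT \<omega>|\<sigma>. indicator {..1} r * r ^ (?q - 1) * indicator E \<omega>)"
      by (rule integral_complex_of_real)
    also have "(LINT \<omega>|\<sigma>. indicator {..1} r * r ^ (?q - 1) * indicator E \<omega>) =
        indicator {..1} r * r ^ (?q - 1) * measure \<sigma> E"
      using E s sp ES by (simp add: Int_absorb2)
    finally show ?thesis .
  qed
  have "(LINT x|lborel. f x) = complex_of_real (measure lborel (koranyi_cone 1 E))"
  proof -
    have "f = (\<lambda>x. complex_of_real (indicator (koranyi_cone 1 E) x))"
      by (auto simp: f_def indicator_def)
    then show ?thesis by (simp add: integral_complex_of_real)
  qed
  moreover have "(LINT r:{0<..}|lborel. (LINT \<omega>|\<sigma>. r ^ (?q - 1) *\<^sub>R f (heis_dil r \<omega>))) =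
      (LINT r|lborel. complex_of_real (r ^ (?q - 1) * indicator {0..1} r * measure \<sigma> E))"
    unfolding set_lebesgue_integral_def
  proof (rule Bochner_Integration.integral_cong)
    fix r :: real
    show "indicator {0<..} r *\<^sub>R (LINT \<omega>|\<sigma>. r ^ (?q - 1) *\<^sub>R f (heis_dil r \<omega>)) =
        complex_of_real (r ^ (?q - 1) * indicator {0..1} r * measure \<sigma> E)"
    proof (cases "0 < r")
      case True
      then show ?thesis using inner[OF True] by (simp only:) (simp add: indicator_def)
    next
      case False
      then show ?thesis by (auto simp: indicator_def hom_dim_def)
    qed
  qed simp
  moreover have "\<dots> = complex_of_real (measure \<sigma> E / ?q)"
  proof -
    have "(LINT r|lborel. r ^ (?q - 1) * indicator {0..1::real} r) = 1 / ?q"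
      using integral_power[of 0 1 "?q - 1"] q by simp
    then show ?thesis by (subst integral_complex_of_real) simp
  qed
  ultimately have "complex_of_real (measure lborel (koranyi_cone 1 E)) = complex_of_real (measure \<sigma> E / ?q)"
    using * by simp
  then show ?thesis using q by (simp only: of_real_eq_iff) simp
qed

lemma ex1_koranyi_polar: "\<exists>!\<sigma>::'n::finite heis measure. koranyi_polar \<sigma>"
proof (rule ex1I)
  show "koranyi_polar (koranyi_measure0 :: 'n heis measure)" by (rule koranyi_polar_measure0)
  fix \<sigma> :: "'n heis measure" assume \<sigma>: "koranyi_polar \<sigma>"
  show "\<sigma> = koranyi_measure0"
  proof (rule measure_eqI)
    show "sets \<sigma> = sets koranyi_measure0"
      using \<sigma> by (simp add: koranyi_polar_def sets_koranyi_measure0)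
    fix E assume "E \<in> sets \<sigma>"
    then have E: "E \<in> sets (restrict_space borel koranyi_sphere)"
      using \<sigma> by (simp add: koranyi_polar_def)
    have "finite_measure \<sigma>" using \<sigma> by (simp add: koranyi_polar_def)
    then show "emeasure \<sigma> E = emeasure koranyi_measure0 E"
      using koranyi_polar_determines[OF \<sigma> E] koranyi_polar_determines[OF koranyi_polar_measure0 E]
      by (simp add: finite_measure.emeasure_eq_measure[OF finite_koranyi_measure0]
          finite_measure.emeasure_eq_measure)
  qed
qed

lemma koranyi_polar_koranyi_measure: "koranyi_polar koranyi_measure"
  unfolding koranyi_measure_def using ex1_koranyi_polar by (rule theI')


section \<open>Spherical means and the lacunary maximal function\<close>

text \<open>
  Where the integral over the sphere does not converge absolutely, the Bochner integral is 0;
  for \<open>f\<close> in \<open>L\<^sup>p\<close>, this happens only for \<open>x\<close> in a null set.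
\<close>

definition spherical_mean ::
  "real \<Rightarrow> ('n::finite heis \<Rightarrow> complex) \<Rightarrow> 'n heis \<Rightarrow> complex" where
  "spherical_mean r f x = (LINT y|koranyi_measure. f (x \<odot> heis_dil r (heis_inv y)))"

definition lacunary_maximal ::
  "real \<Rightarrow> ('n::finite heis \<Rightarrow> complex) \<Rightarrow> 'n heis \<Rightarrow> ennreal" where
  "lacunary_maximal \<delta> f x = (SUP k::int. ennreal (cmod (spherical_mean (\<delta> powi k) f x)))"


section \<open>Lebesgue spaces\<close>

text \<open>The power of an extended nonnegative real, for positive exponents only.\<close>

definition ennreal_powr :: "ennreal \<Rightarrow> real \<Rightarrow> ennreal" where
  "ennreal_powr a p = (if a = \<infinity> then \<infinity> else ennreal (enn2real a powr p))"

definition Lp_enorm :: "real \<Rightarrow> 'a measure \<Rightarrow> ('a \<Rightarrow> ennreal) \<Rightarrow> ennreal" where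
  "Lp_enorm p M g = ennreal_powr (\<integral>\<^sup>+x. ennreal_powr (g x) p \<partial>M) (1 / p)"

text \<open>
  Functions rather than classes modulo null sets. With \<open>M = lborel\<close>, membership requires
  Borel measurability; every class of Lebesgue measurable functions has such a representative.
\<close>

definition Lp_functions :: "real \<Rightarrow> 'a measure \<Rightarrow> ('a \<Rightarrow> complex) set" where
  "Lp_functions p M =
     {f \<in> borel_measurable M. Lp_enorm p M (\<lambda>x. ennreal (cmod (f x))) < \<infinity>}"

end

theory Submission imports Defs begin

text \<open>
  The Koranyi sphere is a union of curves \<open>\<theta> \<mapsto> (profile \<theta> *\<^sub>R \<omega>, \<plusminus>\<theta> / 4)\<close> with \<open>norm \<omega> = 1\<close>, and for
  \<open>n \<ge> 2\<close> the density of the surface measure along each curve is bounded, so spherical means are dominated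
  by averages over \<open>\<omega>\<close> of curve averages. A curve together with all its dilates lies in an abelian
  subgroup isomorphic to the plane, and right translations preserve the Haar measure, so transference
  reduces the claim to a planar lacunary maximal function along curves.

  In the plane, decompose a function by dyadic martingale differences in the first variable only. On a
  difference of cell size \<open>h\<close>, a curve average of scale much larger than \<open>h\<close> has small \<open>L\<^sup>2\<close> norm: expanding
  its square produces integrals of the mean-zero function along a difference of two profiles, which has a monotone
  derivative bounded below, so that the contributions of complete cells nearly cancel. Orthogonality of the
  differences sums the scales and yields geometric decay in the number of dyadic steps. On \<open>L\<^sup>q\<close> the
  corresponding maximal functions are dominated by shifted dyadic maximal functions, whose norms
  grow only polynomially in the number of steps, because a shift costs its logarithm. Interpolation and
  summation give every \<open>p > 1\<close>.
\<close>

text \<open>The second coordinate of a curve is linear in \<theta>, which is why averaging in the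
  first variable is enough. Two curve points with parameter gap b differ by a constant in the second
  coordinate, so the expanded square involves functions of one variable only; and for the L^q bounds
  the integral over \<theta> is itself an average in the second variable.

  A difference of profiles has slope of size at least b / 2, and the operator norm so obtained is of
  order 1 / b, not integrable at b = 0. The geometric mean with the trivial bound 1 is of order
  b^(-1/2), which is integrable, at the cost of half the decay exponent.

  The profile has a vertical tangent at \<theta> = 1 and is Hoelder continuous only of exponent 1/4.
  Cells 2^j times shorter than the radius therefore require 16^j pieces of the curve; their number
  cancels against their length.

  The radii are not dyadic, but cells have to be nested: each radius is rounded up to a power of
  two. As \<delta> < 1/2, distinct radii receive distinct powers, and this makes the differences at
  equal j orthogonal.\<close>

section \<open>Layer-cake formula and real interpolation\<close>

lemma nn_integral_powr_below:
  fixes e s :: real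
  assumes "0 < e" "0 \<le> s"
  shows "(\<integral>\<^sup>+l. ennreal (l powr (e - 1)) * indicator {0<..<s} l \<partial>lborel) = ennreal (s powr e / e)"
proof -
  have I: "((\<lambda>x. x powr (e - 1)) has_integral (s powr e / e)) {0..s}"
    using has_integral_powr_from_0[of "e - 1" s] assms by simp
  have ind: "(\<lambda>x. indicator {0..s} x * x powr (e - 1)) = (\<lambda>x. if x \<in> {0..s} then x powr (e - 1) else 0)"
    by (auto simp: indicator_def)
  have "(\<integral>\<^sup>+l. ennreal (indicator {0..s} l * l powr (e - 1)) \<partial>lborel) = ennreal (s powr e / e)"
    by (intro nn_integral_has_integral_lborel) (simp_all only: ind I has_integral_restrict_UNIV, auto)
  moreover have "(\<integral>\<^sup>+l. ennreal (l powr (e - 1)) * indicator {0<..<s} l \<partial>lborel) =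
      (\<integral>\<^sup>+l. ennreal (indicator {0..s} l * l powr (e - 1)) \<partial>lborel)"
    by (intro nn_integral_cong_AE)
      (use AE_lborel_singleton[of 0] AE_lborel_singleton[of s] in \<open>eventually_elim, auto simp: indicator_def\<close>)
  ultimately show ?thesis by simp
qed

lemma nn_integral_powr_above:
  fixes e s :: real
  assumes "0 < e" "0 < s"
  shows "(\<integral>\<^sup>+l. ennreal (l powr (- e - 1)) * indicator {s..} l \<partial>lborel) = ennreal (s powr (- e) / e)"
proof -
  have I: "((\<lambda>x. x powr (- e - 1)) has_integral (s powr (- e) / e)) {s..}"
    using has_integral_powr_to_inf[of "- e - 1" s] assms by simp
  have ind: "(\<lambda>x. indicator {s..} x * x powr (- e - 1)) = (\<lambda>x. if x \<in> {s..} then x powr (- e - 1) else 0)"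
    by (auto simp: indicator_def)
  have "(\<integral>\<^sup>+l. ennreal (indicator {s..} l * l powr (- e - 1)) \<partial>lborel) = ennreal (s powr (- e) / e)"
    by (intro nn_integral_has_integral_lborel) (simp_all only: ind I has_integral_restrict_UNIV, auto)
  moreover have "(\<integral>\<^sup>+l. ennreal (l powr (- e - 1)) * indicator {s..} l \<partial>lborel) =
      (\<integral>\<^sup>+l. ennreal (indicator {s..} l * l powr (- e - 1)) \<partial>lborel)"
    by (intro nn_integral_cong) (auto simp: indicator_def)
  ultimately show ?thesis by simp
qed

lemma layer_cake:
  fixes S :: "'a \<Rightarrow> real"
  assumes "sigma_finite_measure M" and [measurable]: "S \<in> borel_measurable M"
    and S: "\<And>x. x \<in> space M \<Longrightarrow> 0 \<le> S x" and p: "0 < p"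
  shows "(\<integral>\<^sup>+x. ennreal (S x powr p) \<partial>M) =
    (\<integral>\<^sup>+l. ennreal (p * l powr (p - 1)) * indicator {0<..} l * emeasure M {x \<in> space M. l < S x} \<partial>lborel)"
proof -
  interpret M: sigma_finite_measure M by fact
  interpret P: pair_sigma_finite lborel M ..
  have "(\<integral>\<^sup>+x. ennreal (S x powr p) \<partial>M) =
      (\<integral>\<^sup>+x. (\<integral>\<^sup>+l. ennreal (p * l powr (p - 1)) * indicator {0<..} l * indicator {l<..} (S x) \<partial>lborel) \<partial>M)"
  proof (rule nn_integral_cong)
    fix x assume x: "x \<in> space M"
    have "(\<integral>\<^sup>+l. ennreal (p * l powr (p - 1)) * indicator {0<..} l * indicator {l<..} (S x) \<partial>lborel) =
        (\<integral>\<^sup>+l. ennreal p * (ennreal (l powr (p - 1)) * indicator {0<..<S x} l) \<partial>lborel)"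
      by (intro nn_integral_cong) (use p in \<open>auto simp: indicator_def ennreal_mult\<close>)
    also have "\<dots> = ennreal p * ennreal (S x powr p / p)"
      using nn_integral_powr_below[OF p S[OF x]] by (simp add: nn_integral_cmult)
    finally show "ennreal (S x powr p) =
        (\<integral>\<^sup>+l. ennreal (p * l powr (p - 1)) * indicator {0<..} l * indicator {l<..} (S x) \<partial>lborel)"
      using p by (simp flip: ennreal_mult)
  qed
  also have "\<dots> = (\<integral>\<^sup>+l. (\<integral>\<^sup>+x. ennreal (p * l powr (p - 1)) * indicator {0<..} l * indicator {l<..} (S x) \<partial>M) \<partial>lborel)"
    by (rule P.Fubini') (simp add: indicator_def, measurable)
  also have "\<dots> = (\<integral>\<^sup>+l. ennreal (p * l powr (p - 1)) * indicator {0<..} l * emeasure M {x \<in> space M. l < S x} \<partial>lborel)"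
  proof (rule nn_integral_cong)
    fix l :: real
    have "(\<integral>\<^sup>+x. ennreal (p * l powr (p - 1)) * indicator {0<..} l * indicator {l<..} (S x) \<partial>M) =
      ennreal (p * l powr (p - 1)) * indicator {0<..} l * (\<integral>\<^sup>+x. indicator {l<..} (S x) \<partial>M)"
      by (rule nn_integral_cmult) measurable
    also have "(\<integral>\<^sup>+x. indicator {l<..} (S x) \<partial>M) = (\<integral>\<^sup>+x. indicator {x \<in> space M. l < S x} x \<partial>M)"
      by (intro nn_integral_cong) (auto simp: indicator_def)
    finally show "(\<integral>\<^sup>+x. ennreal (p * l powr (p - 1)) * indicator {0<..} l * indicator {l<..} (S x) \<partial>M) =
      ennreal (p * l powr (p - 1)) * indicator {0<..} l * emeasure M {x \<in> space M. l < S x}"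
      by simp
  qed
  finally show ?thesis .
qed

text \<open>The cut at height \<open>\<gamma> * l\<close> is built into the hypothesis
  \<open>weak\<close>, so the lemma speaks of two functions and not of an operator. Integrating in l
  before x leaves an elementary power integral at each point. The free \<open>\<gamma>\<close> moves
  weight between the two endpoint constants; the decay argument later lets it grow or shrink
  geometrically in the number of steps.\<close>

lemma marcinkiewicz:
  fixes S f :: "'a \<Rightarrow> real" and p q0 q1 \<gamma> A0 A1 :: real
  assumes M: "sigma_finite_measure M"
    and [measurable]: "S \<in> borel_measurable M" "f \<in> borel_measurable M"
    and S: "\<And>x. x \<in> space M \<Longrightarrow> 0 \<le> S x" and f: "\<And>x. x \<in> space M \<Longrightarrow> 0 \<le> f x"
    and par: "0 < q0" "q0 < p" "p < q1" "0 < \<gamma>" "0 \<le> A0" "0 \<le> A1"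
    and weak: "\<And>l. 0 < l \<Longrightarrow> emeasure M {x \<in> space M. l < S x} \<le>
        ennreal (A0 * l powr - q0) * (\<integral>\<^sup>+x. ennreal (f x powr q0) * indicator {\<gamma> * l<..} (f x) \<partial>M)
      + ennreal (A1 * l powr - q1) * (\<integral>\<^sup>+x. ennreal (f x powr q1) * indicator {..\<gamma> * l} (f x) \<partial>M)"
  shows "(\<integral>\<^sup>+x. ennreal (S x powr p) \<partial>M) \<le>
     ennreal (p * (A0 * \<gamma> powr (q0 - p) / (p - q0) + A1 * \<gamma> powr (q1 - p) / (q1 - p)))
       * (\<integral>\<^sup>+x. ennreal (f x powr p) \<partial>M)"
proof -
  interpret M: sigma_finite_measure M by fact
  interpret P: pair_sigma_finite lborel M ..
  \<comment> \<open>\<open>u\<close> and \<open>v\<close> are the two terms of \<open>weak\<close>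
    times the layer-cake density, rewritten with x fixed: \<open>u\<close> lives on the levels below
    f x / \<gamma>, \<open>v\<close> on those above.\<close>
  define u where "u l x = ennreal (p * A0) * (ennreal (l powr (p - q0 - 1)) * indicator {0<..<f x / \<gamma>} l * ennreal (f x powr q0))" for l x
  define v where "v l x = ennreal (p * A1) * (ennreal (l powr (- (q1 - p) - 1)) * indicator {0<..} l * indicator {f x / \<gamma>..} l * ennreal (f x powr q1))" for l x
  have "(\<integral>\<^sup>+x. ennreal (S x powr p) \<partial>M) =
    (\<integral>\<^sup>+l. ennreal (p * l powr (p - 1)) * indicator {0<..} l * emeasure M {x \<in> space M. l < S x} \<partial>lborel)"
    using par by (intro layer_cake M S) auto
  also have "\<dots> \<le> (\<integral>\<^sup>+l. (\<integral>\<^sup>+x. u l x + v l x \<partial>M) \<partial>lborel)"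
  proof (rule nn_integral_mono)
    fix l :: real
    show "ennreal (p * l powr (p - 1)) * indicator {0<..} l * emeasure M {x \<in> space M. l < S x}
      \<le> (\<integral>\<^sup>+x. u l x + v l x \<partial>M)"
    proof (cases "0 < l")
      case True
      have e0: "p * l powr (p - 1) * (A0 * l powr - q0) = p * A0 * l powr (p - q0 - 1)"
        using True by (simp add: algebra_simps flip: powr_add)
      have e1: "p * l powr (p - 1) * (A1 * l powr - q1) = p * A1 * l powr (- (q1 - p) - 1)"
        using True by (simp add: algebra_simps flip: powr_add)
      have E0: "ennreal (p * l powr (p - 1)) * ennreal (A0 * l powr - q0) = ennreal (p * A0 * l powr (p - q0 - 1))"
        and E1: "ennreal (p * l powr (p - 1)) * ennreal (A1 * l powr - q1) = ennreal (p * A1 * l powr (- (q1 - p) - 1))"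
        using par by (subst ennreal_mult[symmetric], simp, simp, simp add: e0 e1)+
      have "ennreal (p * l powr (p - 1)) * indicator {0<..} l * emeasure M {x \<in> space M. l < S x}
        \<le> ennreal (p * l powr (p - 1)) *
         (ennreal (A0 * l powr - q0) * (\<integral>\<^sup>+x. ennreal (f x powr q0) * indicator {\<gamma> * l<..} (f x) \<partial>M)
      + ennreal (A1 * l powr - q1) * (\<integral>\<^sup>+x. ennreal (f x powr q1) * indicator {..\<gamma> * l} (f x) \<partial>M))"
        using weak[OF True] True by (intro mult_mono) auto
      also have "\<dots> = (\<integral>\<^sup>+x. ennreal (p * A0 * l powr (p - q0 - 1)) * (ennreal (f x powr q0) * indicator {\<gamma> * l<..} (f x)) \<partial>M)
        + (\<integral>\<^sup>+x. ennreal (p * A1 * l powr (- (q1 - p) - 1)) * (ennreal (f x powr q1) * indicator {..\<gamma> * l} (f x)) \<partial>M)"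
        by (subst (1 2) nn_integral_cmult) (simp_all add: distrib_left E0 E1 flip: mult.assoc)
      also have "\<dots> = (\<integral>\<^sup>+x. u l x + v l x \<partial>M)"
      proof (subst nn_integral_add[symmetric])
        show "(\<integral>\<^sup>+x. ennreal (p * A0 * l powr (p - q0 - 1)) * (ennreal (f x powr q0) * indicator {\<gamma> * l<..} (f x))
          + ennreal (p * A1 * l powr (- (q1 - p) - 1)) * (ennreal (f x powr q1) * indicator {..\<gamma> * l} (f x)) \<partial>M)
          = (\<integral>\<^sup>+x. u l x + v l x \<partial>M)"
        proof (rule nn_integral_cong)
          fix x
          have "(\<gamma> * l < f x) = (l < f x / \<gamma>)" "(f x \<le> \<gamma> * l) = (f x / \<gamma> \<le> l)"
            using par by (auto simp: field_simps)
          then show "ennreal (p * A0 * l powr (p - q0 - 1)) * (ennreal (f x powr q0) * indicator {\<gamma> * l<..} (f x))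
          + ennreal (p * A1 * l powr (- (q1 - p) - 1)) * (ennreal (f x powr q1) * indicator {..\<gamma> * l} (f x)) = u l x + v l x"
            using True par by (auto simp: u_def v_def indicator_def ennreal_mult mult_ac)
        qed
      qed measurable
      finally show ?thesis .
    qed simp
  qed
  also have "\<dots> = (\<integral>\<^sup>+x. (\<integral>\<^sup>+l. u l x + v l x \<partial>lborel) \<partial>M)"
    by (rule P.Fubini'[symmetric]) (simp add: u_def v_def indicator_def, measurable)
  also have "\<dots> \<le> (\<integral>\<^sup>+x. ennreal (p * (A0 * \<gamma> powr (q0 - p) / (p - q0) + A1 * \<gamma> powr (q1 - p) / (q1 - p))) * ennreal (f x powr p) \<partial>M)"
  proof (rule nn_integral_mono)
    fix x assume x: "x \<in> space M"
    show "(\<integral>\<^sup>+l. u l x + v l x \<partial>lborel) \<le>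
      ennreal (p * (A0 * \<gamma> powr (q0 - p) / (p - q0) + A1 * \<gamma> powr (q1 - p) / (q1 - p))) * ennreal (f x powr p)"
    proof (cases "f x = 0")
      case True
      then have "u l x + v l x = 0" for l by (simp add: u_def v_def)
      then show ?thesis by simp
    next
      case False
      then have fx: "0 < f x" using f[OF x] by simp
      have [measurable]: "(\<lambda>l. u l x) \<in> borel_measurable lborel" "(\<lambda>l. v l x) \<in> borel_measurable lborel"
        unfolding u_def v_def by measurable
      have U: "(\<integral>\<^sup>+l. u l x \<partial>lborel) = ennreal (p * A0 * ((f x / \<gamma>) powr (p - q0) / (p - q0) * f x powr q0))"
        unfolding u_def using par fx
        by (subst nn_integral_cmult, measurable, subst nn_integral_multc, measurable,
            subst nn_integral_powr_below) (auto simp flip: ennreal_mult)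
      have "(\<integral>\<^sup>+l. v l x \<partial>lborel) = (\<integral>\<^sup>+l. ennreal (p * A1) * (ennreal (l powr (- (q1 - p) - 1)) * indicator {f x / \<gamma>..} l * ennreal (f x powr q1)) \<partial>lborel)"
      proof (rule nn_integral_cong)
        fix l
        have "f x / \<gamma> \<le> l \<Longrightarrow> 0 < l" using fx par by (meson divide_pos_pos order_less_le_trans)
        then show "v l x = ennreal (p * A1) * (ennreal (l powr (- (q1 - p) - 1)) * indicator {f x / \<gamma>..} l * ennreal (f x powr q1))"
          unfolding v_def by (auto simp: indicator_def)
      qed
      also have "\<dots> = ennreal (p * A1 * ((f x / \<gamma>) powr (- (q1 - p)) / (q1 - p) * f x powr q1))"
        using par fx
        by (subst nn_integral_cmult, measurable, subst nn_integral_multc, measurable,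
            subst nn_integral_powr_above) (auto simp flip: ennreal_mult)
      finally have V: "(\<integral>\<^sup>+l. v l x \<partial>lborel) = ennreal (p * A1 * ((f x / \<gamma>) powr (- (q1 - p)) / (q1 - p) * f x powr q1))" .
      have U': "(f x / \<gamma>) powr (p - q0) * f x powr q0 = \<gamma> powr (q0 - p) * f x powr p"
        using fx par by (simp add: powr_divide powr_diff field_simps)
      have V': "(f x / \<gamma>) powr (- (q1 - p)) * f x powr q1 = \<gamma> powr (q1 - p) * f x powr p"
        using fx par by (simp add: powr_divide powr_diff powr_minus field_simps)
      have "(\<integral>\<^sup>+l. u l x + v l x \<partial>lborel) = ennreal (p * A0 * ((f x / \<gamma>) powr (p - q0) / (p - q0) * f x powr q0)
         + p * A1 * ((f x / \<gamma>) powr (- (q1 - p)) / (q1 - p) * f x powr q1))"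
        using par by (subst nn_integral_add) (simp_all add: U V)
      also have "p * A0 * ((f x / \<gamma>) powr (p - q0) / (p - q0) * f x powr q0)
         + p * A1 * ((f x / \<gamma>) powr (- (q1 - p)) / (q1 - p) * f x powr q1)
         = p * A0 / (p - q0) * ((f x / \<gamma>) powr (p - q0) * f x powr q0)
         + p * A1 / (q1 - p) * ((f x / \<gamma>) powr (- (q1 - p)) * f x powr q1)" by simp
      also have "\<dots> = (p * (A0 * \<gamma> powr (q0 - p) / (p - q0) + A1 * \<gamma> powr (q1 - p) / (q1 - p))) * f x powr p"
        unfolding U' V' by (simp add: algebra_simps)
      finally show ?thesis using par by (simp add: ennreal_mult)
    qed
  qed
  also have "\<dots> = ennreal (p * (A0 * \<gamma> powr (q0 - p) / (p - q0) + A1 * \<gamma> powr (q1 - p) / (q1 - p)))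
       * (\<integral>\<^sup>+x. ennreal (f x powr p) \<partial>M)"
    by (rule nn_integral_cmult) measurable
  finally show ?thesis .
qed

section \<open>Powers of extended nonnegative reals, Jensen's inequality, translation
  invariance\<close>

lemma ennreal_powr_ennreal: "0 \<le> x \<Longrightarrow> ennreal_powr (ennreal x) p = ennreal (x powr p)"
  by (simp add: ennreal_powr_def)

lemma ennreal_powr_top [simp]: "ennreal_powr \<infinity> p = \<infinity>" "ennreal_powr top p = \<infinity>"
  by (simp_all add: ennreal_powr_def)

lemma ennreal_powr_0 [simp]: "ennreal_powr 0 p = 0"
  by (simp add: ennreal_powr_def)

lemma ennreal_powr_mono: "0 < p \<Longrightarrow> a \<le> b \<Longrightarrow> ennreal_powr a p \<le> ennreal_powr b p"
  by (cases a; cases b) (auto simp: ennreal_powr_ennreal top_unique intro!: ennreal_leI powr_mono2)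

lemma ennreal_powr_mult: "0 < p \<Longrightarrow> ennreal_powr (a * b) p = ennreal_powr a p * ennreal_powr b p"
  by (cases a; cases b)
    (auto simp: ennreal_powr_ennreal powr_mult ennreal_mult_top ennreal_top_mult simp flip: ennreal_mult)

lemma ennreal_powr_powr_inverse: "0 < p \<Longrightarrow> ennreal_powr (ennreal_powr a p) (1 / p) = a"
  by (cases a) (auto simp: ennreal_powr_ennreal powr_powr)

lemma ennreal_powr_inverse_powr: "0 < p \<Longrightarrow> ennreal_powr (ennreal_powr a (1 / p)) p = a"
  by (cases a) (auto simp: ennreal_powr_ennreal powr_powr)

text \<open>Raising to the power p is an order isomorphism whose inverse is the power 1 / p. This
  covers infinite values and an empty index set at once.\<close>

lemma ennreal_powr_SUP:
  assumes "0 < p" shows "ennreal_powr (SUP i\<in>I. f i) p = (SUP i\<in>I. ennreal_powr (f i) p)"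
proof (rule antisym)
  have "(SUP i\<in>I. f i) \<le> ennreal_powr (SUP i\<in>I. ennreal_powr (f i) p) (1 / p)"
  proof (rule SUP_least)
    fix i assume "i \<in> I"
    then have "ennreal_powr (f i) p \<le> (SUP i\<in>I. ennreal_powr (f i) p)" by (rule SUP_upper)
    then have "ennreal_powr (ennreal_powr (f i) p) (1 / p) \<le> ennreal_powr (SUP i\<in>I. ennreal_powr (f i) p) (1 / p)"
      using assms by (intro ennreal_powr_mono) auto
    then show "f i \<le> ennreal_powr (SUP i\<in>I. ennreal_powr (f i) p) (1 / p)"
      using assms by (simp add: ennreal_powr_powr_inverse)
  qed
  then have "ennreal_powr (SUP i\<in>I. f i) p \<le> ennreal_powr (ennreal_powr (SUP i\<in>I. ennreal_powr (f i) p) (1 / p)) p"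
    using assms by (intro ennreal_powr_mono)
  then show "ennreal_powr (SUP i\<in>I. f i) p \<le> (SUP i\<in>I. ennreal_powr (f i) p)"
    using assms by (simp add: ennreal_powr_inverse_powr)
  show "(SUP i\<in>I. ennreal_powr (f i) p) \<le> ennreal_powr (SUP i\<in>I. f i) p"
    using assms by (intro SUP_least ennreal_powr_mono SUP_upper)
qed

lemma borel_measurable_ennreal_powr [measurable]:
  assumes [measurable]: "f \<in> borel_measurable M"
  shows "(\<lambda>x. ennreal_powr (f x) p) \<in> borel_measurable M"
  unfolding ennreal_powr_def by measurable

text \<open>By convexity a^p lies above its tangent at any height c; Young's inequality is this
  statement solved for a. Integrating it and optimising c gives the bound. Only an upper bound for
  the total mass is assumed, so that the lemma serves cells, balls, finite sums and weighted sums
  alike.\<close>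

lemma nn_integral_jensen_powr:
  assumes [measurable]: "F \<in> borel_measurable M" and m: "emeasure M (space M) \<le> ennreal m" "0 < m" and p: "1 < p"
  shows "ennreal_powr (\<integral>\<^sup>+x. F x \<partial>M) p \<le> ennreal (m powr (p - 1)) * (\<integral>\<^sup>+x. ennreal_powr (F x) p \<partial>M)"
proof (cases "\<integral>\<^sup>+x. ennreal_powr (F x) p \<partial>M")
  case (real i)
  show ?thesis
  proof (cases "i = 0")
    case True
    then have "AE x in M. ennreal_powr (F x) p = 0"
      using real nn_integral_0_iff_AE[of "\<lambda>x. ennreal_powr (F x) p" M] by simp
    then have "AE x in M. F x = 0"
      by eventually_elim (metis ennreal_powr_0 ennreal_powr_powr_inverse p less_trans zero_less_one)
    then have "(\<integral>\<^sup>+x. F x \<partial>M) = 0"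
      by (subst nn_integral_0_iff_AE) auto
    then show ?thesis by simp
  next
    case False
    then have i: "0 < i" using real by simp
    \<comment> \<open>The p-mean of F with respect to mass m; with this choice the two integrated
      terms add up to c * m.\<close>
    define c where "c = (i / m) powr (1 / p)"
    have c: "0 < c" using i m by (simp add: c_def)
    have cp: "c powr p = i / m" using i m p by (simp add: c_def powr_powr)
    have pt: "F x \<le> ennreal (c powr (1 - p) / p) * ennreal_powr (F x) p + ennreal (c * (1 - 1 / p))" for x
    proof (cases "F x")
      case (real a)
      have "a / c * 1 \<le> (a / c) powr p / p + 1 powr (1 / (1 - 1/p)) / (1 / (1 - 1/p))"
        using p real c by (intro Youngs_inequality) (auto simp: field_simps)
      then have "a \<le> c * ((a / c) powr p / p + (1 - 1/p))"
        using c by (simp add: field_simps)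
      also have "\<dots> = c powr (1 - p) / p * a powr p + c * (1 - 1/p)"
        using c real by (simp add: powr_divide powr_diff field_simps)
      finally show ?thesis
        using real c p by (simp add: ennreal_powr_ennreal flip: ennreal_mult ennreal_plus)
    next
      case top
      then show ?thesis using c p by (simp add: ennreal_mult_top)
    qed
    have "(\<integral>\<^sup>+x. F x \<partial>M) \<le> (\<integral>\<^sup>+x. ennreal (c powr (1 - p) / p) * ennreal_powr (F x) p + ennreal (c * (1 - 1 / p)) \<partial>M)"
      by (intro nn_integral_mono pt)
    also have "\<dots> = ennreal (c powr (1 - p) / p) * ennreal i + ennreal (c * (1 - 1 / p)) * emeasure M (space M)"
      by (subst nn_integral_add) (auto simp: nn_integral_cmult real)
    also have "\<dots> \<le> ennreal (c powr (1 - p) / p) * ennreal i + ennreal (c * (1 - 1 / p)) * ennreal m"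
      using m by (intro add_left_mono mult_left_mono) auto
    also have "\<dots> = ennreal (c powr (1 - p) / p * i + c * (1 - 1 / p) * m)"
      using c p m i by (simp flip: ennreal_mult ennreal_plus)
    also have "c powr (1 - p) / p * i + c * (1 - 1 / p) * m = c * m"
    proof -
      have "i = c powr p * m" using cp m by simp
      then have "c powr (1 - p) * i = c * m" using c by (simp add: powr_diff)
      then show ?thesis using p by (simp add: field_simps)
    qed
    finally have "ennreal_powr (\<integral>\<^sup>+x. F x \<partial>M) p \<le> ennreal_powr (ennreal (c * m)) p"
      using p by (intro ennreal_powr_mono) auto
    also have "\<dots> = ennreal (m powr (p - 1) * i)"
      using c m by (simp add: ennreal_powr_ennreal powr_mult cp powr_diff mult_ac)
    finally show ?thesis using real by (simp add: ennreal_mult)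
  qed
next
  case top
  then show ?thesis using m by (simp add: ennreal_mult_top)
qed

lemma nn_integral_lborel_translate:
  fixes f :: "'a::euclidean_space \<Rightarrow> ennreal"
  assumes [measurable]: "f \<in> borel_measurable borel"
  shows "(\<integral>\<^sup>+x. f (x + a) \<partial>lborel) = (\<integral>\<^sup>+x. f x \<partial>lborel)"
proof -
  have "(\<integral>\<^sup>+x. f x \<partial>lborel) = (\<integral>\<^sup>+x. f x \<partial>distr lborel borel ((+) a))"
    by (simp only: lborel_distr_plus)
  also have "\<dots> = (\<integral>\<^sup>+x. f (a + x) \<partial>lborel)" by (subst nn_integral_distr) auto
  finally show ?thesis by (simp add: add.commute)
qed

lemma nn_integral_lborel_translate_diff:
  fixes f :: "'a::euclidean_space \<Rightarrow> ennreal"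
  assumes "f \<in> borel_measurable borel"
  shows "(\<integral>\<^sup>+x. f (x - a) \<partial>lborel) = (\<integral>\<^sup>+x. f x \<partial>lborel)"
  using nn_integral_lborel_translate[OF assms, of "- a"] by simp

lemma emeasure_lborel_translate:
  fixes S :: "'a::euclidean_space set"
  assumes [measurable]: "S \<in> sets borel"
  shows "{x. x - a \<in> S} \<in> sets borel" and "emeasure lborel {x. x - a \<in> S} = emeasure lborel S"
proof -
  show [measurable]: "{x. x - a \<in> S} \<in> sets borel" by measurable
  have "emeasure lborel {x. x - a \<in> S} = (\<integral>\<^sup>+x. indicator {x. x - a \<in> S} x \<partial>lborel)"
    by simp
  also have "\<dots> = (\<integral>\<^sup>+x. indicator S (x - a) \<partial>lborel)"
    by (intro nn_integral_cong) (auto simp: indicator_def)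
  also have "\<dots> = emeasure lborel S"
    by (subst nn_integral_lborel_translate_diff) auto
  finally show "emeasure lborel {x. x - a \<in> S} = emeasure lborel S" .
qed

section \<open>Averages over the cells of a partition\<close>

text \<open>A partition is encoded by a label map whose fibres are the cells. Measurability is asked
  of the relation \<open>c x = c y\<close>, so the type of labels carries no structure. As all cells
  have measure \<open>\<kappa>\<close>, the normalising factor is a constant.\<close>

locale equipartition =
  fixes c :: "'a::euclidean_space \<Rightarrow> 'i" and \<kappa> :: real
  assumes \<kappa>: "0 < \<kappa>"
    and cells [measurable]: "Measurable.pred (borel \<Otimes>\<^sub>M borel) (\<lambda>(x, y). c x = c y)"
    and emeasure_cell: "emeasure lborel {y. c y = c x} = ennreal \<kappa>"
begin

definition avg :: "('a \<Rightarrow> ennreal) \<Rightarrow> 'a \<Rightarrow> ennreal" where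
  "avg F x = ennreal (1 / \<kappa>) * (\<integral>\<^sup>+y. F y * of_bool (c y = c x) \<partial>lborel)"

lemma cells' [measurable]: "Measurable.pred (borel \<Otimes>\<^sub>M borel) (\<lambda>z. c (fst z) = c (snd z))"
  using cells by (simp add: case_prod_beta)

lemma pred_cell [measurable]:
  assumes [measurable]: "f \<in> borel_measurable M" "g \<in> borel_measurable M"
  shows "Measurable.pred M (\<lambda>x. c (f x) = c (g x))"
proof -
  have "(\<lambda>x. (f x, g x)) \<in> M \<rightarrow>\<^sub>M borel \<Otimes>\<^sub>M borel" by measurable
  from measurable_compose[OF this cells'] show ?thesis by simp
qed

lemma avg_measurable [measurable]:
  assumes [measurable]: "F \<in> borel_measurable borel"
  shows "avg F \<in> borel_measurable borel"
  unfolding avg_def[abs_def] by measurable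

lemma avg_measurable' [measurable]:
  assumes [measurable]: "F \<in> borel_measurable borel" "g \<in> borel_measurable M"
  shows "(\<lambda>x. avg F (g x)) \<in> borel_measurable M"
  by (rule measurable_compose[OF assms(2) avg_measurable]) fact

lemma avg_cong_cell: "c x = c x' \<Longrightarrow> avg F x = avg F x'"
  by (simp add: avg_def)

lemma avg_mono: "(\<And>x. F x \<le> G x) \<Longrightarrow> avg F x \<le> avg G x"
  unfolding avg_def by (intro mult_left_mono nn_integral_mono mult_right_mono) auto

lemma avg_of_const: "avg (\<lambda>_. B) x = B"
proof -
  have "(\<integral>\<^sup>+y. B * of_bool (c y = c x) \<partial>lborel) = (\<integral>\<^sup>+y. B * indicator {y. c y = c x} y \<partial>lborel)"
    by (intro nn_integral_cong) (auto simp: indicator_def)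
  also have "\<dots> = B * ennreal \<kappa>"
    by (subst nn_integral_cmult_indicator) (auto simp: emeasure_cell)
  finally show ?thesis
    using \<kappa> by (simp add: avg_def mult.commute[of B] flip: ennreal_mult mult.assoc)
qed

lemma avg_bound: "(\<And>x. F x \<le> B) \<Longrightarrow> avg F x \<le> B"
  using avg_mono[of F "\<lambda>_. B" x] by (simp add: avg_of_const)

text \<open>In the double integral over pairs of points in a common cell, g may be evaluated at
  either of the two points.\<close>

lemma avg_adjoint:
  assumes [measurable]: "F \<in> borel_measurable borel" "g \<in> borel_measurable borel"
    and g: "\<And>x y. c x = c y \<Longrightarrow> g x = g y"
  shows "(\<integral>\<^sup>+x. avg F x * g x \<partial>lborel) = (\<integral>\<^sup>+x. F x * g x \<partial>lborel)"
proof -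
  have "(\<integral>\<^sup>+x. avg F x * g x \<partial>lborel) =
    (\<integral>\<^sup>+x. (\<integral>\<^sup>+y. ennreal (1 / \<kappa>) * g x * F y * of_bool (c y = c x) \<partial>lborel) \<partial>lborel)"
    unfolding avg_def by (subst nn_integral_cmult[symmetric] nn_integral_multc[symmetric]; measurable)+
       (simp add: mult_ac)
  also have "\<dots> = (\<integral>\<^sup>+y. (\<integral>\<^sup>+x. ennreal (1 / \<kappa>) * g x * F y * of_bool (c y = c x) \<partial>lborel) \<partial>lborel)"
    by (rule lborel_pair.Fubini') measurable
  also have "\<dots> = (\<integral>\<^sup>+y. (\<integral>\<^sup>+x. ennreal (1 / \<kappa>) * g y * F y * indicator {x. c x = c y} x \<partial>lborel) \<partial>lborel)"
    by (intro nn_integral_cong) (auto simp: indicator_def dest: g)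
  also have "\<dots> = (\<integral>\<^sup>+y. F y * g y * (ennreal \<kappa> * ennreal (1 / \<kappa>)) \<partial>lborel)"
    by (intro nn_integral_cong, subst nn_integral_cmult_indicator) (auto simp: emeasure_cell mult_ac)
  also have "ennreal \<kappa> * ennreal (1 / \<kappa>) = 1"
    using \<kappa> by (simp flip: ennreal_mult)
  finally show ?thesis by simp
qed

lemma nn_integral_avg:
  assumes "F \<in> borel_measurable borel"
  shows "(\<integral>\<^sup>+x. avg F x \<partial>lborel) = (\<integral>\<^sup>+x. F x \<partial>lborel)"
  using avg_adjoint[OF assms, of "\<lambda>_. 1"] by simp

text \<open>Jensen's inequality for the normalised Lebesgue measure on the cell of x.\<close>

lemma avg_powr:
  assumes [measurable]: "F \<in> borel_measurable borel" and p: "1 < p"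
  shows "ennreal_powr (avg F x) p \<le> avg (\<lambda>y. ennreal_powr (F y) p) x"
proof -
  define N where "N = density lborel (\<lambda>y. ennreal (1 / \<kappa>) * of_bool (c y = c x))"
  have *: "avg G x = (\<integral>\<^sup>+y. G y \<partial>N)" if [measurable]: "G \<in> borel_measurable borel" for G
    unfolding N_def avg_def
    by (subst nn_integral_density, measurable, subst nn_integral_cmult[symmetric], measurable) (simp add: mult_ac)
  have "emeasure N (space N) \<le> ennreal 1"
    using *[of "\<lambda>_. 1"] by (simp add: avg_of_const)
  then have "ennreal_powr (\<integral>\<^sup>+y. F y \<partial>N) p \<le> ennreal (1 powr (p - 1)) * (\<integral>\<^sup>+y. ennreal_powr (F y) p \<partial>N)"
    by (intro nn_integral_jensen_powr) (auto simp: p N_def)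
  then show ?thesis by (simp add: *)
qed

lemma nn_integral_avg_powr:
  assumes [measurable]: "F \<in> borel_measurable borel" and p: "1 < p"
  shows "(\<integral>\<^sup>+x. ennreal_powr (avg F x) p \<partial>lborel) \<le> (\<integral>\<^sup>+x. ennreal_powr (F x) p \<partial>lborel)"
proof -
  have "(\<integral>\<^sup>+x. ennreal_powr (avg F x) p \<partial>lborel) \<le> (\<integral>\<^sup>+x. avg (\<lambda>y. ennreal_powr (F y) p) x \<partial>lborel)"
    using p by (intro nn_integral_mono avg_powr) auto
  then show ?thesis by (simp add: nn_integral_avg)
qed

end

section \<open>Intervals and rectangles as cells; maximal functions of shifted averages\<close>

lemma floor_cell_eq:
  fixes h :: real assumes "0 < h"
  shows "{y. \<lfloor>y / h\<rfloor> = m} = {h * of_int m..<h * of_int m + h}"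
  using assms by (auto simp: floor_eq_iff field_simps)

lemma equipartition_floor: "0 < h \<Longrightarrow> equipartition (\<lambda>x::real. \<lfloor>x / h\<rfloor>) h"
proof
  assume "0 < h"
  then show "emeasure lborel {y. \<lfloor>y / h\<rfloor> = \<lfloor>x / h\<rfloor>} = ennreal h" for x
    by (simp add: floor_cell_eq)
qed simp_all

definition cell2 :: "real \<Rightarrow> real \<Rightarrow> real \<times> real \<Rightarrow> int \<times> int" where
  "cell2 a b x = (\<lfloor>fst x / a\<rfloor>, \<lfloor>snd x / b\<rfloor>)"

lemma equipartition_cell2: 
  assumes "0 < a" "0 < b" shows "equipartition (cell2 a b) (a * b)"
proof
  show "0 < a * b" using assms by simp
  have [measurable]: "fst \<in> borel_measurable (borel :: (real \<times> real) measure)" "snd \<in> borel_measurable (borel :: (real \<times> real) measure)"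
    by (intro borel_measurable_continuous_onI continuous_intros)+
  show "Measurable.pred (borel \<Otimes>\<^sub>M borel) (\<lambda>(x, y). cell2 a b x = cell2 a b y)"
    unfolding cell2_def case_prod_beta by simp measurable
  fix x :: "real \<times> real"
  have "{y. cell2 a b y = cell2 a b x} = {y. \<lfloor>y / a\<rfloor> = \<lfloor>fst x / a\<rfloor>} \<times> {y. \<lfloor>y / b\<rfloor> = \<lfloor>snd x / b\<rfloor>}"
    by (auto simp: cell2_def)
  then show "emeasure lborel {y. cell2 a b y = cell2 a b x} = ennreal (a * b)"
    using assms by (simp add: floor_cell_eq lborel_prod[symmetric] lborel.emeasure_pair_measure_Times ennreal_mult)
qed

definition davg :: "real \<Rightarrow> real \<Rightarrow> (real \<times> real \<Rightarrow> ennreal) \<Rightarrow> real \<times> real \<Rightarrow> ennreal" where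
  "davg a b = equipartition.avg (cell2 a b) (a * b)"

lemma davg_measurable [measurable]:
  assumes ab: "0 < a" "0 < b" and "F \<in> borel_measurable borel" "g \<in> borel_measurable M"
  shows "(\<lambda>x. davg a b F (g x)) \<in> borel_measurable M"
  unfolding davg_def by (rule equipartition.avg_measurable'[OF equipartition_cell2[OF ab] assms(3,4)])

text \<open>A stopping argument in which small indices are coarse scales. If the average of index k
  at x - v k exceeds l, then x - v k lies in the stopping set of some level j \<le> k. Each k below
  j + L contributes one translate of that set; for larger k the shift is at most one cell of level
  j, and nine neighbouring translates cover all of them. The price of the shifts is thus the number
  L of scales needed to absorb them, the logarithm of their relative size.\<close>

lemma shifted_maximal_weak:
  fixes K :: "int set" and a b :: "int \<Rightarrow> real" and v :: "int \<Rightarrow> real \<times> real" and L :: nat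
  assumes K: "finite K" and a: "\<And>k. 0 < a k" and b: "\<And>k. 0 < b k"
    and nested: "\<And>j k x y. j \<in> K \<Longrightarrow> k \<in> K \<Longrightarrow> j \<le> k \<Longrightarrow> cell2 (a k) (b k) x = cell2 (a k) (b k) y
      \<Longrightarrow> cell2 (a j) (b j) x = cell2 (a j) (b j) y"
    and shift: "\<And>j k. j \<in> K \<Longrightarrow> k \<in> K \<Longrightarrow> j + int L \<le> k \<Longrightarrow> \<bar>fst (v k)\<bar> \<le> a j \<and> \<bar>snd (v k)\<bar> \<le> b j"
    and f [measurable]: "f \<in> borel_measurable borel" and l: "0 < l"
  shows "emeasure lborel {x. \<exists>k\<in>K. ennreal l < davg (a k) (b k) f (x - v k)}
    \<le> ennreal ((9 + real L) / l) * (\<integral>\<^sup>+x. f x \<partial>lborel)"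
proof -
  note [measurable] = a b
  have eq: "equipartition (cell2 (a k) (b k)) (a k * b k)" for k
    using a b by (rule equipartition_cell2)
  define A where "A k = davg (a k) (b k) f" for k
  have [measurable]: "A k \<in> borel_measurable borel" for k
    unfolding A_def by measurable
  have [measurable]: "(\<lambda>x. A k (x - w)) \<in> borel_measurable borel" for k w
    by (rule measurable_compose[of "\<lambda>x. x - w" borel borel]) measurable
  \<comment> \<open>The stopping set of level j: among the indices in \<open>K\<close>, j is the
    first, hence the coarsest, whose average exceeds l. For j in \<open>K\<close> these sets are
    disjoint, and each is a union of cells of its level.\<close>
  define \<Omega> where "\<Omega> j = {x. ennreal l < A j x \<and> (\<forall>i\<in>K. i < j \<longrightarrow> A i x \<le> ennreal l)}" for j
  have \<Omega>m [measurable]: "\<Omega> j \<in> sets borel" for j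
  proof -
    have "\<Omega> j = {x. ennreal l < A j x} \<inter> (\<Inter>i\<in>{i\<in>K. i < j}. {x. A i x \<le> ennreal l})"
      by (auto simp: \<Omega>_def)
    also have "\<dots> \<in> sets borel"
      using K by (cases "{i\<in>K. i < j} = {}") (auto intro!: sets.Int sets.finite_INT)
    finally show ?thesis .
  qed
  have sat: "x \<in> \<Omega> j \<longleftrightarrow> y \<in> \<Omega> j" if "cell2 (a j) (b j) x = cell2 (a j) (b j) y" "j \<in> K" for j x y
  proof -
    have "A i x = A i y" if "i \<in> K" "i \<le> j" for i
      unfolding A_def davg_def
      by (rule equipartition.avg_cong_cell[OF eq]) (rule nested[OF \<open>i \<in> K\<close> \<open>j \<in> K\<close> \<open>i \<le> j\<close>], fact)
    then show ?thesis using \<open>j \<in> K\<close> by (auto simp: \<Omega>_def)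
  qed
  have "(\<Sum>j\<in>K. ennreal l * emeasure lborel (\<Omega> j)) \<le> (\<Sum>j\<in>K. \<integral>\<^sup>+x. f x * indicator (\<Omega> j) x \<partial>lborel)"
  proof (rule sum_mono)
    fix j assume j: "j \<in> K"
    have "ennreal l * emeasure lborel (\<Omega> j) = (\<integral>\<^sup>+x. ennreal l * indicator (\<Omega> j) x \<partial>lborel)"
      by (simp add: nn_integral_cmult_indicator)
    also have "\<dots> \<le> (\<integral>\<^sup>+x. A j x * indicator (\<Omega> j) x \<partial>lborel)"
      by (intro nn_integral_mono) (auto simp: \<Omega>_def indicator_def)
    also have "\<dots> = (\<integral>\<^sup>+x. f x * indicator (\<Omega> j) x \<partial>lborel)"
      unfolding A_def davg_def
    proof (rule equipartition.avg_adjoint[OF eq f])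
      show "(indicator (\<Omega> j) x :: ennreal) = indicator (\<Omega> j) y" if "cell2 (a j) (b j) x = cell2 (a j) (b j) y" for x y
        using sat[OF that j] by (simp add: indicator_def)
    qed measurable
    finally show "ennreal l * emeasure lborel (\<Omega> j) \<le> (\<integral>\<^sup>+x. f x * indicator (\<Omega> j) x \<partial>lborel)" .
  qed
  also have "\<dots> = (\<integral>\<^sup>+x. (\<Sum>j\<in>K. f x * indicator (\<Omega> j) x) \<partial>lborel)"
    by (rule nn_integral_sum[symmetric]) measurable
  also have "\<dots> \<le> (\<integral>\<^sup>+x. f x \<partial>lborel)"
  proof (rule nn_integral_mono)
    fix x
    have "i = j" if "i \<in> K" "j \<in> K" "x \<in> \<Omega> i" "x \<in> \<Omega> j" for i j
      using that by (cases i j rule: linorder_cases) (auto simp: \<Omega>_def not_le[symmetric])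
    then have "(\<Sum>j\<in>K. indicator (\<Omega> j) x :: ennreal) \<le> 1"
    proof (cases "\<exists>j\<in>K. x \<in> \<Omega> j")
      case True
      then obtain j where j: "j \<in> K" "x \<in> \<Omega> j" by blast
      have "(\<Sum>i\<in>K. indicator (\<Omega> i) x :: ennreal) = (\<Sum>i\<in>K. if i = j then 1 else 0)"
        using j \<open>\<And>i j. _ \<Longrightarrow> _ \<Longrightarrow> _ \<Longrightarrow> _ \<Longrightarrow> i = j\<close> by (intro sum.cong) (auto simp: indicator_def)
      then show ?thesis using K j by simp
    qed (auto intro!: sum_nonpos simp: indicator_def)
    then show "(\<Sum>j\<in>K. f x * indicator (\<Omega> j) x) \<le> f x"
      using mult_left_mono[of "\<Sum>j\<in>K. indicator (\<Omega> j) x" 1 "f x"] by (simp add: sum_distrib_left)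
  qed
  finally have sum\<Omega>: "(\<Sum>j\<in>K. ennreal l * emeasure lborel (\<Omega> j)) \<le> (\<integral>\<^sup>+x. f x \<partial>lborel)" .
  \<comment> \<open>Everything that the shifts of index at least j can reach from the stopping set
    of level j.\<close>
  define G where "G j = (\<Union>k\<in>{k\<in>K. j \<le> k}. {x. x - v k \<in> \<Omega> j})" for j
  have Gm [measurable]: "G j \<in> sets borel" for j
    unfolding G_def using K emeasure_lborel_translate(1)[OF \<Omega>m] by (intro sets.finite_UN) auto
  have G: "emeasure lborel (G j) \<le> ennreal (9 + real L) * emeasure lborel (\<Omega> j)" if j: "j \<in> K" for j
  proof -
    define I where "I = {-1, 0, 1 :: int} \<times> {-1, 0, 1 :: int}"
    define T where "T e = (of_int (fst e) * a j, of_int (snd e) * b j)" for e :: "int \<times> int"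
    have sub: "G j \<subseteq> (\<Union>k\<in>{j..<j + int L}. {x. x - v k \<in> \<Omega> j}) \<union> (\<Union>e\<in>I. {x. x - T e \<in> \<Omega> j})"
    proof
      fix x assume "x \<in> G j"
      then obtain k where k: "k \<in> K" "j \<le> k" "x - v k \<in> \<Omega> j" by (auto simp: G_def)
      show "x \<in> (\<Union>k\<in>{j..<j + int L}. {x. x - v k \<in> \<Omega> j}) \<union> (\<Union>e\<in>I. {x. x - T e \<in> \<Omega> j})"
      proof (cases "k < j + int L")
        case True
        then show ?thesis using k by auto
      next
        case False
        then have v: "\<bar>fst (v k)\<bar> \<le> a j" "\<bar>snd (v k)\<bar> \<le> b j" using shift[OF j k(1)] by auto
        have *: "\<lfloor>s / h\<rfloor> - \<lfloor>(s - w) / h\<rfloor> \<in> {-1, 0, 1}" if "\<bar>w\<bar> \<le> h" "0 < h" for s w h :: real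
        proof -
          have "\<bar>s / h - (s - w) / h\<bar> \<le> 1" using that by (simp add: field_simps flip: diff_divide_distrib)
          then show ?thesis by (auto; linarith)
        qed
        have **: "\<lfloor>(s - of_int (\<lfloor>s / h\<rfloor> - m) * h) / h\<rfloor> = m" if "0 < h" for s h :: real and m :: int
        proof -
          have "(s - of_int (\<lfloor>s / h\<rfloor> - m) * h) / h = s / h - of_int (\<lfloor>s / h\<rfloor> - m)"
            using that by (simp add: diff_divide_distrib)
          then show ?thesis by (simp only: floor_diff_of_int)
        qed
        \<comment> \<open>Moving x back by \<open>e\<close> whole cells lands in the cell of x - v
          k. As the shift is at most one cell in each direction, the entries of \<open>e\<close> are
          -1, 0 or 1.\<close>
        define e where "e = (\<lfloor>fst x / a j\<rfloor> - \<lfloor>(fst x - fst (v k)) / a j\<rfloor>, \<lfloor>snd x / b j\<rfloor> - \<lfloor>(snd x - snd (v k)) / b j\<rfloor>)"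
        have "e \<in> I"
          unfolding e_def I_def using *[OF v(1) a] *[OF v(2) b] by blast
        moreover have "cell2 (a j) (b j) (x - T e) = cell2 (a j) (b j) (x - v k)"
          unfolding cell2_def T_def e_def by (simp only: fst_diff snd_diff fst_conv snd_conv **[OF a] **[OF b])
        ultimately show ?thesis using sat[OF _ j] k by blast
      qed
    qed
    have tm: "{x. x - w \<in> \<Omega> j} \<in> sets lborel" for w
      using emeasure_lborel_translate(1)[OF \<Omega>m] by simp
    have "emeasure lborel (G j) \<le> emeasure lborel ((\<Union>k\<in>{j..<j + int L}. {x. x - v k \<in> \<Omega> j}) \<union> (\<Union>e\<in>I. {x. x - T e \<in> \<Omega> j}))"
      by (intro emeasure_mono[OF sub] sets.Un sets.finite_UN tm) (auto simp: I_def)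
    also have "\<dots> \<le> emeasure lborel (\<Union>k\<in>{j..<j + int L}. {x. x - v k \<in> \<Omega> j}) + emeasure lborel (\<Union>e\<in>I. {x. x - T e \<in> \<Omega> j})"
      by (intro emeasure_subadditive sets.finite_UN tm) (auto simp: I_def)
    also have "\<dots> \<le> (\<Sum>k\<in>{j..<j + int L}. emeasure lborel {x. x - v k \<in> \<Omega> j}) + (\<Sum>e\<in>I. emeasure lborel {x. x - T e \<in> \<Omega> j})"
      by (intro add_mono emeasure_subadditive_finite) (auto simp: I_def tm[simplified])
    also have "(\<Sum>k\<in>{j..<j + int L}. emeasure lborel {x. x - v k \<in> \<Omega> j}) = ennreal (real L) * emeasure lborel (\<Omega> j)"
      by (simp add: emeasure_lborel_translate(2)[OF \<Omega>m] ennreal_of_nat_eq_real_of_nat)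
    also have "(\<Sum>e\<in>I. emeasure lborel {x. x - T e \<in> \<Omega> j}) = ennreal 9 * emeasure lborel (\<Omega> j)"
      by (simp add: emeasure_lborel_translate(2)[OF \<Omega>m] I_def card_cartesian_product)
    also have "ennreal (real L) * emeasure lborel (\<Omega> j) + ennreal 9 * emeasure lborel (\<Omega> j) = ennreal (9 + real L) * emeasure lborel (\<Omega> j)"
      by (subst ennreal_plus) (simp_all add: distrib_right add.commute)
    finally show ?thesis .
  qed
  have sub: "{x. \<exists>k\<in>K. ennreal l < davg (a k) (b k) f (x - v k)} \<subseteq> (\<Union>j\<in>K. G j)"
  proof
    fix x assume "x \<in> {x. \<exists>k\<in>K. ennreal l < davg (a k) (b k) f (x - v k)}"
    then obtain k where k: "k \<in> K" "ennreal l < A k (x - v k)" by (auto simp: A_def)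
    define J where "J = {i\<in>K. ennreal l < A i (x - v k)}"
    have J: "finite J" "k \<in> J" using K k by (auto simp: J_def)
    then have m: "Min J \<in> J" "Min J \<le> k" by (auto intro: Min_in)
    have "x - v k \<in> \<Omega> (Min J)"
      unfolding \<Omega>_def
    proof (intro CollectI conjI ballI impI)
      show "ennreal l < A (Min J) (x - v k)" using m by (simp add: J_def)
      fix i assume i: "i \<in> K" "i < Min J"
      then have "i \<notin> J" using J by (auto dest: Min_le)
      then show "A i (x - v k) \<le> ennreal l" using i by (simp add: J_def)
    qed
    then show "x \<in> (\<Union>j\<in>K. G j)" using m k by (auto simp: G_def J_def)
  qed
  have "ennreal l * emeasure lborel {x. \<exists>k\<in>K. ennreal l < davg (a k) (b k) f (x - v k)} \<le> ennreal l * emeasure lborel (\<Union>j\<in>K. G j)"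
    using K by (intro mult_left_mono emeasure_mono sub) auto
  also have "\<dots> \<le> ennreal l * (\<Sum>j\<in>K. ennreal (9 + real L) * emeasure lborel (\<Omega> j))"
    using K by (intro mult_left_mono order_trans[OF emeasure_subadditive_finite] sum_mono G) auto
  also have "\<dots> = ennreal (9 + real L) * (\<Sum>j\<in>K. ennreal l * emeasure lborel (\<Omega> j))"
    by (simp add: sum_distrib_left mult_ac)
  also have "\<dots> \<le> ennreal (9 + real L) * (\<integral>\<^sup>+x. f x \<partial>lborel)"
    by (intro mult_left_mono sum\<Omega>) auto
  finally have "ennreal (1 / l) * (ennreal l * emeasure lborel {x. \<exists>k\<in>K. ennreal l < davg (a k) (b k) f (x - v k)})
     \<le> ennreal (1 / l) * (ennreal (9 + real L) * (\<integral>\<^sup>+x. f x \<partial>lborel))"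
    by (rule mult_left_mono) auto
  moreover have "ennreal (1 / l) * ennreal (9 + real L) = ennreal ((9 + real L) / l)"
    using l by (subst ennreal_mult[symmetric]) auto
  moreover have "ennreal (1 / l) * ennreal l = 1"
    using l by (simp flip: ennreal_mult)
  ultimately show ?thesis by (simp only: mult_1_left flip: mult.assoc)
qed

text \<open>Weak type at exponent 1 is interpolated with the trivial bound on bounded functions: the
  part of f below l / 2 has averages at most l / 2. The upper endpoint therefore enters as exponent
  q + 1 with constant 0, and the cut is at \<open>\<gamma>\<close> = 1 / 2. The bound
  \<open>B\<close> makes the supremum real-valued.\<close>

lemma shifted_maximal_strong:
  fixes K :: "int set" and a b :: "int \<Rightarrow> real" and v :: "int \<Rightarrow> real \<times> real" and L :: nat and f :: "real \<times> real \<Rightarrow> real"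
  assumes K: "finite K" and a: "\<And>k. 0 < a k" and b: "\<And>k. 0 < b k"
    and nested: "\<And>j k x y. j \<in> K \<Longrightarrow> k \<in> K \<Longrightarrow> j \<le> k \<Longrightarrow> cell2 (a k) (b k) x = cell2 (a k) (b k) y
      \<Longrightarrow> cell2 (a j) (b j) x = cell2 (a j) (b j) y"
    and shift: "\<And>j k. j \<in> K \<Longrightarrow> k \<in> K \<Longrightarrow> j + int L \<le> k \<Longrightarrow> \<bar>fst (v k)\<bar> \<le> a j \<and> \<bar>snd (v k)\<bar> \<le> b j"
    and f [measurable]: "f \<in> borel_measurable borel" and f0: "\<And>x. 0 \<le> f x" and fB: "\<And>x. f x \<le> B" and q: "1 < q"
  shows "(\<integral>\<^sup>+x. ennreal_powr (SUP k\<in>K. davg (a k) (b k) f (x - v k)) q \<partial>lborel)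
    \<le> ennreal (q * (2 * (9 + real L) * (1 / 2) powr (1 - q) / (q - 1))) * (\<integral>\<^sup>+x. ennreal (f x powr q) \<partial>lborel)"
proof -
  note [measurable] = a b
  have eq: "equipartition (cell2 (a k) (b k)) (a k * b k)" for k
    using a b by (rule equipartition_cell2)
  have B: "0 \<le> B" using f0 fB order_trans by blast
  define A where "A k = davg (a k) (b k) f" for k
  define S where "S x = (SUP k\<in>K. A k (x - v k))" for x
  have [measurable]: "A k \<in> borel_measurable borel" for k
    unfolding A_def by measurable
  have [measurable]: "(\<lambda>x. A k (x - w)) \<in> borel_measurable borel" for k w
    by (rule measurable_compose[of "\<lambda>x. x - w" borel borel]) measurable
  have [measurable]: "S \<in> borel_measurable borel"
    unfolding S_def using K by (intro borel_measurable_SUP) (auto intro: countable_finite)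
  have "A k x \<le> ennreal B" for k x
    unfolding A_def davg_def using fB by (intro equipartition.avg_bound[OF eq]) (auto intro: ennreal_leI)
  then have SB: "S x \<le> ennreal B" for x unfolding S_def by (intro SUP_least)
  then have Sfin: "ennreal (enn2real (S x)) = S x" for x
    by (metis ennreal_enn2real ennreal_less_top order_le_less_trans)
  have "(\<integral>\<^sup>+x. ennreal (enn2real (S x) powr q) \<partial>lborel) \<le> 
    ennreal (q * ((2 * (9 + real L)) * (1/2) powr (1 - q) / (q - 1) + 0 * (1/2) powr (q + 1 - q) / (q + 1 - q))) * (\<integral>\<^sup>+x. ennreal (f x powr q) \<partial>lborel)"
  proof (rule marcinkiewicz)
    fix l :: real assume l: "0 < l"
    define g where "g x = ennreal (f x powr 1) * indicator {1/2 * l<..} (f x)" for x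
    have [measurable]: "g \<in> borel_measurable borel" unfolding g_def by measurable
    have "{x \<in> space lborel. l < enn2real (S x)} \<subseteq> {x. \<exists>k\<in>K. ennreal (l / 2) < davg (a k) (b k) g (x - v k)}"
    proof
      fix x assume "x \<in> {x \<in> space lborel. l < enn2real (S x)}"
      then have "ennreal l < S x" using l Sfin by (metis (mono_tags, lifting) mem_Collect_eq ennreal_less_iff less_imp_le)
      then obtain k where k: "k \<in> K" "ennreal l < A k (x - v k)" by (auto simp: S_def less_SUP_iff)
      interpret E: equipartition "cell2 (a k) (b k)" "a k * b k" by (rule eq)
      have "A k (x - v k) \<le> E.avg (\<lambda>y. ennreal (l / 2) + g y) (x - v k)"
        unfolding A_def davg_def
      proof (rule E.avg_mono)
        fix y show "ennreal (f y) \<le> ennreal (l / 2) + g y"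
          using f0[of y] l by (auto simp: g_def indicator_def intro: ennreal_leI add_increasing2)
      qed
      also have "\<dots> = E.avg (\<lambda>_. ennreal (l / 2)) (x - v k) + E.avg g (x - v k)"
        unfolding E.avg_def by (simp add: distrib_right nn_integral_add distrib_left)
      also have "\<dots> = ennreal (l / 2) + E.avg g (x - v k)" by (simp only: E.avg_of_const)
      finally have "ennreal l < ennreal (l / 2) + E.avg g (x - v k)" by (rule order_less_le_trans[OF k(2)])
      moreover have "ennreal l = ennreal (l / 2) + ennreal (l / 2)" using l by (subst ennreal_plus[symmetric]) auto
      ultimately have "ennreal (l / 2) < E.avg g (x - v k)"
        by (simp only: ennreal_add_left_cancel_less)
      then show "x \<in> {x. \<exists>k\<in>K. ennreal (l / 2) < davg (a k) (b k) g (x - v k)}"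
        using k by (auto simp: davg_def)
    qed
    then have "emeasure lborel {x \<in> space lborel. l < enn2real (S x)} \<le> emeasure lborel {x. \<exists>k\<in>K. ennreal (l / 2) < davg (a k) (b k) g (x - v k)}"
    proof (rule emeasure_mono)
      have "{x. \<exists>k\<in>K. ennreal (l / 2) < davg (a k) (b k) g (x - v k)} = (\<Union>k\<in>K. {x. ennreal (l / 2) < davg (a k) (b k) g (x - v k)})" by auto
      also have "\<dots> \<in> sets lborel" 
      proof (intro sets.finite_UN K)
        fix k
        have [measurable]: "(\<lambda>x. davg (a k) (b k) g (x - v k)) \<in> borel_measurable borel" 
          by (rule davg_measurable) measurable
        show "{x. ennreal (l / 2) < davg (a k) (b k) g (x - v k)} \<in> sets lborel" by measurable
      qed
      finally show "{x. \<exists>k\<in>K. ennreal (l / 2) < davg (a k) (b k) g (x - v k)} \<in> sets lborel" .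
    qed
    also have "\<dots> \<le> ennreal ((9 + real L) / (l / 2)) * (\<integral>\<^sup>+x. g x \<partial>lborel)"
      using l by (intro shifted_maximal_weak[OF K a b nested shift]) auto
    also have "(9 + real L) / (l / 2) = 2 * (9 + real L) * l powr - 1" using l by (simp add: powr_minus_divide)
    finally show "emeasure lborel {x \<in> space lborel. l < enn2real (S x)} \<le> 
       ennreal (2 * (9 + real L) * l powr - 1) * (\<integral>\<^sup>+x. ennreal (f x powr 1) * indicator {1/2 * l<..} (f x) \<partial>lborel)
      + ennreal (0 * l powr - (q + 1)) * (\<integral>\<^sup>+x. ennreal (f x powr (q + 1)) * indicator {..1/2 * l} (f x) \<partial>lborel)"
      by (simp add: g_def)
  qed (use q f0 in \<open>auto intro: lborel.sigma_finite_measure_axioms\<close>)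
  also have "(\<integral>\<^sup>+x. ennreal (enn2real (S x) powr q) \<partial>lborel) = (\<integral>\<^sup>+x. ennreal_powr (S x) q \<partial>lborel)"
    by (intro nn_integral_cong) (metis Sfin ennreal_powr_ennreal enn2real_nonneg)
  finally show ?thesis by (simp add: S_def A_def)
qed

section \<open>An oscillation estimate on the line\<close>

lemma integrable_bounded_support:
  fixes f :: "'a \<Rightarrow> real"
  assumes "f \<in> borel_measurable M" "A \<in> sets M" "emeasure M A < \<infinity>"
    and "\<And>x. x \<in> space M \<Longrightarrow> x \<notin> A \<Longrightarrow> f x = 0" "\<And>x. x \<in> space M \<Longrightarrow> \<bar>f x\<bar> \<le> B"
  shows "integrable M f"
  using assms by (intro integrableI_bounded_set[where A=A and B=B]) auto

text \<open>The primitive of \<phi> vanishes at every cell border, because \<phi> vanishes far to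
  the left and complete cells integrate to zero. Elsewhere only the part of the cell already entered
  is left, and an interval has two ends.\<close>

lemma zero_mean_primitive:
  fixes \<phi> :: "real \<Rightarrow> real" and h B R :: real
  assumes [measurable]: "\<phi> \<in> borel_measurable borel" and B: "\<And>x. \<bar>\<phi> x\<bar> \<le> B"
    and R: "\<And>x. R < \<bar>x\<bar> \<Longrightarrow> \<phi> x = 0" and h: "0 < h"
    and zero: "\<And>m::int. (LINT v|lborel. \<phi> v * of_bool (\<lfloor>v / h\<rfloor> = m)) = 0"
    and x: "x0 \<le> x1"
  shows "\<bar>LINT v|lborel. \<phi> v * indicator {x0..x1} v\<bar> \<le>
    (LINT v|lborel. \<bar>\<phi> v\<bar> * of_bool (\<lfloor>v / h\<rfloor> = \<lfloor>x0 / h\<rfloor>)) + (LINT v|lborel. \<bar>\<phi> v\<bar> * of_bool (\<lfloor>v / h\<rfloor> = \<lfloor>x1 / h\<rfloor>))"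
proof -
  have int: "integrable lborel (\<lambda>v. \<phi> v * g v)" if [measurable]: "g \<in> borel_measurable borel" and g: "\<And>v. \<bar>g v\<bar> \<le> 1" for g :: "real \<Rightarrow> real"
  proof (rule integrable_bounded_support[where A="{-\<bar>R\<bar>..\<bar>R\<bar>}" and B=B])
    show "\<bar>\<phi> v * g v\<bar> \<le> B" for v
      using mult_mono[OF B[of v] g[of v]] order_trans[OF abs_ge_zero B[of v]] by (simp add: abs_mult)
    show "\<phi> v * g v = 0" if "v \<notin> {-\<bar>R\<bar>..\<bar>R\<bar>}" for v
      using that by (subst R) auto
  qed auto
  have int_abs: "integrable lborel (\<lambda>v. \<bar>\<phi> v\<bar> * of_bool (\<lfloor>v / h\<rfloor> = m))" for m
    using integrable_abs[OF int[of "\<lambda>v. of_bool (\<lfloor>v / h\<rfloor> = m)"]] by (simp add: abs_mult)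
  define P where "P x = (LINT v|lborel. \<phi> v * of_bool (v < x))" for x
  define \<Phi> where "\<Phi> x = (LINT v|lborel. \<bar>\<phi> v\<bar> * of_bool (\<lfloor>v / h\<rfloor> = \<lfloor>x / h\<rfloor>))" for x
  have cell: "(\<lfloor>v / h\<rfloor> = m) \<longleftrightarrow> h * m \<le> v \<and> v < h * (m + 1)" for v and m :: int
    using h by (auto simp: floor_eq_iff field_simps)
  have step: "P (h * of_int (m + 1)) = P (h * of_int m)" for m :: int
  proof -
    have "P (h * of_int (m + 1)) = (LINT v|lborel. \<phi> v * of_bool (v < h * of_int m) + \<phi> v * of_bool (\<lfloor>v / h\<rfloor> = m))"
      unfolding P_def
    proof (rule Bochner_Integration.integral_cong)
      fix v
      have "h * of_int m < h * of_int (m + 1)" using h by simp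
      then show "\<phi> v * of_bool (v < h * of_int (m + 1)) = \<phi> v * of_bool (v < h * of_int m) + \<phi> v * of_bool (\<lfloor>v / h\<rfloor> = m)"
        by (auto simp: cell)
    qed simp
    also have "\<dots> = P (h * of_int m) + 0"
      unfolding P_def zero[of m, symmetric] by (intro Bochner_Integration.integral_add int) auto
    finally show ?thesis by simp
  qed
  \<comment> \<open>A cell border to the left of the support; the primitive is zero there, and the
    induction over borders starts from it.\<close>
  define m0 where "m0 = - \<lceil>R / h\<rceil>"
  have m0: "h * of_int m0 \<le> - R"
  proof -
    have "R \<le> of_int \<lceil>R / h\<rceil> * h" using h by (simp flip: pos_divide_le_eq)
    then show ?thesis by (simp add: m0_def mult.commute)
  qed
  have P0: "P (h * of_int m) = 0" for m
  proof (cases "m0 \<le> m")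
    case True
    then show ?thesis
    proof (induction m rule: int_ge_induct)
      case base
      have "\<phi> v * of_bool (v < h * of_int m0) = 0" for v
        using R[of v] m0 by (cases "v < h * of_int m0") (auto simp: abs_if split: if_splits)
      then show ?case unfolding P_def by (simp only: Bochner_Integration.integral_zero)
    next
      case (step i)
      then show ?case using \<open>\<And>m. P (h * of_int (m + 1)) = P (h * of_int m)\<close>[of i] by simp
    qed
  next
    case False
    then have "h * of_int m \<le> - R" using m0 h by (smt (verit) mult_left_mono of_int_le_iff)
    then have "\<phi> v * of_bool (v < h * of_int m) = 0" for v
      using R[of v] by (cases "v < h * of_int m") (auto simp: abs_if split: if_splits)
    then show ?thesis unfolding P_def by (simp only: Bochner_Integration.integral_zero)
  qed
  have P: "\<bar>P x\<bar> \<le> \<Phi> x" for x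
  proof -
    have lo: "h * of_int \<lfloor>x / h\<rfloor> \<le> x" and up: "x < h * (of_int \<lfloor>x / h\<rfloor> + 1)" using cell[of x] by auto
    have "P x = (LINT v|lborel. \<phi> v * of_bool (v < h * of_int \<lfloor>x / h\<rfloor>) + \<phi> v * of_bool (\<lfloor>v / h\<rfloor> = \<lfloor>x / h\<rfloor> \<and> v < x))"
      unfolding P_def
      by (rule Bochner_Integration.integral_cong) (use lo up in \<open>auto simp: cell\<close>)
    also have "\<dots> = P (h * of_int \<lfloor>x / h\<rfloor>) + (LINT v|lborel. \<phi> v * of_bool (\<lfloor>v / h\<rfloor> = \<lfloor>x / h\<rfloor> \<and> v < x))"
      unfolding P_def by (intro Bochner_Integration.integral_add int) auto
    finally have "\<bar>P x\<bar> = \<bar>LINT v|lborel. \<phi> v * of_bool (\<lfloor>v / h\<rfloor> = \<lfloor>x / h\<rfloor> \<and> v < x)\<bar>" by (simp add: P0)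
    also have "\<dots> \<le> (LINT v|lborel. \<bar>\<phi> v * of_bool (\<lfloor>v / h\<rfloor> = \<lfloor>x / h\<rfloor> \<and> v < x)\<bar>)" by (rule integral_abs_bound)
    also have "\<dots> \<le> \<Phi> x"
      unfolding \<Phi>_def by (intro integral_mono integrable_abs int int_abs) auto
    finally show ?thesis .
  qed
  have "(LINT v|lborel. \<phi> v * indicator {x0..x1} v) = (LINT v|lborel. \<phi> v * of_bool (v < x1) - \<phi> v * of_bool (v < x0))"
  proof (rule integral_cong_AE)
    show "AE v in lborel. \<phi> v * indicator {x0..x1} v = \<phi> v * of_bool (v < x1) - \<phi> v * of_bool (v < x0)"
      using AE_lborel_singleton[of x1] by eventually_elim (use x in \<open>auto simp: indicator_def\<close>)
  qed measurable
  also have "\<dots> = P x1 - P x0"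
    unfolding P_def by (intro Bochner_Integration.integral_diff int) auto
  finally have "\<bar>LINT v|lborel. \<phi> v * indicator {x0..x1} v\<bar> \<le> \<Phi> x0 + \<Phi> x1"
    using P[of x0] P[of x1] by linarith
  then show ?thesis by (simp add: \<Phi>_def)
qed

lemma square_enorm: "ennreal_powr (ennreal \<bar>w\<bar>) 2 = ennreal (w\<^sup>2)"
  by (simp add: ennreal_powr_ennreal)

text \<open>Cauchy-Schwarz on \<open>{0..H}\<close> followed by Fubini; each of the two contributes
  one factor H.\<close>

lemma nn_integral_square_integral:
  fixes w :: "real \<Rightarrow> real \<Rightarrow> real"
  assumes [measurable]: "(\<lambda>(c, u). w c u) \<in> borel_measurable (borel \<Otimes>\<^sub>M borel)" and H: "0 < H"
    and D: "\<And>c. c \<in> {0..H} \<Longrightarrow> (\<integral>\<^sup>+u. ennreal ((w c u)\<^sup>2) \<partial>lborel) \<le> D"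
  shows "(\<integral>\<^sup>+u. ennreal ((LINT c|lborel. w c u * indicator {0..H} c)\<^sup>2) \<partial>lborel) \<le> ennreal (H\<^sup>2) * D"
proof -
  have "(\<integral>\<^sup>+u. ennreal ((LINT c|lborel. w c u * indicator {0..H} c)\<^sup>2) \<partial>lborel)
    \<le> (\<integral>\<^sup>+u. ennreal H * (\<integral>\<^sup>+c. ennreal ((w c u)\<^sup>2) * indicator {0..H} c \<partial>lborel) \<partial>lborel)"
  proof (rule nn_integral_mono)
    fix u :: real
    have [measurable]: "(\<lambda>c. w c u) \<in> borel_measurable borel"
    proof -
      have "(\<lambda>c. (c, u)) \<in> borel \<rightarrow>\<^sub>M borel \<Otimes>\<^sub>M borel" by measurable
      from measurable_compose[OF this assms(1)] show ?thesis by simp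
    qed
    define N where "N = restrict_space lborel {0..H}"
    have N: "(\<integral>\<^sup>+c. F c \<partial>N) = (\<integral>\<^sup>+c. F c * indicator {0..H} c \<partial>lborel)" for F :: "real \<Rightarrow> ennreal"
      unfolding N_def by (rule nn_integral_restrict_space) simp
    have "ennreal \<bar>LINT c|lborel. w c u * indicator {0..H} c\<bar> \<le> (\<integral>\<^sup>+c. ennreal (norm (w c u * indicator {0..H} c)) \<partial>lborel)"
      using integral_norm_bound_ennreal[of lborel "\<lambda>c. w c u * indicator {0..H} c"]
      by (cases "integrable lborel (\<lambda>c. w c u * indicator {0..H} c)") (auto simp: not_integrable_integral_eq)
    also have "\<dots> = (\<integral>\<^sup>+c. ennreal \<bar>w c u\<bar> \<partial>N)"
      unfolding N by (intro nn_integral_cong) (auto simp: indicator_def)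
    finally have "ennreal ((LINT c|lborel. w c u * indicator {0..H} c)\<^sup>2) \<le> ennreal_powr (\<integral>\<^sup>+c. ennreal \<bar>w c u\<bar> \<partial>N) 2"
      using ennreal_powr_mono[of 2] by (simp flip: square_enorm)
    also have "\<dots> \<le> ennreal (H powr (2 - 1)) * (\<integral>\<^sup>+c. ennreal_powr (ennreal \<bar>w c u\<bar>) 2 \<partial>N)"
      using H by (intro nn_integral_jensen_powr) (auto simp: N_def emeasure_restrict_space space_restrict_space intro!: measurable_restrict_space1)
    also have "\<dots> = ennreal H * (\<integral>\<^sup>+c. ennreal ((w c u)\<^sup>2) * indicator {0..H} c \<partial>lborel)"
      using H by (simp add: square_enorm N)
    finally show "ennreal ((LINT c|lborel. w c u * indicator {0..H} c)\<^sup>2) \<le> ennreal H * (\<integral>\<^sup>+c. ennreal ((w c u)\<^sup>2) * indicator {0..H} c \<partial>lborel)" .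
  qed
  also have "\<dots> = ennreal H * (\<integral>\<^sup>+u. (\<integral>\<^sup>+c. ennreal ((w c u)\<^sup>2) * indicator {0..H} c \<partial>lborel) \<partial>lborel)"
    by (rule nn_integral_cmult) measurable
  also have "\<dots> \<le> ennreal H * (D * ennreal H)"
  proof (rule mult_left_mono)
    have "(\<integral>\<^sup>+u. (\<integral>\<^sup>+c. ennreal ((w c u)\<^sup>2) * indicator {0..H} c \<partial>lborel) \<partial>lborel) =
       (\<integral>\<^sup>+c. (\<integral>\<^sup>+u. ennreal ((w c u)\<^sup>2) * indicator {0..H} c \<partial>lborel) \<partial>lborel)"
      by (rule lborel_pair.Fubini') measurable
    also have "\<dots> \<le> (\<integral>\<^sup>+c. D * indicator {0..H} c \<partial>lborel)"
    proof (rule nn_integral_mono)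
      fix c show "(\<integral>\<^sup>+u. ennreal ((w c u)\<^sup>2) * indicator {0..H} c \<partial>lborel) \<le> D * indicator {0..H} c"
        using D[of c] by (cases "c \<in> {0..H}") auto
    qed
    also have "\<dots> = D * ennreal H" using H by (simp add: nn_integral_cmult_indicator)
    finally show "(\<integral>\<^sup>+u. (\<integral>\<^sup>+c. ennreal ((w c u)\<^sup>2) * indicator {0..H} c \<partial>lborel) \<partial>lborel) \<le> D * ennreal H" .
  qed simp
  finally show ?thesis
    using H by (simp add: power2_eq_square ennreal_mult mult_ac)
qed

text \<open>The integral over a cell is h times the average over it, and averaging is a contraction
  of L^2.\<close>

lemma nn_integral_square_cell:
  fixes \<phi> :: "real \<Rightarrow> real"
  assumes [measurable]: "\<phi> \<in> borel_measurable borel" and B: "\<And>x. \<bar>\<phi> x\<bar> \<le> B"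
    and h: "0 < h"
  shows "(\<integral>\<^sup>+x. ennreal ((LINT v|lborel. \<bar>\<phi> v\<bar> * of_bool (\<lfloor>v / h\<rfloor> = \<lfloor>x / h\<rfloor>))\<^sup>2) \<partial>lborel) \<le> ennreal (h\<^sup>2) * (\<integral>\<^sup>+x. ennreal ((\<phi> x)\<^sup>2) \<partial>lborel)"
proof -
  interpret E: equipartition "\<lambda>x::real. \<lfloor>x / h\<rfloor>" h by (rule equipartition_floor[OF h])
  have "(\<integral>\<^sup>+x. ennreal ((LINT v|lborel. \<bar>\<phi> v\<bar> * of_bool (\<lfloor>v / h\<rfloor> = \<lfloor>x / h\<rfloor>))\<^sup>2) \<partial>lborel) =
    (\<integral>\<^sup>+x. ennreal (h\<^sup>2) * ennreal_powr (E.avg (\<lambda>v. ennreal \<bar>\<phi> v\<bar>) x) 2 \<partial>lborel)"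
  proof (rule nn_integral_cong)
    fix x :: real
    have "integrable lborel (\<lambda>v. \<bar>\<phi> v\<bar> * of_bool (\<lfloor>v / h\<rfloor> = \<lfloor>x / h\<rfloor>))"
    proof (rule integrable_bounded_support[where A="{v. \<lfloor>v / h\<rfloor> = \<lfloor>x / h\<rfloor>}" and B=B])
      show "\<bar>\<bar>\<phi> v\<bar> * of_bool (\<lfloor>v / h\<rfloor> = \<lfloor>x / h\<rfloor>)\<bar> \<le> B" for v
        using B[of v] order_trans[OF abs_ge_zero B[of v]] by (auto simp: abs_mult)
    qed (auto simp: E.emeasure_cell)
    then have "ennreal (LINT v|lborel. \<bar>\<phi> v\<bar> * of_bool (\<lfloor>v / h\<rfloor> = \<lfloor>x / h\<rfloor>)) = (\<integral>\<^sup>+v. ennreal (\<bar>\<phi> v\<bar> * of_bool (\<lfloor>v / h\<rfloor> = \<lfloor>x / h\<rfloor>)) \<partial>lborel)"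
      by (intro nn_integral_eq_integral[symmetric]) auto
    also have "\<dots> = ennreal h * E.avg (\<lambda>v. ennreal \<bar>\<phi> v\<bar>) x"
      unfolding E.avg_def using h
      by (simp flip: mult.assoc ennreal_mult) (auto intro!: nn_integral_cong)
    finally have *: "ennreal (LINT v|lborel. \<bar>\<phi> v\<bar> * of_bool (\<lfloor>v / h\<rfloor> = \<lfloor>x / h\<rfloor>)) = ennreal h * E.avg (\<lambda>v. ennreal \<bar>\<phi> v\<bar>) x" .
    have "ennreal ((LINT v|lborel. \<bar>\<phi> v\<bar> * of_bool (\<lfloor>v / h\<rfloor> = \<lfloor>x / h\<rfloor>))\<^sup>2) = ennreal_powr (ennreal (LINT v|lborel. \<bar>\<phi> v\<bar> * of_bool (\<lfloor>v / h\<rfloor> = \<lfloor>x / h\<rfloor>))) 2"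
      by (subst ennreal_powr_ennreal) (auto intro!: integral_nonneg_AE)
    also have "\<dots> = ennreal (h\<^sup>2) * ennreal_powr (E.avg (\<lambda>v. ennreal \<bar>\<phi> v\<bar>) x) 2"
      unfolding * using h by (simp add: ennreal_powr_mult ennreal_powr_ennreal)
    finally show "ennreal ((LINT v|lborel. \<bar>\<phi> v\<bar> * of_bool (\<lfloor>v / h\<rfloor> = \<lfloor>x / h\<rfloor>))\<^sup>2) = ennreal (h\<^sup>2) * ennreal_powr (E.avg (\<lambda>v. ennreal \<bar>\<phi> v\<bar>) x) 2" .
  qed
  also have "\<dots> \<le> ennreal (h\<^sup>2) * (\<integral>\<^sup>+x. ennreal_powr (ennreal \<bar>\<phi> x\<bar>) 2 \<partial>lborel)"
    by (subst nn_integral_cmult) (auto intro!: mult_left_mono E.nn_integral_avg_powr)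
  finally show ?thesis by (simp add: square_enorm)
qed

text \<open>The estimate without cancellation. It takes over where the parameter gap is too small
  for \<open>oscillation\<close> to gain anything.\<close>

lemma oscillation_trivial:
  fixes \<phi> F :: "real \<Rightarrow> real"
  assumes [measurable]: "\<phi> \<in> borel_measurable borel" "F \<in> borel_measurable borel" and L: "0 < L" "L \<le> 1"
  shows "(\<integral>\<^sup>+u. ennreal ((LINT \<theta>|lborel. \<phi> (u - F \<theta>) * indicator {0..L} \<theta>)\<^sup>2) \<partial>lborel) \<le> (\<integral>\<^sup>+u. ennreal ((\<phi> u)\<^sup>2) \<partial>lborel)"
proof -
  have "(\<integral>\<^sup>+u. ennreal ((LINT \<theta>|lborel. \<phi> (u - F \<theta>) * indicator {0..L} \<theta>)\<^sup>2) \<partial>lborel) \<le> ennreal (L\<^sup>2) * (\<integral>\<^sup>+u. ennreal ((\<phi> u)\<^sup>2) \<partial>lborel)"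
  proof (rule nn_integral_square_integral)
    show "(\<lambda>(\<theta>, u). \<phi> (u - F \<theta>)) \<in> borel_measurable (borel \<Otimes>\<^sub>M borel)" by measurable
    show "(\<integral>\<^sup>+u. ennreal ((\<phi> (u - F \<theta>))\<^sup>2) \<partial>lborel) \<le> (\<integral>\<^sup>+u. ennreal ((\<phi> u)\<^sup>2) \<partial>lborel)" for \<theta>
      by (subst nn_integral_lborel_translate_diff[of "\<lambda>u. ennreal ((\<phi> u)\<^sup>2)"]) auto
  qed fact
  also have "\<dots> \<le> 1 * (\<integral>\<^sup>+u. ennreal ((\<phi> u)\<^sup>2) \<partial>lborel)"
    using L by (intro mult_right_mono) (auto simp: power_le_one)
  finally show ?thesis by simp
qed

text \<open>
  Writing \<open>1 / \<psi>\<close> as an integral of indicators of initial segments turns the integral of \<open>\<phi>\<close> along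
  \<open>F\<close> into integrals of \<open>\<phi>\<close> over intervals, where only the two end cells contribute.
\<close>

lemma oscillation:
  fixes \<phi> F \<psi> :: "real \<Rightarrow> real" and h B R r \<eta> L :: real
  assumes \<phi>m [measurable]: "\<phi> \<in> borel_measurable borel" and B: "\<And>x. \<bar>\<phi> x\<bar> \<le> B"
    and R: "\<And>x. R < \<bar>x\<bar> \<Longrightarrow> \<phi> x = 0" and h: "0 < h"
    and zero: "\<And>m::int. (LINT v|lborel. \<phi> v * of_bool (\<lfloor>v / h\<rfloor> = m)) = 0"
    and [measurable]: "F \<in> borel_measurable borel" "\<psi> \<in> borel_measurable borel"
    and r: "0 < r" and \<eta>: "0 < \<eta>" and L: "0 < L"
    and deriv: "\<And>\<theta>. \<theta> \<in> {0..L} \<Longrightarrow> (F has_real_derivative - \<psi> \<theta>) (at \<theta>)"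
    and cont: "continuous_on {0..L} \<psi>"
    and mono: "\<And>x y. 0 \<le> x \<Longrightarrow> x \<le> y \<Longrightarrow> y \<le> L \<Longrightarrow> \<psi> x \<le> \<psi> y"
    and lower: "\<And>\<theta>. \<theta> \<in> {0..L} \<Longrightarrow> \<eta> \<le> \<psi> \<theta>"
  shows "(\<integral>\<^sup>+u. ennreal ((LINT \<theta>|lborel. \<phi> (u - r * F \<theta>) * indicator {0..L} \<theta>)\<^sup>2) \<partial>lborel)
    \<le> ennreal ((2 * h / (r * \<eta>))\<^sup>2) * (\<integral>\<^sup>+u. ennreal ((\<phi> u)\<^sup>2) \<partial>lborel)"
proof -
  \<comment> \<open>As \<psi> is at least \<eta>, the value 1 / \<psi> never exceeds
    \<open>H\<close>, so the range \<open>{0..H}\<close> of the layer variable c sees all of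
    it.\<close>
  define H where "H = 1 / \<eta>"
  have H: "0 < H" using \<eta> by (simp add: H_def)
  define I where "I = (\<integral>\<^sup>+u. ennreal ((\<phi> u)\<^sup>2) \<partial>lborel)"
  \<comment> \<open>The weight \<open>\<psi>\<close> is put in as the Jacobian of the substitution
    below; the cut-off \<open>c * \<psi> \<theta> < 1\<close> has integral 1 / \<psi> in c and takes
    it out again.\<close>
  define V where "V c u = (LINT \<theta>|lborel. \<phi> (u - r * F \<theta>) * \<psi> \<theta> * indicator {0..L} \<theta> * of_bool (c * \<psi> \<theta> < 1))" for c u
  define \<Phi> where "\<Phi> x = (LINT v|lborel. \<bar>\<phi> v\<bar> * of_bool (\<lfloor>v / h\<rfloor> = \<lfloor>x / h\<rfloor>))" for x
  have B0: "0 \<le> B" using B[of 0] by linarith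
  have \<Phi>0: "0 \<le> \<Phi> x" for x unfolding \<Phi>_def by (intro integral_nonneg_AE) auto
  have [measurable]: "\<Phi> \<in> borel_measurable borel" unfolding \<Phi>_def by measurable
  have \<psi>0: "0 < \<psi> \<theta>" if "\<theta> \<in> {0..L}" for \<theta> using lower[OF that] \<eta> by linarith
  have Vm: "(\<lambda>(c, u). V c u) \<in> borel_measurable (borel \<Otimes>\<^sub>M borel)"
    unfolding V_def by measurable
  have layer: "(LINT \<theta>|lborel. \<phi> (u - r * F \<theta>) * indicator {0..L} \<theta>) = (LINT c|lborel. V c u * indicator {0..H} c)" for u
  proof -
    define k where "k c \<theta> = indicator {0..H} c * (\<phi> (u - r * F \<theta>) * \<psi> \<theta> * indicator {0..L} \<theta> * of_bool (c * \<psi> \<theta> < 1))" for c \<theta> :: real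
    have [measurable]: "(\<lambda>(c, \<theta>). k c \<theta>) \<in> borel_measurable (borel \<Otimes>\<^sub>M borel)" unfolding k_def by measurable
    have int: "integrable (lborel \<Otimes>\<^sub>M lborel) (\<lambda>(c, \<theta>). k c \<theta>)"
    proof (rule integrable_bounded_support[where A="{0..H} \<times> {0..L}" and B="B * \<psi> L"])
      fix z :: "real \<times> real"
      show "z \<notin> {0..H} \<times> {0..L} \<Longrightarrow> (case z of (c, \<theta>) \<Rightarrow> k c \<theta>) = 0"
        by (cases z) (auto simp: k_def indicator_def)
      show "\<bar>case z of (c, \<theta>) \<Rightarrow> k c \<theta>\<bar> \<le> B * \<psi> L"
      proof (cases z)
        case (Pair c \<theta>)
        show ?thesis
        proof (cases "\<theta> \<in> {0..L}")
          case True
          then have "\<bar>\<phi> (u - r * F \<theta>) * \<psi> \<theta>\<bar> \<le> B * \<psi> L"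
            unfolding abs_mult using \<psi>0[OF True] mono[of \<theta> L] B0 by (intro mult_mono B) auto
          then show ?thesis using Pair \<psi>0[of L] B0 L by (auto simp: k_def indicator_def)
        next
          case False
          then show ?thesis using Pair \<psi>0[of L] B0 L by (auto simp: k_def indicator_def)
        qed
      qed
    next
      show "emeasure (lborel \<Otimes>\<^sub>M lborel) ({0..H} \<times> {0..L}) < \<infinity>"
        using H L by (simp add: lborel.emeasure_pair_measure_Times ennreal_mult_less_top)
    qed measurable
    have "(LINT \<theta>|lborel. \<phi> (u - r * F \<theta>) * indicator {0..L} \<theta>) = (LINT \<theta>|lborel. (LINT c|lborel. k c \<theta>))"
    proof (rule Bochner_Integration.integral_cong)
      fix \<theta> :: real
      show "\<phi> (u - r * F \<theta>) * indicator {0..L} \<theta> = (LINT c|lborel. k c \<theta>)"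
      proof (cases "\<theta> \<in> {0..L}")
        case True
        have "indicator {0..H} c * of_bool (c * \<psi> \<theta> < 1) = (indicator {0..<1 / \<psi> \<theta>} c :: real)" for c
        proof -
          have "c \<le> H" if "c * \<psi> \<theta> < 1" "0 \<le> c"
          proof -
            have "c * \<eta> \<le> c * \<psi> \<theta>" using lower[OF True] that by (intro mult_left_mono)
            then show ?thesis using that \<eta> by (simp add: H_def field_simps)
          qed
          then show ?thesis using \<psi>0[OF True] by (auto simp: indicator_def field_simps)
        qed
        then have "k c \<theta> = (\<phi> (u - r * F \<theta>) * \<psi> \<theta>) * indicator {0..<1 / \<psi> \<theta>} c" for c
          using True by (simp add: k_def)
        then show ?thesis using True \<psi>0[OF True] by simp
      qed (simp add: k_def)
    qed simp
    also have "\<dots> = (LINT c|lborel. (LINT \<theta>|lborel. k c \<theta>))"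
      by (rule lborel_pair.Fubini_integral[OF int])
    also have "\<dots> = (LINT c|lborel. V c u * indicator {0..H} c)"
      unfolding k_def V_def by (simp add: mult.commute)
    finally show ?thesis .
  qed
  have "(\<integral>\<^sup>+u. ennreal ((V c u)\<^sup>2) \<partial>lborel) \<le> ennreal (4 * h\<^sup>2 / r\<^sup>2) * I" if c: "c \<in> {0..H}" for c
  proof -
    define A where "A = {\<theta> \<in> {0..L}. c * \<psi> \<theta> < 1}"
    have down: "x \<in> A" if "y \<in> A" "0 \<le> x" "x \<le> y" for x y
    proof -
      have "c * \<psi> x \<le> c * \<psi> y" using that c by (intro mult_left_mono mono) (auto simp: A_def)
      then show ?thesis using that by (auto simp: A_def)
    qed
    \<comment> \<open>Since \<psi> increases, \<open>A\<close> is an initial segment of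
      \<open>{0..L}\<close>. Whether its end point belongs to it is left open, hence the equality
      almost everywhere.\<close>
    have "\<exists>\<beta>\<in>{0..L}. AE \<theta> in lborel. \<theta> \<in> A \<longleftrightarrow> \<theta> \<in> {0..\<beta>}"
    proof (cases "A = {}")
      case True
      then show ?thesis using AE_lborel_singleton[of 0] L by (intro bexI[of _ 0]) auto
    next
      case False
      have bdd: "bdd_above A" by (auto simp: A_def intro!: bdd_aboveI[of _ L])
      have S: "Sup A \<in> {0..L}"
      proof -
        obtain x where "x \<in> A" using False by blast
        then have "0 \<le> x" "x \<le> Sup A" using bdd by (auto simp: A_def intro: cSup_upper)
        moreover have "Sup A \<le> L" using False by (intro cSup_least) (auto simp: A_def)
        ultimately show ?thesis by simp
      qed
      have "\<theta> \<in> A \<longleftrightarrow> \<theta> \<in> {0..Sup A}" if "\<theta> \<noteq> Sup A" for \<theta>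
      proof
        assume "\<theta> \<in> A" then show "\<theta> \<in> {0..Sup A}" using bdd by (auto simp: A_def intro: cSup_upper)
      next
        assume "\<theta> \<in> {0..Sup A}"
        then have "0 \<le> \<theta>" "\<theta> < Sup A" using that by auto
        then obtain y where "y \<in> A" "\<theta> < y" using less_cSup_iff[OF False bdd] by blast
        then show "\<theta> \<in> A" using down[of y \<theta>] \<open>0 \<le> \<theta>\<close> by simp
      qed
      then show ?thesis using AE_lborel_singleton[of "Sup A"] S by (intro bexI[of _ "Sup A"]) (auto elim!: eventually_mono)
    qed
    then obtain \<beta> where \<beta>: "\<beta> \<in> {0..L}" and AE: "AE \<theta> in lborel. \<theta> \<in> A \<longleftrightarrow> \<theta> \<in> {0..\<beta>}" by blast
    have V: "\<bar>V c u\<bar> \<le> (1 / r) * (\<Phi> (u - r * F 0) + \<Phi> (u - r * F \<beta>))" for u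
    proof -
      \<comment> \<open>The argument of \<phi> moves to the right with speed r * \<psi>, so the
        substitution turns the weighted integral into an integral of \<phi> over one
        interval.\<close>
      define G where "G \<theta> = u - r * F \<theta>" for \<theta>
      have G: "(G has_real_derivative r * \<psi> \<theta>) (at \<theta>)" if "\<theta> \<in> {0..\<beta>}" for \<theta>
        unfolding G_def using deriv[of \<theta>] that \<beta> by (auto intro!: derivative_eq_intros)
      have pos: "0 \<le> r * \<psi> \<theta>" if "\<theta> \<in> {0..\<beta>}" for \<theta> using \<psi>0[of \<theta>] that \<beta> r by auto
      have Gle: "G 0 \<le> G \<beta>"
        using \<beta> G pos by (intro DERIV_nonneg_imp_nondecreasing[of 0 \<beta> G]) fastforce+
      have ig: "set_integrable lborel {G 0..G \<beta>} \<phi>"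
        unfolding set_integrable_def
        by (rule integrable_bounded_support[where A="{G 0..G \<beta>}" and B=B]) (use B B0 in \<open>auto simp: indicator_def emeasure_lborel_Icc_eq\<close>)
      have cont': "continuous_on {0..\<beta>} (\<lambda>\<theta>. r * \<psi> \<theta>)"
        using \<beta> by (intro continuous_intros continuous_on_subset[OF cont]) auto
      have "V c u = (LINT \<theta>|lborel. \<phi> (G \<theta>) * \<psi> \<theta> * indicator {0..\<beta>} \<theta>)"
        unfolding V_def
      proof (rule integral_cong_AE)
        show "AE \<theta> in lborel. \<phi> (u - r * F \<theta>) * \<psi> \<theta> * indicator {0..L} \<theta> * of_bool (c * \<psi> \<theta> < 1) = \<phi> (G \<theta>) * \<psi> \<theta> * indicator {0..\<beta>} \<theta>"
          using AE by eventually_elim (use \<beta> in \<open>auto simp: G_def A_def indicator_def\<close>)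
      qed (unfold G_def, measurable)
      then have "r * V c u = (LINT \<theta>|lborel. \<phi> (G \<theta>) * (r * \<psi> \<theta>) * indicator {0..\<beta>} \<theta>)"
        by (simp add: mult_ac flip: integral_mult_right_zero)
      also have "\<dots> = (LINT x|lborel. \<phi> x * indicator {G 0..G \<beta>} x)"
        using integral_substitution(2)[OF ig G cont' pos] \<beta> by simp
      finally have "\<bar>r * V c u\<bar> \<le> \<Phi> (G 0) + \<Phi> (G \<beta>)"
        using zero_mean_primitive[OF \<phi>m B R h zero Gle] by (simp add: \<Phi>_def)
      then show ?thesis using r by (simp add: abs_mult G_def field_simps)
    qed
    have sq: "(V c u)\<^sup>2 \<le> (2 / r\<^sup>2) * ((\<Phi> (u - r * F 0))\<^sup>2 + (\<Phi> (u - r * F \<beta>))\<^sup>2)" for u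
    proof -
      have "(V c u)\<^sup>2 \<le> ((1 / r) * (\<Phi> (u - r * F 0) + \<Phi> (u - r * F \<beta>)))\<^sup>2"
        using V[of u] by (rule abs_le_square_iff[THEN iffD1, OF order_trans[OF _ abs_ge_self]])
      also have "\<dots> \<le> (1 / r\<^sup>2) * (2 * ((\<Phi> (u - r * F 0))\<^sup>2 + (\<Phi> (u - r * F \<beta>))\<^sup>2))"
        unfolding power_mult_distrib power_divide power_one
        using sum_squares_bound[of "\<Phi> (u - r * F 0)" "\<Phi> (u - r * F \<beta>)"]
        by (intro mult_left_mono) (auto simp: power2_sum)
      finally show ?thesis by (simp add: algebra_simps)
    qed
    have "(\<integral>\<^sup>+u. ennreal ((V c u)\<^sup>2) \<partial>lborel) \<le> (\<integral>\<^sup>+u. ennreal (2 / r\<^sup>2) * (ennreal ((\<Phi> (u - r * F 0))\<^sup>2) + ennreal ((\<Phi> (u - r * F \<beta>))\<^sup>2)) \<partial>lborel)"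
      by (intro nn_integral_mono order_trans[OF ennreal_leI[OF sq]])
        (subst ennreal_mult, simp, simp, subst ennreal_plus, simp_all)
    also have "\<dots> = ennreal (2 / r\<^sup>2) * ((\<integral>\<^sup>+u. ennreal ((\<Phi> (u - r * F 0))\<^sup>2) \<partial>lborel) + (\<integral>\<^sup>+u. ennreal ((\<Phi> (u - r * F \<beta>))\<^sup>2) \<partial>lborel))"
      by (subst nn_integral_cmult, measurable, subst nn_integral_add) auto
    also have "\<dots> = ennreal (2 / r\<^sup>2) * ((\<integral>\<^sup>+u. ennreal ((\<Phi> u)\<^sup>2) \<partial>lborel) + (\<integral>\<^sup>+u. ennreal ((\<Phi> u)\<^sup>2) \<partial>lborel))"
      by (subst (1 2) nn_integral_lborel_translate_diff[of "\<lambda>u. ennreal ((\<Phi> u)\<^sup>2)"]) auto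
    also have "\<dots> \<le> ennreal (2 / r\<^sup>2) * (ennreal (h\<^sup>2) * I + ennreal (h\<^sup>2) * I)"
      using nn_integral_square_cell[OF \<phi>m B h] unfolding I_def \<Phi>_def by (intro mult_left_mono add_mono) auto
    also have "\<dots> = (ennreal (2 / r\<^sup>2) * (ennreal (h\<^sup>2) + ennreal (h\<^sup>2))) * I"
      by (simp add: distrib_right mult.assoc)
    also have "ennreal (2 / r\<^sup>2) * (ennreal (h\<^sup>2) + ennreal (h\<^sup>2)) = ennreal (4 * h\<^sup>2 / r\<^sup>2)"
      by (simp flip: ennreal_plus ennreal_mult)
    finally show ?thesis .
  qed
  then have "(\<integral>\<^sup>+u. ennreal ((LINT c|lborel. V c u * indicator {0..H} c)\<^sup>2) \<partial>lborel) \<le> ennreal (H\<^sup>2) * (ennreal (4 * h\<^sup>2 / r\<^sup>2) * I)"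
    by (intro nn_integral_square_integral Vm H)
  also have "\<dots> = ennreal (H\<^sup>2 * (4 * h\<^sup>2 / r\<^sup>2)) * I"
    by (subst ennreal_mult, simp, simp, simp only: mult.assoc)
  also have "H\<^sup>2 * (4 * h\<^sup>2 / r\<^sup>2) = (2 * h / (r * \<eta>))\<^sup>2"
    by (simp add: H_def power_mult_distrib power_divide)
  finally show ?thesis by (simp add: layer I_def)
qed

section \<open>The profile curve\<close>

text \<open>The Koranyi sphere is the set of all \<open>(profile \<theta> *\<^sub>R \<omega>, \<plusminus>\<theta> / 4)\<close> with \<open>norm \<omega> = 1\<close> and \<open>0 \<le> \<theta> \<le> 1\<close>.\<close>

definition profile :: "real \<Rightarrow> real" where "profile \<theta> = (1 - \<theta>\<^sup>2) powr (1/4)"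
definition profile1 :: "real \<Rightarrow> real" where "profile1 \<theta> = - (\<theta> / 2) * (1 - \<theta>\<^sup>2) powr (-3/4)"
definition profile2 :: "real \<Rightarrow> real" where
  "profile2 \<theta> = - (1/2) * (1 - \<theta>\<^sup>2) powr (-3/4) - (3/4) * \<theta>\<^sup>2 * (1 - \<theta>\<^sup>2) powr (-7/4)"

lemma profile_measurable [measurable]: "profile \<in> borel_measurable borel" "profile1 \<in> borel_measurable borel"
  unfolding profile_def[abs_def] profile1_def[abs_def] by measurable

lemma profile_range: "0 \<le> \<theta> \<Longrightarrow> \<theta> \<le> 1 \<Longrightarrow> 0 \<le> profile \<theta> \<and> profile \<theta> \<le> 1"
  by (auto simp: profile_def power_le_one intro!: powr_le1)

lemma square_less_one: "0 \<le> \<theta> \<Longrightarrow> \<theta> < 1 \<Longrightarrow> \<theta>\<^sup>2 < (1::real)"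
  by (simp add: power_less_one_iff)

lemma profile_deriv:
  assumes "0 \<le> \<theta>" "\<theta> < 1"
  shows "(profile has_real_derivative profile1 \<theta>) (at \<theta>)"
proof -
  have p: "0 < 1 - \<theta>\<^sup>2" using square_less_one[OF assms] by simp
  have "((\<lambda>\<theta>. (1 - \<theta>\<^sup>2) powr (1/4)) has_real_derivative (1/4) * (1 - \<theta>\<^sup>2) powr (1/4 - of_nat 1) * (- (2 * \<theta>))) (at \<theta>)"
    by (rule DERIV_fun_powr) (use p in \<open>auto intro!: derivative_eq_intros\<close>)
  then show ?thesis unfolding profile_def[abs_def] profile1_def by (simp add: field_simps)
qed

lemma profile1_deriv:
  assumes "0 \<le> \<theta>" "\<theta> < 1"
  shows "(profile1 has_real_derivative profile2 \<theta>) (at \<theta>)"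
proof -
  have p: "0 < 1 - \<theta>\<^sup>2" using square_less_one[OF assms] by simp
  have "((\<lambda>\<theta>. (1 - \<theta>\<^sup>2) powr (-3/4)) has_real_derivative (-3/4) * (1 - \<theta>\<^sup>2) powr (-3/4 - of_nat 1) * (- (2 * \<theta>))) (at \<theta>)"
    by (rule DERIV_fun_powr) (use p in \<open>auto intro!: derivative_eq_intros\<close>)
  then have "((\<lambda>\<theta>. - (\<theta> / 2) * (1 - \<theta>\<^sup>2) powr (-3/4)) has_real_derivative
     (- (1/2)) * (1 - \<theta>\<^sup>2) powr (-3/4) + (-3/4) * (1 - \<theta>\<^sup>2) powr (-3/4 - of_nat 1) * (- (2 * \<theta>)) * (- (\<theta> / 2))) (at \<theta>)"
    by (intro DERIV_mult) (auto intro!: derivative_eq_intros)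
  then show ?thesis unfolding profile1_def[abs_def] profile2_def by (simp add: field_simps power2_eq_square)
qed

lemma powr_neg_ge_one: "0 < x \<Longrightarrow> x \<le> 1 \<Longrightarrow> 0 \<le> e \<Longrightarrow> 1 \<le> x powr (- e)" for x e :: real
  using powr_mono2'[of "- e" x 1] by simp

text \<open>Uniform concavity of the profile. It separates the slopes of two copies shifted by b by
  at least b / 2.\<close>

lemma profile2_le:
  assumes "0 \<le> \<theta>" "\<theta> < 1" shows "profile2 \<theta> \<le> - 1/2"
proof -
  have "1 \<le> (1 - \<theta>\<^sup>2) powr (-3/4)"
    using powr_neg_ge_one[of "1 - \<theta>\<^sup>2" "3/4"] square_less_one[OF assms] by simp
  moreover have "0 \<le> (3/4) * \<theta>\<^sup>2 * (1 - \<theta>\<^sup>2) powr (-7/4)" by simp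
  ultimately show ?thesis unfolding profile2_def by linarith
qed

text \<open>A decreasing second derivative makes the slope of a difference of shifted profiles
  monotone, as \<open>oscillation\<close> demands.\<close>

lemma profile2_antimono:
  assumes "0 \<le> x" "x \<le> y" "y < 1" shows "profile2 y \<le> profile2 x"
proof -
  have sq: "x\<^sup>2 \<le> y\<^sup>2" "y\<^sup>2 < 1" using assms square_less_one[of y] by (auto intro: power_mono)
  have "(1 - x\<^sup>2) powr (-3/4) \<le> (1 - y\<^sup>2) powr (-3/4)" "(1 - x\<^sup>2) powr (-7/4) \<le> (1 - y\<^sup>2) powr (-7/4)"
    using sq by (auto intro!: powr_mono2')
  moreover have "(3/4) * x\<^sup>2 * (1 - x\<^sup>2) powr (-7/4) \<le> (3/4) * y\<^sup>2 * (1 - y\<^sup>2) powr (-7/4)"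
    using sq calculation by (intro mult_mono) auto
  ultimately show ?thesis by (simp add: profile2_def)
qed

text \<open>The slope is unbounded near 1, so no Lipschitz bound can hold. The exponent 1/4 comes
  from the subadditivity of the fourth root, and the factor 2 from the Lipschitz constant of x^2 on
  the unit interval.\<close>

lemma profile_holder:
  assumes "0 \<le> x" "x \<le> y" "y \<le> 1"
  shows "profile y \<le> profile x" "profile x \<le> profile y + (2 * (y - x)) powr (1/4)"
proof -
  have sq: "x\<^sup>2 \<le> y\<^sup>2" "y\<^sup>2 \<le> 1" using assms by (auto intro: power_mono simp: power_le_one)
  then show "profile y \<le> profile x" unfolding profile_def by (intro powr_mono2) auto
  have sub: "(s + t) powr (1/4) \<le> s powr (1/4) + t powr (1/4)" if "0 \<le> s" "0 \<le> t" for s t :: real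
  proof -
    define a b where "a = s powr (1/4)" and "b = t powr (1/4)"
    have ab: "0 \<le> a" "0 \<le> b" by (auto simp: a_def b_def)
    have p4: "(z powr (1/4)) ^ 4 = z" if "0 \<le> z" for z :: real
    proof (cases "z = 0")
      case False
      then have "(z powr (1/4)) ^ 4 = (z powr (1/4)) powr (real 4)" using that by (intro powr_realpow[symmetric]) simp
      then show ?thesis using that by (simp only: powr_powr) simp
    qed simp
    have "s + t = a ^ 4 + b ^ 4" using that by (simp add: a_def b_def p4)
    also have "\<dots> \<le> (a + b) ^ 4"
      using ab by (simp add: power4_eq_xxxx algebra_simps add_nonneg_nonneg)
    finally have "(s + t) powr (1/4) \<le> ((a + b) ^ 4) powr (1/4)" using that by (intro powr_mono2) auto
    also have "((a + b) ^ 4) powr (1/4) = a + b"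
    proof (cases "a + b = 0")
      case False
      then have "0 < a + b" using ab by linarith
      then have "((a + b) ^ 4) powr (1/4) = ((a + b) powr (real 4)) powr (1/4)" by (simp only: powr_realpow)
      then show ?thesis using ab by (simp only: powr_powr) simp
    qed simp
    finally show ?thesis by (simp add: a_def b_def)
  qed
  have "y\<^sup>2 - x\<^sup>2 = (y - x) * (y + x)" by (simp add: power2_eq_square algebra_simps)
  also have "\<dots> \<le> (y - x) * 2" using assms by (intro mult_left_mono) auto
  finally have le: "1 - x\<^sup>2 \<le> (1 - y\<^sup>2) + 2 * (y - x)" by linarith
  have "profile x \<le> ((1 - y\<^sup>2) + 2 * (y - x)) powr (1/4)"
    unfolding profile_def using sq le by (intro powr_mono2) auto
  also have "\<dots> \<le> profile y + (2 * (y - x)) powr (1/4)"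
    unfolding profile_def using sq assms by (intro sub) auto
  finally show "profile x \<le> profile y + (2 * (y - x)) powr (1/4)" .
qed

text \<open>Here b is the parameter gap. \<open>oscillation\<close> gives an operator norm of order
  h / (r b), whose integral over b diverges at 0; the geometric mean with the trivial bound has
  order b^(-1/2) and can be integrated.\<close>

lemma profile_difference_oscillation:
  fixes \<phi> :: "real \<Rightarrow> real" and h B R r a b :: real
  assumes \<phi>: "\<phi> \<in> borel_measurable borel" and B: "\<And>x. \<bar>\<phi> x\<bar> \<le> B"
    and R: "\<And>x. R < \<bar>x\<bar> \<Longrightarrow> \<phi> x = 0" and h: "0 < h"
    and zero: "\<And>m::int. (LINT v|lborel. \<phi> v * of_bool (\<lfloor>v / h\<rfloor> = m)) = 0"
    and r: "0 < r" and ab: "0 < b" "b < a" "a < 1"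
  shows "(\<integral>\<^sup>+u. ennreal ((LINT \<theta>|lborel. \<phi> (u - r * (profile (\<theta> + b) - profile \<theta>)) * indicator {0..a - b} \<theta>)\<^sup>2) \<partial>lborel)
    \<le> ennreal ((2 * sqrt (h / r) * b powr (-1/2))\<^sup>2) * (\<integral>\<^sup>+u. ennreal ((\<phi> u)\<^sup>2) \<partial>lborel)"
    (is "?W \<le> _ * ?I")
proof -
  note [measurable] = \<phi>
  define F where "F \<theta> = profile (\<theta> + b) - profile \<theta>" for \<theta>
  define \<psi> where "\<psi> \<theta> = profile1 \<theta> - profile1 (\<theta> + b)" for \<theta>
  have [measurable]: "F \<in> borel_measurable borel" "\<psi> \<in> borel_measurable borel"
    unfolding F_def \<psi>_def by measurable
  have d1: "(profile1 has_real_derivative profile2 \<theta>) (at \<theta>)" "((\<lambda>\<theta>. profile1 (\<theta> + b)) has_real_derivative profile2 (\<theta> + b)) (at \<theta>)"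
    if "\<theta> \<in> {0..a - b}" for \<theta>
    using that ab profile1_deriv[of \<theta>] profile1_deriv[of "\<theta> + b"] by (auto simp: DERIV_shift)
  have d\<psi>: "(\<psi> has_real_derivative profile2 \<theta> - profile2 (\<theta> + b)) (at \<theta>)" if "\<theta> \<in> {0..a - b}" for \<theta>
    unfolding \<psi>_def using d1[OF that] by (rule DERIV_diff)
  have W1: "?W \<le> ennreal ((2 * h / (r * (b / 2)))\<^sup>2) * ?I"
    unfolding F_def[symmetric]
  proof (rule oscillation[OF \<phi> B R h zero])
    show "(F has_real_derivative - \<psi> \<theta>) (at \<theta>)" if "\<theta> \<in> {0..a - b}" for \<theta>
    proof -
      have "(profile has_real_derivative profile1 \<theta>) (at \<theta>)" "((\<lambda>\<theta>. profile (\<theta> + b)) has_real_derivative profile1 (\<theta> + b)) (at \<theta>)"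
        using that ab profile_deriv[of \<theta>] profile_deriv[of "\<theta> + b"] by (auto simp: DERIV_shift)
      then show ?thesis unfolding F_def \<psi>_def using DERIV_diff by fastforce
    qed
    show "continuous_on {0..a - b} \<psi>"
      using d\<psi> by (intro DERIV_continuous_on[where D="\<lambda>\<theta>. profile2 \<theta> - profile2 (\<theta> + b)"]) (auto intro: has_field_derivative_at_within)
    show "\<psi> x \<le> \<psi> y" if "0 \<le> x" "x \<le> y" "y \<le> a - b" for x y
    proof (rule DERIV_nonneg_imp_nondecreasing[OF \<open>x \<le> y\<close>])
      fix z assume z: "x \<le> z" "z \<le> y"
      then have "0 \<le> profile2 z - profile2 (z + b)" using that ab profile2_antimono[of z "z + b"] by auto
      then show "\<exists>D. (\<psi> has_real_derivative D) (at z) \<and> 0 \<le> D" using d\<psi>[of z] that z by auto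
    qed
    show "b / 2 \<le> \<psi> \<theta>" if "\<theta> \<in> {0..a - b}" for \<theta>
    proof -
      have d: "(profile1 has_real_derivative profile2 x) (at x)" if "\<theta> \<le> x" "x \<le> \<theta> + b" for x
        using that \<open>\<theta> \<in> {0..a - b}\<close> ab by (intro profile1_deriv) auto
      have "\<theta> < \<theta> + b" using ab by simp
      from MVT2[OF this d] obtain z where z: "\<theta> < z" "z < \<theta> + b" "profile1 (\<theta> + b) - profile1 \<theta> = b * profile2 z"
        by auto
      have "b * profile2 z \<le> b * (- 1/2)" using z that ab by (intro mult_left_mono profile2_le) auto
      then show ?thesis using z by (simp add: \<psi>_def)
    qed
  qed (use ab r in auto)
  have W2: "?W \<le> ?I"
    using oscillation_trivial[of \<phi> "\<lambda>\<theta>. r * F \<theta>" "a - b"] ab unfolding F_def[symmetric] by simp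
  \<comment> \<open>\<open>k\<close> is the operator norm from \<open>oscillation\<close>, and the
    claim for squared norms is min(1, k^2) \<le> k.\<close>
  define k where "k = 4 * h / (r * b)"
  have k: "0 < k" using h r ab by (simp add: k_def)
  have sk: "(2 * sqrt (h / r) * b powr (-1/2))\<^sup>2 = k"
    using h r ab by (simp add: k_def power_mult_distrib powr_power powr_minus field_simps)
  show ?thesis
  proof (cases "k \<le> 1")
    case True
    have "(2 * h / (r * (b / 2)))\<^sup>2 = k * k" by (simp add: k_def power2_eq_square)
    also have "\<dots> \<le> k * 1" using True k by (intro mult_left_mono) auto
    finally show ?thesis unfolding sk by (intro order_trans[OF W1] mult_right_mono ennreal_leI) auto
  next
    case False
    then have "1 * ?I \<le> ennreal k * ?I" by (intro mult_right_mono) auto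
    then show ?thesis unfolding sk using W2 by simp
  qed
qed


section \<open>Square-integral estimate for averages over the curve\<close>

lemma nn_integral_even:
  fixes f :: "real \<Rightarrow> ennreal"
  assumes [measurable]: "f \<in> borel_measurable borel" and even: "\<And>b. f (- b) = f b"
  shows "(\<integral>\<^sup>+b. f b \<partial>lborel) = 2 * (\<integral>\<^sup>+b. f b * indicator {0<..} b \<partial>lborel)"
proof -
  have "(\<integral>\<^sup>+b. f b \<partial>lborel) = (\<integral>\<^sup>+b. f b * indicator {0<..} b + f b * indicator {..<0} b \<partial>lborel)"
    by (intro nn_integral_cong_AE) (use AE_lborel_singleton[of 0] in \<open>eventually_elim, auto simp: indicator_def\<close>)
  also have "\<dots> = (\<integral>\<^sup>+b. f b * indicator {0<..} b \<partial>lborel) + (\<integral>\<^sup>+b. f b * indicator {..<0} b \<partial>lborel)"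
    by (rule nn_integral_add) measurable
  also have "(\<integral>\<^sup>+b. f b * indicator {..<0} b \<partial>lborel) = (\<integral>\<^sup>+b. f (- b) * indicator {..<0} (- b) \<partial>lborel)"
    using nn_integral_real_affine[of "\<lambda>b. f b * indicator {..<0} b" "-1" 0] by simp
  also have "\<dots> = (\<integral>\<^sup>+b. f b * indicator {0<..} b \<partial>lborel)"
    by (intro nn_integral_cong) (auto simp: indicator_def even)
  finally show ?thesis by (simp add: mult_2)
qed

lemma integral_translate:
  fixes f :: "'a::euclidean_space \<Rightarrow> real"
  assumes [measurable]: "f \<in> borel_measurable borel"
  shows "(LINT x|lborel. f (x + a)) = (LINT x|lborel. f x)"
proof -
  have "(LINT x|lborel. f x) = (LINT x|distr lborel borel ((+) a). f x)"
    by (simp only: lborel_distr_plus)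
  also have "\<dots> = (LINT x|lborel. f (a + x))" by (subst integral_distr) auto
  finally show ?thesis by (simp add: add.commute)
qed

lemma measurable_fst_snd_real2 [measurable]:
  "fst \<in> borel_measurable (borel :: (real \<times> real) measure)"
  "snd \<in> borel_measurable (borel :: (real \<times> real) measure)"
  by (intro borel_measurable_continuous_onI continuous_intros)+

text \<open>The square of the average is an integral over pairs of curve points, sorted by their
  parameter gap b. For fixed b the second coordinates of the two points differ by c * b whatever
  \<theta> is, so the correlation at gap b reduces to \<open>profile_difference_oscillation\<close>
  on each horizontal line. Stopping at a < 1 keeps away from the end of the curve, where the profile
  has infinite slope.\<close>

lemma curve_average_L2_truncated:
  fixes f :: "real \<times> real \<Rightarrow> real" and h B R r a c :: real
  assumes f [measurable]: "f \<in> borel_measurable borel" and B: "\<And>x. \<bar>f x\<bar> \<le> B"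
    and R: "\<And>x. R < \<bar>fst x\<bar> \<or> R < \<bar>snd x\<bar> \<Longrightarrow> f x = 0" and h: "0 < h"
    and zero: "\<And>(m::int) t. (LINT v|lborel. f (v, t) * of_bool (\<lfloor>v / h\<rfloor> = m)) = 0"
    and r: "0 < r" and a: "0 < a" "a < 1"
  shows "(\<integral>\<^sup>+x. ennreal ((LINT \<theta>|lborel. f (fst x - r * profile \<theta>, snd x - c * \<theta>) * indicator {0..a} \<theta>)\<^sup>2) \<partial>lborel)
    \<le> ennreal (8 * sqrt (h / r)) * (\<integral>\<^sup>+x. ennreal ((f x)\<^sup>2) \<partial>lborel)"
proof -
  define w where "w \<theta> = (r * profile \<theta>, c * \<theta>)" for \<theta>
  have [measurable]: "w \<in> borel_measurable borel" unfolding w_def[abs_def]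
    by (subst borel_prod[symmetric]) measurable
  have B0: "0 \<le> B" using B[of 0] by linarith
  define H where "H x \<theta> = f (x - w \<theta>) * indicator {0..a} \<theta>" for x \<theta>
  have [measurable]: "(\<lambda>z. H (g z) (k z)) \<in> borel_measurable M" if [measurable]: "g \<in> borel_measurable M" "k \<in> borel_measurable M" for g k and M :: "'z measure"
    unfolding H_def by measurable
  define A where "A x = (LINT \<theta>|lborel. H x \<theta>)" for x
  have A: "(LINT \<theta>|lborel. f (fst x - r * profile \<theta>, snd x - c * \<theta>) * indicator {0..a} \<theta>) = A x" for x
    unfolding A_def H_def w_def by (simp add: minus_prod_def)
  have HB: "\<bar>H x \<theta>\<bar> \<le> B" for x \<theta> using B[of "x - w \<theta>"] B0 by (auto simp: H_def indicator_def)
  have H0: "H x \<theta> = 0" if "\<theta> \<notin> {0..a}" for x \<theta> using that by (simp add: H_def)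
  define R' where "R' = \<bar>R\<bar> + r + \<bar>c\<bar>"
  have w_bound: "\<bar>fst (w \<theta>)\<bar> \<le> r \<and> \<bar>snd (w \<theta>)\<bar> \<le> \<bar>c\<bar>" if "\<theta> \<in> {0..a}" for \<theta>
    using that a profile_range[of \<theta>] r by (auto simp: w_def abs_mult mult_left_le)
  have HR: "H x \<theta> = 0" if "x \<notin> {-R'..R'} \<times> {-R'..R'}" for x \<theta>
  proof (cases "\<theta> \<in> {0..a}")
    case True
    have "R' < \<bar>fst x\<bar> \<or> R' < \<bar>snd x\<bar>" using that by (cases x) auto
    then have "R < \<bar>fst (x - w \<theta>)\<bar> \<or> R < \<bar>snd (x - w \<theta>)\<bar>"
      using w_bound[OF True] r unfolding R'_def fst_diff snd_diff by linarith
    then show ?thesis using R[of "x - w \<theta>"] by (simp add: H_def)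
  qed (rule H0)
  have box_fin: "emeasure lborel ({-s..s} \<times> {-s..s}) < \<infinity>" for s :: real
    by (rule emeasure_bounded_finite) (intro bounded_Times bounded_closed_interval)
  define N where "N = (LINT x|lborel. (f x)\<^sup>2)"
  have intf2: "integrable lborel (\<lambda>x. (f x)\<^sup>2)"
  proof (rule integrable_bounded_support[where A="{-\<bar>R\<bar>..\<bar>R\<bar>} \<times> {-\<bar>R\<bar>..\<bar>R\<bar>}" and B="B\<^sup>2"])
    show "\<bar>(f x)\<^sup>2\<bar> \<le> B\<^sup>2" for x using power_mono[OF B[of x], of 2] by simp
    fix x :: "real \<times> real" assume "x \<notin> {-\<bar>R\<bar>..\<bar>R\<bar>} \<times> {-\<bar>R\<bar>..\<bar>R\<bar>}"
    then have "R < \<bar>fst x\<bar> \<or> R < \<bar>snd x\<bar>" by (cases x) auto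
    then show "(f x)\<^sup>2 = 0" using R[of x] by simp
  qed (use box_fin in \<open>auto intro!: borel_closed closed_Times\<close>)
  have N: "ennreal N = (\<integral>\<^sup>+x. ennreal ((f x)\<^sup>2) \<partial>lborel)"
    unfolding N_def using intf2 by (intro nn_integral_eq_integral[symmetric]) auto
  have N0: "0 \<le> N" unfolding N_def by (intro integral_nonneg_AE) auto
  \<comment> \<open>The variable y stands for (\<theta>, b): the parameter of one point and the gap,
    of either sign, to the other.\<close>
  define K where "K x y = H x (fst y) * H x (fst y + snd y)" for x y :: "real \<times> real"
  have [measurable]: "(\<lambda>z. K (g z) (k z)) \<in> borel_measurable M" if [measurable]: "g \<in> borel_measurable M" "k \<in> borel_measurable M" for g k and M :: "'z measure"
    unfolding K_def by measurable
  have K0: "K x y = 0" if "y \<notin> {-1..1} \<times> {-1..1}" for x y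
  proof -
    have "fst y \<notin> {0..a} \<or> fst y + snd y \<notin> {0..a}" using that a by (cases y) auto
    then show ?thesis by (elim disjE) (simp_all add: K_def H0)
  qed
  have KB: "\<bar>K x y\<bar> \<le> B * B" for x y
    unfolding K_def abs_mult using B0 by (intro mult_mono HB) auto
  have intK: "integrable (lborel \<Otimes>\<^sub>M lborel) (\<lambda>(x, y). K x y)"
  proof (rule integrable_bounded_support[where A="({-R'..R'} \<times> {-R'..R'}) \<times> ({-1..1} \<times> {-1..1})" and B="B * B"])
    show "emeasure (lborel \<Otimes>\<^sub>M lborel) (({-R'..R'} \<times> {-R'..R'}) \<times> ({-1..1::real} \<times> {-1..1::real})) < \<infinity>"
      using box_fin[of R'] box_fin[of 1]
      by (subst lborel.emeasure_pair_measure_Times) (auto intro!: borel_closed closed_Times simp: ennreal_mult_less_top)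
    show "(case z of (x, y) \<Rightarrow> K x y) = 0" if "z \<notin> ({-R'..R'} \<times> {-R'..R'}) \<times> ({-1..1} \<times> {-1..1})" for z
    proof -
      obtain x y where Pair: "z = (x, y)" by (rule prod.exhaust)
      then have "x \<notin> {-R'..R'} \<times> {-R'..R'} \<or> y \<notin> {-1..1} \<times> {-1..1}" using that by blast
      then have "K x y = 0" using K0[of y x] HR[of x] by (elim disjE) (simp_all add: K_def)
      then show ?thesis using Pair by simp
    qed
    show "\<bar>case z of (x, y) \<Rightarrow> K x y\<bar> \<le> B * B" for z by (cases z) (simp add: KB)
    show "({-R'..R'} \<times> {-R'..R'}) \<times> ({-1..1::real} \<times> {-1..1::real}) \<in> sets (lborel \<Otimes>\<^sub>M lborel)"
      by (intro pair_measureI) (auto intro!: borel_closed closed_Times)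
  qed measurable
  define \<gamma> where "\<gamma> y = (LINT x|lborel. K x y)" for y
  have [measurable]: "\<gamma> \<in> borel_measurable borel" unfolding \<gamma>_def by measurable
  have int\<gamma>: "integrable lborel \<gamma>"
    unfolding \<gamma>_def using lborel_pair.integrable_snd[OF intK] by simp
  have Asq: "(A x)\<^sup>2 = (LINT y|lborel. K x y)" for x
  proof -
    have i1: "integrable (lborel \<Otimes>\<^sub>M lborel) (\<lambda>y. K x y)"
    proof (rule integrable_bounded_support[where A="{-1..1} \<times> {-1..1}" and B="B * B"])
      show "emeasure (lborel \<Otimes>\<^sub>M lborel) ({-1..1::real} \<times> {-1..1::real}) < \<infinity>"
        using box_fin[of 1] by (simp add: lborel_prod)
    qed (use K0 KB in \<open>auto simp: lborel_prod intro!: borel_closed closed_Times\<close>)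
    have "(LINT y|lborel. K x y) = (LINT y|(lborel \<Otimes>\<^sub>M lborel). K x y)" by (simp add: lborel_prod)
    also have "\<dots> = (LINT \<theta>|lborel. (LINT b|lborel. K x (\<theta>, b)))"
      using lborel_pair.integral_fst'[of "\<lambda>y. K x y"] i1 by simp
    also have "\<dots> = (LINT \<theta>|lborel. H x \<theta> * A x)"
    proof (rule Bochner_Integration.integral_cong)
      fix \<theta>
      have "(LINT b|lborel. K x (\<theta>, b)) = H x \<theta> * (LINT b|lborel. H x (b + \<theta>))"
        unfolding K_def by (simp add: add.commute)
      also have "(LINT b|lborel. H x (b + \<theta>)) = A x"
        unfolding A_def by (rule integral_translate) measurable
      finally show "(LINT b|lborel. K x (\<theta>, b)) = H x \<theta> * A x" .
    qed simp
    also have "\<dots> = (A x)\<^sup>2" by (simp add: A_def power2_eq_square)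
    finally show ?thesis by simp
  qed
  have intA: "integrable lborel (\<lambda>x. (A x)\<^sup>2)"
    unfolding Asq using lborel_pair.integrable_fst[OF intK] by simp
  \<comment> \<open>The total correlation of f at gap \<open>b\<close>; by \<open>main\<close>
    below, the squared norm is its integral.\<close>
  define G where "G b = (LINT \<theta>|lborel. \<gamma> (\<theta>, b))" for b
  have [measurable]: "G \<in> borel_measurable borel"
  proof -
    have "(\<lambda>(b, \<theta>). \<gamma> (\<theta>, b)) \<in> borel_measurable (borel \<Otimes>\<^sub>M borel)"
      by (simp add: borel_prod case_prod_beta)
    then show ?thesis unfolding G_def by measurable
  qed
  have int\<gamma>': "integrable (lborel \<Otimes>\<^sub>M lborel) (\<lambda>(\<theta>, b). \<gamma> (\<theta>, b))"
    using int\<gamma> by (simp add: lborel_prod)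
  have intG: "integrable lborel G"
    unfolding G_def using lborel_pair.integrable_snd[OF int\<gamma>'] by simp
  have main: "(LINT x|lborel. (A x)\<^sup>2) = (LINT b|lborel. G b)"
  proof -
    have "(LINT x|lborel. (A x)\<^sup>2) = (LINT x|lborel. (LINT y|lborel. K x y))" by (simp add: Asq)
    also have "\<dots> = (LINT y|lborel. \<gamma> y)"
      unfolding \<gamma>_def by (rule lborel_pair.Fubini_integral[OF intK, symmetric])
    also have "\<dots> = (LINT y|(lborel \<Otimes>\<^sub>M lborel). (case y of (\<theta>, b) \<Rightarrow> \<gamma> (\<theta>, b)))" by (simp add: lborel_prod)
    also have "\<dots> = (LINT b|lborel. G b)"
      unfolding G_def by (rule lborel_pair.integral_snd[OF int\<gamma>', symmetric])
    finally show ?thesis .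
  qed
  \<comment> \<open>Exchanging the two points of a pair reverses the sign of the gap.\<close>
  have Geven: "G (- b) = G b" for b
  proof -
    have "(\<lambda>\<theta>. (\<theta>, - b)) \<in> borel_measurable borel"
      by (intro borel_measurable_continuous_onI continuous_intros)
    then have \<gamma>m: "(\<lambda>\<theta>. \<gamma> (\<theta>, - b)) \<in> borel_measurable borel"
      by (rule measurable_compose) measurable
    have "G (- b) = (LINT \<theta>|lborel. \<gamma> (\<theta> + b, - b))"
      unfolding G_def by (rule integral_translate[OF \<gamma>m, symmetric])
    also have "\<dots> = G b" unfolding G_def \<gamma>_def K_def by (simp add: mult.commute)
    finally show ?thesis .
  qed
  have Gbound: "\<bar>G b\<bar> \<le> 2 * sqrt (h / r) * b powr (-1/2) * N * indicator {0<..<1} b" if b: "0 < b" for b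
  proof (cases "b < a")
    case False
    \<comment> \<open>For a gap of at least a, both parameters fit into \<open>{0..a}\<close> at
      most for \<theta> = 0, a null set.\<close>
    have "K x (\<theta>, b) = 0" if "\<theta> \<noteq> 0" for x \<theta>
    proof (cases "\<theta> \<in> {0..a}")
      case True
      then show ?thesis using H0[of "\<theta> + b" x] \<open>\<not> b < a\<close> that by (simp add: K_def)
    qed (simp add: K_def H0)
    then have \<gamma>0: "\<gamma> (\<theta>, b) = 0" if "\<theta> \<noteq> 0" for \<theta> using that by (simp add: \<gamma>_def)
    have "AE \<theta> in lborel. \<gamma> (\<theta>, b) = 0" using AE_lborel_singleton[of 0] by eventually_elim (rule \<gamma>0)
    then have "G b = 0" unfolding G_def by (rule integral_eq_zero_AE)
    then show ?thesis using N0 b h r by (simp add: indicator_def)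
  next
    case True
    \<comment> \<open>The displacement between the two points of a pair. Its second entry does not
      depend on \<theta>, so \<open>W\<close> is formed on each horizontal line separately, up to a
      vertical translation.\<close>
    define w' where "w' \<theta> = (r * (profile (\<theta> + b) - profile \<theta>), c * b)" for \<theta>
    have [measurable]: "w' \<in> borel_measurable borel" unfolding w'_def[abs_def]
      by (subst borel_prod[symmetric]) measurable
    define I where "I = (indicator {0..a - b} :: real \<Rightarrow> real)"
    have [measurable]: "I \<in> borel_measurable borel" unfolding I_def by measurable
    define \<kappa> where "\<kappa> = 2 * sqrt (h / r) * b powr (-1/2)"
    have \<kappa>: "0 < \<kappa>" using h r b by (simp add: \<kappa>_def)
    define W where "W x = (LINT \<theta>|lborel. f (x - w' \<theta>) * I \<theta>)" for x
    have [measurable]: "W \<in> borel_measurable borel" unfolding W_def by measurable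
    have \<gamma>: "\<gamma> (\<theta>, b) = (LINT x|lborel. f x * (f (x - w' \<theta>) * I \<theta>))" for \<theta>
    proof (cases "\<theta> \<in> {0..a - b}")
      case \<theta>: True
      have "\<gamma> (\<theta>, b) = (LINT x|lborel. f (x - w \<theta>) * f (x - w (\<theta> + b)))"
        using \<theta> b by (simp add: \<gamma>_def K_def H_def)
      also have "\<dots> = (LINT x|lborel. f ((x + w \<theta>) - w \<theta>) * f ((x + w \<theta>) - w (\<theta> + b)))"
        by (rule integral_translate[symmetric]) measurable
      also have "\<dots> = (LINT x|lborel. f x * f (x - w' \<theta>))"
        by (intro Bochner_Integration.integral_cong refl arg_cong2[where f="(*)"] arg_cong[where f=f])
          (auto simp: w_def w'_def prod_eq_iff algebra_simps)
      finally show ?thesis using \<theta> by (simp add: I_def)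
    next
      case False
      then have z: "H x \<theta> * H x (\<theta> + b) = 0" for x using H0[of \<theta> x] H0[of "\<theta> + b" x] b by auto
      have "\<gamma> (\<theta>, b) = 0" unfolding \<gamma>_def K_def fst_conv snd_conv z by simp
      then show ?thesis using False by (simp add: I_def)
    qed
    have intk: "integrable (lborel \<Otimes>\<^sub>M lborel) (\<lambda>(x, \<theta>). f x * (f (x - w' \<theta>) * I \<theta>))"
    proof (rule integrable_bounded_support[where A="({-\<bar>R\<bar>..\<bar>R\<bar>} \<times> {-\<bar>R\<bar>..\<bar>R\<bar>}) \<times> {0..1}" and B="B * B"])
      show "emeasure (lborel \<Otimes>\<^sub>M lborel) (({-\<bar>R\<bar>..\<bar>R\<bar>} \<times> {-\<bar>R\<bar>..\<bar>R\<bar>}) \<times> {0..1::real}) < \<infinity>"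
        using box_fin[of "\<bar>R\<bar>"]
        by (subst lborel.emeasure_pair_measure_Times) (auto intro!: borel_closed closed_Times simp: ennreal_mult_less_top)
      show "({-\<bar>R\<bar>..\<bar>R\<bar>} \<times> {-\<bar>R\<bar>..\<bar>R\<bar>}) \<times> {0..1::real} \<in> sets (lborel \<Otimes>\<^sub>M lborel)"
        by (intro pair_measureI) (auto intro!: borel_closed closed_Times)
      fix z :: "(real \<times> real) \<times> real"
      show "\<bar>case z of (x, \<theta>) \<Rightarrow> f x * (f (x - w' \<theta>) * I \<theta>)\<bar> \<le> B * B"
      proof -
        obtain x \<theta> where Pair: "z = (x, \<theta>)" by (rule prod.exhaust)
        have "\<bar>f (x - w' \<theta>) * I \<theta>\<bar> \<le> B" using B[of "x - w' \<theta>"] B0 by (auto simp: I_def indicator_def)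
        then have "\<bar>f x\<bar> * \<bar>f (x - w' \<theta>) * I \<theta>\<bar> \<le> B * B" using B0 by (intro mult_mono B) auto
        then show ?thesis using Pair by (simp add: abs_mult)
      qed
      assume z: "z \<notin> ({-\<bar>R\<bar>..\<bar>R\<bar>} \<times> {-\<bar>R\<bar>..\<bar>R\<bar>}) \<times> {0..1}"
      show "(case z of (x, \<theta>) \<Rightarrow> f x * (f (x - w' \<theta>) * I \<theta>)) = 0"
      proof -
        obtain x \<theta> where Pair: "z = (x, \<theta>)" by (rule prod.exhaust)
        have "\<theta> \<notin> {0..a - b} \<or> R < \<bar>fst x\<bar> \<or> R < \<bar>snd x\<bar>"
          using z Pair a b by (cases x) auto
        then show ?thesis using Pair R[of x] by (auto simp: I_def)
      qed
    qed measurable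
    have "G b = (LINT \<theta>|lborel. (LINT x|lborel. f x * (f (x - w' \<theta>) * I \<theta>)))"
      by (simp add: G_def \<gamma>)
    also have "\<dots> = (LINT x|lborel. (LINT \<theta>|lborel. f x * (f (x - w' \<theta>) * I \<theta>)))"
      by (rule lborel_pair.Fubini_integral[OF intk])
    also have "\<dots> = (LINT x|lborel. f x * W x)" by (simp add: W_def)
    finally have GW: "G b = (LINT x|lborel. f x * W x)" .
    have W2: "(\<integral>\<^sup>+x. ennreal ((W x)\<^sup>2) \<partial>lborel) \<le> ennreal (\<kappa>\<^sup>2) * ennreal N"
    proof -
      define g where "g t = (\<integral>\<^sup>+u. ennreal ((f (u, t))\<^sup>2) \<partial>lborel)" for t
      have [measurable]: "(\<lambda>x. f (fst x, snd x)) \<in> borel_measurable (borel \<Otimes>\<^sub>M borel)"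
        "(\<lambda>x. W (fst x, snd x)) \<in> borel_measurable (borel \<Otimes>\<^sub>M borel)"
        by (simp_all add: borel_prod)
      have ft [measurable]: "(\<lambda>u. f (u, t)) \<in> borel_measurable borel" for t
        by (rule measurable_compose[OF _ f]) (intro borel_measurable_continuous_onI continuous_intros)
      have [measurable]: "g \<in> borel_measurable borel"
        unfolding g_def by (rule lborel.borel_measurable_nn_integral) (simp add: borel_prod case_prod_beta)
      have "(\<integral>\<^sup>+x. ennreal ((W x)\<^sup>2) \<partial>lborel) = (\<integral>\<^sup>+x. ennreal ((W x)\<^sup>2) \<partial>(lborel \<Otimes>\<^sub>M lborel))" by (simp add: lborel_prod)
      also have "\<dots> = (\<integral>\<^sup>+t. (\<integral>\<^sup>+u. ennreal ((W (u, t))\<^sup>2) \<partial>lborel) \<partial>lborel)"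
        by (rule lborel_pair.nn_integral_snd[symmetric]) (simp add: lborel_prod)
      also have "\<dots> \<le> (\<integral>\<^sup>+t. ennreal (\<kappa>\<^sup>2) * g (t - c * b) \<partial>lborel)"
      proof (rule nn_integral_mono)
        fix t
        have "(\<integral>\<^sup>+u. ennreal ((LINT \<theta>|lborel. f (u - r * (profile (\<theta> + b) - profile \<theta>), t - c * b) * indicator {0..a - b} \<theta>)\<^sup>2) \<partial>lborel)
          \<le> ennreal ((2 * sqrt (h / r) * b powr (-1/2))\<^sup>2) * (\<integral>\<^sup>+u. ennreal ((f (u, t - c * b))\<^sup>2) \<partial>lborel)"
          by (rule profile_difference_oscillation[where B=B and R=R]) (use B R h zero r b True a(2) in auto)
        then show "(\<integral>\<^sup>+u. ennreal ((W (u, t))\<^sup>2) \<partial>lborel) \<le> ennreal (\<kappa>\<^sup>2) * g (t - c * b)"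
          by (simp add: W_def w'_def I_def \<kappa>_def g_def)
      qed
      also have "\<dots> = ennreal (\<kappa>\<^sup>2) * (\<integral>\<^sup>+t. g (t - c * b) \<partial>lborel)" by (rule nn_integral_cmult) measurable
      also have "(\<integral>\<^sup>+t. g (t - c * b) \<partial>lborel) = (\<integral>\<^sup>+t. g t \<partial>lborel)"
        by (rule nn_integral_lborel_translate_diff) measurable
      also have "\<dots> = (\<integral>\<^sup>+x. ennreal ((f x)\<^sup>2) \<partial>(lborel \<Otimes>\<^sub>M lborel))"
        unfolding g_def by (rule lborel_pair.nn_integral_snd) (simp add: lborel_prod)
      finally show ?thesis by (simp add: N lborel_prod)
    qed
    have "ennreal \<bar>G b\<bar> \<le> (\<integral>\<^sup>+x. ennreal (norm (f x * W x)) \<partial>lborel)"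
      unfolding GW using integral_norm_bound_ennreal[of lborel "\<lambda>x. f x * W x"]
      by (cases "integrable lborel (\<lambda>x. f x * W x)") (auto simp: not_integrable_integral_eq)
    also have "\<dots> \<le> (\<integral>\<^sup>+x. ennreal (\<kappa> / 2) * ennreal ((f x)\<^sup>2) + ennreal (1 / (2 * \<kappa>)) * ennreal ((W x)\<^sup>2) \<partial>lborel)"
    proof (rule nn_integral_mono)
      fix x
      \<comment> \<open>Cauchy-Schwarz in the form of the arithmetic-geometric mean; with weight
        \<kappa> both terms are bounded by \<kappa> * N / 2.\<close>
      have "0 \<le> (\<kappa> * \<bar>f x\<bar> - \<bar>W x\<bar>)\<^sup>2" by simp
      then have "2 * \<kappa> * (\<bar>f x\<bar> * \<bar>W x\<bar>) \<le> \<kappa>\<^sup>2 * (f x)\<^sup>2 + (W x)\<^sup>2"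
        by (simp add: power2_diff power_mult_distrib mult_ac)
      then have "\<bar>f x\<bar> * \<bar>W x\<bar> \<le> \<kappa> / 2 * (f x)\<^sup>2 + 1 / (2 * \<kappa>) * (W x)\<^sup>2"
        using \<kappa> by (simp add: field_simps power2_eq_square)
      then have "ennreal (norm (f x * W x)) \<le> ennreal (\<kappa> / 2 * (f x)\<^sup>2 + 1 / (2 * \<kappa>) * (W x)\<^sup>2)"
        by (intro ennreal_leI) (simp add: abs_mult)
      also have "\<dots> = ennreal (\<kappa> / 2 * (f x)\<^sup>2) + ennreal (1 / (2 * \<kappa>) * (W x)\<^sup>2)"
        using \<kappa> by (intro ennreal_plus) auto
      also have "\<dots> = ennreal (\<kappa> / 2) * ennreal ((f x)\<^sup>2) + ennreal (1 / (2 * \<kappa>)) * ennreal ((W x)\<^sup>2)"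
        using \<kappa> by (intro arg_cong2[where f="(+)"] ennreal_mult) auto
      finally show "ennreal (norm (f x * W x)) \<le> ennreal (\<kappa> / 2) * ennreal ((f x)\<^sup>2) + ennreal (1 / (2 * \<kappa>)) * ennreal ((W x)\<^sup>2)" .
    qed
    also have "\<dots> = ennreal (\<kappa> / 2) * ennreal N + ennreal (1 / (2 * \<kappa>)) * (\<integral>\<^sup>+x. ennreal ((W x)\<^sup>2) \<partial>lborel)"
      by (subst nn_integral_add) (simp_all add: nn_integral_cmult N)
    also have "\<dots> \<le> ennreal (\<kappa> / 2) * ennreal N + ennreal (1 / (2 * \<kappa>)) * (ennreal (\<kappa>\<^sup>2) * ennreal N)"
      by (intro add_left_mono mult_left_mono W2) simp
    also have "ennreal (\<kappa>\<^sup>2) * ennreal N = ennreal (\<kappa>\<^sup>2 * N)" using N0 by (simp add: ennreal_mult)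
    also have "ennreal (\<kappa> / 2) * ennreal N + ennreal (1 / (2 * \<kappa>)) * ennreal (\<kappa>\<^sup>2 * N) = ennreal (\<kappa> / 2 * N) + ennreal (1 / (2 * \<kappa>) * (\<kappa>\<^sup>2 * N))"
      using \<kappa> N0 by (intro arg_cong2[where f="(+)"] ennreal_mult[symmetric]) auto
    also have "\<dots> = ennreal (\<kappa> / 2 * N + 1 / (2 * \<kappa>) * (\<kappa>\<^sup>2 * N))"
      using \<kappa> N0 by (intro ennreal_plus[symmetric]) auto
    also have "\<kappa> / 2 * N + 1 / (2 * \<kappa>) * (\<kappa>\<^sup>2 * N) = \<kappa> * N"
      using \<kappa> by (simp add: power2_eq_square)
    finally have "\<bar>G b\<bar> \<le> \<kappa> * N" using \<kappa> N0 by (simp add: ennreal_le_iff)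
    then show ?thesis using b True a by (simp add: \<kappa>_def)
  qed
  have "(\<integral>\<^sup>+x. ennreal ((A x)\<^sup>2) \<partial>lborel) = ennreal (LINT b|lborel. G b)"
    unfolding main[symmetric] using intA by (intro nn_integral_eq_integral) auto
  also have "\<dots> \<le> ennreal \<bar>LINT b|lborel. G b\<bar>" by (intro ennreal_leI) simp
  also have "\<dots> \<le> (\<integral>\<^sup>+b. ennreal \<bar>G b\<bar> \<partial>lborel)"
    using integral_norm_bound_ennreal[OF intG] by simp
  also have "\<dots> = 2 * (\<integral>\<^sup>+b. ennreal \<bar>G b\<bar> * indicator {0<..} b \<partial>lborel)"
    by (rule nn_integral_even) (auto simp: Geven)
  also have "\<dots> \<le> 2 * (\<integral>\<^sup>+b. ennreal (2 * sqrt (h / r) * N) * (ennreal (b powr (1/2 - 1)) * indicator {0<..<1} b) \<partial>lborel)"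
  proof (intro mult_left_mono nn_integral_mono)
    fix b :: real
    show "ennreal \<bar>G b\<bar> * indicator {0<..} b \<le> ennreal (2 * sqrt (h / r) * N) * (ennreal (b powr (1/2 - 1)) * indicator {0<..<1} b)"
    proof (cases "0 < b")
      case True
      have "ennreal \<bar>G b\<bar> \<le> ennreal (2 * sqrt (h / r) * b powr (-1/2) * N * indicator {0<..<1} b)"
        by (intro ennreal_leI Gbound True)
      also have "\<dots> = ennreal (2 * sqrt (h / r) * N) * (ennreal (b powr (1/2 - 1)) * indicator {0<..<1} b)"
        using N0 h r by (auto simp: indicator_def mult_ac simp flip: ennreal_mult)
      finally show ?thesis using True by simp
    qed simp
  qed simp
  \<comment> \<open>The constant 8 is 2 for the two signs of the gap, 2 from the oscillation bound
    and 2 for the integral of b^(-1/2) over (0, 1).\<close>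
  also have "\<dots> = 2 * (ennreal (2 * sqrt (h / r) * N) * ennreal 2)"
    using nn_integral_powr_below[of "1/2" 1] by (subst nn_integral_cmult) auto
  also have "\<dots> = ennreal (8 * sqrt (h / r)) * ennreal N"
  proof -
    have "ennreal (2 * sqrt (h / r) * N) * ennreal 2 = ennreal (2 * sqrt (h / r) * N * 2)"
      using N0 h r by (intro ennreal_mult[symmetric]) auto
    moreover have "ennreal 2 * ennreal (2 * sqrt (h / r) * N * 2) = ennreal (2 * (2 * sqrt (h / r) * N * 2))"
      using N0 h r by (intro ennreal_mult[symmetric]) auto
    moreover have "2 * (2 * sqrt (h / r) * N * 2) = 8 * sqrt (h / r) * N" by simp
    moreover have "ennreal (8 * sqrt (h / r) * N) = ennreal (8 * sqrt (h / r)) * ennreal N"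
      using N0 h r by (intro ennreal_mult) auto
    ultimately show ?thesis by (simp only: ennreal_numeral)
  qed
  finally show ?thesis by (simp only: A N)
qed

text \<open>The truncated averages converge pointwise as a tends to 1, and their bound does not
  depend on a; Fatou's lemma carries it to the limit.\<close>

lemma curve_average_L2:
  fixes f :: "real \<times> real \<Rightarrow> real" and h B R r c :: real
  assumes f [measurable]: "f \<in> borel_measurable borel" and B: "\<And>x. \<bar>f x\<bar> \<le> B"
    and R: "\<And>x. R < \<bar>fst x\<bar> \<or> R < \<bar>snd x\<bar> \<Longrightarrow> f x = 0" and h: "0 < h"
    and zero: "\<And>(m::int) t. (LINT v|lborel. f (v, t) * of_bool (\<lfloor>v / h\<rfloor> = m)) = 0"
    and r: "0 < r"
  shows "(\<integral>\<^sup>+x. ennreal ((LINT \<theta>|lborel. f (fst x - r * profile \<theta>, snd x - c * \<theta>) * indicator {0..1} \<theta>)\<^sup>2) \<partial>lborel)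
    \<le> ennreal (8 * sqrt (h / r)) * (\<integral>\<^sup>+x. ennreal ((f x)\<^sup>2) \<partial>lborel)"
proof -
  define w where "w \<theta> = (r * profile \<theta>, c * \<theta>)" for \<theta>
  have [measurable]: "w \<in> borel_measurable borel" unfolding w_def[abs_def]
    by (subst borel_prod[symmetric]) measurable
  have fw: "f (fst x - r * profile \<theta>, snd x - c * \<theta>) = f (x - w \<theta>)" for x \<theta>
    by (simp add: w_def minus_prod_def)
  define a where "a n = 1 - inverse (real (Suc (Suc n)))" for n
  have a: "0 < a n" "a n < 1" for n by (auto simp: a_def field_simps)
  have "a \<longlonglongrightarrow> 1 - 0"
    unfolding a_def by (intro tendsto_diff tendsto_const LIMSEQ_Suc[OF LIMSEQ_inverse_real_of_nat])
  then have lim_a: "a \<longlonglongrightarrow> 1" by simp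
  define X where "X n x = (LINT \<theta>|lborel. f (x - w \<theta>) * indicator {0..a n} \<theta>)" for n x
  define Y where "Y x = (LINT \<theta>|lborel. f (x - w \<theta>) * indicator {0..1} \<theta>)" for x
  have [measurable]: "X n \<in> borel_measurable borel" for n unfolding X_def by measurable
  have lim: "(\<lambda>n. X n x) \<longlonglongrightarrow> Y x" for x
    unfolding X_def Y_def
  proof (rule integral_dominated_convergence[where w="\<lambda>\<theta>. \<bar>B\<bar> * indicator {0..1} \<theta>"])
    show "AE \<theta> in lborel. (\<lambda>n. f (x - w \<theta>) * indicator {0..a n} \<theta>) \<longlonglongrightarrow> f (x - w \<theta>) * indicator {0..1} \<theta>"
      using AE_lborel_singleton[of 1]
    proof eventually_elim
      case (elim \<theta>)
      show ?case
      proof (cases "\<theta> \<in> {0..1}")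
        case True
        then have "\<theta> < 1" using elim by auto
        then have "eventually (\<lambda>n. \<theta> < a n) sequentially" by (rule order_tendstoD(1)[OF lim_a])
        then have "eventually (\<lambda>n. f (x - w \<theta>) * indicator {0..a n} \<theta> = f (x - w \<theta>) * indicator {0..1} \<theta>) sequentially"
          by eventually_elim (use True in auto)
        then show ?thesis by (rule tendsto_eventually)
      next
        case False
        then have "f (x - w \<theta>) * indicator {0..a n} \<theta> = 0" for n using a(2)[of n] by (auto simp: indicator_def)
        then show ?thesis using False by (intro tendsto_eventually always_eventually allI) (auto simp: indicator_def)
      qed
    qed
    show "AE \<theta> in lborel. norm (f (x - w \<theta>) * indicator {0..a n} \<theta>) \<le> \<bar>B\<bar> * indicator {0..1} \<theta>" for n
    proof (rule AE_I2)
      fix \<theta>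
      have "\<bar>f (x - w \<theta>)\<bar> \<le> \<bar>B\<bar>" using B[of "x - w \<theta>"] by linarith
      then show "norm (f (x - w \<theta>) * indicator {0..a n} \<theta>) \<le> \<bar>B\<bar> * indicator {0..1} \<theta>"
        using a(2)[of n] by (auto simp: indicator_def)
    qed
  qed (auto intro!: integrable_mult_right integrable_real_indicator)
  have "(\<integral>\<^sup>+x. ennreal ((Y x)\<^sup>2) \<partial>lborel) = (\<integral>\<^sup>+x. liminf (\<lambda>n. ennreal ((X n x)\<^sup>2)) \<partial>lborel)"
    by (intro nn_integral_cong lim_imp_Liminf[symmetric] tendsto_ennrealI tendsto_power lim) simp
  also have "\<dots> \<le> liminf (\<lambda>n. \<integral>\<^sup>+x. ennreal ((X n x)\<^sup>2) \<partial>lborel)"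
    by (rule nn_integral_liminf) measurable
  also have "\<dots> \<le> liminf (\<lambda>n::nat. ennreal (8 * sqrt (h / r)) * (\<integral>\<^sup>+x. ennreal ((f x)\<^sup>2) \<partial>lborel))"
  proof (intro Liminf_mono always_eventually allI)
    fix n
    have "(\<integral>\<^sup>+x. ennreal ((LINT \<theta>|lborel. f (fst x - r * profile \<theta>, snd x - c * \<theta>) * indicator {0..a n} \<theta>)\<^sup>2) \<partial>lborel)
      \<le> ennreal (8 * sqrt (h / r)) * (\<integral>\<^sup>+x. ennreal ((f x)\<^sup>2) \<partial>lborel)"
      by (rule curve_average_L2_truncated[where B=B and R=R]) (fact f B R h zero r a)+
    then show "(\<integral>\<^sup>+x. ennreal ((X n x)\<^sup>2) \<partial>lborel) \<le> ennreal (8 * sqrt (h / r)) * (\<integral>\<^sup>+x. ennreal ((f x)\<^sup>2) \<partial>lborel)"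
      by (simp add: X_def fw)
  qed
  also have "\<dots> = ennreal (8 * sqrt (h / r)) * (\<integral>\<^sup>+x. ennreal ((f x)\<^sup>2) \<partial>lborel)"
    by (simp add: Liminf_const)
  finally show ?thesis by (simp add: Y_def fw)
qed

section \<open>Averaging in the first variable\<close>

text \<open>Conditional expectation in the first variable with the second one frozen. This extended
  version makes sense for every function and serves the positivity arguments; the real version
  \<open>Eu\<close> exists so that differences can be formed.\<close>

definition nEu :: "real \<Rightarrow> (real \<times> real \<Rightarrow> ennreal) \<Rightarrow> real \<times> real \<Rightarrow> ennreal" where
  "nEu h F x = equipartition.avg (\<lambda>u::real. \<lfloor>u / h\<rfloor>) h (\<lambda>u. F (u, snd x)) (fst x)"

definition Eu :: "real \<Rightarrow> (real \<times> real \<Rightarrow> real) \<Rightarrow> real \<times> real \<Rightarrow> real" where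
  "Eu h F x = enn2real (nEu h F x)"

text \<open>A class on which all integrals over cells and curves converge and which is closed under
  sums and under cutting at a level, as interpolation requires.\<close>

definition nice :: "(real \<times> real \<Rightarrow> real) \<Rightarrow> bool" where
  "nice F \<longleftrightarrow> F \<in> borel_measurable borel \<and> (\<exists>B. \<forall>x. 0 \<le> F x \<and> F x \<le> B) \<and>
     (\<exists>R. \<forall>x. R < \<bar>fst x\<bar> \<or> R < \<bar>snd x\<bar> \<longrightarrow> F x = 0)"

lemma niceE:
  assumes "nice F"
  obtains B R where "F \<in> borel_measurable borel" "\<And>x. 0 \<le> F x" "\<And>x. F x \<le> B"
    "\<forall>x. R < \<bar>fst x\<bar> \<or> R < \<bar>snd x\<bar> \<longrightarrow> F x = 0" "0 \<le> B" "0 \<le> R"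
proof -
  obtain B R where 1: "F \<in> borel_measurable borel" "\<forall>x. 0 \<le> F x \<and> F x \<le> B" "\<forall>x. R < \<bar>fst x\<bar> \<or> R < \<bar>snd x\<bar> \<longrightarrow> F x = 0"
    using assms by (auto simp: nice_def)
  have "0 \<le> B" using 1(2) order_trans by blast
  then show ?thesis using 1 by (intro that[of B "max R 0"]) auto
qed

lemma measurable_pair_real [measurable]:
  fixes f g :: "'a \<Rightarrow> real"
  assumes [measurable]: "f \<in> borel_measurable M" "g \<in> borel_measurable M"
  shows "(\<lambda>x. (f x, g x)) \<in> borel_measurable M"
  by (rule borel_measurable_Pair) fact+

lemma nEu_eq: 
  assumes h: "0 < h"
  shows "nEu h F x = ennreal (1 / h) * (\<integral>\<^sup>+y. F (y, snd x) * of_bool (\<lfloor>y / h\<rfloor> = \<lfloor>fst x / h\<rfloor>) \<partial>lborel)"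
  unfolding nEu_def by (rule equipartition.avg_def[OF equipartition_floor[OF h]])

lemma nEu_measurable:
  assumes h: "0 < h" and [measurable]: "F \<in> borel_measurable borel"
  shows "nEu h F \<in> borel_measurable borel"
proof -
  have "(\<lambda>x. nEu h F (fst x, snd x)) \<in> borel_measurable (borel \<Otimes>\<^sub>M borel)"
    unfolding nEu_eq[OF h] by measurable
  then show ?thesis by (simp add: borel_prod)
qed

lemma nEu_section: "nEu h F (u, t) = equipartition.avg (\<lambda>u::real. \<lfloor>u / h\<rfloor>) h (\<lambda>u. F (u, t)) u"
  by (simp add: nEu_def)

context
  fixes F :: "real \<times> real \<Rightarrow> real" and B R h :: real
  assumes F [measurable]: "F \<in> borel_measurable borel" and F0: "\<And>x. 0 \<le> F x" and FB: "\<And>x. F x \<le> B"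
    and FR: "\<forall>x. R < \<bar>fst x\<bar> \<or> R < \<bar>snd x\<bar> \<longrightarrow> F x = 0" and h: "0 < h"
begin

lemma nEu_le: "nEu h F x \<le> ennreal B"
  unfolding nEu_def using FB by (intro equipartition.avg_bound[OF equipartition_floor[OF h]] ennreal_leI)

lemma ennreal_Eu: "ennreal (Eu h F x) = nEu h F x"
  unfolding Eu_def by (metis nEu_le ennreal_enn2real ennreal_less_top order_le_less_trans)

lemma Eu_nonneg: "0 \<le> Eu h F x" by (simp add: Eu_def)

lemma Eu_le: "Eu h F x \<le> B"
proof -
  have "0 \<le> B" using F0 FB order_trans by blast
  then show ?thesis using nEu_le[of x] by (simp flip: ennreal_Eu)
qed

lemma Eu_measurable: "Eu h F \<in> borel_measurable borel"
proof -
  have [measurable]: "nEu h F \<in> borel_measurable borel" by (rule nEu_measurable[OF h]) measurable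
  show ?thesis unfolding Eu_def[abs_def] by measurable
qed

lemma Eu_support: "R + h < \<bar>fst x\<bar> \<or> R + h < \<bar>snd x\<bar> \<Longrightarrow> Eu h F x = 0"
proof -
  assume x: "R + h < \<bar>fst x\<bar> \<or> R + h < \<bar>snd x\<bar>"
  have z: "ennreal (F (y, snd x)) * of_bool (\<lfloor>y / h\<rfloor> = \<lfloor>fst x / h\<rfloor>) = 0" for y
  proof (cases "\<lfloor>y / h\<rfloor> = \<lfloor>fst x / h\<rfloor>")
    case True
    then have "\<bar>y / h - fst x / h\<bar> < 1" by linarith
    then have "\<bar>y - fst x\<bar> < h" using h by (simp add: field_simps flip: diff_divide_distrib)
    then have "R < \<bar>y\<bar> \<or> R < \<bar>snd x\<bar>" using x h by linarith
    then show ?thesis using FR[rule_format, of "(y, snd x)"] by simp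
  qed simp
  have "nEu h F x = 0" by (simp only: nEu_eq[OF h] z) simp
  then show ?thesis by (simp add: Eu_def)
qed

lemma nn_integral_Eu_section:
  assumes [measurable]: "g \<in> borel_measurable borel" and g: "\<And>x y. \<lfloor>x / h\<rfloor> = \<lfloor>y / h\<rfloor> \<Longrightarrow> g x = g y"
  shows "(\<integral>\<^sup>+u. ennreal (Eu h F (u, t)) * g u \<partial>lborel) = (\<integral>\<^sup>+u. ennreal (F (u, t)) * g u \<partial>lborel)"
  unfolding ennreal_Eu nEu_section
  by (rule equipartition.avg_adjoint[OF equipartition_floor[OF h] _ assms(1) g]) measurable

end

lemma floor_half_cell:
  assumes "\<lfloor>x / (h / 2)\<rfloor> = \<lfloor>y / (h / 2)\<rfloor>" shows "\<lfloor>x / h\<rfloor> = \<lfloor>y / (h::real)\<rfloor>"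
proof -
  have d: "\<lfloor>z / h\<rfloor> = \<lfloor>z / (h / 2)\<rfloor> div 2" for z
    using floor_divide_real_eq_div[of 2 "z / (h / 2)"] by simp
  show ?thesis by (simp only: d assms)
qed

text \<open>Besides regularity, the two properties of a martingale difference behind the L^2
  argument: mean zero on the coarser cells, for the oscillation estimate, and Pythagoras, for the
  sum over scales. Pythagoras is stated as a sum because subtraction in \<open>ennreal\<close> is
  truncated.\<close>

lemma Eu_difference:
  assumes "nice F" and h: "0 < h"
  defines "D \<equiv> \<lambda>x. Eu (h / 2) F x - Eu h F x"
  shows "D \<in> borel_measurable borel" "\<exists>B. \<forall>x. \<bar>D x\<bar> \<le> B" "\<exists>R. \<forall>x. R < \<bar>fst x\<bar> \<or> R < \<bar>snd x\<bar> \<longrightarrow> D x = 0"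
    and "\<And>(m::int) t. (LINT v|lborel. D (v, t) * of_bool (\<lfloor>v / h\<rfloor> = m)) = 0"
    and "(\<integral>\<^sup>+x. ennreal ((D x)\<^sup>2) \<partial>lborel) + (\<integral>\<^sup>+x. ennreal ((Eu h F x)\<^sup>2) \<partial>lborel) = (\<integral>\<^sup>+x. ennreal ((Eu (h / 2) F x)\<^sup>2) \<partial>lborel)"
proof -
  obtain B R where F [measurable]: "F \<in> borel_measurable borel" and F0: "\<And>x. 0 \<le> F x" and FB: "\<And>x. F x \<le> B"
    and FR: "\<forall>x. R < \<bar>fst x\<bar> \<or> R < \<bar>snd x\<bar> \<longrightarrow> F x = 0" and B0: "0 \<le> B" and R0: "0 \<le> R"
    by (rule niceE[OF \<open>nice F\<close>]) (rule that)
  note N = F F0 FB FR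
  have h2: "0 < h / 2" using h by simp
  note [measurable] = Eu_measurable[OF N h] Eu_measurable[OF N h2]
  show [measurable]: "D \<in> borel_measurable borel" unfolding D_def by measurable
  have DB: "\<bar>D x\<bar> \<le> B" for x
    using Eu_nonneg[OF N h, of x] Eu_le[OF N h, of x] Eu_nonneg[OF N h2, of x] Eu_le[OF N h2, of x]
    unfolding D_def by linarith
  then show "\<exists>B. \<forall>x. \<bar>D x\<bar> \<le> B" by blast
  have DR: "D x = 0" if "R + h < \<bar>fst x\<bar> \<or> R + h < \<bar>snd x\<bar>" for x
    using Eu_support[OF N h, of x] Eu_support[OF N h2, of x] that h unfolding D_def by auto
  then show "\<exists>R. \<forall>x. R < \<bar>fst x\<bar> \<or> R < \<bar>snd x\<bar> \<longrightarrow> D x = 0" by blast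
  have sec [measurable]: "(\<lambda>u. g (u, t)) \<in> borel_measurable borel" if [measurable]: "g \<in> borel_measurable borel" for g :: "real \<times> real \<Rightarrow> real" and t
    by measurable
  have intE: "integrable lborel (\<lambda>v. Eu h' F (v, t) * of_bool (\<lfloor>v / h\<rfloor> = m))" if h': "0 < h'" for h' t and m :: int
  proof (rule integrable_bounded_support[where A="{v. \<lfloor>v / h\<rfloor> = m}" and B=B])
    note [measurable] = Eu_measurable[OF N h']
    show "(\<lambda>v. Eu h' F (v, t) * of_bool (\<lfloor>v / h\<rfloor> = m)) \<in> borel_measurable lborel" by measurable
    show "\<bar>Eu h' F (v, t) * of_bool (\<lfloor>v / h\<rfloor> = m)\<bar> \<le> B" for v
      using Eu_nonneg[OF N h', of "(v, t)"] Eu_le[OF N h', of "(v, t)"] B0 by (auto simp: abs_mult)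
    show "emeasure lborel {v. \<lfloor>v / h\<rfloor> = m} < \<infinity>" using h by (simp add: floor_cell_eq)
  qed auto
  show "(LINT v|lborel. D (v, t) * of_bool (\<lfloor>v / h\<rfloor> = m)) = 0" for m :: int and t
  proof -
    have *: "ennreal (LINT v|lborel. Eu h' F (v, t) * of_bool (\<lfloor>v / h\<rfloor> = m)) = (\<integral>\<^sup>+v. ennreal (F (v, t)) * of_bool (\<lfloor>v / h\<rfloor> = m) \<partial>lborel)"
      if h': "0 < h'" "\<And>x y. \<lfloor>x / h'\<rfloor> = \<lfloor>y / h'\<rfloor> \<Longrightarrow> \<lfloor>x / h\<rfloor> = \<lfloor>y / h\<rfloor>" for h'
    proof -
      have "ennreal (LINT v|lborel. Eu h' F (v, t) * of_bool (\<lfloor>v / h\<rfloor> = m)) = (\<integral>\<^sup>+v. ennreal (Eu h' F (v, t) * of_bool (\<lfloor>v / h\<rfloor> = m)) \<partial>lborel)"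
        using Eu_nonneg[OF N h'(1)] by (intro nn_integral_eq_integral[symmetric] intE h') auto
      also have "\<dots> = (\<integral>\<^sup>+v. ennreal (Eu h' F (v, t)) * of_bool (\<lfloor>v / h\<rfloor> = m) \<partial>lborel)"
        by (intro nn_integral_cong) auto
      also have "\<dots> = (\<integral>\<^sup>+v. ennreal (F (v, t)) * of_bool (\<lfloor>v / h\<rfloor> = m) \<partial>lborel)"
      proof (rule nn_integral_Eu_section[OF N h'(1)])
        show "(\<lambda>v. of_bool (\<lfloor>v / h\<rfloor> = m)) \<in> borel_measurable borel" by measurable
        show "of_bool (\<lfloor>x / h\<rfloor> = m) = (of_bool (\<lfloor>y / h\<rfloor> = m) :: ennreal)" if "\<lfloor>x / h'\<rfloor> = \<lfloor>y / h'\<rfloor>" for x y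
          using h'(2)[OF that] by simp
      qed
      finally show ?thesis .
    qed
    have "ennreal (LINT v|lborel. Eu (h / 2) F (v, t) * of_bool (\<lfloor>v / h\<rfloor> = m)) = ennreal (LINT v|lborel. Eu h F (v, t) * of_bool (\<lfloor>v / h\<rfloor> = m))"
      using *[OF h2 floor_half_cell] *[OF h] by simp
    then have "(LINT v|lborel. Eu (h / 2) F (v, t) * of_bool (\<lfloor>v / h\<rfloor> = m)) = (LINT v|lborel. Eu h F (v, t) * of_bool (\<lfloor>v / h\<rfloor> = m))"
      using Eu_nonneg[OF N h] Eu_nonneg[OF N h2] by (subst (asm) ennreal_inj) (auto intro!: integral_nonneg_AE)
    then show ?thesis
      unfolding D_def left_diff_distrib
      by (subst Bochner_Integration.integral_diff[OF intE[OF h2] intE[OF h]]) simp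
  qed
  define P Q where "P = (\<lambda>x. Eu (h / 2) F x)" and "Q = (\<lambda>x. Eu h F x)"
  have [measurable]: "P \<in> borel_measurable borel" "Q \<in> borel_measurable borel" unfolding P_def Q_def by measurable
  have P0: "0 \<le> P x" and Q0: "0 \<le> Q x" for x unfolding P_def Q_def by (rule Eu_nonneg[OF N h2] Eu_nonneg[OF N h])+
  have prod: "(\<integral>\<^sup>+x. G x \<partial>lborel) = (\<integral>\<^sup>+t. (\<integral>\<^sup>+u. G (u, t) \<partial>lborel) \<partial>lborel)" if [measurable]: "G \<in> borel_measurable borel" for G :: "real \<times> real \<Rightarrow> ennreal"
    using lborel_pair.nn_integral_snd[of G] by (simp add: lborel_prod)
  have Qc: "Q (x, t) = Q (y, t)" if "\<lfloor>x / h\<rfloor> = \<lfloor>y / h\<rfloor>" for x y t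
    unfolding Q_def Eu_def nEu_eq[OF h] using that by simp
  \<comment> \<open>Both sides equal the pairing of F with Q: averaging is self-adjoint, and Q is
    constant on the coarse cells, hence also on the fine ones.\<close>
  have PQ: "(\<integral>\<^sup>+x. ennreal (P x) * ennreal (Q x) \<partial>lborel) = (\<integral>\<^sup>+x. ennreal (Q x) * ennreal (Q x) \<partial>lborel)"
  proof -
    have "(\<integral>\<^sup>+u. ennreal (P (u, t)) * ennreal (Q (u, t)) \<partial>lborel) = (\<integral>\<^sup>+u. ennreal (Q (u, t)) * ennreal (Q (u, t)) \<partial>lborel)" for t
    proof -
      have "(\<integral>\<^sup>+u. ennreal (P (u, t)) * ennreal (Q (u, t)) \<partial>lborel) = (\<integral>\<^sup>+u. ennreal (F (u, t)) * ennreal (Q (u, t)) \<partial>lborel)"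
        unfolding P_def
      proof (rule nn_integral_Eu_section[OF N h2])
        show "(\<lambda>u. ennreal (Q (u, t))) \<in> borel_measurable borel" by measurable
        show "ennreal (Q (x, t)) = ennreal (Q (y, t))" if "\<lfloor>x / (h / 2)\<rfloor> = \<lfloor>y / (h / 2)\<rfloor>" for x y
          using Qc[OF floor_half_cell[OF that]] by simp
      qed
      also have "\<dots> = (\<integral>\<^sup>+u. ennreal (Eu h F (u, t)) * ennreal (Q (u, t)) \<partial>lborel)"
      proof (rule nn_integral_Eu_section[OF N h, symmetric])
        show "(\<lambda>u. ennreal (Q (u, t))) \<in> borel_measurable borel" by measurable
        show "ennreal (Q (x, t)) = ennreal (Q (y, t))" if "\<lfloor>x / h\<rfloor> = \<lfloor>y / h\<rfloor>" for x y
          using Qc[OF that] by simp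
      qed
      finally show ?thesis by (simp add: Q_def)
    qed
    then show ?thesis by (subst (1 2) prod) simp_all
  qed
  \<comment> \<open>A finite value can be cancelled from both sides of the expanded square
    below.\<close>
  have QQfin: "(\<integral>\<^sup>+x. ennreal (Q x) * ennreal (Q x) \<partial>lborel) < \<infinity>"
  proof -
    define S where "S = {-(R + h)..R + h} \<times> {-(R + h)..R + h}"
    have "(\<integral>\<^sup>+x. ennreal (Q x) * ennreal (Q x) \<partial>lborel) \<le> (\<integral>\<^sup>+x. ennreal (B * B) * indicator S x \<partial>lborel)"
    proof (rule nn_integral_mono)
      fix x :: "real \<times> real"
      show "ennreal (Q x) * ennreal (Q x) \<le> ennreal (B * B) * indicator S x"
      proof (cases "x \<in> S")
        case True
        then show ?thesis using Q0[of x] Eu_le[OF N h, of x]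
          by (simp add: Q_def flip: ennreal_mult) (intro ennreal_leI mult_mono, auto simp: B0)
      next
        case False
        then have "R + h < \<bar>fst x\<bar> \<or> R + h < \<bar>snd x\<bar>" by (cases x) (auto simp: S_def)
        then show ?thesis using Eu_support[OF N h, of x] by (simp add: Q_def)
      qed
    qed
    also have "\<dots> = ennreal (B * B) * emeasure lborel S"
      by (rule nn_integral_cmult_indicator) (auto simp: S_def intro!: borel_closed closed_Times)
    also have "\<dots> < \<infinity>"
    proof -
      have "emeasure lborel S < \<infinity>" unfolding S_def by (rule emeasure_bounded_finite) (intro bounded_Times bounded_closed_interval)
      then show ?thesis by (simp add: ennreal_mult_less_top)
    qed
    finally show ?thesis .
  qed
  have "(\<integral>\<^sup>+x. ennreal ((D x)\<^sup>2) \<partial>lborel) + (\<integral>\<^sup>+x. ennreal (P x) * ennreal (Q x) \<partial>lborel) + (\<integral>\<^sup>+x. ennreal (P x) * ennreal (Q x) \<partial>lborel)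
    = (\<integral>\<^sup>+x. ennreal ((D x)\<^sup>2) + ennreal (P x) * ennreal (Q x) + ennreal (P x) * ennreal (Q x) \<partial>lborel)"
    by (subst nn_integral_add, measurable, subst nn_integral_add) auto
  also have "\<dots> = (\<integral>\<^sup>+x. ennreal ((P x)\<^sup>2) + ennreal (Q x) * ennreal (Q x) \<partial>lborel)"
  proof (rule nn_integral_cong)
    fix x
    have "(D x)\<^sup>2 + P x * Q x + P x * Q x = (P x)\<^sup>2 + Q x * Q x"
      by (simp add: D_def P_def Q_def power2_eq_square algebra_simps)
    then show "ennreal ((D x)\<^sup>2) + ennreal (P x) * ennreal (Q x) + ennreal (P x) * ennreal (Q x) = ennreal ((P x)\<^sup>2) + ennreal (Q x) * ennreal (Q x)"
      using P0[of x] Q0[of x] by (simp flip: ennreal_mult ennreal_plus)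
  qed
  also have "\<dots> = (\<integral>\<^sup>+x. ennreal ((P x)\<^sup>2) \<partial>lborel) + (\<integral>\<^sup>+x. ennreal (Q x) * ennreal (Q x) \<partial>lborel)"
    by (rule nn_integral_add) measurable
  finally have "(\<integral>\<^sup>+x. ennreal (Q x) * ennreal (Q x) \<partial>lborel) + ((\<integral>\<^sup>+x. ennreal ((D x)\<^sup>2) \<partial>lborel) + (\<integral>\<^sup>+x. ennreal (Q x) * ennreal (Q x) \<partial>lborel))
    = (\<integral>\<^sup>+x. ennreal (Q x) * ennreal (Q x) \<partial>lborel) + (\<integral>\<^sup>+x. ennreal ((P x)\<^sup>2) \<partial>lborel)"
    unfolding PQ by (simp add: ac_simps)
  then have "(\<integral>\<^sup>+x. ennreal ((D x)\<^sup>2) \<partial>lborel) + (\<integral>\<^sup>+x. ennreal (Q x) * ennreal (Q x) \<partial>lborel) = (\<integral>\<^sup>+x. ennreal ((P x)\<^sup>2) \<partial>lborel)"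
    using QQfin by (subst (asm) ennreal_add_left_cancel) auto
  also have "(\<lambda>x. ennreal (Q x) * ennreal (Q x)) = (\<lambda>x. ennreal ((Q x)\<^sup>2))"
    using Q0 by (auto simp: power2_eq_square ennreal_mult)
  finally show "(\<integral>\<^sup>+x. ennreal ((D x)\<^sup>2) \<partial>lborel) + (\<integral>\<^sup>+x. ennreal ((Eu h F x)\<^sup>2) \<partial>lborel) = (\<integral>\<^sup>+x. ennreal ((Eu (h / 2) F x)\<^sup>2) \<partial>lborel)"
    by (simp add: P_def Q_def)
qed

section \<open>Growth of the averaged maximal functions\<close>

text \<open>Take for e the number of cell borders between x and x + s. A continuum of shifts is
  thereby reduced to a list of m + 1 shifts that is the same for all x and s.\<close>

lemma floor_shift_cases:
  fixes x s h :: real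
  assumes "0 < h" "0 \<le> s" "s \<le> real m * h"
  shows "\<exists>e\<le>m. \<lfloor>(x + s) / h\<rfloor> = \<lfloor>(x + real e * h) / h\<rfloor>"
proof -
  define e where "e = nat (\<lfloor>(x + s) / h\<rfloor> - \<lfloor>x / h\<rfloor>)"
  have le: "x / h \<le> (x + s) / h" "(x + s) / h \<le> x / h + real m"
    using assms by (auto simp: field_simps)
  then have "\<lfloor>x / h\<rfloor> \<le> \<lfloor>(x + s) / h\<rfloor>" by (intro floor_mono)
  then have e: "int e = \<lfloor>(x + s) / h\<rfloor> - \<lfloor>x / h\<rfloor>" by (simp add: e_def)
  have "\<lfloor>(x + s) / h\<rfloor> \<le> \<lfloor>x / h\<rfloor> + int m" using le(2) by linarith
  then have "e \<le> m" using e by linarith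
  moreover have "\<lfloor>(x + real e * h) / h\<rfloor> = \<lfloor>(x + s) / h\<rfloor>"
  proof -
    have "(x + real e * h) / h = x / h + of_int (int e)" using assms by (simp add: field_simps)
    then have "\<lfloor>(x + real e * h) / h\<rfloor> = \<lfloor>x / h\<rfloor> + int e" by (simp only: floor_add_int)
    then show ?thesis using e by simp
  qed
  ultimately show ?thesis by auto
qed

lemma davg_eq_iterated:
  fixes F :: "real \<times> real \<Rightarrow> ennreal"
  assumes [measurable]: "F \<in> borel_measurable borel" and h: "0 < h" and b: "0 < b"
  shows "davg h b F (X, Y) = ennreal (1 / b) * (\<integral>\<^sup>+s. nEu h F (X, s) * of_bool (\<lfloor>s / b\<rfloor> = \<lfloor>Y / b\<rfloor>) \<partial>lborel)"
proof -
  have m [measurable]: "(\<lambda>z::real \<times> real. \<lfloor>fst z / h\<rfloor>) \<in> borel \<rightarrow>\<^sub>M count_space UNIV" "(\<lambda>z::real \<times> real. \<lfloor>snd z / b\<rfloor>) \<in> borel \<rightarrow>\<^sub>M count_space UNIV"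
    by measurable
  have "davg h b F (X, Y) = ennreal (1 / (h * b)) * (\<integral>\<^sup>+z. F z * of_bool (cell2 h b z = cell2 h b (X, Y)) \<partial>lborel)"
    unfolding davg_def by (rule equipartition.avg_def[OF equipartition_cell2[OF h b]])
  also have "(\<integral>\<^sup>+z. F z * of_bool (cell2 h b z = cell2 h b (X, Y)) \<partial>lborel) =
    (\<integral>\<^sup>+z. F z * of_bool (\<lfloor>fst z / h\<rfloor> = \<lfloor>X / h\<rfloor>) * of_bool (\<lfloor>snd z / b\<rfloor> = \<lfloor>Y / b\<rfloor>) \<partial>(lborel \<Otimes>\<^sub>M lborel))"
    unfolding lborel_prod by (intro nn_integral_cong) (auto simp: cell2_def)
  also have "\<dots> = (\<integral>\<^sup>+s. (\<integral>\<^sup>+v. F (v, s) * of_bool (\<lfloor>v / h\<rfloor> = \<lfloor>X / h\<rfloor>) * of_bool (\<lfloor>s / b\<rfloor> = \<lfloor>Y / b\<rfloor>) \<partial>lborel) \<partial>lborel)"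
    by (subst lborel_pair.nn_integral_snd[symmetric]) (simp_all add: lborel_prod)
  also have "\<dots> = (\<integral>\<^sup>+s. (\<integral>\<^sup>+v. F (v, s) * of_bool (\<lfloor>v / h\<rfloor> = \<lfloor>X / h\<rfloor>) \<partial>lborel) * of_bool (\<lfloor>s / b\<rfloor> = \<lfloor>Y / b\<rfloor>) \<partial>lborel)"
    by (intro nn_integral_cong nn_integral_multc) measurable
  finally have 1: "davg h b F (X, Y) = ennreal (1 / (h * b)) * (\<integral>\<^sup>+s. (\<integral>\<^sup>+v. F (v, s) * of_bool (\<lfloor>v / h\<rfloor> = \<lfloor>X / h\<rfloor>) \<partial>lborel) * of_bool (\<lfloor>s / b\<rfloor> = \<lfloor>Y / b\<rfloor>) \<partial>lborel)" .
  have "(\<integral>\<^sup>+s. nEu h F (X, s) * of_bool (\<lfloor>s / b\<rfloor> = \<lfloor>Y / b\<rfloor>) \<partial>lborel) =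
    (\<integral>\<^sup>+s. ennreal (1 / h) * ((\<integral>\<^sup>+v. F (v, s) * of_bool (\<lfloor>v / h\<rfloor> = \<lfloor>X / h\<rfloor>) \<partial>lborel) * of_bool (\<lfloor>s / b\<rfloor> = \<lfloor>Y / b\<rfloor>)) \<partial>lborel)"
    unfolding nEu_eq[OF h] by (simp add: mult.assoc)
  also have "\<dots> = ennreal (1 / h) * (\<integral>\<^sup>+s. (\<integral>\<^sup>+v. F (v, s) * of_bool (\<lfloor>v / h\<rfloor> = \<lfloor>X / h\<rfloor>) \<partial>lborel) * of_bool (\<lfloor>s / b\<rfloor> = \<lfloor>Y / b\<rfloor>) \<partial>lborel)"
    by (rule nn_integral_cmult) measurable
  finally have 2: "(\<integral>\<^sup>+s. nEu h F (X, s) * of_bool (\<lfloor>s / b\<rfloor> = \<lfloor>Y / b\<rfloor>) \<partial>lborel) = \<dots>" .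
  have "ennreal (1 / (h * b)) = ennreal (1 / b) * ennreal (1 / h)"
    using h b by (simp flip: ennreal_mult add: mult.commute)
  then show ?thesis by (simp only: 1 2 mult.assoc)
qed

text \<open>On a piece of length 1 / N the first coordinate varies by at most 2 * h, by the Hoelder
  bound, and the second by at most b, since |c| / N \<le> b. So the cell of a point on the piece is
  one of 3 * 2 candidates. The second coordinate runs through the piece with speed |c|, hence the
  integral over \<theta> is an integral in that coordinate, and no averaging of F in it had to be
  done beforehand. The factor 4 / N bounds b / |c|, by r > \<rho> / 2.\<close>

lemma curve_average_pieces:
  fixes F :: "real \<times> real \<Rightarrow> ennreal" and \<rho> r c :: real and j :: nat and x :: "real \<times> real"
  assumes F [measurable]: "F \<in> borel_measurable borel" and \<rho>: "0 < \<rho>" and r: "\<rho> / 2 < r" "r \<le> \<rho>" and c: "\<bar>c\<bar> = r\<^sup>2 / 4"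
  defines "N \<equiv> 16 ^ j :: nat" and "h \<equiv> \<rho> / 2 ^ j" and "b \<equiv> \<rho>\<^sup>2 / (4 * 16 ^ j)"
  defines "v \<equiv> \<lambda>(a, e, e'). (r * profile (real a / real N) - real e * h, c * real a / real N + max c 0 / real N - real e' * b)"
  shows "(\<integral>\<^sup>+\<theta>. nEu h F (fst x - r * profile \<theta>, snd x - c * \<theta>) * indicator {0..1} \<theta> \<partial>lborel)
    \<le> ennreal (4 / real N) * (\<Sum>i\<in>{..<N} \<times> {..2} \<times> {..1}. davg h b F (x - v i))"
proof -
  have N: "0 < real N" by (simp add: N_def)
  have h: "0 < h" using \<rho> by (simp add: h_def)
  have b: "0 < b" using \<rho> by (simp add: b_def)
  have r0: "0 < r" using \<rho> r by linarith
  have c0: "0 < \<bar>c\<bar>" unfolding c using r0 by simp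
  have sq: "r\<^sup>2 \<le> \<rho>\<^sup>2" "\<rho>\<^sup>2 / 4 \<le> r\<^sup>2"
    using r r0 \<rho> power_mono[of r \<rho> 2] power_mono[of "\<rho> / 2" r 2] by (auto simp: power_divide)
  have cN: "\<bar>c\<bar> / N \<le> b" unfolding c b_def using sq(1) by (simp add: N_def field_simps)
  have bc: "b / \<bar>c\<bar> \<le> 4 / N"
  proof -
    have "b * N = \<rho>\<^sup>2 / 4" by (simp add: b_def N_def)
    also have "\<dots> \<le> 4 * \<bar>c\<bar>" using sq(2) c by simp
    finally show ?thesis using c0 N by (simp add: field_simps)
  qed
  note [measurable] = nEu_measurable[OF h F]
  define J where "J a = {real a / N..<(real a + 1) / N}" for a :: nat
  \<comment> \<open>\<open>X a\<close> and \<open>Y a\<close> are the least coordinates on the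
    piece. The first increases with \<theta>; which end minimises the second depends on the sign of
    \<open>c\<close>, hence \<open>max c 0\<close>.\<close>
  define X where "X a = fst x - r * profile (real a / N)" for a :: nat
  define Y where "Y a = snd x - c * real a / N - max c 0 / N" for a :: nat
  have "(\<integral>\<^sup>+\<theta>. nEu h F (fst x - r * profile \<theta>, snd x - c * \<theta>) * indicator {0..1} \<theta> \<partial>lborel)
    \<le> (\<integral>\<^sup>+\<theta>. (\<Sum>a<N. nEu h F (fst x - r * profile \<theta>, snd x - c * \<theta>) * indicator (J a) \<theta>) \<partial>lborel)"
  proof (rule nn_integral_mono_AE)
    show "AE \<theta> in lborel. nEu h F (fst x - r * profile \<theta>, snd x - c * \<theta>) * indicator {0..1} \<theta>
      \<le> (\<Sum>a<N. nEu h F (fst x - r * profile \<theta>, snd x - c * \<theta>) * indicator (J a) \<theta>)"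
      using AE_lborel_singleton[of 1]
    proof eventually_elim
      case (elim \<theta>)
      show ?case
      proof (cases "\<theta> \<in> {0..1}")
        case True
        define a where "a = nat \<lfloor>\<theta> * N\<rfloor>"
        have "0 \<le> \<theta> * N" "\<theta> * N < N" using True elim N by auto
        then have a: "real a \<le> \<theta> * N" "\<theta> * N < real a + 1" "a < N"
          unfolding a_def by linarith+
        then have "\<theta> \<in> J a" using N by (simp add: J_def field_simps)
        then have "nEu h F (fst x - r * profile \<theta>, snd x - c * \<theta>) * indicator {0..1} \<theta> = nEu h F (fst x - r * profile \<theta>, snd x - c * \<theta>) * indicator (J a) \<theta>"
          using True by simp
        also have "\<dots> \<le> (\<Sum>a<N. nEu h F (fst x - r * profile \<theta>, snd x - c * \<theta>) * indicator (J a) \<theta>)"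
          using a by (intro member_le_sum) auto
        finally show ?thesis .
      qed simp
    qed
  qed
  also have "\<dots> = (\<Sum>a<N. \<integral>\<^sup>+\<theta>. nEu h F (fst x - r * profile \<theta>, snd x - c * \<theta>) * indicator (J a) \<theta> \<partial>lborel)"
    by (rule nn_integral_sum) (simp add: J_def)
  also have "\<dots> \<le> (\<Sum>a<N. \<Sum>z\<in>{..2} \<times> {..1}. ennreal (4 / N) * davg h b F (X a + real (fst z) * h, Y a + real (snd z) * b))"
  proof (rule sum_mono)
    fix a assume "a \<in> {..<N}"
    then have a: "a < N" by simp
    \<comment> \<open>The first coordinate is frozen at a multiple of the cell width, which changes
      nothing because \<open>nEu\<close> is constant on cells; the indicator holds s in one vertical
      cell.\<close>
    define g where "g z s = nEu h F (X a + real (fst z) * h, s) * of_bool (\<lfloor>s / b\<rfloor> = \<lfloor>(Y a + real (snd z) * b) / b\<rfloor>)" for z :: "nat \<times> nat" and s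
    have [measurable]: "g z \<in> borel_measurable borel" for z unfolding g_def by measurable
    have "(\<integral>\<^sup>+\<theta>. nEu h F (fst x - r * profile \<theta>, snd x - c * \<theta>) * indicator (J a) \<theta> \<partial>lborel)
      \<le> (\<integral>\<^sup>+\<theta>. (\<Sum>z\<in>{..2} \<times> {..1}. g z (snd x - c * \<theta>)) \<partial>lborel)"
    proof (rule nn_integral_mono)
      fix \<theta>
      show "nEu h F (fst x - r * profile \<theta>, snd x - c * \<theta>) * indicator (J a) \<theta> \<le> (\<Sum>z\<in>{..2} \<times> {..1}. g z (snd x - c * \<theta>))"
      proof (cases "\<theta> \<in> J a")
        case True
        then have \<theta>: "real a / N \<le> \<theta>" "\<theta> < (real a + 1) / N" by (auto simp: J_def)
        have \<theta>01: "0 \<le> real a / N" "\<theta> \<le> 1"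
        proof -
          have "(real a + 1) / N \<le> 1" using a N by simp
          then show "\<theta> \<le> 1" using \<theta> by linarith
        qed simp
        define s where "s = (snd x - c * \<theta>) - Y a"
        have d: "0 \<le> \<theta> - real a / N" "\<theta> - real a / N \<le> 1 / N" using \<theta> by (auto simp: add_divide_distrib)
        have s_eq: "s = max c 0 / N - c * (\<theta> - real a / N)" by (simp add: s_def Y_def algebra_simps)
        have s: "0 \<le> s" "s \<le> real 1 * b"
        proof -
          have "\<bar>c\<bar> * (\<theta> - real a / N) \<le> \<bar>c\<bar> * (1 / N)" using d by (intro mult_left_mono) auto
          moreover have "0 \<le> \<bar>c\<bar> * (\<theta> - real a / N)" using d by simp
          ultimately have "0 \<le> s \<and> s \<le> \<bar>c\<bar> / N" unfolding s_eq by (cases "0 \<le> c") (auto simp: max_def)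
          then show "0 \<le> s" "s \<le> real 1 * b" using cN by auto
        qed
        define s' where "s' = (fst x - r * profile \<theta>) - X a"
        have s': "0 \<le> s'" "s' \<le> real 2 * h"
        proof -
          have hol: "profile \<theta> \<le> profile (real a / N)" "profile (real a / N) \<le> profile \<theta> + (2 * (\<theta> - real a / N)) powr (1/4)"
            using profile_holder[of "real a / N" \<theta>] \<theta> \<theta>01 by auto
          have eq: "s' = r * (profile (real a / N) - profile \<theta>)" by (simp add: s'_def X_def algebra_simps)
          show "0 \<le> s'" unfolding eq using hol r0 by simp
          have "(2 * (\<theta> - real a / N)) powr (1/4) \<le> ((2 / 2 ^ j) ^ 4) powr (1/4)"
          proof (rule powr_mono2)
            have "2 * (\<theta> - real a / N) \<le> 2 * (1 / N)" using d by simp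
            \<comment> \<open>The factor is raised from 2 to 16 to obtain an exact fourth
              power.\<close>
            also have "\<dots> \<le> 16 / N" using N by (simp add: divide_right_mono)
            also have "\<dots> = (2 / 2 ^ j) ^ 4"
            proof -
              have "(2 ^ j) ^ 4 = ((2::real) ^ 4) ^ j" by (simp only: power_mult[symmetric] mult.commute)
              then show ?thesis by (simp add: N_def power_divide)
            qed
            finally show "2 * (\<theta> - real a / N) \<le> (2 / 2 ^ j) ^ 4" .
          qed (use d in auto)
          also have "((2 / 2 ^ j :: real) ^ 4) powr (1/4) = 2 / 2 ^ j"
          proof -
            have "((2 / 2 ^ j :: real) ^ 4) powr (1/4) = ((2 / 2 ^ j) powr real 4) powr (1/4)" by (subst powr_realpow) auto
            also have "\<dots> = 2 / 2 ^ j" unfolding powr_powr by simp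
            finally show ?thesis .
          qed
          finally have "r * (profile (real a / N) - profile \<theta>) \<le> \<rho> * (2 / 2 ^ j)"
            using hol r r0 \<rho> by (intro mult_mono) auto
          then show "s' \<le> real 2 * h" unfolding eq by (simp add: h_def mult.commute)
        qed
        obtain e where e: "e \<le> 2" "\<lfloor>(X a + s') / h\<rfloor> = \<lfloor>(X a + real e * h) / h\<rfloor>"
          using floor_shift_cases[OF h s'] by blast
        obtain e' where e': "e' \<le> 1" "\<lfloor>(Y a + s) / b\<rfloor> = \<lfloor>(Y a + real e' * b) / b\<rfloor>"
          using floor_shift_cases[OF b s] by blast
        have "nEu h F (fst x - r * profile \<theta>, snd x - c * \<theta>) = g (e, e') (snd x - c * \<theta>)"
          using e e' unfolding g_def nEu_eq[OF h] by (simp add: s_def s'_def)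
        also have "\<dots> \<le> (\<Sum>z\<in>{..2} \<times> {..1}. g z (snd x - c * \<theta>))"
          using e e' by (intro member_le_sum) auto
        finally show ?thesis using True by simp
      qed simp
    qed
    also have "\<dots> = (\<Sum>z\<in>{..2} \<times> {..1}. \<integral>\<^sup>+\<theta>. g z (snd x - c * \<theta>) \<partial>lborel)"
      by (rule nn_integral_sum) measurable
    also have "\<dots> \<le> (\<Sum>z\<in>{..2} \<times> {..1}. ennreal (4 / N) * davg h b F (X a + real (fst z) * h, Y a + real (snd z) * b))"
    proof (rule sum_mono)
      fix z :: "nat \<times> nat"
      define D where "D = davg h b F (X a + real (fst z) * h, Y a + real (snd z) * b)"
      have "(\<integral>\<^sup>+s. g z s \<partial>lborel) = ennreal \<bar>- c\<bar> * (\<integral>\<^sup>+\<theta>. g z (snd x + - c * \<theta>) \<partial>lborel)"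
        using c0 by (intro nn_integral_real_affine) auto
      then have "ennreal (1 / \<bar>c\<bar>) * (\<integral>\<^sup>+s. g z s \<partial>lborel) = ennreal (1 / \<bar>c\<bar>) * (ennreal \<bar>c\<bar> * (\<integral>\<^sup>+\<theta>. g z (snd x - c * \<theta>) \<partial>lborel))"
        by simp
      also have "\<dots> = (\<integral>\<^sup>+\<theta>. g z (snd x - c * \<theta>) \<partial>lborel)"
        using c0 by (simp flip: mult.assoc ennreal_mult)
      finally have 1: "(\<integral>\<^sup>+\<theta>. g z (snd x - c * \<theta>) \<partial>lborel) = ennreal (1 / \<bar>c\<bar>) * (\<integral>\<^sup>+s. g z s \<partial>lborel)" by simp
      have "D = ennreal (1 / b) * (\<integral>\<^sup>+s. g z s \<partial>lborel)"
        unfolding D_def g_def by (rule davg_eq_iterated[OF F h b])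
      then have "ennreal b * D = (\<integral>\<^sup>+s. g z s \<partial>lborel)"
        using b by (simp flip: mult.assoc ennreal_mult)
      then have "(\<integral>\<^sup>+\<theta>. g z (snd x - c * \<theta>) \<partial>lborel) = ennreal (1 / \<bar>c\<bar>) * ennreal b * D"
        by (simp add: 1 mult.assoc)
      also have "ennreal (1 / \<bar>c\<bar>) * ennreal b = ennreal (b / \<bar>c\<bar>)" using b c0 by (simp flip: ennreal_mult)
      also have "\<dots> * D \<le> ennreal (4 / N) * D" using bc by (intro mult_right_mono ennreal_leI) auto
      finally show "(\<integral>\<^sup>+\<theta>. g z (snd x - c * \<theta>) \<partial>lborel) \<le> ennreal (4 / N) * davg h b F (X a + real (fst z) * h, Y a + real (snd z) * b)"
        by (simp add: D_def)
    qed
    finally show "(\<integral>\<^sup>+\<theta>. nEu h F (fst x - r * profile \<theta>, snd x - c * \<theta>) * indicator (J a) \<theta> \<partial>lborel)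
      \<le> (\<Sum>z\<in>{..2} \<times> {..1}. ennreal (4 / N) * davg h b F (X a + real (fst z) * h, Y a + real (snd z) * b))" .
  qed
  also have "\<dots> = (\<Sum>i\<in>{..<N} \<times> {..2} \<times> {..1}. ennreal (4 / N) * davg h b F (x - v i))"
    unfolding sum.cartesian_product
    by (rule sum.cong) (auto simp: v_def X_def Y_def minus_prod_def algebra_simps)
  finally show ?thesis by (simp add: sum_distrib_left)
qed

text \<open>Cells nest when their lengths differ by a power of two; this is the reason for rounding
  the radii to dyadic scales.\<close>

lemma floor_refine:
  assumes "\<lfloor>x / a\<rfloor> = \<lfloor>y / a\<rfloor>" shows "\<lfloor>x / (a * 2 ^ m)\<rfloor> = \<lfloor>y / (a * 2 ^ m :: real)\<rfloor>"
proof -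
  have d: "\<lfloor>z / (a * 2 ^ m)\<rfloor> = \<lfloor>z / a\<rfloor> div 2 ^ m" for z
    using floor_divide_real_eq_div[of "2 ^ m" "z / a"] by (simp add: divide_divide_eq_left)
  show ?thesis by (simp only: d assms)
qed

lemma sum_jensen_powr:
  fixes M :: "'i \<Rightarrow> ennreal"
  assumes I: "finite I" "I \<noteq> {}" and q: "1 < q"
  shows "ennreal_powr (\<Sum>i\<in>I. M i) q \<le> ennreal (real (card I) powr (q - 1)) * (\<Sum>i\<in>I. ennreal_powr (M i) q)"
proof -
  have "ennreal_powr (\<integral>\<^sup>+i. M i \<partial>count_space I) q \<le> ennreal (real (card I) powr (q - 1)) * (\<integral>\<^sup>+i. ennreal_powr (M i) q \<partial>count_space I)"
    using I q by (intro nn_integral_jensen_powr) (auto simp: emeasure_count_space ennreal_of_nat_eq_real_of_nat card_gt_0_iff)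
  then show ?thesis using I by (simp add: nn_integral_count_space_finite)
qed

text \<open>All 6 * 16^j terms of \<open>curve_average_pieces\<close> are shifted maximal functions
  with the same bound. The weight 4 / N against 6 * N terms gives the 24, so the number of pieces
  disappears, and what grows with j is only the number of scales needed to absorb the shifts. The
  factor 11 + 2 * j is 9 plus that number.\<close>

lemma curve_maximal_growth:
  fixes K :: "int set" and n :: "int \<Rightarrow> int" and r c :: "int \<Rightarrow> real" and F :: "real \<times> real \<Rightarrow> real" and j :: nat
  defines "\<rho> \<equiv> \<lambda>k. 2 powi (- n k) :: real"
  assumes K: "finite K" and n: "strict_mono n" and r: "\<And>k. \<rho> k / 2 < r k" "\<And>k. r k \<le> \<rho> k" and c: "\<And>k. \<bar>c k\<bar> = (r k)\<^sup>2 / 4"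
    and F [measurable]: "F \<in> borel_measurable borel" and F0: "\<And>x. 0 \<le> F x" and FB: "\<And>x. F x \<le> B" and q: "1 < q"
  shows "(\<integral>\<^sup>+x. ennreal_powr (SUP k\<in>K. \<integral>\<^sup>+\<theta>. nEu (\<rho> k / 2 ^ j) F (fst x - r k * profile \<theta>, snd x - c k * \<theta>) * indicator {0..1} \<theta> \<partial>lborel) q \<partial>lborel)
    \<le> ennreal (24 powr q * (q * (2 * (11 + 2 * real j) * (1 / 2) powr (1 - q) / (q - 1)))) * (\<integral>\<^sup>+x. ennreal (F x powr q) \<partial>lborel)"
proof -
  \<comment> \<open>The profile is Hoelder continuous of exponent 1/4, so on each of \<open>16 ^ j\<close> pieces it varies by less than two cell lengths.\<close>
  define N :: nat where "N = 16 ^ j"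
  define h where "h k = \<rho> k / 2 ^ j" for k
  define b where "b k = (\<rho> k)\<^sup>2 / (4 * 16 ^ j)" for k
  define v where "v k = (\<lambda>(a, e, e'). (r k * profile (real a / real N) - real e * h k, c k * real a / real N + max (c k) 0 / real N - real e' * b k))" for k
  define I where "I = {..<N} \<times> {..2::nat} \<times> {..1::nat}"
  have N: "0 < real N" by (simp add: N_def)
  have I: "finite I" "I \<noteq> {}" "card I = 6 * N" using N by (auto simp: I_def card_cartesian_product)
  have \<rho>: "0 < \<rho> k" for k by (simp add: \<rho>_def)
  have h: "0 < h k" and b: "0 < b k" for k using \<rho>[of k] by (auto simp: h_def b_def)
  have \<rho>_eq: "\<rho> i = \<rho> k * 2 ^ nat (n k - n i)" if "i \<le> k" for i k
  proof -
    have le: "n i \<le> n k" using n that by (simp add: strict_mono_less_eq)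
    have "(2::real) powi (- n i) = 2 powi (- n k + (n k - n i))" by simp
    also have "\<dots> = 2 powi (- n k) * 2 powi (n k - n i)" by (rule power_int_add) simp
    also have "(2::real) powi (n k - n i) = 2 ^ nat (n k - n i)" using le by (simp add: power_int_def)
    finally show ?thesis by (simp add: \<rho>_def)
  qed
  have h_eq: "h i = h k * 2 ^ nat (n k - n i)" if "i \<le> k" for i k
    using \<rho>_eq[OF that] by (simp add: h_def)
  have b_eq: "b i = b k * 2 ^ (2 * nat (n k - n i))" if "i \<le> k" for i k
    using \<rho>_eq[OF that] by (simp add: b_def power_mult_distrib mult.commute flip: power_mult)
  \<comment> \<open>The shifts of index k are at most 4 * \<rho> k and (\<rho> k)^2 in the two
    coordinates. At a scale that is m powers of two coarser, the first is within the cell width once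
    m \<ge> j + 2 and the second within the cell height once 2 * m \<ge> 4 * j + 2; both hold from m
    = 2 * j + 2 on.\<close>
  define L where "L = 2 * j + 2"
  have step: "int (nat (n k - n i)) \<ge> k - i" if "i \<le> k" for i k
  proof -
    have "n i + (k - i) \<le> n k" using that
    proof (induction k rule: int_ge_induct)
      case (step k)
      then show ?case using strict_monoD[OF n, of k "k + 1"] by simp
    qed simp
    then show ?thesis by simp
  qed
  define C where "C = q * (2 * (9 + real L) * (1 / 2) powr (1 - q) / (q - 1))"
  have C0: "0 \<le> C" using q by (simp add: C_def)
  define M where "M i x = (SUP k\<in>K. davg (h k) (b k) F (x - v k i))" for i and x :: "real \<times> real"
  have [measurable]: "M i \<in> borel_measurable borel" for i
    unfolding M_def using K
  proof (intro borel_measurable_SUP countable_finite)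
    fix k
    show "(\<lambda>x. davg (h k) (b k) F (x - v k i)) \<in> borel_measurable borel"
      by (rule davg_measurable[OF h b]) measurable
  qed
  have M: "(\<integral>\<^sup>+x. ennreal_powr (M i x) q \<partial>lborel) \<le> ennreal C * (\<integral>\<^sup>+x. ennreal (F x powr q) \<partial>lborel)" if i: "i \<in> I" for i
    unfolding M_def C_def
  proof (rule shifted_maximal_strong[OF K h b _ _ F F0 FB q])
    show "cell2 (h i) (b i) x = cell2 (h i) (b i) y" if "i \<le> k" "cell2 (h k) (b k) x = cell2 (h k) (b k) y" for i k x y
      using that floor_refine[of "fst x" "h k" "fst y"] floor_refine[of "snd x" "b k" "snd y"]
      unfolding cell2_def h_eq[OF that(1)] b_eq[OF that(1)] by auto
    show "\<bar>fst (v k i)\<bar> \<le> h l \<and> \<bar>snd (v k i)\<bar> \<le> b l" if lk: "l + int L \<le> k" for l k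
    proof -
      obtain a e e' where i_eq: "i = (a, e, e')" "a < N" "e \<le> 2" "e' \<le> 1" using i by (auto simp: I_def)
      define m where "m = nat (n k - n l)"
      have "l \<le> k" using lk by linarith
      from step[OF this] have "int (2 * j + 2) \<le> int m" using lk unfolding L_def m_def by linarith
      then have m: "2 * j + 2 \<le> m" by linarith
      have pr: "0 \<le> profile (real a / N)" "profile (real a / N) \<le> 1"
        using profile_range[of "real a / N"] i_eq N by auto
      have r0: "0 < r k" using r(1)[of k] \<rho>[of k] by linarith
      have "\<bar>fst (v k i)\<bar> \<le> r k * profile (real a / N) + real e * h k"
        unfolding i_eq v_def using r0 pr h[of k] by (simp add: abs_le_iff)
      also have "\<dots> \<le> \<rho> k * 1 + 2 * \<rho> k"
      proof (intro add_mono mult_mono)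
        show "h k \<le> \<rho> k" unfolding h_def using \<rho>[of k] by (simp add: field_simps)
      qed (use r(2)[of k] \<rho>[of k] pr i_eq h[of k] in auto)
      also have "\<dots> \<le> \<rho> k * (4 :: real)" using \<rho>[of k] by simp
      also have "\<dots> \<le> \<rho> k * (2 ^ m / 2 ^ j)"
      proof (rule mult_left_mono)
        have "(4::real) * 2 ^ j = 2 ^ (j + 2)" by (simp add: power_add)
        also have "\<dots> \<le> 2 ^ m" using m by (intro power_increasing) auto
        finally show "(4::real) \<le> 2 ^ m / 2 ^ j" by (simp add: field_simps)
      qed (use \<rho>[of k] in simp)
      also have "\<dots> = h l" using \<rho>_eq[of l k] lk by (simp add: h_def m_def)
      finally have 1: "\<bar>fst (v k i)\<bar> \<le> h l" .
      have rsq: "(r k)\<^sup>2 \<le> (\<rho> k)\<^sup>2" using r0 r(2)[of k] by (intro power_mono) auto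
      have bk: "b k \<le> (\<rho> k)\<^sup>2 / 4" unfolding b_def using \<rho>[of k] by (simp add: field_simps)
      have "\<bar>c k * real a / N + max (c k) 0 / N\<bar> \<le> \<bar>c k\<bar>"
      proof -
        have "\<bar>c k * real a / N + max (c k) 0 / N\<bar> \<le> \<bar>c k * real a / N\<bar> + \<bar>max (c k) 0 / N\<bar>" by (rule abs_triangle_ineq)
        also have "\<dots> \<le> \<bar>c k\<bar> * real a / N + \<bar>c k\<bar> / N"
          using N by (intro add_mono) (auto simp: abs_mult divide_right_mono)
        also have "\<dots> = \<bar>c k\<bar> * ((real a + 1) / N)" by (simp add: add_divide_distrib distrib_left)
        also have "\<dots> \<le> \<bar>c k\<bar> * 1" using i_eq N by (intro mult_left_mono) auto
        finally show ?thesis by simp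
      qed
      moreover have "\<bar>real e' * b k\<bar> \<le> b k" using i_eq b[of k] by (auto simp: le_Suc_eq)
      ultimately have "\<bar>snd (v k i)\<bar> \<le> \<bar>c k\<bar> + b k"
        unfolding i_eq v_def case_prod_conv snd_conv by linarith
      also have "\<dots> \<le> (\<rho> k)\<^sup>2 * 1" using rsq bk c[of k] zero_le_power2[of "\<rho> k"] by linarith
      also have "\<dots> \<le> (\<rho> k)\<^sup>2 * (2 ^ (2 * m) / (4 * 16 ^ j))"
      proof (rule mult_left_mono)
        have "(4::real) * 16 ^ j = 2 ^ (2 + 4 * j)" by (simp add: power_add power_mult)
        also have "\<dots> \<le> 2 ^ (2 * m)" using m by (intro power_increasing) auto
        finally show "(1::real) \<le> 2 ^ (2 * m) / (4 * 16 ^ j)" by (simp add: field_simps)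
      qed simp
      also have "\<dots> = b l" using b_eq[of l k] lk by (simp add: b_def m_def)
      finally show ?thesis using 1 by simp
    qed
  qed
  have "(\<integral>\<^sup>+x. ennreal_powr (SUP k\<in>K. \<integral>\<^sup>+\<theta>. nEu (\<rho> k / 2 ^ j) F (fst x - r k * profile \<theta>, snd x - c k * \<theta>) * indicator {0..1} \<theta> \<partial>lborel) q \<partial>lborel)
    \<le> (\<integral>\<^sup>+x. ennreal_powr (ennreal (4 / N)) q * (ennreal (real (6 * N) powr (q - 1)) * (\<Sum>i\<in>I. ennreal_powr (M i x) q)) \<partial>lborel)"
  proof (rule nn_integral_mono)
    fix x :: "real \<times> real"
    have "(SUP k\<in>K. \<integral>\<^sup>+\<theta>. nEu (\<rho> k / 2 ^ j) F (fst x - r k * profile \<theta>, snd x - c k * \<theta>) * indicator {0..1} \<theta> \<partial>lborel)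
      \<le> ennreal (4 / N) * (\<Sum>i\<in>I. M i x)"
    proof (rule SUP_least)
      fix k assume k: "k \<in> K"
      have "(\<integral>\<^sup>+\<theta>. nEu (\<rho> k / 2 ^ j) F (fst x - r k * profile \<theta>, snd x - c k * \<theta>) * indicator {0..1} \<theta> \<partial>lborel)
        \<le> ennreal (4 / N) * (\<Sum>i\<in>I. davg (h k) (b k) F (x - v k i))"
        using curve_average_pieces[of "\<lambda>x. ennreal (F x)" "\<rho> k" "r k" "c k" j x] \<rho> r c
        by (simp add: h_def b_def I_def N_def v_def)
      also have "\<dots> \<le> ennreal (4 / N) * (\<Sum>i\<in>I. M i x)"
        using k by (intro mult_left_mono sum_mono) (auto simp: M_def intro: SUP_upper)
      finally show "(\<integral>\<^sup>+\<theta>. nEu (\<rho> k / 2 ^ j) F (fst x - r k * profile \<theta>, snd x - c k * \<theta>) * indicator {0..1} \<theta> \<partial>lborel)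
        \<le> ennreal (4 / N) * (\<Sum>i\<in>I. M i x)" .
    qed
    then have "ennreal_powr (SUP k\<in>K. \<integral>\<^sup>+\<theta>. nEu (\<rho> k / 2 ^ j) F (fst x - r k * profile \<theta>, snd x - c k * \<theta>) * indicator {0..1} \<theta> \<partial>lborel) q
      \<le> ennreal_powr (ennreal (4 / N) * (\<Sum>i\<in>I. M i x)) q"
      using q by (intro ennreal_powr_mono) auto
    also have "\<dots> = ennreal_powr (ennreal (4 / N)) q * ennreal_powr (\<Sum>i\<in>I. M i x) q"
      using q by (intro ennreal_powr_mult) auto
    also have "\<dots> \<le> ennreal_powr (ennreal (4 / N)) q * (ennreal (real (card I) powr (q - 1)) * (\<Sum>i\<in>I. ennreal_powr (M i x) q))"
      using I q by (intro mult_left_mono sum_jensen_powr) auto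
    finally show "ennreal_powr (SUP k\<in>K. \<integral>\<^sup>+\<theta>. nEu (\<rho> k / 2 ^ j) F (fst x - r k * profile \<theta>, snd x - c k * \<theta>) * indicator {0..1} \<theta> \<partial>lborel) q
      \<le> ennreal_powr (ennreal (4 / N)) q * (ennreal (real (6 * N) powr (q - 1)) * (\<Sum>i\<in>I. ennreal_powr (M i x) q))"
      by (simp only: I(3))
  qed
  also have "\<dots> = ennreal_powr (ennreal (4 / N)) q * (ennreal (real (6 * N) powr (q - 1)) * (\<Sum>i\<in>I. \<integral>\<^sup>+x. ennreal_powr (M i x) q \<partial>lborel))"
    by (subst nn_integral_cmult, measurable, subst nn_integral_cmult, measurable, subst nn_integral_sum) auto
  also have "\<dots> \<le> ennreal_powr (ennreal (4 / N)) q * (ennreal (real (6 * N) powr (q - 1)) * (\<Sum>i\<in>I. ennreal C * (\<integral>\<^sup>+x. ennreal (F x powr q) \<partial>lborel)))"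
    by (intro mult_left_mono sum_mono M) auto
  also have "\<dots> = ennreal (24 powr q * C) * (\<integral>\<^sup>+x. ennreal (F x powr q) \<partial>lborel)"
  proof -
    define J where "J = (\<integral>\<^sup>+x. ennreal (F x powr q) \<partial>lborel)"
    have "(\<Sum>i\<in>I. ennreal C * J) = ennreal (real (6 * N)) * (ennreal C * J)"
      by (simp only: sum_constant I(3) ennreal_of_nat_eq_real_of_nat)
    then have "ennreal_powr (ennreal (4 / N)) q * (ennreal (real (6 * N) powr (q - 1)) * (\<Sum>i\<in>I. ennreal C * J))
      = ennreal ((4 / N) powr q) * ennreal (real (6 * N) powr (q - 1)) * ennreal (real (6 * N)) * ennreal C * J"
      using N by (simp add: ennreal_powr_ennreal mult.assoc)
    also have "ennreal ((4 / N) powr q) * ennreal (real (6 * N) powr (q - 1)) * ennreal (real (6 * N)) * ennreal C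
      = ennreal ((4 / N) powr q * real (6 * N) powr (q - 1) * real (6 * N) * C)"
      using C0 N by (simp only: ennreal_mult mult_nonneg_nonneg powr_ge_zero of_nat_0_le_iff)
    also have "(4 / N) powr q * real (6 * N) powr (q - 1) * real (6 * N) * C = 24 powr q * C"
    proof -
      have "real (6 * N) powr (q - 1) * real (6 * N) = real (6 * N) powr q"
        using N powr_add[of "real (6 * N)" "q - 1" 1] by simp
      then have "(4 / N) powr q * real (6 * N) powr (q - 1) * real (6 * N) = (4 / N) powr q * real (6 * N) powr q"
        by (simp only: mult.assoc)
      also have "\<dots> = (4 / N * real (6 * N)) powr q" by (subst powr_mult) auto
      also have "4 / N * real (6 * N) = 24" using N by simp
      finally show ?thesis by simp
    qed
    finally show ?thesis by (simp add: J_def)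
  qed
  finally show ?thesis by (simp add: C_def L_def add.commute)
qed

section \<open>The planar maximal theorem\<close>

lemma nice_add:
  assumes "nice F" "nice G" shows "nice (\<lambda>x. F x + G x)"
proof -
  obtain B R where F: "F \<in> borel_measurable borel" "\<And>x. 0 \<le> F x" "\<And>x. F x \<le> B"
    "\<forall>x. R < \<bar>fst x\<bar> \<or> R < \<bar>snd x\<bar> \<longrightarrow> F x = 0" by (rule niceE[OF assms(1)]) (rule that)
  obtain B' R' where G: "G \<in> borel_measurable borel" "\<And>x. 0 \<le> G x" "\<And>x. G x \<le> B'"
    "\<forall>x. R' < \<bar>fst x\<bar> \<or> R' < \<bar>snd x\<bar> \<longrightarrow> G x = 0" by (rule niceE[OF assms(2)]) (rule that)
  show ?thesis
    unfolding nice_def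
  proof (intro conjI)
    show "\<exists>B. \<forall>x. 0 \<le> F x + G x \<and> F x + G x \<le> B"
      using F G by (intro exI[of _ "B + B'"]) (auto intro!: add_mono add_nonneg_nonneg)
    show "\<exists>R. \<forall>x. R < \<bar>fst x\<bar> \<or> R < \<bar>snd x\<bar> \<longrightarrow> F x + G x = 0"
      using F(4) G(4) by (intro exI[of _ "max R R'"]) auto
  qed (use F G in auto)
qed

lemma nice_indicator:
  assumes "nice F" and [measurable]: "A \<in> sets borel" shows "nice (\<lambda>x. F x * indicator A (F x))"
proof -
  obtain B R where F [measurable]: "F \<in> borel_measurable borel" and F0: "\<And>x. 0 \<le> F x" "\<And>x. F x \<le> B"
    "\<forall>x. R < \<bar>fst x\<bar> \<or> R < \<bar>snd x\<bar> \<longrightarrow> F x = 0" and B: "0 \<le> B" by (rule niceE[OF assms(1)]) (rule that)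
  show ?thesis
    unfolding nice_def
  proof (intro conjI)
    show "\<exists>B. \<forall>x. 0 \<le> F x * indicator A (F x) \<and> F x * indicator A (F x) \<le> B"
      using F0 B by (intro exI[of _ B]) (auto simp: indicator_def)
    show "\<exists>R. \<forall>x. R < \<bar>fst x\<bar> \<or> R < \<bar>snd x\<bar> \<longrightarrow> F x * indicator A (F x) = 0"
      using F0(3) by (intro exI[of _ R]) auto
  qed measurable
qed

lemma chebyshev_powr:
  fixes S :: "'a \<Rightarrow> real"
  assumes [measurable]: "S \<in> borel_measurable M" and S: "\<And>x. x \<in> space M \<Longrightarrow> 0 \<le> S x" and l: "0 < l" and q: "0 < q"
  shows "emeasure M {x \<in> space M. l / 2 < S x} \<le> ennreal (2 powr q * l powr - q) * (\<integral>\<^sup>+x. ennreal (S x powr q) \<partial>M)"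
proof -
  have "emeasure M {x \<in> space M. l / 2 < S x} = (\<integral>\<^sup>+x. indicator {x \<in> space M. l / 2 < S x} x \<partial>M)" by simp
  also have "\<dots> \<le> (\<integral>\<^sup>+x. ennreal (2 powr q * l powr - q) * ennreal (S x powr q) \<partial>M)"
  proof (rule nn_integral_mono)
    fix x assume x: "x \<in> space M"
    show "indicator {x \<in> space M. l / 2 < S x} x \<le> ennreal (2 powr q * l powr - q) * ennreal (S x powr q)"
    proof (cases "l / 2 < S x")
      case True
      then have "1 \<le> (2 / l * S x) powr q" using l q by (intro ge_one_powr_ge_zero) (auto simp: field_simps)
      also have "\<dots> = 2 powr q * l powr - q * S x powr q"
        using l S[OF x] by (simp add: powr_mult powr_divide powr_minus_divide)
      finally show ?thesis using x True by (simp flip: ennreal_mult)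
    qed simp
  qed
  also have "\<dots> = ennreal (2 powr q * l powr - q) * (\<integral>\<^sup>+x. ennreal (S x powr q) \<partial>M)"
    by (rule nn_integral_cmult) measurable
  finally show ?thesis .
qed

text \<open>F is cut at height \<open>\<gamma> * l\<close>; by subadditivity T F exceeds l only
  where T exceeds l / 2 on one of the two parts. The powers of 2 in the bound come from this
  halving. The dependence on \<open>\<gamma>\<close> and on both endpoint constants stays explicit
  because all of them vary with the step later.\<close>

lemma sublinear_interpolation:
  fixes T :: "(real \<times> real \<Rightarrow> real) \<Rightarrow> real \<times> real \<Rightarrow> real" and p q0 q1 \<gamma> B0 B1 :: real
  assumes meas: "\<And>F. nice F \<Longrightarrow> T F \<in> borel_measurable borel" and nonneg: "\<And>F x. nice F \<Longrightarrow> 0 \<le> T F x"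
    and sub: "\<And>F G x. nice F \<Longrightarrow> nice G \<Longrightarrow> T (\<lambda>x. F x + G x) x \<le> T F x + T G x"
    and B: "0 \<le> B0" "0 \<le> B1"
    and strong0: "\<And>F. nice F \<Longrightarrow> (\<integral>\<^sup>+x. ennreal (T F x powr q0) \<partial>lborel) \<le> ennreal B0 * (\<integral>\<^sup>+x. ennreal (F x powr q0) \<partial>lborel)"
    and strong1: "\<And>F. nice F \<Longrightarrow> (\<integral>\<^sup>+x. ennreal (T F x powr q1) \<partial>lborel) \<le> ennreal B1 * (\<integral>\<^sup>+x. ennreal (F x powr q1) \<partial>lborel)"
    and par: "0 < q0" "q0 < p" "p < q1" "0 < \<gamma>" and F: "nice F"
  shows "(\<integral>\<^sup>+x. ennreal (T F x powr p) \<partial>lborel) \<le>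
    ennreal (p * (2 powr q0 * B0 * \<gamma> powr (q0 - p) / (p - q0) + 2 powr q1 * B1 * \<gamma> powr (q1 - p) / (q1 - p))) * (\<integral>\<^sup>+x. ennreal (F x powr p) \<partial>lborel)"
proof (rule marcinkiewicz)
  show "sigma_finite_measure (lborel :: (real \<times> real) measure)" by (rule lborel.sigma_finite_measure_axioms)
  have Fm [measurable]: "F \<in> borel_measurable borel" and F0: "0 \<le> F x" for x using F unfolding nice_def by blast+
  show "T F \<in> borel_measurable lborel" "F \<in> borel_measurable lborel" using meas[OF F] by auto
  show "0 \<le> F x" "0 \<le> T F x" for x using F0 nonneg[OF F] by auto
  fix l :: real assume l: "0 < l"
  have q1: "0 < q1" using par by linarith
  have part: "emeasure lborel {x \<in> space lborel. l / 2 < T (\<lambda>x. F x * indicator A (F x)) x} \<le>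
      ennreal (2 powr q * C * l powr - q) * (\<integral>\<^sup>+x. ennreal (F x powr q) * indicator A (F x) \<partial>lborel)"
    if q: "0 < q" and C: "0 \<le> C" and A [measurable]: "A \<in> sets borel"
      and st: "\<And>F. nice F \<Longrightarrow> (\<integral>\<^sup>+x. ennreal (T F x powr q) \<partial>lborel) \<le> ennreal C * (\<integral>\<^sup>+x. ennreal (F x powr q) \<partial>lborel)" for A q C
  proof -
    define G where "G = (\<lambda>x. F x * indicator A (F x))"
    have G: "nice G" unfolding G_def by (rule nice_indicator[OF F A])
    have "emeasure lborel {x \<in> space lborel. l / 2 < T G x} \<le> ennreal (2 powr q * l powr - q) * (\<integral>\<^sup>+x. ennreal (T G x powr q) \<partial>lborel)"
      using meas[OF G] nonneg[OF G] by (intro chebyshev_powr l q) auto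
    also have "\<dots> \<le> ennreal (2 powr q * l powr - q) * (ennreal C * (\<integral>\<^sup>+x. ennreal (G x powr q) \<partial>lborel))"
      by (intro mult_left_mono st G) simp
    also have "(\<lambda>x. ennreal (G x powr q)) = (\<lambda>x. ennreal (F x powr q) * indicator A (F x))"
      by (auto simp: G_def indicator_def)
    finally show ?thesis using C by (simp add: G_def ennreal_mult mult_ac)
  qed
  have split: "F = (\<lambda>x. F x * indicator {\<gamma> * l<..} (F x) + F x * indicator {..\<gamma> * l} (F x))"
    by (auto simp: indicator_def)
  have le: "T F x \<le> T (\<lambda>x. F x * indicator {\<gamma> * l<..} (F x)) x + T (\<lambda>x. F x * indicator {..\<gamma> * l} (F x)) x" for x
    by (subst split, rule sub) (auto intro!: nice_indicator F)
  have [measurable]: "T (\<lambda>x. F x * indicator {\<gamma> * l<..} (F x)) \<in> borel_measurable borel" "T (\<lambda>x. F x * indicator {..\<gamma> * l} (F x)) \<in> borel_measurable borel"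
    by (auto intro!: meas nice_indicator F)
  have "emeasure lborel {x \<in> space lborel. l < T F x} \<le> emeasure lborel ({x \<in> space lborel. l / 2 < T (\<lambda>x. F x * indicator {\<gamma> * l<..} (F x)) x} \<union> {x \<in> space lborel. l / 2 < T (\<lambda>x. F x * indicator {..\<gamma> * l} (F x)) x})"
  proof (rule emeasure_mono)
    show "{x \<in> space lborel. l < T F x} \<subseteq> {x \<in> space lborel. l / 2 < T (\<lambda>x. F x * indicator {\<gamma> * l<..} (F x)) x} \<union> {x \<in> space lborel. l / 2 < T (\<lambda>x. F x * indicator {..\<gamma> * l} (F x)) x}"
    proof
      fix x assume "x \<in> {x \<in> space lborel. l < T F x}"
      then show "x \<in> {x \<in> space lborel. l / 2 < T (\<lambda>x. F x * indicator {\<gamma> * l<..} (F x)) x} \<union> {x \<in> space lborel. l / 2 < T (\<lambda>x. F x * indicator {..\<gamma> * l} (F x)) x}"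
        using le[of x] by (simp only: mem_Collect_eq Un_iff space_lborel UNIV_I simp_thms) linarith
    qed
  qed measurable
  also have "\<dots> \<le> emeasure lborel {x \<in> space lborel. l / 2 < T (\<lambda>x. F x * indicator {\<gamma> * l<..} (F x)) x} + emeasure lborel {x \<in> space lborel. l / 2 < T (\<lambda>x. F x * indicator {..\<gamma> * l} (F x)) x}"
    by (rule emeasure_subadditive) measurable
  also have "\<dots> \<le> ennreal (2 powr q0 * B0 * l powr - q0) * (\<integral>\<^sup>+x. ennreal (F x powr q0) * indicator {\<gamma> * l<..} (F x) \<partial>lborel)
     + ennreal (2 powr q1 * B1 * l powr - q1) * (\<integral>\<^sup>+x. ennreal (F x powr q1) * indicator {..\<gamma> * l} (F x) \<partial>lborel)"
    by (intro add_mono part strong0 strong1 B par q1) auto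
  finally show "emeasure lborel {x \<in> space lborel. l < T F x} \<le> ennreal (2 powr q0 * B0 * l powr - q0) * (\<integral>\<^sup>+x. ennreal (F x powr q0) * indicator {\<gamma> * l<..} (F x) \<partial>lborel)
     + ennreal (2 powr q1 * B1 * l powr - q1) * (\<integral>\<^sup>+x. ennreal (F x powr q1) * indicator {..\<gamma> * l} (F x) \<partial>lborel)" .
qed (use par B in auto)

lemma nn_integral_nEu_powr:
  assumes [measurable]: "F \<in> borel_measurable borel" and h: "0 < h" and p: "1 < p"
  shows "(\<integral>\<^sup>+x. ennreal_powr (nEu h F x) p \<partial>lborel) \<le> (\<integral>\<^sup>+x. ennreal_powr (F x) p \<partial>lborel)"
proof -
  note [measurable] = nEu_measurable[OF h assms(1)]
  have prod: "(\<integral>\<^sup>+x. G x \<partial>lborel) = (\<integral>\<^sup>+t. (\<integral>\<^sup>+u. G (u, t) \<partial>lborel) \<partial>lborel)" if [measurable]: "G \<in> borel_measurable borel" for G :: "real \<times> real \<Rightarrow> ennreal"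
    using lborel_pair.nn_integral_snd[of G] by (simp add: lborel_prod)
  have "(\<integral>\<^sup>+u. ennreal_powr (nEu h F (u, t)) p \<partial>lborel) \<le> (\<integral>\<^sup>+u. ennreal_powr (F (u, t)) p \<partial>lborel)" for t
    unfolding nEu_section by (rule equipartition.nn_integral_avg_powr[OF equipartition_floor[OF h] _ p]) measurable
  then have "(\<integral>\<^sup>+t. (\<integral>\<^sup>+u. ennreal_powr (nEu h F (u, t)) p \<partial>lborel) \<partial>lborel) \<le> (\<integral>\<^sup>+t. (\<integral>\<^sup>+u. ennreal_powr (F (u, t)) p \<partial>lborel) \<partial>lborel)"
    by (rule nn_integral_mono)
  moreover have "(\<integral>\<^sup>+x. ennreal_powr (nEu h F x) p \<partial>lborel) = (\<integral>\<^sup>+t. (\<integral>\<^sup>+u. ennreal_powr (nEu h F (u, t)) p \<partial>lborel) \<partial>lborel)"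
    by (rule prod) measurable
  moreover have "(\<integral>\<^sup>+x. ennreal_powr (F x) p \<partial>lborel) = (\<integral>\<^sup>+t. (\<integral>\<^sup>+u. ennreal_powr (F (u, t)) p \<partial>lborel) \<partial>lborel)"
    by (rule prod) measurable
  ultimately show ?thesis by simp
qed

section \<open>Curve averages and the maximal operators of a lacunary family of curves\<close>

definition curve_avg :: "real \<Rightarrow> real \<Rightarrow> (real \<times> real \<Rightarrow> real) \<Rightarrow> real \<times> real \<Rightarrow> real" where
  "curve_avg r c G x = (LINT \<theta>|lborel. G (fst x - r * profile \<theta>, snd x - c * \<theta>) * indicator {0..1} \<theta>)"

definition ncurve_avg :: "real \<Rightarrow> real \<Rightarrow> (real \<times> real \<Rightarrow> ennreal) \<Rightarrow> real \<times> real \<Rightarrow> ennreal" where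
  "ncurve_avg r c G x = (\<integral>\<^sup>+\<theta>. G (fst x - r * profile \<theta>, snd x - c * \<theta>) * indicator {0..1} \<theta> \<partial>lborel)"

lemma curve_avg_measurable:
  assumes [measurable]: "G \<in> borel_measurable borel" shows "curve_avg r c G \<in> borel_measurable borel"
proof -
  have "(\<lambda>x. curve_avg r c G (fst x, snd x)) \<in> borel_measurable (borel \<Otimes>\<^sub>M borel)"
    unfolding curve_avg_def by measurable
  then show ?thesis by (simp add: borel_prod)
qed

lemma ncurve_avg_measurable:
  assumes [measurable]: "G \<in> borel_measurable borel" shows "ncurve_avg r c G \<in> borel_measurable borel"
proof -
  have "(\<lambda>x. ncurve_avg r c G (fst x, snd x)) \<in> borel_measurable (borel \<Otimes>\<^sub>M borel)"
    unfolding ncurve_avg_def by measurable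
  then show ?thesis by (simp add: borel_prod)
qed

lemma curve_avg_integrable:
  fixes B :: real
  assumes [measurable]: "G \<in> borel_measurable borel" and B: "\<And>x. \<bar>G x\<bar> \<le> B"
  shows "integrable lborel (\<lambda>\<theta>. G (fst x - r * profile \<theta>, snd x - c * \<theta>) * indicator {0..1::real} \<theta>)"
proof (rule integrable_bounded_support[where A="{0..1}" and B=B])
  show "\<bar>G (fst x - r * profile \<theta>, snd x - c * \<theta>) * indicator {0..1} \<theta>\<bar> \<le> B" for \<theta>
    using B[of "(fst x - r * profile \<theta>, snd x - c * \<theta>)"] order_trans[OF abs_ge_zero B] by (auto simp: indicator_def)
qed auto

lemma curve_avg_add:
  fixes B B' :: real
  assumes "G \<in> borel_measurable borel" "\<And>x. \<bar>G x\<bar> \<le> B" "H \<in> borel_measurable borel" "\<And>x. \<bar>H x\<bar> \<le> B'"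
  shows "curve_avg r c (\<lambda>x. G x + H x) x = curve_avg r c G x + curve_avg r c H x"
    and "curve_avg r c (\<lambda>x. G x - H x) x = curve_avg r c G x - curve_avg r c H x"
  unfolding curve_avg_def distrib_right left_diff_distrib
  by (rule Bochner_Integration.integral_add Bochner_Integration.integral_diff, (rule curve_avg_integrable, fact, fact)+)+

lemma curve_avg_bound:
  fixes B :: real
  assumes "G \<in> borel_measurable borel" "\<And>x. \<bar>G x\<bar> \<le> B"
  shows "\<bar>curve_avg r c G x\<bar> \<le> B"
proof -
  have "\<bar>curve_avg r c G x\<bar> \<le> (LINT \<theta>|lborel. \<bar>G (fst x - r * profile \<theta>, snd x - c * \<theta>) * indicator {0..1} \<theta>\<bar>)"
    unfolding curve_avg_def by (rule integral_abs_bound)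
  also have "\<dots> \<le> (LINT \<theta>|lborel. B * indicator {0..1::real} \<theta>)"
  proof (intro integral_mono integrable_abs curve_avg_integrable[OF assms])
    show "integrable lborel (\<lambda>\<theta>. B * indicator {0..1::real} \<theta>)"
      by (rule integrable_bounded_support[where A="{0..1}" and B="\<bar>B\<bar>"]) (auto simp: indicator_def)
  qed (use assms(2) in \<open>auto simp: indicator_def\<close>)
  finally show ?thesis by simp
qed

lemma ennreal_curve_avg:
  assumes "G \<in> borel_measurable borel" "\<And>x. 0 \<le> G x" "\<And>x. G x \<le> B"
  shows "ennreal (curve_avg r c G x) = ncurve_avg r c (\<lambda>x. ennreal (G x)) x"
proof -
  have "\<bar>G x\<bar> \<le> B" for x using assms(2,3)[of x] by simp
  from curve_avg_integrable[OF assms(1) this]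
  have "ennreal (curve_avg r c G x) = (\<integral>\<^sup>+\<theta>. ennreal (G (fst x - r * profile \<theta>, snd x - c * \<theta>) * indicator {0..1::real} \<theta>) \<partial>lborel)"
    unfolding curve_avg_def using assms(2) by (intro nn_integral_eq_integral[symmetric]) auto
  also have "\<dots> = ncurve_avg r c (\<lambda>x. ennreal (G x)) x"
    unfolding ncurve_avg_def by (intro nn_integral_cong) (auto simp: indicator_def)
  finally show ?thesis .
qed

lemma Eu_add:
  assumes "nice F" "nice G" and h: "0 < h"
  shows "Eu h (\<lambda>x. F x + G x) x = Eu h F x + Eu h G x"
proof -
  obtain B R where F [measurable]: "F \<in> borel_measurable borel" and F0: "\<And>x. 0 \<le> F x" "\<And>x. F x \<le> B"
    "\<forall>x. R < \<bar>fst x\<bar> \<or> R < \<bar>snd x\<bar> \<longrightarrow> F x = 0" by (rule niceE[OF assms(1)]) (rule that)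
  obtain B' R' where G [measurable]: "G \<in> borel_measurable borel" and G0: "\<And>x. 0 \<le> G x" "\<And>x. G x \<le> B'"
    "\<forall>x. R' < \<bar>fst x\<bar> \<or> R' < \<bar>snd x\<bar> \<longrightarrow> G x = 0" by (rule niceE[OF assms(2)]) (rule that)
  have "nEu h (\<lambda>x. ennreal (F x + G x)) x = nEu h (\<lambda>x. ennreal (F x)) x + nEu h (\<lambda>x. ennreal (G x)) x"
    unfolding nEu_eq[OF h] using F0 G0 by (simp add: distrib_right nn_integral_add distrib_left)
  also have "\<dots> = ennreal (Eu h F x) + ennreal (Eu h G x)"
    by (simp only: ennreal_Eu[OF F F0 h] ennreal_Eu[OF G G0 h])
  also have "\<dots> = ennreal (Eu h F x + Eu h G x)"
    by (intro ennreal_plus[symmetric] Eu_nonneg[OF F F0 h] Eu_nonneg[OF G G0 h])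
  finally have eq: "nEu h (\<lambda>x. ennreal (F x + G x)) x = ennreal (Eu h F x + Eu h G x)" .
  show ?thesis
    unfolding Eu_def[of h "\<lambda>x. F x + G x"] eq
    by (intro enn2real_ennreal add_nonneg_nonneg Eu_nonneg[OF F F0 h] Eu_nonneg[OF G G0 h])
qed

text \<open>Half of the geometric decay pays for the linear factor, which is that of the growth
  constant at step j + 1.\<close>

lemma polynomial_geometric_bound:
  fixes y :: real assumes y: "0 < y" "y < 1"
  shows "\<exists>C\<ge>0. \<forall>j::nat. (13 + 2 * real j) * y ^ j \<le> C * sqrt y ^ j"
proof -
  have s: "0 < sqrt y" "sqrt y < 1" using y by auto
  have "(\<lambda>j. of_nat j * sqrt y ^ j) \<longlonglongrightarrow> 0"
    using s by (intro powser_times_n_limit_0) auto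
  then have "Bseq (\<lambda>j. real j * sqrt y ^ j)" by (intro convergent_imp_Bseq) (auto simp: convergent_def)
  then obtain C where C: "0 < C" "\<And>j. norm (real j * sqrt y ^ j) \<le> C" by (auto simp: Bseq_def)
  have "(13 + 2 * real j) * y ^ j \<le> (13 + 2 * C) * sqrt y ^ j" for j
  proof -
    have "(13 + 2 * real j) * y ^ j = ((13 + 2 * real j) * sqrt y ^ j) * sqrt y ^ j"
      using y by (simp add: mult.assoc flip: power_mult_distrib)
    also have "(13 + 2 * real j) * sqrt y ^ j \<le> 13 * 1 + 2 * C"
      using C(2)[of j] s by (auto simp: distrib_right intro!: add_mono power_le_one)
    finally show ?thesis using s by (simp add: mult_right_mono)
  qed
  then show ?thesis using C by (intro exI[of _ "13 + 2 * C"]) auto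
qed

text \<open>Each radius lies within a factor 2 below the dyadic scale 2^(-n k), and strict
  monotonicity of \<open>n\<close> expresses lacunarity: different k have different scales. Only the
  size of \<open>c\<close> is prescribed, so one locale serves the upper and the lower half of the
  sphere.\<close>

locale lacunary_curve =
  fixes n :: "int \<Rightarrow> int" and r c :: "int \<Rightarrow> real"
  assumes n: "strict_mono n"
    and r_gt: "\<And>k. 2 powi (- n k) / 2 < r k" and r_le: "\<And>k. r k \<le> 2 powi (- n k)"
    and c: "\<And>k. \<bar>c k\<bar> = (r k)\<^sup>2 / 4"
begin

text \<open>Cells are measured relative to the radius of their own curve: a larger step j is a finer
  resolution at every k at once.\<close>

definition len :: "nat \<Rightarrow> int \<Rightarrow> real" where "len j k = 2 powi (- n k) / 2 ^ j"

definition dif :: "nat \<Rightarrow> int \<Rightarrow> (real \<times> real \<Rightarrow> real) \<Rightarrow> real \<times> real \<Rightarrow> real" where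
  "dif j k F x = Eu (len j k / 2) F x - Eu (len j k) F x"

definition nmax :: "int set \<Rightarrow> nat \<Rightarrow> (real \<times> real \<Rightarrow> ennreal) \<Rightarrow> real \<times> real \<Rightarrow> ennreal" where
  "nmax K j F x = (SUP k\<in>K. ncurve_avg (r k) (c k) (nEu (len j k) F) x)"

definition dmax :: "int set \<Rightarrow> nat \<Rightarrow> (real \<times> real \<Rightarrow> real) \<Rightarrow> real \<times> real \<Rightarrow> real" where
  "dmax K j F x = enn2real (SUP k\<in>K. ennreal \<bar>curve_avg (r k) (c k) (dif j k F) x\<bar>)"

text \<open>The constant of \<open>curve_maximal_growth\<close>. It is linear in j, and any
  geometric gain defeats it.\<close>

definition growth :: "real \<Rightarrow> nat \<Rightarrow> real" where
  "growth q j = 24 powr q * (q * (2 * (11 + 2 * real j) * (1 / 2) powr (1 - q) / (q - 1)))"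

lemma len_pos: "0 < len j k" by (simp add: len_def)
lemma len_Suc: "len j k / 2 = len (Suc j) k" by (simp add: len_def)
lemma r_pos: "0 < r k" using r_gt[of k] by (smt (verit) zero_less_power_int half_gt_zero)

lemma growth_nonneg: "1 < q \<Longrightarrow> 0 \<le> growth q j" by (simp add: growth_def)

lemma growth_mono: "1 < q \<Longrightarrow> growth q j \<le> growth q (Suc j)"
  unfolding growth_def by (intro mult_left_mono divide_right_mono mult_right_mono) auto

lemma nmax_bound:
  assumes "finite K" "nice F" "1 < q"
  shows "(\<integral>\<^sup>+x. ennreal_powr (nmax K j F x) q \<partial>lborel) \<le> ennreal (growth q j) * (\<integral>\<^sup>+x. ennreal (F x powr q) \<partial>lborel)"
proof -
  obtain B R where F: "F \<in> borel_measurable borel" "\<And>x. 0 \<le> F x" "\<And>x. F x \<le> B"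
    by (rule niceE[OF assms(2)]) (rule that)
  show ?thesis
    using curve_maximal_growth[OF assms(1) n r_gt r_le c F assms(3), of j]
    unfolding nmax_def ncurve_avg_def len_def growth_def by simp
qed

context
  fixes F assumes F: "nice F"
begin

lemma dif_measurable: "dif j k F \<in> borel_measurable borel"
  unfolding dif_def by (rule Eu_difference(1)[OF F len_pos])

lemma Eu_nice_measurable: "Eu (len j k) F \<in> borel_measurable borel"
proof -
  obtain B R where N: "F \<in> borel_measurable borel" "\<And>x. 0 \<le> F x" "\<And>x. F x \<le> B"
    "\<forall>x. R < \<bar>fst x\<bar> \<or> R < \<bar>snd x\<bar> \<longrightarrow> F x = 0" by (rule niceE[OF F]) (rule that)
  show ?thesis by (rule Eu_measurable[OF N len_pos])
qed

lemma Eu_nice_bounds: "\<exists>B. \<forall>j k x. 0 \<le> Eu (len j k) F x \<and> Eu (len j k) F x \<le> B"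
proof -
  obtain B R where N: "F \<in> borel_measurable borel" "\<And>x. 0 \<le> F x" "\<And>x. F x \<le> B"
    "\<forall>x. R < \<bar>fst x\<bar> \<or> R < \<bar>snd x\<bar> \<longrightarrow> F x = 0" by (rule niceE[OF F]) (rule that)
  show ?thesis using Eu_nonneg[OF N len_pos] Eu_le[OF N len_pos] by blast
qed

lemma ennreal_Eu_nice: "(\<lambda>x. ennreal (Eu (len j k) F x)) = nEu (len j k) F"
proof -
  obtain B R where N: "F \<in> borel_measurable borel" "\<And>x. 0 \<le> F x" "\<And>x. F x \<le> B"
    "\<forall>x. R < \<bar>fst x\<bar> \<or> R < \<bar>snd x\<bar> \<longrightarrow> F x = 0" by (rule niceE[OF F]) (rule that)
  show ?thesis using ennreal_Eu[OF N len_pos] by blast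
qed

lemma curve_avg_Eu_nice:
  "ennreal (curve_avg (r k) (c k) (Eu (len j k) F) x) = ncurve_avg (r k) (c k) (nEu (len j k) F) x"
proof -
  obtain B where B: "\<And>x. 0 \<le> Eu (len j k) F x" "\<And>x. Eu (len j k) F x \<le> B" using Eu_nice_bounds by blast
  show ?thesis unfolding ennreal_Eu_nice[symmetric] by (rule ennreal_curve_avg[OF Eu_nice_measurable B])
qed

lemma curve_avg_dif:
  "curve_avg (r k) (c k) (dif j k F) x = curve_avg (r k) (c k) (Eu (len (Suc j) k) F) x - curve_avg (r k) (c k) (Eu (len j k) F) x"
proof -
  obtain B where B: "\<And>j x. 0 \<le> Eu (len j k) F x" "\<And>j x. Eu (len j k) F x \<le> B" using Eu_nice_bounds by blast
  have "\<bar>Eu (len j k) F x\<bar> \<le> B" for j x using B[of j x] by simp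
  then show ?thesis
    unfolding dif_def len_Suc by (intro curve_avg_add(2) Eu_nice_measurable)
qed

text \<open>The differences of a nice function are bounded uniformly in k, so
  \<open>enn2real\<close> in the definition of \<open>dmax\<close> never meets an infinite
  value.\<close>

lemma dif_sup: "ennreal (dmax K j F x) = (SUP k\<in>K. ennreal \<bar>curve_avg (r k) (c k) (dif j k F) x\<bar>)"
proof -
  obtain B where B: "\<And>j k x. 0 \<le> Eu (len j k) F x" "\<And>j k x. Eu (len j k) F x \<le> B" using Eu_nice_bounds by blast
  have "\<bar>dif j k F y\<bar> \<le> B" for k y
    using B(1)[of "Suc j" k y] B(2)[of "Suc j" k y] B(1)[of j k y] B(2)[of j k y] unfolding dif_def len_Suc by linarith
  then have "(SUP k\<in>K. ennreal \<bar>curve_avg (r k) (c k) (dif j k F) x\<bar>) \<le> ennreal B"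
    by (intro SUP_least ennreal_leI curve_avg_bound dif_measurable)
  then show ?thesis
    unfolding dmax_def by (metis ennreal_enn2real ennreal_less_top order_le_less_trans)
qed

lemma dmax_nonneg: "0 \<le> dmax K j F x" by (simp add: dmax_def)

lemma dmax_measurable: "finite K \<Longrightarrow> dmax K j F \<in> borel_measurable borel"
proof -
  assume K: "finite K"
  have [measurable]: "curve_avg (r k) (c k) (dif j k F) \<in> borel_measurable borel" for k
    by (rule curve_avg_measurable[OF dif_measurable])
  have "(\<lambda>x. SUP k\<in>K. ennreal \<bar>curve_avg (r k) (c k) (dif j k F) x\<bar>) \<in> borel_measurable borel"
    using K by (intro borel_measurable_SUP countable_finite) auto
  then show ?thesis unfolding dmax_def[abs_def] by measurable
qed

text \<open>The absolute difference of two nonnegative numbers is at most the larger one. Away from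
  L^2 this crude step is enough, since only slow growth in j is wanted there.\<close>

lemma dmax_le_nmax: "ennreal (dmax K j F x) \<le> max (nmax K (Suc j) F x) (nmax K j F x)"
  unfolding dif_sup
proof (rule SUP_least)
  fix k assume k: "k \<in> K"
  define P Q where "P = curve_avg (r k) (c k) (Eu (len (Suc j) k) F) x" and "Q = curve_avg (r k) (c k) (Eu (len j k) F) x"
  have PQ: "ennreal P \<le> nmax K (Suc j) F x" "ennreal Q \<le> nmax K j F x"
    unfolding P_def Q_def curve_avg_Eu_nice nmax_def using k by (auto intro: SUP_upper)
  obtain B where B: "\<And>j k x. 0 \<le> Eu (len j k) F x" using Eu_nice_bounds by blast
  have "0 \<le> P" "0 \<le> Q" unfolding P_def Q_def curve_avg_def using B by (auto intro!: integral_nonneg_AE)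
  then have "\<bar>P - Q\<bar> \<le> P \<or> \<bar>P - Q\<bar> \<le> Q" by linarith
  then show "ennreal \<bar>curve_avg (r k) (c k) (dif j k F) x\<bar> \<le> max (nmax K (Suc j) F x) (nmax K j F x)"
    unfolding curve_avg_dif P_def[symmetric] Q_def[symmetric]
    by (elim disjE)
      (rule order_trans[OF order_trans[OF ennreal_leI PQ(1)] max.cobounded1], assumption,
       rule order_trans[OF order_trans[OF ennreal_leI PQ(2)] max.cobounded2], assumption)
qed

lemma dmax_growth:
  assumes K: "finite K" and q: "1 < q"
  shows "(\<integral>\<^sup>+x. ennreal (dmax K j F x powr q) \<partial>lborel) \<le> ennreal (2 * growth q (Suc j)) * (\<integral>\<^sup>+x. ennreal (F x powr q) \<partial>lborel)"
proof -
  have F': "F \<in> borel_measurable borel" using F by (simp add: nice_def)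
  have m [measurable]: "nmax K i F \<in> borel_measurable borel" for i
    unfolding nmax_def[abs_def]
    by (intro borel_measurable_SUP countable_finite K ncurve_avg_measurable nEu_measurable len_pos) (use F' in measurable)
  have "(\<integral>\<^sup>+x. ennreal (dmax K j F x powr q) \<partial>lborel) \<le> (\<integral>\<^sup>+x. ennreal_powr (nmax K (Suc j) F x) q + ennreal_powr (nmax K j F x) q \<partial>lborel)"
  proof (rule nn_integral_mono)
    fix x
    have "ennreal (dmax K j F x powr q) = ennreal_powr (ennreal (dmax K j F x)) q"
      by (simp add: ennreal_powr_ennreal dmax_nonneg)
    also have "\<dots> \<le> ennreal_powr (max (nmax K (Suc j) F x) (nmax K j F x)) q"
      using q by (intro ennreal_powr_mono dmax_le_nmax) auto
    also have "\<dots> \<le> ennreal_powr (nmax K (Suc j) F x) q + ennreal_powr (nmax K j F x) q"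
      by (simp add: max_def)
    finally show "ennreal (dmax K j F x powr q) \<le> ennreal_powr (nmax K (Suc j) F x) q + ennreal_powr (nmax K j F x) q" .
  qed
  also have "\<dots> = (\<integral>\<^sup>+x. ennreal_powr (nmax K (Suc j) F x) q \<partial>lborel) + (\<integral>\<^sup>+x. ennreal_powr (nmax K j F x) q \<partial>lborel)"
    by (rule nn_integral_add) measurable
  also have "\<dots> \<le> ennreal (growth q (Suc j)) * (\<integral>\<^sup>+x. ennreal (F x powr q) \<partial>lborel) + ennreal (growth q (Suc j)) * (\<integral>\<^sup>+x. ennreal (F x powr q) \<partial>lborel)"
  proof (rule add_mono)
    show "(\<integral>\<^sup>+x. ennreal_powr (nmax K (Suc j) F x) q \<partial>lborel) \<le> ennreal (growth q (Suc j)) * (\<integral>\<^sup>+x. ennreal (F x powr q) \<partial>lborel)"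
      by (rule nmax_bound[OF K F q])
    have "(\<integral>\<^sup>+x. ennreal_powr (nmax K j F x) q \<partial>lborel) \<le> ennreal (growth q j) * (\<integral>\<^sup>+x. ennreal (F x powr q) \<partial>lborel)"
      by (rule nmax_bound[OF K F q])
    also have "\<dots> \<le> ennreal (growth q (Suc j)) * (\<integral>\<^sup>+x. ennreal (F x powr q) \<partial>lborel)"
      by (rule mult_right_mono[OF ennreal_leI[OF growth_mono[OF q]]]) simp
    finally show "(\<integral>\<^sup>+x. ennreal_powr (nmax K j F x) q \<partial>lborel) \<le> ennreal (growth q (Suc j)) * (\<integral>\<^sup>+x. ennreal (F x powr q) \<partial>lborel)" .
  qed
  also have "\<dots> = ennreal (2 * growth q (Suc j)) * (\<integral>\<^sup>+x. ennreal (F x powr q) \<partial>lborel)"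
  proof -
    have "ennreal (2 * growth q (Suc j)) = ennreal (growth q (Suc j)) + ennreal (growth q (Suc j))"
      unfolding mult_2 by (intro ennreal_plus growth_nonneg q)
    then show ?thesis by (simp only: distrib_right)
  qed
  finally show ?thesis .
qed

text \<open>At step j the cell length is at most 2 / 2^j times the radius, and this ratio is the
  whole gain.\<close>

lemma dif_L2: "(\<integral>\<^sup>+x. ennreal ((curve_avg (r k) (c k) (dif j k F) x)\<^sup>2) \<partial>lborel) \<le> ennreal (8 * sqrt (2 / 2 ^ j)) * (\<integral>\<^sup>+x. ennreal ((dif j k F x)\<^sup>2) \<partial>lborel)"
proof -
  obtain B where B: "\<And>x. \<bar>dif j k F x\<bar> \<le> B" using Eu_difference(2)[OF F len_pos] unfolding dif_def by blast
  obtain R where R: "\<And>x. R < \<bar>fst x\<bar> \<or> R < \<bar>snd x\<bar> \<Longrightarrow> dif j k F x = 0" using Eu_difference(3)[OF F len_pos] unfolding dif_def by blast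
  have "(\<integral>\<^sup>+x. ennreal ((curve_avg (r k) (c k) (dif j k F) x)\<^sup>2) \<partial>lborel) \<le> ennreal (8 * sqrt (len j k / r k)) * (\<integral>\<^sup>+x. ennreal ((dif j k F x)\<^sup>2) \<partial>lborel)"
    unfolding curve_avg_def
  proof (rule curve_average_L2[where B=B and R=R])
    show "(LINT v|lborel. dif j k F (v, t) * of_bool (\<lfloor>v / len j k\<rfloor> = m)) = 0" for m :: int and t
      unfolding dif_def by (rule Eu_difference(4)[OF F len_pos])
  qed (use B R dif_measurable len_pos r_pos in auto)
  also have "\<dots> \<le> ennreal (8 * sqrt (2 / 2 ^ j)) * (\<integral>\<^sup>+x. ennreal ((dif j k F x)\<^sup>2) \<partial>lborel)"
  proof (intro mult_right_mono ennreal_leI mult_left_mono real_sqrt_le_mono)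
    have "2 powi (- n k) \<le> 2 * r k" using r_gt[of k] by simp
    then have "2 powi (- n k) / 2 ^ j / r k \<le> 2 / 2 ^ j" using r_pos[of k] by (simp add: field_simps)
    then show "len j k / r k \<le> 2 / 2 ^ j" by (simp add: len_def)
  qed auto
  finally show ?thesis .
qed

text \<open>For fixed j the difference of index k sits between the consecutive dyadic scales n k + j
  and n k + j + 1. Distinct k give distinct positions, so the sum is part of a telescoping sum of
  Pythagoras identities, which never exceeds the squared norm of F.\<close>

lemma dif_orthogonal:
  assumes K: "finite K"
  shows "(\<Sum>k\<in>K. \<integral>\<^sup>+x. ennreal ((dif j k F x)\<^sup>2) \<partial>lborel) \<le> (\<integral>\<^sup>+x. ennreal (F x powr 2) \<partial>lborel)"
proof -
  obtain B R where N: "F \<in> borel_measurable borel" "\<And>x. 0 \<le> F x" "\<And>x. F x \<le> B"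
    "\<forall>x. R < \<bar>fst x\<bar> \<or> R < \<bar>snd x\<bar> \<longrightarrow> F x = 0" by (rule niceE[OF F]) (rule that)
  define h where "h i = (2 powi (- i) :: real)" for i :: int
  have h: "0 < h i" for i by (simp add: h_def)
  have h_add: "h (i + l) = h i * h l" for i l
  proof -
    have "- (i + l) = - i + - l" by simp
    then show ?thesis unfolding h_def by (metis power_int_add zero_neq_numeral)
  qed
  have h_half: "h i / 2 = h (i + 1)" for i unfolding h_add by (simp add: h_def power_int_minus)
  define e where "e i = (\<integral>\<^sup>+x. ennreal ((Eu (h i) F x)\<^sup>2) \<partial>lborel)" for i
  define d where "d i = (\<integral>\<^sup>+x. ennreal ((Eu (h i / 2) F x - Eu (h i) F x)\<^sup>2) \<partial>lborel)" for i
  have de: "d i + e i = e (i + 1)" for i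
    using Eu_difference(5)[OF F h[of i]] unfolding d_def e_def by (simp only: h_half)
  have e_le: "e i \<le> (\<integral>\<^sup>+x. ennreal (F x powr 2) \<partial>lborel)" for i
  proof -
    have "e i = (\<integral>\<^sup>+x. ennreal_powr (nEu (h i) F x) 2 \<partial>lborel)"
      unfolding e_def ennreal_Eu[OF N h, symmetric]
      by (intro nn_integral_cong) (simp add: ennreal_powr_ennreal Eu_nonneg[OF N h])
    also have "\<dots> \<le> (\<integral>\<^sup>+x. ennreal_powr (ennreal (F x)) 2 \<partial>lborel)"
      using N(1) h by (intro nn_integral_nEu_powr) auto
    also have "\<dots> = (\<integral>\<^sup>+x. ennreal (F x powr 2) \<partial>lborel)"
      by (intro nn_integral_cong ennreal_powr_ennreal N)
    finally show ?thesis .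
  qed
  have tele: "(\<Sum>l<m. d (a + int l)) + e a = e (a + int m)" for a m
  proof (induction m)
    case (Suc m)
    have "(\<Sum>l<Suc m. d (a + int l)) + e a = d (a + int m) + ((\<Sum>l<m. d (a + int l)) + e a)"
      by (simp add: ac_simps)
    also have "\<dots> = e (a + int m + 1)" unfolding Suc.IH by (rule de)
    finally show ?case by (simp add: ac_simps)
  qed simp
  define I where "I = (\<lambda>k. n k + int j) ` K"
  have "finite I" using K by (simp add: I_def)
  \<comment> \<open>The missing scales between the least and the greatest index are filled in to
    make the sum telescope; 0 is inserted so that both extrema exist for empty
    \<open>K\<close>.\<close>
  define a b where "a = Min (insert 0 I)" and "b = Max (insert 0 I)"
  have ab: "I \<subseteq> {a..b}" using \<open>finite I\<close> by (auto simp: a_def b_def)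
  have "(\<Sum>k\<in>K. \<integral>\<^sup>+x. ennreal ((dif j k F x)\<^sup>2) \<partial>lborel) = (\<Sum>k\<in>K. d (n k + int j))"
  proof (rule sum.cong)
    fix k
    have "h (n k + int j) = len j k"
      unfolding h_add by (simp add: h_def len_def power_int_minus divide_inverse)
    then show "(\<integral>\<^sup>+x. ennreal ((dif j k F x)\<^sup>2) \<partial>lborel) = d (n k + int j)" by (simp add: d_def dif_def)
  qed simp
  also have "\<dots> = sum d I"
    unfolding I_def using n by (subst sum.reindex) (auto simp: inj_on_def strict_mono_eq)
  also have "\<dots> \<le> sum d ((\<lambda>l. a + int l) ` {..<nat (b - a + 1)})"
  proof (rule sum_mono2)
    show "I \<subseteq> (\<lambda>l. a + int l) ` {..<nat (b - a + 1)}"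
    proof
      fix i assume "i \<in> I"
      then have "a \<le> i" "i \<le> b" using ab by auto
      then have "i = a + int (nat (i - a))" "nat (i - a) < nat (b - a + 1)" by auto
      then show "i \<in> (\<lambda>l. a + int l) ` {..<nat (b - a + 1)}" by blast
    qed
  qed auto
  also have "\<dots> = (\<Sum>l<nat (b - a + 1). d (a + int l))" by (subst sum.reindex) (auto simp: inj_on_def)
  also have "\<dots> \<le> (\<Sum>l<nat (b - a + 1). d (a + int l)) + e a" by simp
  also have "\<dots> \<le> (\<integral>\<^sup>+x. ennreal (F x powr 2) \<partial>lborel)" unfolding tele by (rule e_le)
  finally show ?thesis .
qed

text \<open>A supremum of squares is at most their sum, and orthogonality bounds that sum
  independently of the number of curves.\<close>

lemma dmax_L2:
  assumes K: "finite K"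
  shows "(\<integral>\<^sup>+x. ennreal (dmax K j F x powr 2) \<partial>lborel) \<le> ennreal (8 * sqrt (2 / 2 ^ j)) * (\<integral>\<^sup>+x. ennreal (F x powr 2) \<partial>lborel)"
proof -
  have [measurable]: "curve_avg (r k) (c k) (dif j k F) \<in> borel_measurable borel" for k
    by (rule curve_avg_measurable[OF dif_measurable])
  have "(\<integral>\<^sup>+x. ennreal (dmax K j F x powr 2) \<partial>lborel) \<le> (\<integral>\<^sup>+x. (\<Sum>k\<in>K. ennreal ((curve_avg (r k) (c k) (dif j k F) x)\<^sup>2)) \<partial>lborel)"
  proof (rule nn_integral_mono)
    fix x
    have "ennreal (dmax K j F x powr 2) = ennreal_powr (ennreal (dmax K j F x)) 2"
      by (intro ennreal_powr_ennreal[symmetric] dmax_nonneg)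
    also have "\<dots> = (SUP k\<in>K. ennreal_powr (ennreal \<bar>curve_avg (r k) (c k) (dif j k F) x\<bar>) 2)"
      unfolding dif_sup by (rule ennreal_powr_SUP) simp
    also have "\<dots> = (SUP k\<in>K. ennreal ((curve_avg (r k) (c k) (dif j k F) x)\<^sup>2))"
      by (simp only: square_enorm)
    also have "\<dots> \<le> (\<Sum>k\<in>K. ennreal ((curve_avg (r k) (c k) (dif j k F) x)\<^sup>2))"
      using K by (intro SUP_least member_le_sum) auto
    finally show "ennreal (dmax K j F x powr 2) \<le> (\<Sum>k\<in>K. ennreal ((curve_avg (r k) (c k) (dif j k F) x)\<^sup>2))" .
  qed
  also have "\<dots> = (\<Sum>k\<in>K. \<integral>\<^sup>+x. ennreal ((curve_avg (r k) (c k) (dif j k F) x)\<^sup>2) \<partial>lborel)"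
    by (rule nn_integral_sum) measurable
  also have "\<dots> \<le> (\<Sum>k\<in>K. ennreal (8 * sqrt (2 / 2 ^ j)) * (\<integral>\<^sup>+x. ennreal ((dif j k F x)\<^sup>2) \<partial>lborel))"
    by (intro sum_mono dif_L2)
  also have "\<dots> \<le> ennreal (8 * sqrt (2 / 2 ^ j)) * (\<integral>\<^sup>+x. ennreal (F x powr 2) \<partial>lborel)"
    unfolding sum_distrib_left[symmetric] by (intro mult_left_mono dif_orthogonal K) simp
  finally show ?thesis .
qed

end

lemma dmax_add:
  assumes F: "nice F" and G: "nice G"
  shows "dmax K j (\<lambda>x. F x + G x) x \<le> dmax K j F x + dmax K j G x"
proof -
  have "ennreal (dmax K j (\<lambda>x. F x + G x) x) \<le> ennreal (dmax K j F x) + ennreal (dmax K j G x)"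
    unfolding dif_sup[OF nice_add[OF F G]]
  proof (rule SUP_least)
    fix k assume k: "k \<in> K"
    obtain B where B: "\<And>x. \<bar>dif j k F x\<bar> \<le> B" using Eu_difference(2)[OF F len_pos] unfolding dif_def by blast
    obtain B' where B': "\<And>x. \<bar>dif j k G x\<bar> \<le> B'" using Eu_difference(2)[OF G len_pos] unfolding dif_def by blast
    have hl: "0 < len j k / 2" using len_pos[of j k] by simp
    have "dif j k (\<lambda>x. F x + G x) = (\<lambda>x. dif j k F x + dif j k G x)"
      by (rule ext) (simp add: dif_def Eu_add[OF F G len_pos] Eu_add[OF F G hl])
    then have "curve_avg (r k) (c k) (dif j k (\<lambda>x. F x + G x)) x = curve_avg (r k) (c k) (dif j k F) x + curve_avg (r k) (c k) (dif j k G) x"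
      using curve_avg_add(1)[OF dif_measurable[OF F] B dif_measurable[OF G] B'] by simp
    then have "ennreal \<bar>curve_avg (r k) (c k) (dif j k (\<lambda>x. F x + G x)) x\<bar> \<le> ennreal (\<bar>curve_avg (r k) (c k) (dif j k F) x\<bar> + \<bar>curve_avg (r k) (c k) (dif j k G) x\<bar>)"
      by (intro ennreal_leI) simp
    also have "\<dots> = ennreal \<bar>curve_avg (r k) (c k) (dif j k F) x\<bar> + ennreal \<bar>curve_avg (r k) (c k) (dif j k G) x\<bar>"
      by (intro ennreal_plus) auto
    also have "\<dots> \<le> ennreal (dmax K j F x) + ennreal (dmax K j G x)"
      unfolding dif_sup[OF F] dif_sup[OF G] by (intro add_mono SUP_upper k)
    finally show "ennreal \<bar>curve_avg (r k) (c k) (dif j k (\<lambda>x. F x + G x)) x\<bar> \<le> ennreal (dmax K j F x) + ennreal (dmax K j G x)" .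
  qed
  also have "\<dots> = ennreal (dmax K j F x + dmax K j G x)"
    by (intro ennreal_plus[symmetric] dmax_nonneg F G)
  finally show ?thesis
    using add_nonneg_nonneg[OF dmax_nonneg[OF F] dmax_nonneg[OF G]] by (simp only: ennreal_le_iff)
qed

end

section \<open>Geometric decay of the differences and summation over the steps\<close>

lemma decay_combine:
  fixes A B \<alpha> \<beta> :: real
  assumes AB: "0 \<le> A" "0 \<le> B" and \<alpha>: "0 < \<alpha>" "\<alpha> < 1" and \<beta>: "0 < \<beta>" "\<beta> < 1"
  shows "\<exists>C x. 0 \<le> C \<and> 0 < x \<and> x < 1 \<and> (\<forall>j::nat. A * (13 + 2 * real j) * \<alpha> ^ j + B * \<beta> ^ j \<le> C * x ^ j)"
proof -
  define y where "y = max \<alpha> \<beta>"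
  have y: "0 < y" "y < 1" using \<alpha> \<beta> by (auto simp: y_def)
  obtain C where C: "0 \<le> C" "\<And>j::nat. (13 + 2 * real j) * y ^ j \<le> C * sqrt y ^ j"
    using polynomial_geometric_bound[OF y] by blast
  have "A * (13 + 2 * real j) * \<alpha> ^ j + B * \<beta> ^ j \<le> (A + B) * C * sqrt y ^ j" for j
  proof -
    have pw: "\<alpha> ^ j \<le> y ^ j" "\<beta> ^ j \<le> y ^ j" using \<alpha> \<beta> by (auto simp: y_def intro: power_mono)
    have "A * (13 + 2 * real j) * \<alpha> ^ j \<le> A * (13 + 2 * real j) * y ^ j"
      using AB pw by (intro mult_left_mono) auto
    moreover have "B * \<beta> ^ j \<le> B * ((13 + 2 * real j) * y ^ j)"
    proof (rule mult_left_mono)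
      have "1 * y ^ j \<le> (13 + 2 * real j) * y ^ j" using y by (intro mult_right_mono) auto
      then show "\<beta> ^ j \<le> (13 + 2 * real j) * y ^ j" using pw by linarith
    qed fact
    moreover have "A * ((13 + 2 * real j) * y ^ j) + B * ((13 + 2 * real j) * y ^ j) \<le> A * (C * sqrt y ^ j) + B * (C * sqrt y ^ j)"
      using C AB by (intro add_mono mult_left_mono) auto
    ultimately show ?thesis by (simp add: algebra_simps)
  qed
  then show ?thesis using AB C y by (intro exI[of _ "(A + B) * C"] exI[of _ "sqrt y"]) auto
qed

text \<open>Jensen's inequality for a weighted counting measure. It stands in for the triangle
  inequality in L^p: with geometric weights, the p-th power of a sum is bounded by a sum of p-th
  powers that can be integrated term by term.\<close>

lemma weighted_sum_jensen_powr:
  fixes a :: "nat \<Rightarrow> ennreal" and w :: "nat \<Rightarrow> real"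
  assumes I: "finite I" and w: "\<And>j. 0 < w j" and m: "sum w I \<le> m" "0 < m" and p: "1 < p"
  shows "ennreal_powr (\<Sum>j\<in>I. a j) p \<le> ennreal (m powr (p - 1)) * (\<Sum>j\<in>I. ennreal (w j powr (1 - p)) * ennreal_powr (a j) p)"
proof -
  define N where "N = density (count_space I) (\<lambda>j. ennreal (w j))"
  have N: "(\<integral>\<^sup>+j. F j \<partial>N) = (\<Sum>j\<in>I. ennreal (w j) * F j)" for F :: "nat \<Rightarrow> ennreal"
    unfolding N_def using I by (simp add: nn_integral_density nn_integral_count_space_finite)
  have "emeasure N (space N) = (\<integral>\<^sup>+j. 1 \<partial>N)" by simp
  also have "\<dots> = ennreal (sum w I)" unfolding N using w by (simp add: less_imp_le)
  also have "\<dots> \<le> ennreal m" using m by (intro ennreal_leI)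
  finally have eN: "emeasure N (space N) \<le> ennreal m" .
  have "ennreal_powr (\<integral>\<^sup>+j. ennreal (1 / w j) * a j \<partial>N) p \<le> ennreal (m powr (p - 1)) * (\<integral>\<^sup>+j. ennreal_powr (ennreal (1 / w j) * a j) p \<partial>N)"
    by (rule nn_integral_jensen_powr[OF _ eN m(2) p]) (simp add: N_def)
  also have "(\<integral>\<^sup>+j. ennreal (1 / w j) * a j \<partial>N) = (\<Sum>j\<in>I. a j)"
  proof -
    have "ennreal (w j) * (ennreal (1 / w j) * a j) = a j" for j
      using w[of j] by (simp flip: mult.assoc ennreal_mult)
    then show ?thesis unfolding N by simp
  qed
  also have "(\<integral>\<^sup>+j. ennreal_powr (ennreal (1 / w j) * a j) p \<partial>N) = (\<Sum>j\<in>I. ennreal (w j powr (1 - p)) * ennreal_powr (a j) p)"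
    unfolding N
  proof (rule sum.cong)
    fix j
    have "ennreal (w j) * ennreal_powr (ennreal (1 / w j) * a j) p = ennreal (w j) * ennreal ((1 / w j) powr p) * ennreal_powr (a j) p"
      using w[of j] p by (simp add: ennreal_powr_mult ennreal_powr_ennreal mult.assoc)
    also have "ennreal (w j) * ennreal ((1 / w j) powr p) = ennreal (w j * (1 / w j) powr p)"
      using w[of j] by (intro ennreal_mult[symmetric]) auto
    also have "w j * (1 / w j) powr p = w j powr (1 - p)"
      using w[of j] by (simp add: powr_divide powr_diff)
    finally show "ennreal (w j) * ennreal_powr (ennreal (1 / w j) * a j) p = ennreal (w j powr (1 - p)) * ennreal_powr (a j) p" .
  qed simp
  finally show ?thesis .
qed

lemma sqrt_geometric: "8 * sqrt (2 / 2 ^ j) = 8 * sqrt 2 * (2 powr (-1/2)) ^ j"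
proof -
  have "(2 powr (-1/2)) ^ j = 1 / sqrt (2 ^ j)"
    by (simp add: powr_minus_divide powr_half_sqrt real_sqrt_power power_divide)
  then show ?thesis by (simp add: real_sqrt_divide)
qed

context lacunary_curve
begin

lemma growth_Suc: "growth q (Suc j) = growth q 0 / 11 * (13 + 2 * real j)"
proof -
  define g where "g = 24 powr q * (q * (2 * (1 / 2) powr (1 - q) / (q - 1)))"
  have "growth q j = g * (11 + 2 * real j)" for j by (simp add: growth_def g_def mult_ac)
  then show ?thesis by simp
qed

text \<open>At exponent 2 the constant decays like 2^(-j/2); at every other exponent q > 1 it grows
  linearly. Interpolating between 2 and a q on the other side of p, with a cut height that depends
  geometrically on j, sacrifices half of the decay at exponent 2 to create decay at exponent
  q.\<close>

lemma dmax_decay: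
  assumes p: "1 < p"
  shows "\<exists>C x. 0 \<le> C \<and> 0 < x \<and> x < 1 \<and> (\<forall>K j F. finite K \<longrightarrow> nice F \<longrightarrow>
    (\<integral>\<^sup>+x. ennreal (dmax K j F x powr p) \<partial>lborel) \<le> ennreal (C * x ^ j) * (\<integral>\<^sup>+x. ennreal (F x powr p) \<partial>lborel))"
proof -
  have int: "(\<integral>\<^sup>+x. ennreal (dmax K j F x powr p) \<partial>lborel) \<le>
    ennreal (p * (2 powr q0 * B0 * \<gamma> powr (q0 - p) / (p - q0) + 2 powr q1 * B1 * \<gamma> powr (q1 - p) / (q1 - p))) * (\<integral>\<^sup>+x. ennreal (F x powr p) \<partial>lborel)"
    if "finite K" "nice F" "0 < q0" "q0 < p" "p < q1" "0 < \<gamma>" "0 \<le> B0" "0 \<le> B1"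
      "\<And>F. nice F \<Longrightarrow> (\<integral>\<^sup>+x. ennreal (dmax K j F x powr q0) \<partial>lborel) \<le> ennreal B0 * (\<integral>\<^sup>+x. ennreal (F x powr q0) \<partial>lborel)"
      "\<And>F. nice F \<Longrightarrow> (\<integral>\<^sup>+x. ennreal (dmax K j F x powr q1) \<partial>lborel) \<le> ennreal B1 * (\<integral>\<^sup>+x. ennreal (F x powr q1) \<partial>lborel)"
    for K j F q0 q1 \<gamma> B0 B1
    by (rule sublinear_interpolation[of "dmax K j"]) (use that dmax_measurable dmax_nonneg dmax_add in auto)
  consider "p = 2" | "p < 2" | "2 < p" by linarith
  then show ?thesis
  proof cases
    case 1
    show ?thesis
    proof (rule exI[of _ "8 * sqrt 2"], rule exI[of _ "2 powr (-1/2)"], intro conjI allI impI)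
      show "(2::real) powr (-1/2) < 1" by (rule powr_less_one) auto
      show "(\<integral>\<^sup>+x. ennreal (dmax K j F x powr p) \<partial>lborel) \<le> ennreal (8 * sqrt 2 * (2 powr (-1/2)) ^ j) * (\<integral>\<^sup>+x. ennreal (F x powr p) \<partial>lborel)"
        if "finite K" "nice F" for K j F
        unfolding sqrt_geometric[symmetric] 1 by (rule dmax_L2[OF that(2,1)])
    qed auto
  next
    case 2
    define q where "q = (1 + p) / 2"
    have q: "1 < q" "q < p" using p by (auto simp: q_def)
    \<comment> \<open>Chosen so that the cut height below satisfies \<gamma>^(2 - p) = 2^(j/4). Of
      the decay 2^(-j/2) at exponent 2 this leaves 2^(-j/4).\<close>
    define \<eta> where "\<eta> = 1 / (4 * (2 - p))"
    have \<eta>: "0 < \<eta>" "\<eta> * (2 - p) = 1/4" using 2 by (auto simp: \<eta>_def field_simps)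
    define A where "A = p * (2 powr q * (2 * (growth q 0 / 11)) / (p - q))"
    define B where "B = p * (2 powr 2 * (8 * sqrt 2) / (2 - p))"
    have "0 \<le> A" "0 \<le> B" using p q 2 growth_nonneg[OF q(1), of 0] by (auto simp: A_def B_def)
    moreover have "0 < 2 powr (\<eta> * (q - p))" "2 powr (\<eta> * (q - p)) < 1" "0 < (2::real) powr (-1/4)" "(2::real) powr (-1/4) < 1"
      using \<eta> q by (auto intro!: powr_less_one mult_pos_neg)
    ultimately obtain C x where C: "0 \<le> C" "0 < x" "x < 1" "\<And>j::nat. A * (13 + 2 * real j) * (2 powr (\<eta> * (q - p))) ^ j + B * (2 powr (-1/4)) ^ j \<le> C * x ^ j"
      using decay_combine by metis
    have "(\<integral>\<^sup>+x. ennreal (dmax K j F x powr p) \<partial>lborel) \<le> ennreal (C * x ^ j) * (\<integral>\<^sup>+x. ennreal (F x powr p) \<partial>lborel)" if K: "finite K" and F: "nice F" for K j F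
    proof -
      \<comment> \<open>Now q < p, so a height growing with j makes \<gamma>^(q - p) decay
        geometrically.\<close>
      define \<gamma> where "\<gamma> = 2 powr (\<eta> * real j)"
      have "(\<integral>\<^sup>+x. ennreal (dmax K j F x powr p) \<partial>lborel) \<le>
        ennreal (p * (2 powr q * (2 * growth q (Suc j)) * \<gamma> powr (q - p) / (p - q) + 2 powr 2 * (8 * sqrt (2 / 2 ^ j)) * \<gamma> powr (2 - p) / (2 - p))) * (\<integral>\<^sup>+x. ennreal (F x powr p) \<partial>lborel)"
        by (rule int) (use K F q 2 growth_nonneg dmax_growth dmax_L2 in \<open>auto simp: \<gamma>_def\<close>)
      also have "\<gamma> powr (q - p) = (2 powr (\<eta> * (q - p))) ^ j"
        by (simp add: \<gamma>_def powr_powr mult_ac flip: powr_realpow)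
      also have "8 * sqrt (2 / 2 ^ j) = 8 * sqrt 2 * (2 powr (-1/2)) ^ j" by (rule sqrt_geometric)
      also have "\<gamma> powr (2 - p) = (2 powr (1/4)) ^ j"
      proof -
        have "\<eta> * real j * (2 - p) = (\<eta> * (2 - p)) * real j" by (simp add: algebra_simps)
        then show ?thesis unfolding \<gamma>_def powr_powr by (simp only: \<eta>) (simp flip: powr_realpow add: powr_powr)
      qed
      also have "p * (2 powr q * (2 * growth q (Suc j)) * (2 powr (\<eta> * (q - p))) ^ j / (p - q) + 2 powr 2 * (8 * sqrt 2 * (2 powr (-1/2)) ^ j) * (2 powr (1/4)) ^ j / (2 - p))
         = A * (13 + 2 * real j) * (2 powr (\<eta> * (q - p))) ^ j + B * ((2 powr (-1/2)) ^ j * (2 powr (1/4)) ^ j)"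
      proof -
        define g N where "g = growth q 0 / 11" and "N = 13 + 2 * real j"
        show ?thesis unfolding A_def B_def growth_Suc g_def[symmetric] N_def[symmetric] divide_inverse
          by (simp only: distrib_left distrib_right mult_ac add.commute)
      qed
      also have "(2 powr (-1/2)) ^ j * (2 powr (1/4)) ^ j = ((2::real) powr (-1/4)) ^ j"
        by (simp flip: power_mult_distrib powr_add)
      finally show ?thesis by (rule order_trans) (rule mult_right_mono[OF ennreal_leI[OF C(4)]], simp)
    qed
    then show ?thesis using C by blast
  next
    case 3
    define q where "q = p + 1"
    have q: "1 < q" "p < q" using p by (auto simp: q_def)
    define \<eta> where "\<eta> = 1 / (4 * (p - 2))"
    have \<eta>: "0 < \<eta>" "\<eta> * (p - 2) = 1/4" using 3 by (auto simp: \<eta>_def field_simps)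
    define A where "A = p * (2 powr q * (2 * (growth q 0 / 11)) / (q - p))"
    define B where "B = p * (2 powr 2 * (8 * sqrt 2) / (p - 2))"
    have "0 \<le> A" "0 \<le> B" using p q 3 growth_nonneg[OF q(1), of 0] by (auto simp: A_def B_def)
    moreover have "0 < 2 powr (\<eta> * (p - q))" "2 powr (\<eta> * (p - q)) < 1" "0 < (2::real) powr (-1/4)" "(2::real) powr (-1/4) < 1"
      using \<eta> q by (auto intro!: powr_less_one mult_pos_neg)
    ultimately obtain C x where C: "0 \<le> C" "0 < x" "x < 1" "\<And>j::nat. A * (13 + 2 * real j) * (2 powr (\<eta> * (p - q))) ^ j + B * (2 powr (-1/4)) ^ j \<le> C * x ^ j"
      using decay_combine by metis
    have "(\<integral>\<^sup>+x. ennreal (dmax K j F x powr p) \<partial>lborel) \<le> ennreal (C * x ^ j) * (\<integral>\<^sup>+x. ennreal (F x powr p) \<partial>lborel)" if K: "finite K" and F: "nice F" for K j F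
    proof -
      \<comment> \<open>For p > 2 the exponent q lies above p, so the height has to shrink with j;
        again \<gamma>^(2 - p) = 2^(j/4), while \<gamma>^(q - p) decays.\<close>
      define \<gamma> where "\<gamma> = 2 powr (- \<eta> * real j)"
      have "(\<integral>\<^sup>+x. ennreal (dmax K j F x powr p) \<partial>lborel) \<le>
        ennreal (p * (2 powr 2 * (8 * sqrt (2 / 2 ^ j)) * \<gamma> powr (2 - p) / (p - 2) + 2 powr q * (2 * growth q (Suc j)) * \<gamma> powr (q - p) / (q - p))) * (\<integral>\<^sup>+x. ennreal (F x powr p) \<partial>lborel)"
        by (rule int) (use K F q 3 growth_nonneg dmax_growth dmax_L2 in \<open>auto simp: \<gamma>_def\<close>)
      also have "\<gamma> powr (q - p) = (2 powr (\<eta> * (p - q))) ^ j"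
        by (simp add: \<gamma>_def powr_powr algebra_simps flip: powr_realpow)
      also have "8 * sqrt (2 / 2 ^ j) = 8 * sqrt 2 * (2 powr (-1/2)) ^ j" by (rule sqrt_geometric)
      also have "\<gamma> powr (2 - p) = (2 powr (1/4)) ^ j"
      proof -
        have "- \<eta> * real j * (2 - p) = (\<eta> * (p - 2)) * real j" by (simp add: algebra_simps)
        then show ?thesis unfolding \<gamma>_def powr_powr by (simp only: \<eta>) (simp flip: powr_realpow add: powr_powr)
      qed
      also have "p * (2 powr 2 * (8 * sqrt 2 * (2 powr (-1/2)) ^ j) * (2 powr (1/4)) ^ j / (p - 2) + 2 powr q * (2 * growth q (Suc j)) * (2 powr (\<eta> * (p - q))) ^ j / (q - p))
         = A * (13 + 2 * real j) * (2 powr (\<eta> * (p - q))) ^ j + B * ((2 powr (-1/2)) ^ j * (2 powr (1/4)) ^ j)"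
      proof -
        define g N where "g = growth q 0 / 11" and "N = 13 + 2 * real j"
        show ?thesis unfolding A_def B_def growth_Suc g_def[symmetric] N_def[symmetric] divide_inverse
          by (simp only: distrib_left distrib_right mult_ac add.commute)
      qed
      also have "(2 powr (-1/2)) ^ j * (2 powr (1/4)) ^ j = ((2::real) powr (-1/4)) ^ j"
        by (simp flip: power_mult_distrib powr_add)
      finally show ?thesis by (rule order_trans) (rule mult_right_mono[OF ennreal_leI[OF C(4)]], simp)
    qed
    then show ?thesis using C by blast
  qed
qed

lemma nmax_measurable:
  assumes K: "finite K" and F: "F \<in> borel_measurable borel" shows "nmax K j F \<in> borel_measurable borel"
  unfolding nmax_def[abs_def]
  by (intro borel_measurable_SUP countable_finite K ncurve_avg_measurable nEu_measurable len_pos F)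

text \<open>For each curve separately, resolution J is reached from resolution 0 through J
  successive differences; the supremum over curves is taken afterwards, term by term.\<close>

lemma nmax_telescope:
  assumes K: "finite K" and F: "nice F"
  shows "nmax K J F x \<le> nmax K 0 F x + (\<Sum>j<J. ennreal (dmax K j F x))"
  unfolding nmax_def[of K J]
proof (rule SUP_least)
  fix k assume k: "k \<in> K"
  define a where "a j = curve_avg (r k) (c k) (Eu (len j k) F) x" for j
  obtain B where B: "\<And>j k x. 0 \<le> Eu (len j k) F x" using Eu_nice_bounds[OF F] by blast
  have a0: "0 \<le> a j" for j unfolding a_def curve_avg_def using B by (auto intro!: integral_nonneg_AE)
  have "ennreal (a J) \<le> ennreal (a 0) + (\<Sum>j<J. ennreal \<bar>curve_avg (r k) (c k) (dif j k F) x\<bar>)"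
  proof (induction J)
    case (Suc J)
    have "ennreal (a (Suc J)) \<le> ennreal (a J + \<bar>a (Suc J) - a J\<bar>)" by (intro ennreal_leI) linarith
    also have "\<dots> = ennreal (a J) + ennreal \<bar>curve_avg (r k) (c k) (dif J k F) x\<bar>"
      unfolding curve_avg_dif[OF F] a_def[symmetric] using a0 by (intro ennreal_plus) auto
    also have "\<dots> \<le> ennreal (a 0) + (\<Sum>j<J. ennreal \<bar>curve_avg (r k) (c k) (dif j k F) x\<bar>) + ennreal \<bar>curve_avg (r k) (c k) (dif J k F) x\<bar>"
      by (intro add_right_mono Suc.IH)
    finally show ?case by (simp add: add.assoc)
  qed simp
  also have "\<dots> \<le> nmax K 0 F x + (\<Sum>j<J. ennreal (dmax K j F x))"
    unfolding dif_sup[OF F] a_def curve_avg_Eu_nice[OF F] nmax_def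
    using k by (intro add_mono sum_mono SUP_upper)
  finally show "ncurve_avg (r k) (c k) (nEu (len J k) F) x \<le> nmax K 0 F x + (\<Sum>j<J. ennreal (dmax K j F x))"
    unfolding a_def curve_avg_Eu_nice[OF F] .
qed

text \<open>The constant must not depend on J, because the resolution is sent to infinity
  afterwards.\<close>

lemma nmax_uniform:
  assumes p: "1 < p"
  shows "\<exists>C\<ge>0. \<forall>K J F. finite K \<longrightarrow> nice F \<longrightarrow>
    (\<integral>\<^sup>+x. ennreal_powr (nmax K J F x) p \<partial>lborel) \<le> ennreal C * (\<integral>\<^sup>+x. ennreal (F x powr p) \<partial>lborel)"
proof -
  obtain D x where D: "0 \<le> D" "0 < x" "x < 1" and decay: "\<And>K j F. finite K \<Longrightarrow> nice F \<Longrightarrow>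
    (\<integral>\<^sup>+x. ennreal (dmax K j F x powr p) \<partial>lborel) \<le> ennreal (D * x ^ j) * (\<integral>\<^sup>+x. ennreal (F x powr p) \<partial>lborel)"
    using dmax_decay[OF p] by blast
  \<comment> \<open>With s^p = x the weights s^j balance: the weighted p-th powers of the
    differences are again bounded by a multiple of s^j, as \<open>ws\<close> records.\<close>
  define s where "s = x powr (1 / p)"
  have s: "0 < s" "s < 1" using D p powr_less_mono2[of "1 / p" x 1] by (auto simp: s_def)
  define m where "m = 1 / (1 - s)"
  have m: "0 < m" using s by (simp add: m_def)
  have geo: "(\<Sum>j<J. s ^ j) \<le> m" for J
  proof -
    have "(\<Sum>j<J. s ^ j) \<le> (\<Sum>j. s ^ j)" using s by (intro sum_le_suminf) auto
    then show ?thesis using s by (simp add: m_def suminf_geometric)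
  qed
  have ws: "(s ^ j) powr (1 - p) * x ^ j = s ^ j" for j :: nat
  proof -
    have "x = s powr p" using D p by (simp add: s_def powr_powr)
    then have "x ^ j = s powr (p * real j)" using s by (simp add: powr_powr flip: powr_realpow)
    also have "\<dots> = (s ^ j) powr p" using s by (simp add: powr_powr mult.commute flip: powr_realpow)
    finally have "(s ^ j) powr (1 - p) * x ^ j = (s ^ j) powr (1 - p) * (s ^ j) powr p" by simp
    also have "\<dots> = s ^ j" using s by (simp flip: powr_add)
    finally show ?thesis .
  qed
  define C where "C = 2 powr p * (growth p 0 + m powr (p - 1) * (D * m))"
  have C: "0 \<le> C" using growth_nonneg[OF p, of 0] m D by (simp add: C_def)
  have "(\<integral>\<^sup>+x. ennreal_powr (nmax K J F x) p \<partial>lborel) \<le> ennreal C * (\<integral>\<^sup>+x. ennreal (F x powr p) \<partial>lborel)"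
    if K: "finite K" and F: "nice F" for K J F
  proof -
    define I where "I = (\<integral>\<^sup>+x. ennreal (F x powr p) \<partial>lborel)"
    have [measurable]: "nmax K 0 F \<in> borel_measurable borel" using F by (intro nmax_measurable K) (auto simp: nice_def)
    have [measurable]: "dmax K j F \<in> borel_measurable borel" for j by (rule dmax_measurable[OF F K])
    have "(\<integral>\<^sup>+x. ennreal_powr (nmax K J F x) p \<partial>lborel) \<le>
      (\<integral>\<^sup>+x. ennreal (2 powr p) * (ennreal_powr (nmax K 0 F x) p + ennreal (m powr (p - 1)) * (\<Sum>j<J. ennreal ((s ^ j) powr (1 - p)) * ennreal (dmax K j F x powr p))) \<partial>lborel)"
    proof (rule nn_integral_mono)
      fix z
      define u v where "u = nmax K 0 F z" and "v = (\<Sum>j<J. ennreal (dmax K j F z))"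
      have "u + v \<le> 2 * max u v" unfolding mult_2 by (intro add_mono) auto
      then have "ennreal_powr (nmax K J F z) p \<le> ennreal_powr (2 * max u v) p"
        using nmax_telescope[OF K F, of J z] p unfolding u_def v_def by (intro ennreal_powr_mono) auto
      also have "\<dots> = ennreal (2 powr p) * ennreal_powr (max u v) p"
        using p ennreal_powr_ennreal[of 2 p] by (simp add: ennreal_powr_mult)
      also have "ennreal_powr (max u v) p \<le> ennreal_powr u p + ennreal_powr v p" by (simp add: max_def)
      also have "ennreal_powr v p \<le> ennreal (m powr (p - 1)) * (\<Sum>j<J. ennreal ((s ^ j) powr (1 - p)) * ennreal_powr (ennreal (dmax K j F z)) p)"
        unfolding v_def using s geo m p by (intro weighted_sum_jensen_powr) auto
      finally show "ennreal_powr (nmax K J F z) p \<le> ennreal (2 powr p) * (ennreal_powr (nmax K 0 F z) p + ennreal (m powr (p - 1)) * (\<Sum>j<J. ennreal ((s ^ j) powr (1 - p)) * ennreal (dmax K j F z powr p)))"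
        by (simp add: u_def ennreal_powr_ennreal dmax_nonneg[OF F] mult_left_mono add_left_mono)
    qed
    also have "\<dots> = ennreal (2 powr p) * ((\<integral>\<^sup>+x. ennreal_powr (nmax K 0 F x) p \<partial>lborel) + ennreal (m powr (p - 1)) * (\<Sum>j<J. ennreal ((s ^ j) powr (1 - p)) * (\<integral>\<^sup>+x. ennreal (dmax K j F x powr p) \<partial>lborel)))"
      by (simp add: nn_integral_cmult nn_integral_add nn_integral_sum)
    also have "\<dots> \<le> ennreal (2 powr p) * (ennreal (growth p 0) * I + ennreal (m powr (p - 1)) * (\<Sum>j<J. ennreal ((s ^ j) powr (1 - p)) * (ennreal (D * x ^ j) * I)))"
      unfolding I_def by (intro mult_left_mono add_mono sum_mono nmax_bound decay K F p) auto
    also have "(\<Sum>j<J. ennreal ((s ^ j) powr (1 - p)) * (ennreal (D * x ^ j) * I)) = (\<Sum>j<J. ennreal (D * s ^ j) * I)"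
    proof (rule sum.cong)
      fix j
      have "ennreal ((s ^ j) powr (1 - p)) * ennreal (D * x ^ j) = ennreal ((s ^ j) powr (1 - p) * (D * x ^ j))"
        using D by (intro ennreal_mult[symmetric]) auto
      also have "(s ^ j) powr (1 - p) * (D * x ^ j) = D * s ^ j" using ws[of j] by (simp add: mult.left_commute)
      finally show "ennreal ((s ^ j) powr (1 - p)) * (ennreal (D * x ^ j) * I) = ennreal (D * s ^ j) * I" by (simp add: mult.assoc[symmetric])
    qed simp
    also have "\<dots> = ennreal (D * (\<Sum>j<J. s ^ j)) * I"
      using s D by (simp add: sum_distrib_left flip: sum_distrib_right)
    also have "ennreal (2 powr p) * (ennreal (growth p 0) * I + ennreal (m powr (p - 1)) * (ennreal (D * (\<Sum>j<J. s ^ j)) * I))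
      \<le> ennreal (2 powr p) * (ennreal (growth p 0) * I + ennreal (m powr (p - 1)) * (ennreal (D * m) * I))"
      using D geo[of J] by (intro mult_left_mono add_left_mono mult_right_mono ennreal_leI) auto
    also have "\<dots> = ennreal C * I"
    proof -
      have "ennreal C = ennreal (2 powr p) * (ennreal (growth p 0) + ennreal (m powr (p - 1)) * ennreal (D * m))"
        unfolding C_def using growth_nonneg[OF p, of 0] D m
        by (simp add: ennreal_mult[symmetric] ennreal_plus[symmetric] del: ennreal_plus)
      then show ?thesis by (simp add: distrib_right mult.assoc)
    qed
    finally show ?thesis by (simp add: I_def)
  qed
  then show ?thesis using C by blast
qed

end

section \<open>From averaged functions to all Borel functions\<close>

lemma ennreal_powr_liminf:
  fixes X :: "nat \<Rightarrow> ennreal"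
  assumes p: "0 < p" shows "ennreal_powr (liminf X) p \<le> liminf (\<lambda>j. ennreal_powr (X j) p)"
  unfolding liminf_SUP_INF ennreal_powr_SUP[OF p]
  by (intro SUP_mono bexI[of _ "_::nat"] INF_greatest ennreal_powr_mono p INF_lower) auto

text \<open>Along horizontal lines G is lower semicontinuous, so its cell averages recover at least
  its value at every point, and Fatou's lemma can then be used on each single curve. Outer
  regularity of the finitely many level sets of F makes the excess of G arbitrarily cheap in
  L^p.\<close>

lemma simple_lsc_majorant:
  fixes F :: "real \<times> real \<Rightarrow> real"
  assumes F: "nice F" and fin: "finite (range F)" and p: "1 < p" and \<epsilon>: "0 < (\<epsilon>::real)"
  obtains G where "nice G" "\<And>x. F x \<le> G x" "\<And>x. \<exists>d>0. \<forall>v. \<bar>v - fst x\<bar> < d \<longrightarrow> G x \<le> G (v, snd x)"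
    "(\<integral>\<^sup>+x. ennreal (G x powr p) \<partial>lborel) \<le> (\<integral>\<^sup>+x. ennreal (F x powr p) \<partial>lborel) + ennreal \<epsilon>"
proof -
  obtain B R where Fm [measurable]: "F \<in> borel_measurable borel" and F0: "\<And>x. 0 \<le> F x" and FB: "\<And>x. F x \<le> B"
    and FR: "\<forall>x. R < \<bar>fst x\<bar> \<or> R < \<bar>snd x\<bar> \<longrightarrow> F x = 0" by (rule niceE[OF F]) (rule that)
  define Y where "Y = range F - {0}"
  have Y: "finite Y" "\<And>y. y \<in> Y \<Longrightarrow> 0 < y" using fin F0 by (auto simp: Y_def less_le)
  define T where "T = \<Sum>Y"
  have T: "0 \<le> T" unfolding T_def using Y by (intro sum_nonneg) (auto intro: less_imp_le)
  \<comment> \<open>An open box around the support; the open sets are kept inside it so that G has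
    bounded support too.\<close>
  define \<Omega> where "\<Omega> = {- (R + 1)<..<R + 1} \<times> {- (R + 1)<..<R + 1}"
  have \<Omega>: "open \<Omega>" by (auto simp: \<Omega>_def intro: open_Times)
  \<comment> \<open>The measure allowed for each excess set. On such a set G^p is at most T^p, and
    there are card Y of them; adding 1 to both factors keeps the quotient defined.\<close>
  define e where "e = \<epsilon> / ((T powr p + 1) * (real (card Y) + 1))"
  have e: "0 < e" using \<epsilon> by (simp add: e_def add_nonneg_pos)
  define A where "A y = F -` {y}" for y
  have Am [measurable]: "A y \<in> sets borel" for y
    using measurable_sets[OF Fm, of "{y}"] by (simp add: A_def)
  have "\<exists>U. open U \<and> A y \<subseteq> U \<and> U \<subseteq> \<Omega> \<and> emeasure lborel (U - A y) \<le> ennreal e" if y: "y \<in> Y" for y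
  proof -
    obtain U where U: "open U" "A y \<subseteq> U" "emeasure lborel (U - A y) < ennreal e"
      using outer_regular_lborel[OF Am e] by blast
    have "A y \<subseteq> \<Omega>"
    proof
      fix x assume "x \<in> A y"
      then have "F x \<noteq> 0" using Y(2)[OF y] by (auto simp: A_def)
      then have "\<not> (R < \<bar>fst x\<bar> \<or> R < \<bar>snd x\<bar>)" using FR by blast
      then show "x \<in> \<Omega>" by (cases x) (auto simp: \<Omega>_def)
    qed
    moreover have "emeasure lborel (U \<inter> \<Omega> - A y) \<le> emeasure lborel (U - A y)"
      using U(1) by (intro emeasure_mono) (auto simp: borel_open)
    ultimately show ?thesis using U \<Omega> by (intro exI[of _ "U \<inter> \<Omega>"]) (auto simp: open_Int)
  qed
  then obtain U where U: "\<And>y. y \<in> Y \<Longrightarrow> open (U y)" "\<And>y. y \<in> Y \<Longrightarrow> A y \<subseteq> U y" "\<And>y. y \<in> Y \<Longrightarrow> U y \<subseteq> \<Omega>"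
    "\<And>y. y \<in> Y \<Longrightarrow> emeasure lborel (U y - A y) \<le> ennreal e" by metis
  have Um: "U y \<in> sets borel" if "y \<in> Y" for y using U(1)[OF that] by (rule borel_open)
  define G where "G x = (\<Sum>y\<in>Y. y * indicator (U y) x)" for x
  have Gm [measurable]: "G \<in> borel_measurable borel"
    unfolding G_def using Um by (intro borel_measurable_sum borel_measurable_times borel_measurable_indicator) auto
  have G0: "0 \<le> G x" for x unfolding G_def using Y by (intro sum_nonneg mult_nonneg_nonneg) (auto intro: less_imp_le)
  have GT: "G x \<le> T" for x
    unfolding G_def T_def using Y by (intro sum_mono) (auto simp: indicator_def intro: less_imp_le)
  have FG: "F x \<le> G x" for x
  proof (cases "F x = 0")
    case False
    then have y: "F x \<in> Y" by (simp add: Y_def)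
    then have "x \<in> U (F x)" using U(2)[OF y] by (auto simp: A_def)
    then have "F x = F x * indicator (U (F x)) x" by simp
    also have "\<dots> \<le> G x" unfolding G_def using Y y by (intro member_le_sum mult_nonneg_nonneg) (auto intro: less_imp_le)
    finally show ?thesis .
  qed (simp add: G0)
  have Gnice: "nice G"
    unfolding nice_def
  proof (intro conjI)
    show "\<exists>B. \<forall>x. 0 \<le> G x \<and> G x \<le> B" using G0 GT by blast
    have "G x = 0" if x: "R + 1 < \<bar>fst x\<bar> \<or> R + 1 < \<bar>snd x\<bar>" for x
    proof -
      have "x \<notin> \<Omega>" using x by (cases x) (auto simp: \<Omega>_def)
      then have "x \<notin> U y" if "y \<in> Y" for y using U(3)[OF that] by blast
      then show ?thesis unfolding G_def by (intro sum.neutral) simp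
    qed
    then show "\<exists>R. \<forall>x. R < \<bar>fst x\<bar> \<or> R < \<bar>snd x\<bar> \<longrightarrow> G x = 0" by blast
  qed fact
  have lsc: "\<exists>d>0. \<forall>v. \<bar>v - fst x\<bar> < d \<longrightarrow> G x \<le> G (v, snd x)" for x
  proof -
    define W where "W = \<Inter> (U ` {y \<in> Y. x \<in> U y})"
    have "open W" "x \<in> W" unfolding W_def using Y U(1) by (auto intro!: open_INT)
    then obtain d where d: "0 < d" "ball x d \<subseteq> W" by (meson open_contains_ball)
    have "G x \<le> G (v, snd x)" if v: "\<bar>v - fst x\<bar> < d" for v
    proof -
      have "dist x (v, snd x) = \<bar>v - fst x\<bar>" by (cases x) (simp add: dist_prod_def dist_real_def abs_minus_commute)
      then have vW: "(v, snd x) \<in> W" using d(2) v by auto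
      show ?thesis
        unfolding G_def
      proof (rule sum_mono)
        fix y assume y: "y \<in> Y"
        show "y * indicator (U y) x \<le> y * indicator (U y) (v, snd x)"
          using vW y Y(2)[OF y] by (auto simp: W_def indicator_def)
      qed
    qed
    then show ?thesis using d(1) by blast
  qed
  have "(\<integral>\<^sup>+x. ennreal (G x powr p) \<partial>lborel) \<le> (\<integral>\<^sup>+x. ennreal (F x powr p) + (\<Sum>y\<in>Y. ennreal (T powr p) * indicator (U y - A y) x) \<partial>lborel)"
  proof (rule nn_integral_mono)
    fix x
    show "ennreal (G x powr p) \<le> ennreal (F x powr p) + (\<Sum>y\<in>Y. ennreal (T powr p) * indicator (U y - A y) x)"
    proof (cases "\<exists>y\<in>Y. x \<in> U y - A y")
      case True
      then obtain y where y: "y \<in> Y" "x \<in> U y - A y" by blast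
      have "ennreal (G x powr p) \<le> ennreal (T powr p)" using G0 GT p by (intro ennreal_leI powr_mono2) auto
      also have "\<dots> = ennreal (T powr p) * indicator (U y - A y) x" using y by simp
      also have "\<dots> \<le> (\<Sum>y\<in>Y. ennreal (T powr p) * indicator (U y - A y) x)"
        by (rule member_le_sum[of y Y "\<lambda>y. ennreal (T powr p) * indicator (U y - A y) x"]) (use Y y in auto)
      also have "\<dots> \<le> ennreal (F x powr p) + (\<Sum>y\<in>Y. ennreal (T powr p) * indicator (U y - A y) x)" by simp
      finally show ?thesis .
    next
      case False
      \<comment> \<open>Outside the excess sets, x can lie only in the open set that belongs to its
        own value.\<close>
      have "G x \<le> (\<Sum>y\<in>Y. if y = F x then F x else 0)"
        unfolding G_def
      proof (rule sum_mono)
        fix y assume y: "y \<in> Y"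
        show "y * indicator (U y) x \<le> (if y = F x then F x else 0)"
        proof (cases "x \<in> U y")
          case True
          then have "x \<in> A y" using False y by blast
          then have "F x = y" by (simp add: A_def)
          then show ?thesis using True by simp
        next
          case x: False
          then show ?thesis using F0[of x] by simp
        qed
      qed
      also have "\<dots> \<le> F x" using Y F0[of x] by simp
      finally have "ennreal (G x powr p) \<le> ennreal (F x powr p)" using G0 p by (intro ennreal_leI powr_mono2) auto
      also have "\<dots> \<le> ennreal (F x powr p) + (\<Sum>y\<in>Y. ennreal (T powr p) * indicator (U y - A y) x)" by simp
      finally show ?thesis .
    qed
  qed
  also have "\<dots> = (\<integral>\<^sup>+x. ennreal (F x powr p) \<partial>lborel) + (\<Sum>y\<in>Y. ennreal (T powr p) * emeasure lborel (U y - A y))"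
  proof -
    have m: "(\<lambda>x. ennreal (T powr p) * indicator (U y - A y) x) \<in> borel_measurable lborel" if "y \<in> Y" for y
      using Um[OF that] by simp
    have "(\<integral>\<^sup>+x. ennreal (F x powr p) + (\<Sum>y\<in>Y. ennreal (T powr p) * indicator (U y - A y) x) \<partial>lborel)
      = (\<integral>\<^sup>+x. ennreal (F x powr p) \<partial>lborel) + (\<integral>\<^sup>+x. (\<Sum>y\<in>Y. ennreal (T powr p) * indicator (U y - A y) x) \<partial>lborel)"
    proof (rule nn_integral_add)
      show "(\<lambda>x. \<Sum>y\<in>Y. ennreal (T powr p) * indicator (U y - A y) x) \<in> borel_measurable lborel"
        by (rule borel_measurable_sum[OF m])
    qed measurable
    also have "(\<integral>\<^sup>+x. (\<Sum>y\<in>Y. ennreal (T powr p) * indicator (U y - A y) x) \<partial>lborel) = (\<Sum>y\<in>Y. \<integral>\<^sup>+x. ennreal (T powr p) * indicator (U y - A y) x \<partial>lborel)"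
      by (rule nn_integral_sum[OF m])
    also have "\<dots> = (\<Sum>y\<in>Y. ennreal (T powr p) * emeasure lborel (U y - A y))"
      using Um by (intro sum.cong nn_integral_cmult_indicator) auto
    finally show ?thesis .
  qed
  also have "\<dots> \<le> (\<integral>\<^sup>+x. ennreal (F x powr p) \<partial>lborel) + ennreal \<epsilon>"
  proof (rule add_left_mono)
    have "(\<Sum>y\<in>Y. ennreal (T powr p) * emeasure lborel (U y - A y)) \<le> (\<Sum>y\<in>Y. ennreal (T powr p * e))"
    proof (rule sum_mono)
      fix y assume "y \<in> Y"
      then have "ennreal (T powr p) * emeasure lborel (U y - A y) \<le> ennreal (T powr p) * ennreal e"
        by (intro mult_left_mono U(4)) auto
      then show "ennreal (T powr p) * emeasure lborel (U y - A y) \<le> ennreal (T powr p * e)"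
        using e by (simp only: ennreal_mult powr_ge_zero less_imp_le)
    qed
    also have "\<dots> = ennreal (real (card Y) * (T powr p * e))"
      using e by (subst sum_ennreal) auto
    also have "\<dots> \<le> ennreal \<epsilon>"
    proof (rule ennreal_leI)
      have "T powr p * real (card Y) \<le> (T powr p + 1) * (real (card Y) + 1)" by (simp add: algebra_simps)
      then have "(T powr p * real (card Y)) * e \<le> ((T powr p + 1) * (real (card Y) + 1)) * e" using e by (intro mult_right_mono) auto
      also have "\<dots> = \<epsilon>"
      proof -
        have "0 < (T powr p + 1) * (real (card Y) + 1)" by (intro mult_pos_pos add_nonneg_pos) auto
        then have "(T powr p + 1) * (real (card Y) + 1) \<noteq> 0" by linarith
        then show ?thesis unfolding e_def times_divide_eq_right by (rule nonzero_mult_div_cancel_left)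
      qed
      finally show "real (card Y) * (T powr p * e) \<le> \<epsilon>" by (simp add: mult_ac)
    qed
    finally show "(\<Sum>y\<in>Y. ennreal (T powr p) * emeasure lborel (U y - A y)) \<le> ennreal \<epsilon>" .
  qed
  finally have "(\<integral>\<^sup>+x. ennreal (G x powr p) \<partial>lborel) \<le> (\<integral>\<^sup>+x. ennreal (F x powr p) \<partial>lborel) + ennreal \<epsilon>" .
  then show ?thesis using that Gnice FG lsc by blast
qed

context lacunary_curve
begin

definition planar_max :: "int set \<Rightarrow> (real \<times> real \<Rightarrow> ennreal) \<Rightarrow> real \<times> real \<Rightarrow> ennreal" where
  "planar_max K F x = (SUP k\<in>K. ncurve_avg (r k) (c k) F x)"

lemma planar_max_mono: "(\<And>x. F x \<le> G x) \<Longrightarrow> planar_max K F x \<le> planar_max K G x"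
  unfolding planar_max_def ncurve_avg_def by (intro SUP_mono bexI nn_integral_mono mult_right_mono) auto

lemma planar_max_measurable:
  assumes "finite K" "F \<in> borel_measurable borel" shows "planar_max K F \<in> borel_measurable borel"
  unfolding planar_max_def[abs_def] by (intro borel_measurable_SUP countable_finite ncurve_avg_measurable assms)

lemma len_tendsto: "(\<lambda>j. len j k) \<longlonglongrightarrow> 0"
proof -
  have "(\<lambda>j. 2 powi (- n k) * (1 / 2) ^ j) \<longlonglongrightarrow> 2 powi (- n k) * (0::real)"
    by (intro tendsto_mult tendsto_const LIMSEQ_power_zero) auto
  then show ?thesis by (simp add: len_def[abs_def] power_divide)
qed

text \<open>The cells shrink to length zero, so the cell of x eventually fits into the interval on
  which G stays above its value at x.\<close>

lemma liminf_nEu: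
  assumes lsc: "\<exists>d>0. \<forall>v. \<bar>v - fst x\<bar> < d \<longrightarrow> G x \<le> G (v, snd x)"
  shows "ennreal (G x) \<le> liminf (\<lambda>j. nEu (len j k) (\<lambda>x. ennreal (G x)) x)"
proof (rule Liminf_bounded)
  obtain d where d: "0 < d" "\<And>v. \<bar>v - fst x\<bar> < d \<Longrightarrow> G x \<le> G (v, snd x)" using lsc by blast
  have "eventually (\<lambda>j. len j k < d) sequentially" by (rule order_tendstoD(2)[OF len_tendsto d(1)])
  then show "eventually (\<lambda>j. ennreal (G x) \<le> nEu (len j k) (\<lambda>x. ennreal (G x)) x) sequentially"
  proof eventually_elim
    case (elim j)
    have "ennreal (G x) = equipartition.avg (\<lambda>u::real. \<lfloor>u / len j k\<rfloor>) (len j k) (\<lambda>_. ennreal (G x)) (fst x)"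
      by (rule equipartition.avg_of_const[OF equipartition_floor[OF len_pos], symmetric])
    also have "\<dots> = ennreal (1 / len j k) * (\<integral>\<^sup>+y. ennreal (G x) * of_bool (\<lfloor>y / len j k\<rfloor> = \<lfloor>fst x / len j k\<rfloor>) \<partial>lborel)"
      by (rule equipartition.avg_def[OF equipartition_floor[OF len_pos]])
    also have "\<dots> \<le> nEu (len j k) (\<lambda>x. ennreal (G x)) x"
      unfolding nEu_eq[OF len_pos]
    proof (intro mult_left_mono nn_integral_mono)
      fix y
      show "ennreal (G x) * of_bool (\<lfloor>y / len j k\<rfloor> = \<lfloor>fst x / len j k\<rfloor>) \<le> ennreal (G (y, snd x)) * of_bool (\<lfloor>y / len j k\<rfloor> = \<lfloor>fst x / len j k\<rfloor>)"
      proof (cases "\<lfloor>y / len j k\<rfloor> = \<lfloor>fst x / len j k\<rfloor>")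
        case True
        then have "\<bar>y / len j k - fst x / len j k\<bar> < 1" by linarith
        then have "\<bar>y - fst x\<bar> < len j k" using len_pos[of j k] by (simp add: field_simps flip: diff_divide_distrib)
        then show ?thesis using d(2)[of y] elim True by (simp add: ennreal_leI)
      qed simp
    qed simp
    finally show ?case .
  qed
qed

text \<open>The class of functions grows in three stages: functions lower semicontinuous along
  horizontal lines, by letting the resolution tend to infinity; nice functions with finitely many
  values, by the majorants; all Borel functions with extended values, by monotone approximation. The
  constant is the same in every stage and uniform in \<open>K\<close>.\<close>

theorem planar_bound:
  assumes p: "1 < p"
  shows "\<exists>C\<ge>0. \<forall>K F. finite K \<longrightarrow> F \<in> borel_measurable borel \<longrightarrow>
    (\<integral>\<^sup>+x. ennreal_powr (planar_max K F x) p \<partial>lborel) \<le> ennreal C * (\<integral>\<^sup>+x. ennreal_powr (F x) p \<partial>lborel)"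
proof -
  obtain C where C: "0 \<le> C" and unif: "\<And>K J F. finite K \<Longrightarrow> nice F \<Longrightarrow>
    (\<integral>\<^sup>+x. ennreal_powr (nmax K J F x) p \<partial>lborel) \<le> ennreal C * (\<integral>\<^sup>+x. ennreal (F x powr p) \<partial>lborel)"
    using nmax_uniform[OF p] by blast
  have lsc: "(\<integral>\<^sup>+x. ennreal_powr (planar_max K G x) p \<partial>lborel) \<le> ennreal C * (\<integral>\<^sup>+x. ennreal (G x powr p) \<partial>lborel)"
    if K: "finite K" and G: "nice G" and l: "\<And>x. \<exists>d>0. \<forall>v. \<bar>v - fst x\<bar> < d \<longrightarrow> G x \<le> G (v, snd x)" for K G
  proof -
    have Gm [measurable]: "G \<in> borel_measurable borel" using G by (simp add: nice_def)
    have [measurable]: "nmax K J G \<in> borel_measurable borel" for J by (rule nmax_measurable[OF K]) measurable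
    have [measurable]: "nEu (len J k) G \<in> borel_measurable borel" for J k by (rule nEu_measurable[OF len_pos]) measurable
    have "planar_max K G x \<le> liminf (\<lambda>J. nmax K J G x)" for x
      unfolding planar_max_def
    proof (rule SUP_least)
      fix k assume k: "k \<in> K"
      have "ncurve_avg (r k) (c k) G x \<le> (\<integral>\<^sup>+\<theta>. liminf (\<lambda>J. nEu (len J k) G (fst x - r k * profile \<theta>, snd x - c k * \<theta>) * indicator {0..1} \<theta>) \<partial>lborel)"
        unfolding ncurve_avg_def
      proof (rule nn_integral_mono)
        fix \<theta> :: real
        show "ennreal (G (fst x - r k * profile \<theta>, snd x - c k * \<theta>)) * indicator {0..1} \<theta> \<le> liminf (\<lambda>J. nEu (len J k) G (fst x - r k * profile \<theta>, snd x - c k * \<theta>) * indicator {0..1} \<theta>)"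
          using liminf_nEu[OF l] by (cases "\<theta> \<in> {0..1}") (auto simp: Liminf_const)
      qed
      also have "\<dots> \<le> liminf (\<lambda>J. ncurve_avg (r k) (c k) (nEu (len J k) G) x)"
        unfolding ncurve_avg_def by (rule nn_integral_liminf) measurable
      also have "\<dots> \<le> liminf (\<lambda>J. nmax K J G x)"
        unfolding nmax_def using k by (intro Liminf_mono always_eventually allI SUP_upper)
      finally show "ncurve_avg (r k) (c k) G x \<le> liminf (\<lambda>J. nmax K J G x)" .
    qed
    then have "ennreal_powr (planar_max K G x) p \<le> liminf (\<lambda>J. ennreal_powr (nmax K J G x) p)" for x
      using p by (intro order_trans[OF ennreal_powr_mono ennreal_powr_liminf]) auto
    then have "(\<integral>\<^sup>+x. ennreal_powr (planar_max K G x) p \<partial>lborel) \<le> (\<integral>\<^sup>+x. liminf (\<lambda>J. ennreal_powr (nmax K J G x) p) \<partial>lborel)"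
      by (intro nn_integral_mono)
    also have "\<dots> \<le> liminf (\<lambda>J. \<integral>\<^sup>+x. ennreal_powr (nmax K J G x) p \<partial>lborel)"
      by (rule nn_integral_liminf) measurable
    also have "\<dots> \<le> liminf (\<lambda>J::nat. ennreal C * (\<integral>\<^sup>+x. ennreal (G x powr p) \<partial>lborel))"
      by (intro Liminf_mono always_eventually allI unif K G)
    finally show ?thesis by (simp add: Liminf_const)
  qed
  have simple: "(\<integral>\<^sup>+x. ennreal_powr (planar_max K F x) p \<partial>lborel) \<le> ennreal C * (\<integral>\<^sup>+x. ennreal (F x powr p) \<partial>lborel)"
    if K: "finite K" and F: "nice F" "finite (range F)" for K F
  proof (rule ennreal_le_epsilon)
    fix e :: real assume e: "0 < e"
    define \<epsilon> where "\<epsilon> = e / (C + 1)"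
    have \<epsilon>: "0 < \<epsilon>" "C * \<epsilon> \<le> e" using e C by (auto simp: \<epsilon>_def field_simps)
    obtain G where G: "nice G" "\<And>x. F x \<le> G x" "\<And>x. \<exists>d>0. \<forall>v. \<bar>v - fst x\<bar> < d \<longrightarrow> G x \<le> G (v, snd x)"
      "(\<integral>\<^sup>+x. ennreal (G x powr p) \<partial>lborel) \<le> (\<integral>\<^sup>+x. ennreal (F x powr p) \<partial>lborel) + ennreal \<epsilon>"
      by (rule simple_lsc_majorant[OF F p \<epsilon>(1)]) (rule that)
    have "(\<integral>\<^sup>+x. ennreal_powr (planar_max K F x) p \<partial>lborel) \<le> (\<integral>\<^sup>+x. ennreal_powr (planar_max K G x) p \<partial>lborel)"
      using p G(2) by (intro nn_integral_mono ennreal_powr_mono planar_max_mono) (auto intro: ennreal_leI)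
    also have "\<dots> \<le> ennreal C * (\<integral>\<^sup>+x. ennreal (G x powr p) \<partial>lborel)" by (rule lsc[OF K G(1,3)])
    also have "\<dots> \<le> ennreal C * ((\<integral>\<^sup>+x. ennreal (F x powr p) \<partial>lborel) + ennreal \<epsilon>)"
      by (intro mult_left_mono G(4)) simp
    also have "\<dots> = ennreal C * (\<integral>\<^sup>+x. ennreal (F x powr p) \<partial>lborel) + ennreal (C * \<epsilon>)"
      using C \<epsilon> by (simp add: distrib_left ennreal_mult)
    also have "\<dots> \<le> ennreal C * (\<integral>\<^sup>+x. ennreal (F x powr p) \<partial>lborel) + ennreal e"
      using \<epsilon> by (intro add_left_mono ennreal_leI)
    finally show "(\<integral>\<^sup>+x. ennreal_powr (planar_max K F x) p \<partial>lborel) \<le> ennreal C * (\<integral>\<^sup>+x. ennreal (F x powr p) \<partial>lborel) + ennreal e" .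
  qed
  have "(\<integral>\<^sup>+x. ennreal_powr (planar_max K F x) p \<partial>lborel) \<le> ennreal C * (\<integral>\<^sup>+x. ennreal_powr (F x) p \<partial>lborel)"
    if K: "finite K" and F [measurable]: "F \<in> borel_measurable borel" for K F
  proof -
    obtain f where f: "\<And>i. simple_function borel (f i)" "incseq f" "\<And>i x. f i x < top" "\<And>x. (SUP i. f i x) = F x"
      by (rule borel_measurable_implies_simple_function_sequence'[OF F]) (rule that)
    define D where "D i = {- real i..real i} \<times> {- real i..real i}" for i :: nat
    have [measurable]: "D i \<in> sets borel" for i unfolding D_def by (intro borel_closed closed_Times) auto
    have [measurable]: "f i \<in> borel_measurable borel" for i by (rule borel_measurable_simple_function[OF f(1)])
    \<comment> \<open>Cutting to growing boxes gives bounded support without losing monotonicity in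
      i, so the approximants are nice with finitely many values.\<close>
    define g where "g i x = f i x * indicator (D i) x" for i x
    have gm [measurable]: "g i \<in> borel_measurable borel" for i unfolding g_def by measurable
    have inc: "incseq g"
      using f(2) by (auto simp: incseq_def le_fun_def g_def D_def indicator_def)
    have supg: "(SUP i. g i x) = F x" for x
    proof (rule antisym)
      show "(SUP i. g i x) \<le> F x"
        unfolding f(4)[symmetric] by (intro SUP_mono) (auto simp: g_def indicator_def)
      obtain i0 where i0: "max \<bar>fst x\<bar> \<bar>snd x\<bar> \<le> real i0" using real_arch_simple by blast
      have "f i x \<le> (SUP i. g i x)" for i
      proof -
        have "x \<in> D (max i i0)" using i0 by (cases x) (auto simp: D_def)
        then have "f i x \<le> g (max i i0) x" using incseqD[OF f(2), of i "max i i0"] by (simp add: g_def le_funD)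
        also have "\<dots> \<le> (SUP i. g i x)" by (rule SUP_upper) simp
        finally show ?thesis .
      qed
      then show "F x \<le> (SUP i. g i x)" unfolding f(4)[symmetric] by (rule SUP_least)
    qed
    have gi: "(\<integral>\<^sup>+x. ennreal_powr (planar_max K (g i) x) p \<partial>lborel) \<le> ennreal C * (\<integral>\<^sup>+x. ennreal_powr (F x) p \<partial>lborel)" for i
    proof -
      define h where "h x = enn2real (g i x)" for x
      have gtop: "g i x < top" for x using f(3)[of i x] by (auto simp: g_def indicator_def)
      then have hg: "ennreal (h x) = g i x" for x unfolding h_def by simp
      have h0: "0 \<le> h x" for x by (simp add: h_def)
      have "finite (range (f i))" using simple_functionD(1)[OF f(1)[of i]] by simp
      moreover have "range h \<subseteq> insert 0 (enn2real ` range (f i))" by (auto simp: h_def g_def indicator_def)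
      ultimately have fr: "finite (range h)" by (meson finite.insertI finite_imageI finite_subset)
      have "nice h"
        unfolding nice_def
      proof (intro conjI)
        show "h \<in> borel_measurable borel" unfolding h_def by measurable
        show "\<exists>B. \<forall>x. 0 \<le> h x \<and> h x \<le> B" using fr by (intro exI[of _ "Max (range h)"]) (auto simp: h_def)
        show "\<exists>R. \<forall>x. R < \<bar>fst x\<bar> \<or> R < \<bar>snd x\<bar> \<longrightarrow> h x = 0"
          by (intro exI[of _ "real i"]) (auto simp: h_def g_def D_def indicator_def)
      qed
      then have "(\<integral>\<^sup>+x. ennreal_powr (planar_max K h x) p \<partial>lborel) \<le> ennreal C * (\<integral>\<^sup>+x. ennreal (h x powr p) \<partial>lborel)"
        using fr by (intro simple K)
      also have "(\<integral>\<^sup>+x. ennreal (h x powr p) \<partial>lborel) = (\<integral>\<^sup>+x. ennreal_powr (g i x) p \<partial>lborel)"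
        by (intro nn_integral_cong) (simp only: hg[symmetric] ennreal_powr_ennreal[OF h0])
      also have "\<dots> \<le> (\<integral>\<^sup>+x. ennreal_powr (F x) p \<partial>lborel)"
        using p unfolding supg[symmetric] by (intro nn_integral_mono ennreal_powr_mono SUP_upper) auto
      finally show ?thesis by (simp add: hg mult_left_mono)
    qed
    have pm: "planar_max K F x = (SUP i. planar_max K (g i) x)" for x
    proof -
      have "ncurve_avg (r k) (c k) F x = (SUP i. ncurve_avg (r k) (c k) (g i) x)" for k
      proof -
        have "ncurve_avg (r k) (c k) F x = (\<integral>\<^sup>+\<theta>. (SUP i. g i (fst x - r k * profile \<theta>, snd x - c k * \<theta>) * indicator {0..1} \<theta>) \<partial>lborel)"
          unfolding ncurve_avg_def supg[symmetric] by (simp add: SUP_mult_right_ennreal)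
        also have "\<dots> = (SUP i. ncurve_avg (r k) (c k) (g i) x)"
          unfolding ncurve_avg_def using inc
          by (intro nn_integral_monotone_convergence_SUP) (auto simp: incseq_def le_fun_def intro!: mult_right_mono)
        finally show ?thesis .
      qed
      then show ?thesis unfolding planar_max_def by (subst SUP_commute) simp
    qed
    have "(\<integral>\<^sup>+x. ennreal_powr (planar_max K F x) p \<partial>lborel) = (\<integral>\<^sup>+x. (SUP i. ennreal_powr (planar_max K (g i) x) p) \<partial>lborel)"
      using p by (simp add: pm ennreal_powr_SUP)
    also have "\<dots> = (SUP i. \<integral>\<^sup>+x. ennreal_powr (planar_max K (g i) x) p \<partial>lborel)"
    proof (rule nn_integral_monotone_convergence_SUP)
      show "incseq (\<lambda>i x. ennreal_powr (planar_max K (g i) x) p)"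
        using inc p by (auto simp: incseq_def le_fun_def intro!: ennreal_powr_mono planar_max_mono)
      have [measurable]: "planar_max K (g i) \<in> borel_measurable borel" for i by (rule planar_max_measurable[OF K gm])
      show "(\<lambda>x. ennreal_powr (planar_max K (g i) x) p) \<in> borel_measurable lborel" for i by measurable
    qed
    also have "\<dots> \<le> ennreal C * (\<integral>\<^sup>+x. ennreal_powr (F x) p \<partial>lborel)" by (intro SUP_least gi)
    finally show ?thesis .
  qed
  then show ?thesis using C by blast
qed

end

section \<open>Decomposing the sphere into curves\<close>

text \<open>Only the direction of z enters. Letting z range over the unit ball therefore does the
  work of a surface integral over the Euclidean unit sphere. The sign s selects the upper or the
  lower half of the Koranyi sphere.\<close>

definition ray :: "real \<Rightarrow> complex ^ 'n::finite \<Rightarrow> real \<Rightarrow> 'n heis" where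
  "ray s z \<theta> = (profile \<theta> *\<^sub>R (z /\<^sub>R norm z), s * \<theta> / 4)"

lemma ray_measurable [measurable]:
  assumes [measurable]: "f \<in> borel_measurable M" "g \<in> borel_measurable M"
  shows "(\<lambda>x. ray s (f x) (g x)) \<in> borel_measurable M"
  unfolding ray_def by (intro borel_measurable_Pair) measurable

lemma ray_scale: "0 < a \<Longrightarrow> ray s (a *\<^sub>R z) \<theta> = ray s z \<theta>"
  by (simp add: ray_def)

lemma nn_integral_scaleR:
  fixes f :: "'a::euclidean_space \<Rightarrow> ennreal"
  assumes [measurable]: "f \<in> borel_measurable borel" and a: "0 < a"
  shows "(\<integral>\<^sup>+x. f x \<partial>lborel) = ennreal (a ^ DIM('a)) * (\<integral>\<^sup>+x. f (a *\<^sub>R x) \<partial>lborel)"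
proof -
  have "(lborel :: 'a measure) = density (distr lborel borel (\<lambda>x. 0 + a *\<^sub>R x)) (\<lambda>_. ennreal (\<bar>a\<bar> ^ DIM('a)))"
    using a by (intro lborel_affine) auto
  then have "(\<integral>\<^sup>+x. f x \<partial>lborel) = (\<integral>\<^sup>+x. f x \<partial>density (distr lborel borel (\<lambda>x. 0 + a *\<^sub>R x)) (\<lambda>_. ennreal (\<bar>a\<bar> ^ DIM('a))))"
    by (rule arg_cong)
  also have "\<dots> = ennreal (a ^ DIM('a)) * (\<integral>\<^sup>+x. f (a *\<^sub>R x) \<partial>lborel)"
    using a by (simp add: nn_integral_density nn_integral_distr nn_integral_cmult)
  finally show ?thesis .
qed

lemma koranyi_measure_eq: "(koranyi_measure :: 'n::finite heis measure) = koranyi_measure0"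
  unfolding koranyi_measure_def by (rule the1_equality[OF ex1_koranyi_polar koranyi_polar_measure0])

text \<open>The explicit form of the measure turns a surface integral into a solid integral over the
  punctured Koranyi ball, with the integrand extended to be constant along dilations.\<close>

lemma nn_integral_koranyi_measure:
  fixes g :: "'n::finite heis \<Rightarrow> ennreal"
  assumes [measurable]: "g \<in> borel_measurable borel"
  shows "(\<integral>\<^sup>+\<omega>. g \<omega> \<partial>koranyi_measure) =
    ennreal (hom_dim TYPE('n)) * (\<integral>\<^sup>+x. g (koranyi_proj x) * indicator (koranyi_cone 1 UNIV) x \<partial>lborel)"
proof -
  have m: "koranyi_proj \<in> restrict_space lborel (koranyi_cone 1 UNIV) \<rightarrow>\<^sub>M
      restrict_space borel (koranyi_sphere :: 'n heis set)"
    by (rule measurable_restrict_space3) (auto simp: koranyi_cone_def koranyi_proj_sphere)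
  have g: "g \<in> borel_measurable (restrict_space borel koranyi_sphere)" by (rule measurable_restrict_space1) measurable
  have "(\<integral>\<^sup>+\<omega>. g \<omega> \<partial>koranyi_measure) = ennreal (hom_dim TYPE('n)) *
     (\<integral>\<^sup>+\<omega>. g \<omega> \<partial>distr (restrict_space lborel (koranyi_cone 1 UNIV)) (restrict_space borel koranyi_sphere) koranyi_proj)"
    unfolding koranyi_measure_eq koranyi_measure0_def by (rule nn_integral_scale_measure) (simp add: g)
  also have "(\<integral>\<^sup>+\<omega>. g \<omega> \<partial>distr (restrict_space lborel (koranyi_cone 1 UNIV)) (restrict_space borel koranyi_sphere) koranyi_proj)
    = (\<integral>\<^sup>+x. g (koranyi_proj x) \<partial>restrict_space lborel (koranyi_cone 1 UNIV))"
    by (rule nn_integral_distr[OF m]) (simp add: g)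
  also have "\<dots> = (\<integral>\<^sup>+x. g (koranyi_proj x) * indicator (koranyi_cone 1 UNIV) x \<partial>lborel)"
    by (rule nn_integral_restrict_space) simp
  finally show ?thesis .
qed

lemma proj_section_measurable:
  fixes g :: "'n::finite heis \<Rightarrow> ennreal"
  assumes g: "g \<in> borel_measurable borel"
  shows "(\<lambda>t. g (koranyi_proj (z, s * t))) \<in> borel_measurable borel"
proof -
  have "(\<lambda>t. (z, s * t)) \<in> borel_measurable borel" by (rule borel_measurable_Pair) auto
  from measurable_compose[OF measurable_compose[OF this borel_measurable_koranyi_proj] g] show ?thesis .
qed

lemma profile_pos: "0 \<le> \<theta> \<Longrightarrow> \<theta> < 1 \<Longrightarrow> 0 < profile \<theta>"
  using square_less_one[of \<theta>] by (simp add: profile_def)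

text \<open>\<open>t\<close> is found by requiring that (z, s * t), dilated to norm one, has height
  s * \<theta> / 4; the norm of the point before dilation is then the norm of z divided by
  \<open>profile \<theta>\<close>.\<close>

lemma koranyi_proj_on_ray:
  fixes z :: "complex ^ 'n::finite"
  assumes z: "z \<noteq> 0" and \<theta>: "0 \<le> \<theta>" "\<theta> < 1" and s: "s = 1 \<or> s = -1"
  defines "t \<equiv> (norm z)\<^sup>2 / 4 * (\<theta> * (1 - \<theta>\<^sup>2) powr (-1/2))"
  shows "koranyi_proj (z, s * t) = ray s z \<theta>"
proof -
  define r where "r = norm z"
  have r: "0 < r" using z by (simp add: r_def)
  define u where "u = 1 - \<theta>\<^sup>2"
  have u: "0 < u" using square_less_one[OF \<theta>] by (simp add: u_def)
  have p4: "profile \<theta> ^ 4 = u"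
    using u by (simp add: profile_def u_def[symmetric] powr_powr flip: powr_realpow powr_numeral)
  have p2: "(profile \<theta>)\<^sup>2 = u powr (1/2)"
    using u by (simp add: profile_def u_def[symmetric] powr_powr flip: powr_realpow powr_numeral)
  have pp: "0 < profile \<theta>" by (rule profile_pos[OF \<theta>])
  have "(s * t)\<^sup>2 = t\<^sup>2" using s by auto
  have t2: "16 * t\<^sup>2 = r ^ 4 * (\<theta>\<^sup>2 * (u powr (-1/2))\<^sup>2)"
    by (simp add: t_def r_def u_def[symmetric] power_mult_distrib power_divide flip: power_mult)
  also have "(u powr (-1/2))\<^sup>2 = 1 / u" using u by (simp add: powr_minus_divide powr_half_sqrt power_divide)
  finally have "r ^ 4 + 16 * t\<^sup>2 = r ^ 4 * ((u + \<theta>\<^sup>2) / u)" using u by (simp add: field_simps)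
  also have "\<dots> = r ^ 4 / profile \<theta> ^ 4" using p4 by (simp add: u_def)
  also have "\<dots> = (r / profile \<theta>) ^ 4" by (simp add: power_divide)
  finally have nrm: "koranyi_norm (z, s * t) = r / profile \<theta>"
    using r pp \<open>(s * t)\<^sup>2 = t\<^sup>2\<close> by (simp add: koranyi_norm_def r_def real_root_power_cancel)
  have "(1 / (r / profile \<theta>))\<^sup>2 * (s * t) = s * \<theta> / 4"
  proof -
    have "(1 / (r / profile \<theta>))\<^sup>2 = u powr (1/2) / r\<^sup>2" using p2 by (simp add: power_divide)
    then have "(1 / (r / profile \<theta>))\<^sup>2 * (s * t) = s * \<theta> / 4 * (u powr (1/2) * u powr (-1/2))"
      using r by (simp add: t_def r_def[symmetric] u_def[symmetric] field_simps)
    also have "u powr (1/2) * u powr (-1/2) = 1" using u by (simp flip: powr_add)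
    finally show ?thesis by simp
  qed
  moreover have "(1 / (r / profile \<theta>)) *\<^sub>R z = profile \<theta> *\<^sub>R (z /\<^sub>R norm z)"
    by (simp add: r_def divide_inverse)
  ultimately show ?thesis
    unfolding koranyi_proj_def nrm heis_dil_def ray_def fst_conv snd_conv by (simp only:)
qed

text \<open>For fixed z the height t is exchanged for the curve parameter \<theta>, with
  \<open>t\<close> as a function of \<theta> taken from \<open>koranyi_proj_on_ray\<close>. The
  first factor on the right is its derivative, and membership in the Koranyi ball becomes
  \<open>norm z \<le> profile \<theta>\<close>.\<close>

lemma half_line_substitution:
  fixes G :: "'n::finite heis \<Rightarrow> ennreal" and z :: "complex ^ 'n"
  assumes G [measurable]: "G \<in> borel_measurable borel" and z: "z \<noteq> 0" and s: "s = 1 \<or> s = -1"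
  shows "(\<integral>\<^sup>+t. G (koranyi_proj (z, s * t)) * indicator {t. 0 < t \<and> norm z ^ 4 + 16 * t\<^sup>2 \<le> 1} t \<partial>lborel)
    \<le> (\<integral>\<^sup>+\<theta>. ennreal ((norm z)\<^sup>2 / 4 * (1 - \<theta>\<^sup>2) powr (-3/2)) * G (ray s z \<theta>) * indicator {\<theta>. 0 \<le> \<theta> \<and> \<theta> < 1 \<and> norm z \<le> profile \<theta>} \<theta> \<partial>lborel)"
proof -
  define r where "r = norm z"
  have r: "0 < r" using z by (simp add: r_def)
  show ?thesis
  proof (cases "r < 1")
    case False
    have "1 \<le> r ^ 4" using False by (simp add: one_le_power)
    then have "{t. 0 < t \<and> norm z ^ 4 + 16 * t\<^sup>2 \<le> 1} = {}"
      by (auto simp: r_def[symmetric]) (smt (verit) zero_less_power)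
    then show ?thesis by simp
  next
    case True
    have r4: "0 < r ^ 4" "r ^ 4 < 1" using r True by (auto simp: power_less_one_iff)
    \<comment> \<open>The parameter at which the height leaves the Koranyi ball, that is, where the
      profile equals the norm of z.\<close>
    define b where "b = sqrt (1 - r ^ 4)"
    have b: "0 < b" "b < 1" "b\<^sup>2 = 1 - r ^ 4" using r4 by (auto simp: b_def)
    define T where "T \<theta> = r\<^sup>2 / 4 * (\<theta> * (1 - \<theta>\<^sup>2) powr (-1/2))" for \<theta>
    define T' where "T' \<theta> = r\<^sup>2 / 4 * (1 - \<theta>\<^sup>2) powr (-3/2)" for \<theta>
    have dT: "(T has_real_derivative T' \<theta>) (at \<theta>)" if \<theta>: "\<theta> \<in> {0..b}" for \<theta>
    proof -
      have p: "0 < 1 - \<theta>\<^sup>2" using square_less_one[of \<theta>] \<theta> b by auto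
      have "((\<lambda>\<theta>. (1 - \<theta>\<^sup>2) powr (-1/2)) has_real_derivative (-1/2) * (1 - \<theta>\<^sup>2) powr (-1/2 - of_nat 1) * (- (2 * \<theta>))) (at \<theta>)"
        by (rule DERIV_fun_powr) (use p in \<open>auto intro!: derivative_eq_intros\<close>)
      then have "(T has_real_derivative r\<^sup>2 / 4 * (1 * (1 - \<theta>\<^sup>2) powr (-1/2) + (-1/2) * (1 - \<theta>\<^sup>2) powr (-1/2 - of_nat 1) * (- (2 * \<theta>)) * \<theta>)) (at \<theta>)"
        unfolding T_def[abs_def] by (intro DERIV_cmult DERIV_mult DERIV_ident)
      also have "1 * (1 - \<theta>\<^sup>2) powr (-1/2) + (-1/2) * (1 - \<theta>\<^sup>2) powr (-1/2 - of_nat 1) * (- (2 * \<theta>)) * \<theta> = (1 - \<theta>\<^sup>2) powr (-3/2)"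
      proof -
        have "(1 - \<theta>\<^sup>2) powr (-1/2) = (1 - \<theta>\<^sup>2) powr (-3/2) * (1 - \<theta>\<^sup>2) powr 1" using p by (subst powr_add[symmetric]) simp
        then have e: "(1 - \<theta>\<^sup>2) powr (-1/2) = (1 - \<theta>\<^sup>2) powr (-3/2) * (1 - \<theta>\<^sup>2)" using p by simp
        have "(-1/2 - of_nat 1 :: real) = -3/2" by simp
        then show ?thesis unfolding e by (simp only:) (simp add: algebra_simps power2_eq_square)
      qed
      finally show ?thesis by (simp add: T'_def)
    qed
    have cT: "continuous_on {0..b} T'"
      unfolding T'_def
    proof (intro continuous_intros ballI)
      fix \<theta> assume "\<theta> \<in> {0..b}"
      then have "\<theta>\<^sup>2 < 1" using b by (intro square_less_one) auto
      then show "1 - \<theta>\<^sup>2 \<noteq> 0" by simp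
    qed
    have T0: "T 0 = 0" by (simp add: T_def)
    have Tb: "T b = b / 4"
    proof -
      have "(1 - b\<^sup>2) powr (-1/2) = 1 / r\<^sup>2"
        using b r by (simp add: powr_minus_divide powr_half_sqrt power4_eq_xxxx real_sqrt_mult power2_eq_square)
      then show ?thesis using r by (simp add: T_def)
    qed
    define f where "f t = G (koranyi_proj (z, s * t))" for t
    have f [measurable]: "f \<in> borel_measurable borel" unfolding f_def by (rule proj_section_measurable[OF G])
    have "(\<integral>\<^sup>+t. f t * indicator {t. 0 < t \<and> norm z ^ 4 + 16 * t\<^sup>2 \<le> 1} t \<partial>lborel) \<le> (\<integral>\<^sup>+t. f t * indicator {T 0..T b} t \<partial>lborel)"
    proof (intro nn_integral_mono mult_left_mono)
      fix t
      have "t \<le> b / 4" if t: "0 < t" "r ^ 4 + 16 * t\<^sup>2 \<le> 1"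
      proof -
        have "(4 * t)\<^sup>2 \<le> b\<^sup>2" using t b by (simp add: power_mult_distrib)
        then have "4 * t \<le> b" by (rule power2_le_imp_le) (use b in linarith)
        then show ?thesis by simp
      qed
      then show "indicator {t. 0 < t \<and> norm z ^ 4 + 16 * t\<^sup>2 \<le> 1} t \<le> (indicator {T 0..T b} t :: ennreal)"
        by (auto simp: T0 Tb r_def[symmetric] indicator_def)
    qed simp
    also have "\<dots> = (\<integral>\<^sup>+\<theta>. f (T \<theta>) * ennreal (T' \<theta>) * indicator {0..b} \<theta> \<partial>lborel)"
      using b by (intro nn_integral_substitution_aux dT cT) (auto simp: T'_def)
    also have "\<dots> \<le> (\<integral>\<^sup>+\<theta>. ennreal ((norm z)\<^sup>2 / 4 * (1 - \<theta>\<^sup>2) powr (-3/2)) * G (ray s z \<theta>) * indicator {\<theta>. 0 \<le> \<theta> \<and> \<theta> < 1 \<and> norm z \<le> profile \<theta>} \<theta> \<partial>lborel)"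
    proof (rule nn_integral_mono)
      fix \<theta> :: real
      show "f (T \<theta>) * ennreal (T' \<theta>) * indicator {0..b} \<theta> \<le> ennreal ((norm z)\<^sup>2 / 4 * (1 - \<theta>\<^sup>2) powr (-3/2)) * G (ray s z \<theta>) * indicator {\<theta>. 0 \<le> \<theta> \<and> \<theta> < 1 \<and> norm z \<le> profile \<theta>} \<theta>"
      proof (cases "\<theta> \<in> {0..b}")
        case True
        then have \<theta>: "0 \<le> \<theta>" "\<theta> < 1" using b by auto
        have "\<theta>\<^sup>2 \<le> b\<^sup>2" using True by (intro power_mono) auto
        then have "r ^ 4 \<le> 1 - \<theta>\<^sup>2" using b by simp
        then have "(r ^ 4) powr (1/4) \<le> profile \<theta>" unfolding profile_def by (intro powr_mono2) auto
        moreover have "(r ^ 4) powr (1/4) = r"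
          using r by (simp add: powr_powr flip: powr_numeral)
        ultimately have "norm z \<le> profile \<theta>" by (simp add: r_def)
        moreover have "f (T \<theta>) = G (ray s z \<theta>)"
          unfolding f_def T_def r_def by (subst koranyi_proj_on_ray[OF z \<theta> s]) simp
        ultimately show ?thesis using True \<theta> by (simp add: T'_def r_def mult.commute)
      qed simp
    qed
    finally show ?thesis by (simp add: f_def)
  qed
qed

text \<open>The density of the substitution is, apart from (norm z)^2 / 4, equal to a^(-6) for a =
  profile \<theta>, and it blows up as \<theta> tends to 1. At the same time z is confined to a ball
  of radius a. Rescaling z by a yields a^(2 n) from the volume and a^2 from (norm z)^2, altogether
  a^(2 n - 4), which is at most 1 precisely because n \<ge> 2.\<close>

lemma sphere_integral_le:
  fixes g :: "'n::finite heis \<Rightarrow> ennreal"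
  assumes g [measurable]: "g \<in> borel_measurable borel" and n: "2 \<le> CARD('n)"
  shows "(\<integral>\<^sup>+\<omega>. g \<omega> \<partial>koranyi_measure) \<le> ennreal (hom_dim TYPE('n)) *
    (\<integral>\<^sup>+z. (\<integral>\<^sup>+\<theta>. (g (ray 1 z \<theta>) + g (ray (-1) z \<theta>)) * indicator {0..1} \<theta> \<partial>lborel) * of_bool (norm z \<le> 1) \<partial>lborel)"
proof -
  define W where "W s z \<theta> = ennreal ((norm z)\<^sup>2 / 4 * (1 - \<theta>\<^sup>2) powr (-3/2)) * g (ray s z \<theta>) * of_bool (0 \<le> \<theta> \<and> \<theta> < 1 \<and> norm z \<le> profile \<theta>)"
    for s \<theta> and z :: "complex ^ 'n"
  have Wm: "(\<lambda>(z, \<theta>). W s z \<theta>) \<in> borel_measurable (borel \<Otimes>\<^sub>M borel)" for s unfolding W_def by measurable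
  note [measurable] = Wm
  define H where "H x = g (koranyi_proj x) * indicator (koranyi_cone 1 UNIV) x" for x :: "'n heis"
  have [measurable]: "H \<in> borel_measurable borel" unfolding H_def by measurable
  have cone: "(z, t) \<in> koranyi_cone 1 UNIV \<longleftrightarrow> norm z ^ 4 + 16 * t\<^sup>2 \<le> 1" if "z \<noteq> 0" for z :: "complex ^ 'n" and t
  proof -
    have "0 < koranyi_norm (z, t)"
      using that koranyi_norm_nonneg[of "(z, t)"] koranyi_norm_eq_0[of "(z, t)"] by (auto simp: less_le zero_prod_def)
    then show ?thesis by (simp add: koranyi_cone_def koranyi_norm_def real_root_le_1_iff)
  qed
  have slice: "(\<integral>\<^sup>+t. H (z, t) \<partial>lborel) \<le> (\<integral>\<^sup>+\<theta>. W 1 z \<theta> \<partial>lborel) + (\<integral>\<^sup>+\<theta>. W (-1) z \<theta> \<partial>lborel)" if z: "z \<noteq> 0" for z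
  proof -
    define D where "D = {t::real. 0 < t \<and> norm z ^ 4 + 16 * t\<^sup>2 \<le> 1}"
    have [measurable]: "D \<in> sets borel" unfolding D_def by measurable
    have pm [measurable]: "(\<lambda>t. g (koranyi_proj (z, s * t))) \<in> borel_measurable borel" for s
      by (rule proj_section_measurable[OF g])
    \<comment> \<open>Negative heights are reflected to positive ones, which exchanges the sign 1
      for -1 and leaves the half-line integrals of \<open>half_line_substitution\<close>.\<close>
    have "(\<integral>\<^sup>+t. H (z, t) \<partial>lborel) \<le> (\<integral>\<^sup>+t. g (koranyi_proj (z, 1 * t)) * indicator D t + g (koranyi_proj (z, 1 * t)) * indicator D (- t) \<partial>lborel)"
      by (intro nn_integral_mono_AE) (use AE_lborel_singleton[of 0] in \<open>eventually_elim, auto simp: H_def cone[OF z] D_def indicator_def\<close>)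
    also have "\<dots> = (\<integral>\<^sup>+t. g (koranyi_proj (z, 1 * t)) * indicator D t \<partial>lborel) + (\<integral>\<^sup>+t. g (koranyi_proj (z, 1 * t)) * indicator D (- t) \<partial>lborel)"
      by (rule nn_integral_add) measurable
    also have "(\<integral>\<^sup>+t. g (koranyi_proj (z, 1 * t)) * indicator D (- t) \<partial>lborel) = (\<integral>\<^sup>+t. g (koranyi_proj (z, (-1) * t)) * indicator D t \<partial>lborel)"
      using nn_integral_real_affine[of "\<lambda>t. g (koranyi_proj (z, 1 * t)) * indicator D (- t)" "-1" 0] by simp
    also have "(\<integral>\<^sup>+t. g (koranyi_proj (z, 1 * t)) * indicator D t \<partial>lborel) + (\<integral>\<^sup>+t. g (koranyi_proj (z, (-1) * t)) * indicator D t \<partial>lborel)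
      \<le> (\<integral>\<^sup>+\<theta>. W 1 z \<theta> \<partial>lborel) + (\<integral>\<^sup>+\<theta>. W (-1) z \<theta> \<partial>lborel)"
      using half_line_substitution[OF g z, of 1] half_line_substitution[OF g z, of "-1"]
      unfolding D_def W_def indicator_def by (intro add_mono) auto
    finally show ?thesis .
  qed
  have total: "(\<integral>\<^sup>+z. (\<integral>\<^sup>+\<theta>. W s z \<theta> \<partial>lborel) \<partial>lborel) \<le> (\<integral>\<^sup>+z. (\<integral>\<^sup>+\<theta>. g (ray s z \<theta>) * indicator {0..1} \<theta> \<partial>lborel) * of_bool (norm z \<le> 1) \<partial>lborel)" for s
  proof -
    have "(\<integral>\<^sup>+z. (\<integral>\<^sup>+\<theta>. W s z \<theta> \<partial>lborel) \<partial>lborel) = (\<integral>\<^sup>+\<theta>. (\<integral>\<^sup>+z. W s z \<theta> \<partial>lborel) \<partial>lborel)"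
      using Wm[of s] by (intro lborel_pair.Fubini'[symmetric]) (simp add: case_prod_beta)
    also have "\<dots> \<le> (\<integral>\<^sup>+\<theta>. (\<integral>\<^sup>+z. g (ray s z \<theta>) * indicator {0..1} \<theta> * of_bool (norm z \<le> 1) \<partial>lborel) \<partial>lborel)"
    proof (rule nn_integral_mono)
      fix \<theta> :: real
      show "(\<integral>\<^sup>+z. W s z \<theta> \<partial>lborel) \<le> (\<integral>\<^sup>+z. g (ray s z \<theta>) * indicator {0..1} \<theta> * of_bool (norm z \<le> 1) \<partial>lborel)"
      proof (cases "0 \<le> \<theta> \<and> \<theta> < 1")
        case True
        define a where "a = profile \<theta>"
        have a: "0 < a" "a \<le> 1" using True profile_pos[of \<theta>] profile_range[of \<theta>] by (auto simp: a_def)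
        have u: "0 < 1 - \<theta>\<^sup>2" using True square_less_one[of \<theta>] by simp
        have a6: "(1 - \<theta>\<^sup>2) powr (-3/2) = 1 / a ^ 6"
        proof -
          have "a ^ 6 = (1 - \<theta>\<^sup>2) powr (3/2)" unfolding a_def profile_def using u by (simp add: powr_powr flip: powr_realpow powr_numeral)
          then show ?thesis by (simp add: powr_minus_divide)
        qed
        have [measurable]: "(\<lambda>z. W s z \<theta>) \<in> borel_measurable borel" unfolding W_def by measurable
        have "(\<integral>\<^sup>+z. W s z \<theta> \<partial>lborel) = ennreal (a ^ DIM(complex ^ 'n)) * (\<integral>\<^sup>+z. W s (a *\<^sub>R z) \<theta> \<partial>lborel)"
          by (rule nn_integral_scaleR) (use a in auto)
        also have "\<dots> = (\<integral>\<^sup>+z. ennreal (a ^ DIM(complex ^ 'n)) * W s (a *\<^sub>R z) \<theta> \<partial>lborel)"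
          by (rule nn_integral_cmult[symmetric]) measurable
        also have "\<dots> \<le> (\<integral>\<^sup>+z. g (ray s z \<theta>) * indicator {0..1} \<theta> * of_bool (norm z \<le> 1) \<partial>lborel)"
        proof (rule nn_integral_mono)
          fix z :: "complex ^ 'n"
          show "ennreal (a ^ DIM(complex ^ 'n)) * W s (a *\<^sub>R z) \<theta> \<le> g (ray s z \<theta>) * indicator {0..1} \<theta> * of_bool (norm z \<le> 1)"
          proof (cases "norm z \<le> 1")
            case z: True
            have "a ^ DIM(complex ^ 'n) * ((norm (a *\<^sub>R z))\<^sup>2 / 4 * (1 - \<theta>\<^sup>2) powr (-3/2)) \<le> 1"
            proof -
              \<comment> \<open>The real dimension is twice the complex one. The subtraction of
                natural numbers is exact because \<open>CARD('n)\<close> is at least 2.\<close>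
              have "DIM(complex ^ 'n) + 2 = 6 + (2 * CARD('n) - 4)" using n by simp
              then have "a ^ DIM(complex ^ 'n) * a\<^sup>2 = a ^ 6 * a ^ (2 * CARD('n) - 4)" by (simp only: power_add[symmetric])
              then have "a ^ DIM(complex ^ 'n) * ((norm (a *\<^sub>R z))\<^sup>2 / 4 * (1 - \<theta>\<^sup>2) powr (-3/2)) = a ^ (2 * CARD('n) - 4) * ((norm z)\<^sup>2 / 4)"
                unfolding a6 using a by (simp add: power_mult_distrib field_simps)
              also have "\<dots> \<le> 1 * 1"
                using a z power_le_one[of "norm z" 2] by (intro mult_mono power_le_one) auto
              finally show ?thesis by simp
            qed
            then have "ennreal (a ^ DIM(complex ^ 'n)) * ennreal ((norm (a *\<^sub>R z))\<^sup>2 / 4 * (1 - \<theta>\<^sup>2) powr (-3/2)) \<le> 1"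
              using a by (simp flip: ennreal_mult)
            then have "ennreal (a ^ DIM(complex ^ 'n)) * ennreal ((norm (a *\<^sub>R z))\<^sup>2 / 4 * (1 - \<theta>\<^sup>2) powr (-3/2)) * g (ray s z \<theta>) \<le> 1 * g (ray s z \<theta>)"
              by (rule mult_right_mono) simp
            then show ?thesis
              using True z unfolding W_def ray_scale[OF a(1)] by (auto simp: mult.assoc)
          next
            case False
            then have "\<not> norm (a *\<^sub>R z) \<le> profile \<theta>" using a by (simp add: a_def[symmetric])
            then show ?thesis unfolding W_def by simp
          qed
        qed
        finally show ?thesis .
      next
        case False
        then have "W s z \<theta> = 0" for z by (auto simp: W_def)
        then show ?thesis by simp
      qed
    qed
    also have "\<dots> = (\<integral>\<^sup>+z. (\<integral>\<^sup>+\<theta>. g (ray s z \<theta>) * indicator {0..1} \<theta> * of_bool (norm z \<le> 1) \<partial>lborel) \<partial>lborel)"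
      by (rule lborel_pair.Fubini') measurable
    also have "\<dots> = (\<integral>\<^sup>+z. (\<integral>\<^sup>+\<theta>. g (ray s z \<theta>) * indicator {0..1} \<theta> \<partial>lborel) * of_bool (norm z \<le> 1) \<partial>lborel)"
      by (intro nn_integral_cong nn_integral_multc) measurable
    finally show ?thesis .
  qed
  have "(\<integral>\<^sup>+x. H x \<partial>lborel) = (\<integral>\<^sup>+z. (\<integral>\<^sup>+t. H (z, t) \<partial>lborel) \<partial>lborel)"
    using lborel.nn_integral_fst[of H lborel] by (simp add: lborel_prod)
  also have "\<dots> \<le> (\<integral>\<^sup>+z. (\<integral>\<^sup>+\<theta>. W 1 z \<theta> \<partial>lborel) + (\<integral>\<^sup>+\<theta>. W (-1) z \<theta> \<partial>lborel) \<partial>lborel)"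
  proof (rule nn_integral_mono_AE)
    show "AE z in lborel. (\<integral>\<^sup>+t. H (z, t) \<partial>lborel) \<le> (\<integral>\<^sup>+\<theta>. W 1 z \<theta> \<partial>lborel) + (\<integral>\<^sup>+\<theta>. W (-1) z \<theta> \<partial>lborel)"
      using AE_lborel_singleton[of "0 :: complex ^ 'n"] by eventually_elim (rule slice)
  qed
  also have "\<dots> = (\<integral>\<^sup>+z. (\<integral>\<^sup>+\<theta>. W 1 z \<theta> \<partial>lborel) \<partial>lborel) + (\<integral>\<^sup>+z. (\<integral>\<^sup>+\<theta>. W (-1) z \<theta> \<partial>lborel) \<partial>lborel)"
    by (rule nn_integral_add) measurable
  also have "\<dots> \<le> (\<integral>\<^sup>+z. (\<integral>\<^sup>+\<theta>. g (ray 1 z \<theta>) * indicator {0..1} \<theta> \<partial>lborel) * of_bool (norm z \<le> 1) \<partial>lborel)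
     + (\<integral>\<^sup>+z. (\<integral>\<^sup>+\<theta>. g (ray (-1) z \<theta>) * indicator {0..1} \<theta> \<partial>lborel) * of_bool (norm z \<le> 1) \<partial>lborel)"
    by (intro add_mono total)
  also have "\<dots> = (\<integral>\<^sup>+z. (\<integral>\<^sup>+\<theta>. g (ray 1 z \<theta>) * indicator {0..1} \<theta> \<partial>lborel) * of_bool (norm z \<le> 1)
     + (\<integral>\<^sup>+\<theta>. g (ray (-1) z \<theta>) * indicator {0..1} \<theta> \<partial>lborel) * of_bool (norm z \<le> 1) \<partial>lborel)"
    by (rule nn_integral_add[symmetric]) measurable
  also have "\<dots> = (\<integral>\<^sup>+z. (\<integral>\<^sup>+\<theta>. (g (ray 1 z \<theta>) + g (ray (-1) z \<theta>)) * indicator {0..1} \<theta> \<partial>lborel) * of_bool (norm z \<le> 1) \<partial>lborel)"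
    by (intro nn_integral_cong) (simp add: distrib_right nn_integral_add)
  finally show ?thesis
    unfolding nn_integral_koranyi_measure[OF g] H_def by (rule mult_left_mono) simp
qed

section \<open>Transference to the Heisenberg group\<close>

lemma heis_mult_measurable [measurable]:
  assumes [measurable]: "f \<in> borel_measurable M" "g \<in> borel_measurable M"
  shows "(\<lambda>x. f x \<odot> (g x :: 'n::finite heis)) \<in> borel_measurable M"
proof -
  have "(\<lambda>p::'n heis \<times> 'n heis. fst p \<odot> snd p) \<in> borel_measurable borel"
    unfolding heis_mult_def by (intro borel_measurable_continuous_onI continuous_intros)
  moreover have "(\<lambda>x. (f x, g x)) \<in> borel_measurable M" by (rule borel_measurable_Pair) fact+
  ultimately show ?thesis using measurable_compose[of "\<lambda>x. (f x, g x)" M borel "\<lambda>p. fst p \<odot> snd p" borel] by simp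
qed

lemma heis_inv_measurable [measurable]:
  assumes [measurable]: "f \<in> borel_measurable M"
  shows "(\<lambda>x. heis_inv (f x :: 'n::finite heis)) \<in> borel_measurable M"
proof -
  have "(\<lambda>p::'n heis. heis_inv p) \<in> borel_measurable borel"
    unfolding heis_inv_def by (intro borel_measurable_continuous_onI continuous_intros)
  from measurable_compose[OF assms this] show ?thesis .
qed

text \<open>In coordinates, right translation is a Euclidean translation in z combined with a shear
  in t whose amount depends on z alone.\<close>

lemma nn_integral_heis_right_translate:
  fixes h :: "'n::finite heis \<Rightarrow> ennreal"
  assumes [measurable]: "h \<in> borel_measurable borel"
  shows "(\<integral>\<^sup>+x. h (x \<odot> y) \<partial>lborel) = (\<integral>\<^sup>+x. h x \<partial>lborel)"
proof -
  define \<phi> where "\<phi> z = snd y + (1/2) * Im (\<Sum>j\<in>UNIV. z $ j * cnj (fst y $ j))" for z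
  have prod: "(\<integral>\<^sup>+x. g x \<partial>lborel) = (\<integral>\<^sup>+z. (\<integral>\<^sup>+t. g (z, t) \<partial>lborel) \<partial>lborel)" if [measurable]: "g \<in> borel_measurable borel" for g :: "'n heis \<Rightarrow> ennreal"
    using lborel.nn_integral_fst[of g lborel] by (simp add: lborel_prod)
  have sec [measurable]: "(\<lambda>t. h (z, t)) \<in> borel_measurable borel" for z
  proof -
    have "(\<lambda>t. (z, t)) \<in> borel_measurable borel" by (intro borel_measurable_continuous_onI continuous_intros)
    from measurable_compose[OF this assms] show ?thesis .
  qed
  define H where "H z = (\<integral>\<^sup>+t. h (z, t) \<partial>lborel)" for z
  have "sets (borel \<Otimes>\<^sub>M lborel) = sets (lborel \<Otimes>\<^sub>M lborel :: 'n heis measure)"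
    by (rule sets_pair_measure_cong) auto
  then have "sets (borel \<Otimes>\<^sub>M lborel) = sets (borel :: 'n heis measure)"
    unfolding lborel_prod by simp
  then have "h \<in> borel_measurable (borel \<Otimes>\<^sub>M lborel)"
    using assms by (simp cong: measurable_cong_sets)
  then have [measurable]: "H \<in> borel_measurable borel"
    unfolding H_def by (intro lborel.borel_measurable_nn_integral) simp
  have "(\<integral>\<^sup>+x. h (x \<odot> y) \<partial>lborel) = (\<integral>\<^sup>+z. (\<integral>\<^sup>+t. h ((z, t) \<odot> y) \<partial>lborel) \<partial>lborel)"
    by (rule prod) measurable
  also have "\<dots> = (\<integral>\<^sup>+z. H (z + fst y) \<partial>lborel)"
  proof (rule nn_integral_cong)
    fix z
    have "(\<integral>\<^sup>+t. h ((z, t) \<odot> y) \<partial>lborel) = (\<integral>\<^sup>+t. h (z + fst y, t + \<phi> z) \<partial>lborel)"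
      by (simp add: heis_mult_def \<phi>_def add.assoc)
    also have "\<dots> = H (z + fst y)" unfolding H_def by (rule nn_integral_lborel_translate) measurable
    finally show "(\<integral>\<^sup>+t. h ((z, t) \<odot> y) \<partial>lborel) = H (z + fst y)" .
  qed
  also have "\<dots> = (\<integral>\<^sup>+z. H z \<partial>lborel)" by (rule nn_integral_lborel_translate) measurable
  also have "\<dots> = (\<integral>\<^sup>+x. h x \<partial>lborel)" unfolding H_def by (rule prod[symmetric]) measurable
  finally show ?thesis .
qed

definition line :: "complex ^ 'n::finite \<Rightarrow> real \<times> real \<Rightarrow> 'n heis" where
  "line z v = (fst v *\<^sub>R (z /\<^sub>R norm z), snd v)"

lemma line_measurable [measurable]:
  assumes [measurable]: "f \<in> borel_measurable M"
  shows "(\<lambda>x. line z (f x)) \<in> borel_measurable M"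
proof -
  have "(\<lambda>v. line z v) \<in> borel_measurable borel"
    unfolding line_def by (intro borel_measurable_continuous_onI continuous_intros)
  from measurable_compose[OF assms this] show ?thesis .
qed

text \<open>Two real multiples of one vector have a real pairing, so the imaginary part in the group
  law vanishes and the map is a homomorphism from the plane.\<close>

lemma line_add: "line z v \<odot> line z w = line z (v + w)"
proof -
  have "Im (\<Sum>j\<in>UNIV. (fst v *\<^sub>R (z /\<^sub>R norm z)) $ j * cnj ((fst w *\<^sub>R (z /\<^sub>R norm z)) $ j)) = 0"
    unfolding Im_sum by (rule sum.neutral) (simp only: vector_scaleR_component, simp add: algebra_simps)
  then show ?thesis by (simp add: line_def heis_mult_def scaleR_add_left distrib_right)
qed

lemma dil_inv_ray: "heis_dil r (heis_inv (ray s z \<theta>)) = line z (- r * profile \<theta>, - (s * r\<^sup>2 / 4) * \<theta>)"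
  by (simp add: heis_dil_def heis_inv_def ray_def line_def)

definition ray_max :: "(int \<Rightarrow> real) \<Rightarrow> int set \<Rightarrow> real \<Rightarrow> ('n::finite heis \<Rightarrow> ennreal) \<Rightarrow> complex ^ 'n \<Rightarrow> 'n heis \<Rightarrow> ennreal" where
  "ray_max r K s f z x = (SUP k\<in>K. \<integral>\<^sup>+\<theta>. f (x \<odot> heis_dil (r k) (heis_inv (ray s z \<theta>))) * indicator {0..1} \<theta> \<partial>lborel)"

lemma ray_max_measurable [measurable]:
  fixes f :: "'n::finite heis \<Rightarrow> ennreal"
  assumes K: "finite K" and [measurable]: "f \<in> borel_measurable borel" "g \<in> borel_measurable M" "h \<in> borel_measurable M"
  shows "(\<lambda>x. ray_max r K s f (g x) (h x)) \<in> borel_measurable M"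
  unfolding ray_max_def using K
  by (intro borel_measurable_SUP countable_finite lborel.borel_measurable_nn_integral) (auto simp: case_prod_beta)

context lacunary_curve
begin

text \<open>Shifting x along the subgroup by v changes no integral over the group, so both sides may
  be averaged over v in a box. For fixed x the shifted maximal function at v in \<open>B\<close> is
  dominated by the planar one, formed from f along the subgroup and cut off outside
  \<open>B'\<close>. Whatever the size of the boxes, their areas have ratio 9, so neither
  \<open>K\<close> nor z influences the loss.\<close>

lemma transference:
  fixes f :: "'n::finite heis \<Rightarrow> ennreal"
  assumes f [measurable]: "f \<in> borel_measurable borel" and K: "finite K" and p: "1 < p"
    and cs: "\<And>k. c k = s * (r k)\<^sup>2 / 4"
    and planar: "\<And>F. F \<in> borel_measurable borel \<Longrightarrow>
      (\<integral>\<^sup>+x. ennreal_powr (planar_max K F x) p \<partial>lborel) \<le> ennreal C * (\<integral>\<^sup>+x. ennreal_powr (F x) p \<partial>lborel)"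
    and C: "0 \<le> C"
  shows "(\<integral>\<^sup>+x. ennreal_powr (ray_max r K s f z x) p \<partial>lborel) \<le> ennreal (9 * C) * (\<integral>\<^sup>+x. ennreal_powr (f x) p \<partial>lborel)"
proof -
  define I where "I = (\<integral>\<^sup>+x. ennreal_powr (f x) p \<partial>lborel)"
  define J where "J = (\<integral>\<^sup>+x. ennreal_powr (ray_max r K s f z x) p \<partial>lborel)"
  \<comment> \<open>At least as large as every displacement occurring on the curves; the sum is
    available because \<open>K\<close> is finite.\<close>
  define R where "R = 1 + (\<Sum>k\<in>K. r k + \<bar>c k\<bar>)"
  have nn: "0 \<le> r k + \<bar>c k\<bar>" for k using r_pos[of k] by linarith
  have rk: "r k \<le> R" "\<bar>c k\<bar> \<le> R" if "k \<in> K" for k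
  proof -
    have "r k + \<bar>c k\<bar> \<le> (\<Sum>k\<in>K. r k + \<bar>c k\<bar>)"
      using K that nn by (intro member_le_sum[of k K "\<lambda>k. r k + \<bar>c k\<bar>"])
    then show "r k \<le> R" "\<bar>c k\<bar> \<le> R" using r_pos[of k] by (auto simp: R_def)
  qed
  have R: "0 < R" unfolding R_def by (intro add_pos_nonneg sum_nonneg nn) simp
  define B where "B = {0..R} \<times> {0..R}"
  define B' where "B' = {-R..2 * R} \<times> {-R..2 * R}"
  have [measurable]: "B \<in> sets borel" "B' \<in> sets borel" unfolding B_def B'_def by (intro borel_closed closed_Times closed_atLeastAtMost)+
  have eB: "emeasure lborel B = ennreal (R\<^sup>2)" "emeasure lborel B' = ennreal (9 * R\<^sup>2)"
    unfolding B_def B'_def lborel_prod[symmetric] using R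
    by (simp_all add: lborel.emeasure_pair_measure_Times power2_eq_square flip: ennreal_mult)
  \<comment> \<open>The function f seen from x along the subgroup. The cut-off keeps the integral
    over x of its p-th power a fixed multiple of that of f.\<close>
  define F where "F x v = f (x \<odot> line z v) * indicator B' v" for x and v :: "real \<times> real"
  have [measurable]: "(\<lambda>(x, v). F x v) \<in> borel_measurable (borel \<Otimes>\<^sub>M borel)" unfolding F_def by measurable
  have Fm: "F x \<in> borel_measurable borel" for x unfolding F_def by measurable
  have pt: "ray_max r K s f z (x \<odot> line z v) \<le> planar_max K (F x) v" if v: "v \<in> B" for x v
    unfolding ray_max_def planar_max_def ncurve_avg_def
  proof (intro SUP_mono bexI nn_integral_mono)
    fix k \<theta> assume k: "k \<in> K"
    show "f (x \<odot> line z v \<odot> heis_dil (r k) (heis_inv (ray s z \<theta>))) * indicator {0..1} \<theta>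
       \<le> F x (fst v - r k * profile \<theta>, snd v - c k * \<theta>) * indicator {0..1} \<theta>"
    proof (cases "\<theta> \<in> {0..1}")
      case True
      have pr: "0 \<le> profile \<theta>" "profile \<theta> \<le> 1" using profile_range[of \<theta>] True by auto
      have "0 \<le> r k * profile \<theta>" using pr r_pos[of k] by simp
      moreover have "r k * profile \<theta> \<le> R * 1" using pr rk[OF k] R by (intro mult_mono) auto
      moreover have "\<bar>c k * \<theta>\<bar> \<le> R * 1" unfolding abs_mult using True rk[OF k] R by (intro mult_mono) auto
      ultimately have "(fst v - r k * profile \<theta>, snd v - c k * \<theta>) \<in> B'"
        using v by (cases v) (auto simp: B_def B'_def abs_le_iff)
      moreover have "x \<odot> line z v \<odot> heis_dil (r k) (heis_inv (ray s z \<theta>)) = x \<odot> line z (fst v - r k * profile \<theta>, snd v - c k * \<theta>)"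
        unfolding heis_mult_assoc dil_inv_ray line_add by (cases v) (simp add: cs)
      ultimately show ?thesis by (simp add: F_def)
    qed simp
  qed
  have trans: "(\<integral>\<^sup>+x. (\<integral>\<^sup>+v. G (x \<odot> line z v) * indicator D v \<partial>lborel) \<partial>lborel) = (\<integral>\<^sup>+x. G x \<partial>lborel) * emeasure lborel D"
    if [measurable]: "G \<in> borel_measurable borel" "D \<in> sets borel" for G :: "'n heis \<Rightarrow> ennreal" and D
  proof -
    have "(\<integral>\<^sup>+x. (\<integral>\<^sup>+v. G (x \<odot> line z v) * indicator D v \<partial>lborel) \<partial>lborel) = (\<integral>\<^sup>+v. (\<integral>\<^sup>+x. G (x \<odot> line z v) * indicator D v \<partial>lborel) \<partial>lborel)"
      by (rule lborel_pair.Fubini') measurable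
    also have "\<dots> = (\<integral>\<^sup>+v. (\<integral>\<^sup>+x. G x \<partial>lborel) * indicator D v \<partial>lborel)"
    proof (rule nn_integral_cong)
      fix v
      have "(\<integral>\<^sup>+x. G (x \<odot> line z v) * indicator D v \<partial>lborel) = (\<integral>\<^sup>+x. G (x \<odot> line z v) \<partial>lborel) * indicator D v"
        by (rule nn_integral_multc) measurable
      then show "(\<integral>\<^sup>+x. G (x \<odot> line z v) * indicator D v \<partial>lborel) = (\<integral>\<^sup>+x. G x \<partial>lborel) * indicator D v"
        by (simp add: nn_integral_heis_right_translate)
    qed
    also have "\<dots> = (\<integral>\<^sup>+x. G x \<partial>lborel) * emeasure lborel D" by (rule nn_integral_cmult_indicator) simp
    finally show ?thesis .
  qed
  have [measurable]: "(\<lambda>x. ray_max r K s f z x) \<in> borel_measurable borel" by (rule ray_max_measurable[OF K]) measurable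
  have "J * ennreal (R\<^sup>2) = (\<integral>\<^sup>+x. (\<integral>\<^sup>+v. ennreal_powr (ray_max r K s f z (x \<odot> line z v)) p * indicator B v \<partial>lborel) \<partial>lborel)"
    unfolding J_def eB(1)[symmetric] by (rule trans[symmetric]) measurable
  also have "\<dots> \<le> (\<integral>\<^sup>+x. ennreal C * (\<integral>\<^sup>+v. ennreal_powr (f (x \<odot> line z v)) p * indicator B' v \<partial>lborel) \<partial>lborel)"
  proof (rule nn_integral_mono)
    fix x
    have "(\<integral>\<^sup>+v. ennreal_powr (ray_max r K s f z (x \<odot> line z v)) p * indicator B v \<partial>lborel) \<le> (\<integral>\<^sup>+v. ennreal_powr (planar_max K (F x) v) p \<partial>lborel)"
    proof (rule nn_integral_mono)
      fix v
      show "ennreal_powr (ray_max r K s f z (x \<odot> line z v)) p * indicator B v \<le> ennreal_powr (planar_max K (F x) v) p"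
        using ennreal_powr_mono[OF _ pt, of p v x] p by (cases "v \<in> B") auto
    qed
    also have "\<dots> \<le> ennreal C * (\<integral>\<^sup>+v. ennreal_powr (F x v) p \<partial>lborel)" by (rule planar[OF Fm])
    also have "(\<integral>\<^sup>+v. ennreal_powr (F x v) p \<partial>lborel) = (\<integral>\<^sup>+v. ennreal_powr (f (x \<odot> line z v)) p * indicator B' v \<partial>lborel)"
      by (intro nn_integral_cong) (auto simp: F_def indicator_def)
    finally show "(\<integral>\<^sup>+v. ennreal_powr (ray_max r K s f z (x \<odot> line z v)) p * indicator B v \<partial>lborel) \<le> ennreal C * (\<integral>\<^sup>+v. ennreal_powr (f (x \<odot> line z v)) p * indicator B' v \<partial>lborel)" .
  qed
  also have "\<dots> = ennreal C * (\<integral>\<^sup>+x. (\<integral>\<^sup>+v. ennreal_powr (f (x \<odot> line z v)) p * indicator B' v \<partial>lborel) \<partial>lborel)"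
    by (rule nn_integral_cmult) measurable
  also have "(\<integral>\<^sup>+x. (\<integral>\<^sup>+v. ennreal_powr (f (x \<odot> line z v)) p * indicator B' v \<partial>lborel) \<partial>lborel) = I * ennreal (9 * R\<^sup>2)"
    unfolding I_def eB(2)[symmetric] by (rule trans) measurable
  finally have "ennreal (1 / R\<^sup>2) * (J * ennreal (R\<^sup>2)) \<le> ennreal (1 / R\<^sup>2) * (ennreal C * (I * ennreal (9 * R\<^sup>2)))"
    by (rule mult_left_mono) simp
  moreover have "ennreal (1 / R\<^sup>2) * (J * ennreal (R\<^sup>2)) = J"
  proof -
    have "ennreal (1 / R\<^sup>2) * (J * ennreal (R\<^sup>2)) = (ennreal (1 / R\<^sup>2) * ennreal (R\<^sup>2)) * J" by (simp only: mult_ac)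
    also have "ennreal (1 / R\<^sup>2) * ennreal (R\<^sup>2) = 1" using R by (simp flip: ennreal_mult)
    finally show ?thesis by simp
  qed
  moreover have "ennreal (1 / R\<^sup>2) * (ennreal C * (I * ennreal (9 * R\<^sup>2))) = ennreal (9 * C) * I"
  proof -
    have "ennreal (1 / R\<^sup>2) * (ennreal C * (I * ennreal (9 * R\<^sup>2))) = (ennreal (1 / R\<^sup>2) * ennreal C * ennreal (9 * R\<^sup>2)) * I" by (simp only: mult_ac)
    also have "ennreal (1 / R\<^sup>2) * ennreal C * ennreal (9 * R\<^sup>2) = ennreal (1 / R\<^sup>2 * C * (9 * R\<^sup>2))"
      using C R ennreal_mult[of "1 / R\<^sup>2" C] ennreal_mult[of "1 / R\<^sup>2 * C" "9 * R\<^sup>2"] by simp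
    also have "1 / R\<^sup>2 * C * (9 * R\<^sup>2) = 9 * C" using R by simp
    finally show ?thesis .
  qed
  ultimately show ?thesis by (simp only: I_def J_def)
qed

end

section \<open>The lacunary maximal function\<close>

text \<open>\<open>n k\<close> is the integer part of k times log_2 (1 / \<delta>). As \<delta> <
  1/2, that logarithm exceeds 1, so consecutive integer parts differ by at least 1.\<close>

lemma lacunary_scale:
  fixes \<delta> :: real
  assumes \<delta>: "0 < \<delta>" "\<delta> < 1/2"
  defines "n \<equiv> \<lambda>k::int. \<lfloor>of_int k * (- log 2 \<delta>)\<rfloor>"
  shows "strict_mono n" "2 powi (- n k) / 2 < \<delta> powi k" "\<delta> powi k \<le> 2 powi (- n k)"
proof -
  define L where "L = - log 2 \<delta>"
  have L: "1 < L"
  proof -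
    have "log 2 \<delta> < log 2 (1/2)" using \<delta> by (subst log_less_cancel_iff) auto
    also have "log 2 (1/2) = (-1::real)" by (simp add: log_divide)
    finally show ?thesis by (simp add: L_def)
  qed
  have n: "n k = \<lfloor>of_int k * L\<rfloor>" for k by (simp add: n_def L_def)
  show "strict_mono n"
  proof (rule strict_monoI)
    fix i k :: int assume "i < k"
    then have "of_int i + 1 \<le> (of_int k :: real)" by linarith
    then have "(of_int i + 1) * L \<le> of_int k * L" using L by (intro mult_right_mono) auto
    then have "of_int i * L + 1 \<le> of_int k * L" using L by (simp add: distrib_right)
    then show "n i < n k" unfolding n by linarith
  qed
  have pd: "\<delta> powi k = 2 powr (- (of_int k * L))"
  proof -
    have d: "\<delta> = 2 powr (- L)" using \<delta> by (simp add: L_def)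
    have "\<delta> powi k = \<delta> powr of_int k" using \<delta> by (simp add: powr_real_of_int')
    also have "\<dots> = (2 powr (- L)) powr of_int k" using arg_cong[OF d, of "\<lambda>x. x powr of_int k"] .
    finally show ?thesis by (simp add: powr_powr mult.commute)
  qed
  have p2: "(2::real) powi (- n k) = 2 powr (- of_int (n k))"
    using powr_real_of_int'[of 2 "- n k"] by simp
  have "(2::real) powi (- n k) / 2 = 2 powr (- of_int (n k) - 1)" by (simp add: p2 powr_diff)
  also have "\<dots> < 2 powr (- (of_int k * L))" unfolding n by (intro powr_less_mono) linarith+
  finally show "2 powi (- n k) / 2 < \<delta> powi k" by (simp add: pd)
  show "\<delta> powi k \<le> 2 powi (- n k)" unfolding pd p2 unfolding n by (intro powr_mono) linarith+
qed

text \<open>The constant precedes the quantifier over z: uniformity in the direction is what permits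
  integration over all directions.\<close>

lemma ray_max_bound:
  fixes \<delta> p :: real
  assumes \<delta>: "0 < \<delta>" "\<delta> < 1/2" and p: "1 < p" and s: "s = 1 \<or> s = -1"
  shows "\<exists>C\<ge>0. \<forall>K z (f :: 'n::finite heis \<Rightarrow> ennreal). finite K \<longrightarrow> f \<in> borel_measurable borel \<longrightarrow>
    (\<integral>\<^sup>+x. ennreal_powr (ray_max (\<lambda>k. \<delta> powi k) K s f z x) p \<partial>lborel) \<le> ennreal C * (\<integral>\<^sup>+x. ennreal_powr (f x) p \<partial>lborel)"
proof -
  interpret lacunary_curve "\<lambda>k. \<lfloor>of_int k * (- log 2 \<delta>)\<rfloor>" "\<lambda>k. \<delta> powi k" "\<lambda>k. s * (\<delta> powi k)\<^sup>2 / 4"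
    using lacunary_scale[OF \<delta>] s by unfold_locales (auto simp: abs_mult)
  obtain C where C: "0 \<le> C" "\<And>K F. finite K \<Longrightarrow> F \<in> borel_measurable borel \<Longrightarrow>
    (\<integral>\<^sup>+x. ennreal_powr (planar_max K F x) p \<partial>lborel) \<le> ennreal C * (\<integral>\<^sup>+x. ennreal_powr (F x) p \<partial>lborel)"
    using planar_bound[OF p] by blast
  show ?thesis
    using C by (intro exI[of _ "9 * C"] conjI allI impI transference p) auto
qed

text \<open>The mean of a nonnegative function as an extended number. It exists at every point and
  dominates the absolute value of the Bochner version.\<close>

definition sphere_avg :: "real \<Rightarrow> ('n::finite heis \<Rightarrow> ennreal) \<Rightarrow> 'n heis \<Rightarrow> ennreal" where
  "sphere_avg r f x = (\<integral>\<^sup>+y. f (x \<odot> heis_dil r (heis_inv y)) \<partial>koranyi_measure)"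

text \<open>The supremum over k is pulled inside the integral over directions, where each direction
  and each half of the sphere has its own maximal function. Jensen's inequality over the unit ball
  takes the power p inside as well, and Fubini leaves the uniform bound for a single
  direction.\<close>

lemma sphere_avg_max_bound:
  fixes \<delta> p :: real
  assumes n: "2 \<le> CARD('n::finite)" and \<delta>: "0 < \<delta>" "\<delta> < 1/2" and p: "1 < p"
  shows "\<exists>C\<ge>0. \<forall>K (f :: 'n heis \<Rightarrow> ennreal). finite K \<longrightarrow> f \<in> borel_measurable borel \<longrightarrow>
    (\<integral>\<^sup>+x. ennreal_powr (SUP k\<in>K. sphere_avg (\<delta> powi k) f x) p \<partial>lborel) \<le> ennreal C * (\<integral>\<^sup>+x. ennreal_powr (f x) p \<partial>lborel)"
proof -
  define r where "r k = \<delta> powi k" for k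
  obtain C1 where C1: "0 \<le> C1" "\<And>K z (f :: 'n heis \<Rightarrow> ennreal). finite K \<Longrightarrow> f \<in> borel_measurable borel \<Longrightarrow>
    (\<integral>\<^sup>+x. ennreal_powr (ray_max r K 1 f z x) p \<partial>lborel) \<le> ennreal C1 * (\<integral>\<^sup>+x. ennreal_powr (f x) p \<partial>lborel)"
    using ray_max_bound[OF \<delta> p, of 1, where 'n='n] unfolding r_def by blast
  obtain C2 where C2: "0 \<le> C2" "\<And>K z (f :: 'n heis \<Rightarrow> ennreal). finite K \<Longrightarrow> f \<in> borel_measurable borel \<Longrightarrow>
    (\<integral>\<^sup>+x. ennreal_powr (ray_max r K (-1) f z x) p \<partial>lborel) \<le> ennreal C2 * (\<integral>\<^sup>+x. ennreal_powr (f x) p \<partial>lborel)"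
    using ray_max_bound[OF \<delta> p, of "-1", where 'n='n] unfolding r_def by blast
  define Q where "Q = real (hom_dim TYPE('n))"
  \<comment> \<open>Jensen's inequality asks for a positive bound on the mass of the ball; the added
    1 provides it at once.\<close>
  define V where "V = measure lborel (cball 0 1 :: (complex ^ 'n) set) + 1"
  have V: "0 < V" "emeasure lborel (cball 0 1 :: (complex ^ 'n) set) \<le> ennreal V"
  proof -
    show "0 < V" by (simp add: V_def add_nonneg_pos)
    have "emeasure lborel (cball 0 1 :: (complex ^ 'n) set) = ennreal (measure lborel (cball 0 1 :: (complex ^ 'n) set))"
      by (rule emeasure_eq_ennreal_measure) (use emeasure_lborel_cball_finite in \<open>auto simp: less_top[symmetric]\<close>)
    then show "emeasure lborel (cball 0 1 :: (complex ^ 'n) set) \<le> ennreal V" by (simp add: V_def ennreal_leI)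
  qed
  define N where "N = restrict_space lborel (cball 0 1 :: (complex ^ 'n) set)"
  have N: "(\<integral>\<^sup>+z. F z \<partial>N) = (\<integral>\<^sup>+z. F z * of_bool (norm z \<le> 1) \<partial>lborel)" for F :: "complex ^ 'n \<Rightarrow> ennreal"
    unfolding N_def by (subst nn_integral_restrict_space) (auto intro!: nn_integral_cong simp: indicator_def)
  have eN: "emeasure N (space N) \<le> ennreal V"
    unfolding N_def by (simp add: emeasure_restrict_space space_restrict_space V)
  define C where "C = Q powr p * (V powr (p - 1) * (2 powr p * ((C1 + C2) * V)))"
  have "(\<integral>\<^sup>+x. ennreal_powr (SUP k\<in>K. sphere_avg (\<delta> powi k) f x) p \<partial>lborel) \<le> ennreal C * (\<integral>\<^sup>+x. ennreal_powr (f x) p \<partial>lborel)"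
    if K: "finite K" and f [measurable]: "f \<in> borel_measurable borel" for K and f :: "'n heis \<Rightarrow> ennreal"
  proof -
    define I where "I = (\<integral>\<^sup>+x. ennreal_powr (f x) p \<partial>lborel)"
    define P where "P s z x = ray_max r K s f z x" for s z x
    have Pm: "(\<lambda>(x, z). P s z x) \<in> borel_measurable (borel \<Otimes>\<^sub>M borel)" for s
      unfolding P_def case_prod_beta by (rule ray_max_measurable[OF K]) measurable
    note [measurable] = Pm
    have Pz [measurable]: "(\<lambda>z. P s z x) \<in> borel_measurable borel" for s x
      unfolding P_def by (rule ray_max_measurable[OF K]) measurable
    have PN: "(\<lambda>z. P s z x) \<in> borel_measurable N" for s x
      unfolding N_def by (rule measurable_restrict_space1) (use Pz in simp)
    have le: "(SUP k\<in>K. sphere_avg (\<delta> powi k) f x) \<le> ennreal Q * (\<integral>\<^sup>+z. P 1 z x + P (-1) z x \<partial>N)" for x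
    proof (rule SUP_least)
      fix k assume k: "k \<in> K"
      have "sphere_avg (\<delta> powi k) f x \<le> ennreal Q *
        (\<integral>\<^sup>+z. (\<integral>\<^sup>+\<theta>. (f (x \<odot> heis_dil (r k) (heis_inv (ray 1 z \<theta>))) + f (x \<odot> heis_dil (r k) (heis_inv (ray (-1) z \<theta>)))) * indicator {0..1} \<theta> \<partial>lborel) * of_bool (norm z \<le> 1) \<partial>lborel)"
        unfolding sphere_avg_def Q_def r_def by (rule sphere_integral_le[OF _ n]) measurable
      also have "\<dots> \<le> ennreal Q * (\<integral>\<^sup>+z. P 1 z x + P (-1) z x \<partial>N)"
        unfolding N
      proof (intro mult_left_mono nn_integral_mono mult_right_mono)
        fix z
        have "(\<integral>\<^sup>+\<theta>. (f (x \<odot> heis_dil (r k) (heis_inv (ray 1 z \<theta>))) + f (x \<odot> heis_dil (r k) (heis_inv (ray (-1) z \<theta>)))) * indicator {0..1} \<theta> \<partial>lborel)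
          = (\<integral>\<^sup>+\<theta>. f (x \<odot> heis_dil (r k) (heis_inv (ray 1 z \<theta>))) * indicator {0..1} \<theta> \<partial>lborel) + (\<integral>\<^sup>+\<theta>. f (x \<odot> heis_dil (r k) (heis_inv (ray (-1) z \<theta>))) * indicator {0..1} \<theta> \<partial>lborel)"
          unfolding distrib_right by (rule nn_integral_add) measurable
        also have "\<dots> \<le> P 1 z x + P (-1) z x"
          unfolding P_def ray_max_def by (intro add_mono SUP_upper k)
        finally show "(\<integral>\<^sup>+\<theta>. (f (x \<odot> heis_dil (r k) (heis_inv (ray 1 z \<theta>))) + f (x \<odot> heis_dil (r k) (heis_inv (ray (-1) z \<theta>)))) * indicator {0..1} \<theta> \<partial>lborel) \<le> P 1 z x + P (-1) z x" .
      qed auto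
      finally show "sphere_avg (\<delta> powi k) f x \<le> ennreal Q * (\<integral>\<^sup>+z. P 1 z x + P (-1) z x \<partial>N)" .
    qed
    define W where "W x = (\<integral>\<^sup>+z. (ennreal_powr (P 1 z x) p + ennreal_powr (P (-1) z x) p) * of_bool (norm z \<le> 1) \<partial>lborel)" for x
    have [measurable]: "W \<in> borel_measurable borel" unfolding W_def by measurable
    have "ennreal_powr (SUP k\<in>K. sphere_avg (\<delta> powi k) f x) p \<le> ennreal (Q powr p * (V powr (p - 1) * 2 powr p)) * W x" for x
    proof -
      have "ennreal_powr (SUP k\<in>K. sphere_avg (\<delta> powi k) f x) p \<le> ennreal_powr (ennreal Q * (\<integral>\<^sup>+z. P 1 z x + P (-1) z x \<partial>N)) p"
        using p by (intro ennreal_powr_mono le) auto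
      also have "\<dots> = ennreal (Q powr p) * ennreal_powr (\<integral>\<^sup>+z. P 1 z x + P (-1) z x \<partial>N) p"
        using p by (simp add: ennreal_powr_mult ennreal_powr_ennreal Q_def)
      also have "\<dots> \<le> ennreal (Q powr p) * (ennreal (V powr (p - 1)) * (\<integral>\<^sup>+z. ennreal_powr (P 1 z x + P (-1) z x) p \<partial>N))"
        by (intro mult_left_mono nn_integral_jensen_powr borel_measurable_add PN eN V p) auto
      also have "\<dots> \<le> ennreal (Q powr p) * (ennreal (V powr (p - 1)) * (ennreal (2 powr p) * W x))"
      proof (intro mult_left_mono)
        have "(\<integral>\<^sup>+z. ennreal_powr (P 1 z x + P (-1) z x) p \<partial>N) \<le> (\<integral>\<^sup>+z. ennreal (2 powr p) * ((ennreal_powr (P 1 z x) p + ennreal_powr (P (-1) z x) p) * of_bool (norm z \<le> 1)) \<partial>lborel)"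
          unfolding N
        proof (rule nn_integral_mono)
          fix z
          define u v where "u = P 1 z x" and "v = P (-1) z x"
          have "u + v \<le> 2 * max u v" unfolding mult_2 by (intro add_mono) auto
          then have "ennreal_powr (u + v) p \<le> ennreal_powr (2 * max u v) p" using p by (intro ennreal_powr_mono) auto
          also have "\<dots> = ennreal (2 powr p) * ennreal_powr (max u v) p"
            using p ennreal_powr_ennreal[of 2 p] by (simp add: ennreal_powr_mult)
          also have "\<dots> \<le> ennreal (2 powr p) * (ennreal_powr u p + ennreal_powr v p)"
            by (intro mult_left_mono) (auto simp: max_def)
          finally show "ennreal_powr (P 1 z x + P (-1) z x) p * of_bool (norm z \<le> 1) \<le> ennreal (2 powr p) * ((ennreal_powr (P 1 z x) p + ennreal_powr (P (-1) z x) p) * of_bool (norm z \<le> 1))"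
            by (cases "norm z \<le> 1") (auto simp: u_def v_def)
        qed
        also have "\<dots> = ennreal (2 powr p) * W x" unfolding W_def by (rule nn_integral_cmult) measurable
        finally show "(\<integral>\<^sup>+z. ennreal_powr (P 1 z x + P (-1) z x) p \<partial>N) \<le> ennreal (2 powr p) * W x" .
      qed auto
      also have "\<dots> = ennreal (Q powr p * (V powr (p - 1) * 2 powr p)) * W x"
        by (simp only: ennreal_mult powr_ge_zero mult_nonneg_nonneg mult.assoc)
      finally show ?thesis .
    qed
    then have "(\<integral>\<^sup>+x. ennreal_powr (SUP k\<in>K. sphere_avg (\<delta> powi k) f x) p \<partial>lborel) \<le> (\<integral>\<^sup>+x. ennreal (Q powr p * (V powr (p - 1) * 2 powr p)) * W x \<partial>lborel)"
      by (intro nn_integral_mono)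
    also have "\<dots> = ennreal (Q powr p * (V powr (p - 1) * 2 powr p)) * (\<integral>\<^sup>+x. W x \<partial>lborel)"
      by (rule nn_integral_cmult) measurable
    also have "(\<integral>\<^sup>+x. W x \<partial>lborel) \<le> ennreal ((C1 + C2) * V) * I"
    proof -
      have "(\<integral>\<^sup>+x. W x \<partial>lborel) = (\<integral>\<^sup>+z. (\<integral>\<^sup>+x. (ennreal_powr (P 1 z x) p + ennreal_powr (P (-1) z x) p) * of_bool (norm z \<le> 1) \<partial>lborel) \<partial>lborel)"
        unfolding W_def by (rule lborel_pair.Fubini') measurable
      also have "\<dots> \<le> (\<integral>\<^sup>+z. ennreal (C1 + C2) * I * indicator (cball 0 1) (z :: complex ^ 'n) \<partial>lborel)"
      proof (rule nn_integral_mono)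
        fix z :: "complex ^ 'n"
        have [measurable]: "(\<lambda>x. P s z x) \<in> borel_measurable borel" for s unfolding P_def by (rule ray_max_measurable[OF K]) measurable
        have "(\<integral>\<^sup>+x. ennreal_powr (P 1 z x) p + ennreal_powr (P (-1) z x) p \<partial>lborel) = (\<integral>\<^sup>+x. ennreal_powr (P 1 z x) p \<partial>lborel) + (\<integral>\<^sup>+x. ennreal_powr (P (-1) z x) p \<partial>lborel)"
          by (rule nn_integral_add) measurable
        also have "\<dots> \<le> ennreal C1 * I + ennreal C2 * I"
          unfolding P_def I_def by (intro add_mono C1(2) C2(2) K f)
        also have "\<dots> = ennreal (C1 + C2) * I" using C1(1) C2(1) by (simp add: distrib_right)
        finally show "(\<integral>\<^sup>+x. (ennreal_powr (P 1 z x) p + ennreal_powr (P (-1) z x) p) * of_bool (norm z \<le> 1) \<partial>lborel) \<le> ennreal (C1 + C2) * I * indicator (cball 0 1) z"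
          by (cases "norm z \<le> 1") auto
      qed
      also have "\<dots> = ennreal (C1 + C2) * I * emeasure lborel (cball 0 1 :: (complex ^ 'n) set)"
        by (rule nn_integral_cmult_indicator) simp
      also have "\<dots> \<le> ennreal (C1 + C2) * I * ennreal V" by (intro mult_left_mono V) simp
      also have "\<dots> = ennreal ((C1 + C2) * V) * I"
      proof -
        have "ennreal ((C1 + C2) * V) = ennreal (C1 + C2) * ennreal V" using C1(1) C2(1) V by (intro ennreal_mult) auto
        then show ?thesis by (simp only: mult_ac)
      qed
      finally show ?thesis .
    qed
    finally have "(\<integral>\<^sup>+x. ennreal_powr (SUP k\<in>K. sphere_avg (\<delta> powi k) f x) p \<partial>lborel)
      \<le> ennreal (Q powr p * (V powr (p - 1) * 2 powr p)) * (ennreal ((C1 + C2) * V) * I)"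
      by (simp add: mult_left_mono)
    also have "\<dots> = ennreal C * I"
    proof -
      have "ennreal (Q powr p * (V powr (p - 1) * 2 powr p)) * ennreal ((C1 + C2) * V) = ennreal (Q powr p * (V powr (p - 1) * 2 powr p) * ((C1 + C2) * V))"
        using C1(1) C2(1) V by (intro ennreal_mult[symmetric]) auto
      also have "Q powr p * (V powr (p - 1) * 2 powr p) * ((C1 + C2) * V) = C" by (simp add: C_def)
      finally show ?thesis by (simp only: mult.assoc[symmetric])
    qed
    finally show ?thesis by (simp only: I_def)
  qed
  moreover have "0 \<le> C" using C1(1) C2(1) V by (simp add: C_def)
  ultimately show ?thesis by blast
qed

lemma spherical_mean_measurable:
  fixes f :: "'n::finite heis \<Rightarrow> complex"
  assumes [measurable]: "f \<in> borel_measurable borel"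
  shows "spherical_mean r f \<in> borel_measurable borel"
proof -
  have kp: "koranyi_polar (koranyi_measure :: 'n heis measure)" by (rule koranyi_polar_koranyi_measure)
  interpret S: finite_measure "koranyi_measure :: 'n heis measure" using kp by (simp add: koranyi_polar_def)
  have sets: "sets (koranyi_measure :: 'n heis measure) = sets (restrict_space borel koranyi_sphere)"
    using kp by (simp add: koranyi_polar_def)
  have id: "(\<lambda>\<omega>. \<omega>) \<in> (koranyi_measure :: 'n heis measure) \<rightarrow>\<^sub>M borel"
    by (simp cong: measurable_cong_sets add: sets measurable_restrict_space1)
  have [measurable]: "snd \<in> borel \<Otimes>\<^sub>M (koranyi_measure :: 'n heis measure) \<rightarrow>\<^sub>M (borel :: 'n heis measure)" 
    by (rule measurable_compose[OF measurable_snd id])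
  have "(\<lambda>(x, y). f (x \<odot> heis_dil r (heis_inv y))) \<in> borel_measurable (borel \<Otimes>\<^sub>M (koranyi_measure :: 'n heis measure))"
    unfolding case_prod_beta by measurable
  then show ?thesis
    unfolding spherical_mean_def[abs_def] by (rule S.borel_measurable_lebesgue_integral)
qed

text \<open>Where the mean does not converge absolutely, the Bochner integral is 0 and the
  inequality is trivial.\<close>

lemma cmod_spherical_mean_le:
  "ennreal (cmod (spherical_mean r f x)) \<le> sphere_avg r (\<lambda>x. ennreal (cmod (f x))) x"
  unfolding spherical_mean_def sphere_avg_def
  using integral_norm_bound_ennreal[of koranyi_measure "\<lambda>y. f (x \<odot> heis_dil r (heis_inv y))"]
  by (cases "integrable koranyi_measure (\<lambda>y. f (x \<odot> heis_dil r (heis_inv y)))") (auto simp: not_integrable_integral_eq)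

theorem theorem1p2:
  fixes \<delta> p :: real
  assumes "2 \<le> CARD('n::finite)"
    and "0 < \<delta>" and "\<delta> < 1 / 96"
    and "1 < p"
  shows "\<exists>C::real. \<forall>f :: 'n heis \<Rightarrow> complex. f \<in> Lp_functions p lborel \<longrightarrow>
    lacunary_maximal \<delta> f \<in> borel_measurable lborel \<and>
    Lp_enorm p lborel (lacunary_maximal \<delta> f)
      \<le> ennreal C * Lp_enorm p lborel (\<lambda>x. ennreal (cmod (f x)))"
proof -
  have "\<delta> < 1 / 2" using assms by linarith
  then obtain C where C: "0 \<le> C" "\<And>K (f :: 'n heis \<Rightarrow> ennreal). finite K \<Longrightarrow> f \<in> borel_measurable borel \<Longrightarrow>
    (\<integral>\<^sup>+x. ennreal_powr (SUP k\<in>K. sphere_avg (\<delta> powi k) f x) p \<partial>lborel) \<le> ennreal C * (\<integral>\<^sup>+x. ennreal_powr (f x) p \<partial>lborel)"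
    using sphere_avg_max_bound[OF assms(1,2) _ assms(4)] by blast
  have p: "0 < p" using assms by simp
  show ?thesis
  proof (intro exI[of _ "C powr (1 / p)"] allI impI conjI)
    fix f :: "'n heis \<Rightarrow> complex" assume "f \<in> Lp_functions p lborel"
    then have f [measurable]: "f \<in> borel_measurable borel" by (simp add: Lp_functions_def)
    have [measurable]: "spherical_mean r f \<in> borel_measurable borel" for r by (rule spherical_mean_measurable[OF f])
    have lac: "lacunary_maximal \<delta> f = (\<lambda>x. SUP k. ennreal (cmod (spherical_mean (\<delta> powi k) f x)))"
      by (rule ext) (simp add: lacunary_maximal_def)
    show "lacunary_maximal \<delta> f \<in> borel_measurable lborel"
      unfolding lac by (intro borel_measurable_SUP) auto
    define g where "g x = ennreal (cmod (f x))" for x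
    have [measurable]: "g \<in> borel_measurable borel" unfolding g_def by measurable
    \<comment> \<open>The bounds so far concern finite sets of k, with a constant that does not
      depend on the set. Symmetric ranges exhaust the integers, and monotone convergence reaches the
      full supremum.\<close>
    define S where "S m x = (SUP k\<in>{- int m..int m}. ennreal (cmod (spherical_mean (\<delta> powi k) f x)))" for m x
    have [measurable]: "S m \<in> borel_measurable borel" for m
      unfolding S_def by (intro borel_measurable_SUP countable_finite) auto
    have inc: "S m x \<le> S m' x" if "m \<le> m'" for m m' x
      unfolding S_def using that by (intro SUP_subset_mono) auto
    have supS: "lacunary_maximal \<delta> f x = (SUP m. S m x)" for x
    proof (rule antisym)
      show "lacunary_maximal \<delta> f x \<le> (SUP m. S m x)"
        unfolding lac
      proof (rule SUP_least)
        fix k :: int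
        have "ennreal (cmod (spherical_mean (\<delta> powi k) f x)) \<le> S (nat \<bar>k\<bar>) x"
          unfolding S_def by (rule SUP_upper) auto
        also have "\<dots> \<le> (SUP m. S m x)" by (rule SUP_upper) simp
        finally show "ennreal (cmod (spherical_mean (\<delta> powi k) f x)) \<le> (SUP m. S m x)" .
      qed
      show "(SUP m. S m x) \<le> lacunary_maximal \<delta> f x"
        unfolding lac S_def by (intro SUP_least SUP_upper) auto
    qed
    have "(\<integral>\<^sup>+x. ennreal_powr (lacunary_maximal \<delta> f x) p \<partial>lborel) = (\<integral>\<^sup>+x. (SUP m. ennreal_powr (S m x) p) \<partial>lborel)"
      using p by (simp add: supS ennreal_powr_SUP)
    also have "\<dots> = (SUP m. \<integral>\<^sup>+x. ennreal_powr (S m x) p \<partial>lborel)"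
    proof (rule nn_integral_monotone_convergence_SUP)
      show "incseq (\<lambda>m x. ennreal_powr (S m x) p)"
        unfolding incseq_def le_fun_def using p by (intro allI impI ennreal_powr_mono inc) auto
    qed measurable
    also have "\<dots> \<le> ennreal C * (\<integral>\<^sup>+x. ennreal_powr (g x) p \<partial>lborel)"
    proof (rule SUP_least)
      fix m
      have "(\<integral>\<^sup>+x. ennreal_powr (S m x) p \<partial>lborel) \<le> (\<integral>\<^sup>+x. ennreal_powr (SUP k\<in>{- int m..int m}. sphere_avg (\<delta> powi k) g x) p \<partial>lborel)"
        unfolding S_def g_def using p by (intro nn_integral_mono ennreal_powr_mono SUP_mono' cmod_spherical_mean_le) auto
      also have "\<dots> \<le> ennreal C * (\<integral>\<^sup>+x. ennreal_powr (g x) p \<partial>lborel)" by (intro C(2)) auto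
      finally show "(\<integral>\<^sup>+x. ennreal_powr (S m x) p \<partial>lborel) \<le> ennreal C * (\<integral>\<^sup>+x. ennreal_powr (g x) p \<partial>lborel)" .
    qed
    finally have "Lp_enorm p lborel (lacunary_maximal \<delta> f) \<le> ennreal_powr (ennreal C * (\<integral>\<^sup>+x. ennreal_powr (g x) p \<partial>lborel)) (1 / p)"
      unfolding Lp_enorm_def using p by (intro ennreal_powr_mono) auto
    also have "\<dots> = ennreal (C powr (1 / p)) * Lp_enorm p lborel (\<lambda>x. ennreal (cmod (f x)))"
      unfolding Lp_enorm_def g_def using p C(1) by (simp add: ennreal_powr_mult ennreal_powr_ennreal)
    finally show "Lp_enorm p lborel (lacunary_maximal \<delta> f) \<le> ennreal (C powr (1 / p)) * Lp_enorm p lborel (\<lambda>x. ennreal (cmod (f x)))" .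
  qed
qed

end
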